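(* Let $K$ be a commutative ring, let $A,B$ be $K$-algebras and $E=\{M_1,\dots,M_n\}$ a finite family of $A\otimes B^o$-modules, all of $A,B,M_1,\dots,M_n$ being projective as $K$-modules. For all subfamilies $F,G\subset E$ there is a long exact sequence $$\cdots\longrightarrow\mathcal H^*(F\cup G)\xrightarrow{(\rho^*_{F,F\cup G},\ \rho^*_{G,F\cup G})}\mathcal H^*F\times\mathcal H^*G\xrightarrow{\rho^*_{F\cap G,F}-\rho^*_{F\cap G,G}}\mathcal H^*(F\cap G)\longrightarrow\mathcal H^{*+1}(F\cup G)\longrightarrow\cdots$$ where $\mathcal H^*$ and $\rho^*$ are the modified cohomology and the restriction morphisms defined in the context.
   Context: Conventions. $K$ is a commutative ring, $\otimes=\otimes_K$. Algebras are associative unital $K$-algebras; modules over an algebra are unital left modules; $T^o$ is the opposite algebra of $T$. $A,B$ and all $A\otimes B^o$-modules considered are $K$-projective. Bar complex. For an algebra $T$, $C^T_n=T^{\otimes(n+2)}$ ($n\ge 0$) with differential $a_0\otimes\cdots\otimes a_{n+1}\mapsto\sum_{i=0}^n(-1)^i a_0\otimes\cdots\otimes a_ia_{i+1}\otimes\cdots\otimes a_{n+1}$; $C^{T+}_*$ is its augmentation, with $C^{T+}_{-1}=T$. For a $T\otimes T^o$-module $\Lambda$, $C^*(T,\Lambda)=\mathrm{Hom}_{T\otimes T^o}(C^T_*,\Lambda)$ and $C^*(T)=C^*(T,T)$. Triangular complex. $C^{A,B^o}_*$ is the complex whose part of degree $n\ge 0$ is $\bigoplus_{p+q=n-1;\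 p,q\ge -1}C^{A+}_p\otimes C^{B^o+}_q$, with differential $d\otimes 1+(-1)^{p+1}1\otimes d$ (the summand $p=q=-1$, of degree $-1$, is discarded). For an $A\otimes B^o$-module $M$ put $C^{A,B^o}_*M=C^{A,B^o}_*\otimes_{A\otimes B^o}M$; the summands with $q=-1$ form the subcomplex $C^A_*M=C^A_*\otimes_AM$ and those with $p=-1$ the subcomplex $C^{B^o}_*M=M\otimes_BC^B_*$. Put $C^*_{tri}(M)=\mathrm{Hom}_{A\otimes B^o}(C^{A,B^o}_*M,M)$. Restriction to the two subcomplexes and adjunction give $i^{A*}_{M}:C^*_{tri}(M)\to C^*(A,\mathrm{End}_{B^o}M)$ and $i^{B^o*}_{M}:C^*_{tri}(M)\to C^*(B,\mathrm{End}_AM)$. The structure maps $A\to\mathrm{End}_{B^o}M$, $B\to(\mathrm{End}_AM)^o$ induce $\alpha^*_M:C^*(A)\to C^*(A,\mathrm{End}_{B^o}M)$ and $\beta^*_M:C^*(B)\to C^*(B,\mathrm{End}_AM)$. Modified cohomology. The cone of $f:X^*\to Y^*$ has degree $n$ part $X^n\oplus Y^{n-1}$ and differential $(x,y)\mapsto(dx,f(x)-dy)$. For a finite family $F$ of $A\otimes B^o$-modules let $$\lambda^*_F:\ C^*(A)\oplus\bigoplus_{L\in F}C^*_{tri}(L)\oplus C^*(B)\longrightarrow\bigoplus_{L\in F}C^*(A,\mathrm{End}_{B^o}L)\oplus\bigoplus_{L\in F}C^*(B,\mathrm{End}_AL)$$ be the morphism whose only possibly nonzero components are $\alpha^*_L,\beta^*_L,i^{A*}_L,i^{B^o*}_L$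 ($L\in F$). Put $\mathcal C^*F=\mathrm{cone}(\lambda^*_F)$, and let $\mathcal H^*F$ be its cohomology. (For $F=\emptyset$, $\mathcal H^*\emptyset=HH^*A\times HH^*B$; for $F=\{L\}$, $\mathcal H^*\{L\}$ is the Hochschild cohomology of the triangular matrix algebra $\begin{pmatrix}A&L\\0&B\end{pmatrix}$.) For $F\subset E$, $\rho^*_{F,E}:\mathcal H^*E\to\mathcal H^*F$ is induced by the projection $\mathcal C^*E\to\mathcal C^*F$ which is the identity on $C^*(A)$, $C^*(B)$ and on the terms attached to $L\in F$, and is zero on the terms attached to $L\in E\setminus F$. *)

theory Defs
  imports "HOL-Algebra.Module" "HOL-Algebra.AbelCoset"
begin

section \<open>Algebras, modules, projectivity\<close>

text \<open>The locale \<^locale>\<open>algebra\<close> is for commutative algebras and \<^locale>\<open>module\<close> for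
  modules over commutative rings; the noncommutative versions follow. The \<open>mult\<close> and \<open>one\<close>
  fields of a module record are ignored unless it is used as an algebra.\<close>

locale k_algebra = module R A + A?: ring A for R (structure) and A (structure) +
  assumes smult_mult_left:
      "\<lbrakk>k \<in> carrier R; x \<in> carrier A; y \<in> carrier A\<rbrakk>
        \<Longrightarrow> (k \<odot>\<^bsub>A\<^esub> x) \<otimes>\<^bsub>A\<^esub> y = k \<odot>\<^bsub>A\<^esub> (x \<otimes>\<^bsub>A\<^esub> y)"
    and smult_mult_right:
      "\<lbrakk>k \<in> carrier R; x \<in> carrier A; y \<in> carrier A\<rbrakk>
        \<Longrightarrow> x \<otimes>\<^bsub>A\<^esub> (k \<odot>\<^bsub>A\<^esub> y) = k \<odot>\<^bsub>A\<^esub> (x \<otimes>\<^bsub>A\<^esub> y)"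

locale left_module = abelian_group M
  for T :: "('t, 'r) ring_scheme" and M :: "('t, 'x, 's) module_scheme" +
  assumes smult_closed:
      "\<lbrakk>s \<in> carrier T; x \<in> carrier M\<rbrakk> \<Longrightarrow> s \<odot>\<^bsub>M\<^esub> x \<in> carrier M"
    and smult_l_distr:
      "\<lbrakk>s \<in> carrier T; t \<in> carrier T; x \<in> carrier M\<rbrakk>
        \<Longrightarrow> (s \<oplus>\<^bsub>T\<^esub> t) \<odot>\<^bsub>M\<^esub> x = s \<odot>\<^bsub>M\<^esub> x \<oplus>\<^bsub>M\<^esub> t \<odot>\<^bsub>M\<^esub> x"
    and smult_r_distr:
      "\<lbrakk>s \<in> carrier T; x \<in> carrier M; y \<in> carrier M\<rbrakk>
        \<Longrightarrow> s \<odot>\<^bsub>M\<^esub> (x \<oplus>\<^bsub>M\<^esub> y) = s \<odot>\<^bsub>M\<^esub> x \<oplus>\<^bsub>M\<^esub> s \<odot>\<^bsub>M\<^esub> y"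
    and smult_assoc:
      "\<lbrakk>s \<in> carrier T; t \<in> carrier T; x \<in> carrier M\<rbrakk>
        \<Longrightarrow> (s \<otimes>\<^bsub>T\<^esub> t) \<odot>\<^bsub>M\<^esub> x = s \<odot>\<^bsub>M\<^esub> (t \<odot>\<^bsub>M\<^esub> x)"
    and smult_one: "x \<in> carrier M \<Longrightarrow> \<one>\<^bsub>T\<^esub> \<odot>\<^bsub>M\<^esub> x = x"

definition op_alg :: "('k, 'a) module \<Rightarrow> ('k, 'a) module" where
  "op_alg T = T\<lparr>mult := \<lambda>x y. y \<otimes>\<^bsub>T\<^esub> x\<rparr>"

definition with_smult :: "('s, 'x) module \<Rightarrow> ('t \<Rightarrow> 'x \<Rightarrow> 'x) \<Rightarrow> ('t, 'x) module" where
  "with_smult X act = \<lparr>carrier = carrier X, mult = mult X, one = one X,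
     zero = zero X, add = add X, smult = act\<rparr>"

text \<open>The \<open>K\<close>-module underlying a module \<open>X\<close> over the \<open>K\<close>-algebra \<open>T\<close>.\<close>

definition k_res :: "('k, 't) module \<Rightarrow> ('t, 'x) module \<Rightarrow> ('k, 'x) module" where
  "k_res T X = with_smult X (\<lambda>k x. (k \<odot>\<^bsub>T\<^esub> \<one>\<^bsub>T\<^esub>) \<odot>\<^bsub>X\<^esub> x)"

definition mod_hom ::
  "('t, 'r) ring_scheme \<Rightarrow> ('t, 'x) module \<Rightarrow> ('t, 'y) module \<Rightarrow> ('x \<Rightarrow> 'y) set" where
  "mod_hom T X Y = {f \<in> carrier X \<rightarrow> carrier Y.
     (\<forall>x\<in>carrier X. \<forall>y\<in>carrier X. f (x \<oplus>\<^bsub>X\<^esub> y) = f x \<oplus>\<^bsub>Y\<^esub> f y) \<and>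
     (\<forall>t\<in>carrier T. \<forall>x\<in>carrier X. f (t \<odot>\<^bsub>X\<^esub> x) = t \<odot>\<^bsub>Y\<^esub> f x)}"

text \<open>The lifting property cannot quantify over types. The types chosen for \<open>X\<close> and \<open>Y\<close> include the
  canonical surjection from the free module on the set \<open>P\<close> onto \<open>P\<close>; lifting the identity of \<open>P\<close>
  along it gives the lifting property for all modules.\<close>

definition projective :: "('k, 'r) ring_scheme \<Rightarrow> ('k, 'p) module \<Rightarrow> bool" where
  "projective K P \<longleftrightarrow> module K P \<and>
     (\<forall>(X :: ('k, 'p \<Rightarrow> 'k) module) (Y :: ('k, 'p) module) g f.
        module K X \<longrightarrow> module K Y \<longrightarrow> g \<in> mod_hom K X Y \<longrightarrow> g ` carrier X = carrier Y \<longrightarrow>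
        f \<in> mod_hom K P Y \<longrightarrow>
        (\<exists>h \<in> mod_hom K P X. \<forall>x\<in>carrier P. g (h x) = f x))"

definition zero_mod :: "('t, 'x) module" where
  "zero_mod = \<lparr>carrier = {undefined}, mult = \<lambda>_ _. undefined, one = undefined,
     zero = undefined, add = \<lambda>_ _. undefined, smult = \<lambda>_ _. undefined\<rparr>"

definition prod_mod :: "('t, 'x) module \<Rightarrow> ('t, 'y) module \<Rightarrow> ('t, 'x \<times> 'y) module" where
  "prod_mod X Y = \<lparr>carrier = carrier X \<times> carrier Y, mult = undefined, one = undefined,
     zero = (\<zero>\<^bsub>X\<^esub>, \<zero>\<^bsub>Y\<^esub>),
     add = (\<lambda>(x, y) (x', y'). (x \<oplus>\<^bsub>X\<^esub> x', y \<oplus>\<^bsub>Y\<^esub> y')),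
     smult = (\<lambda>t (x, y). (t \<odot>\<^bsub>X\<^esub> x, t \<odot>\<^bsub>Y\<^esub> y))\<rparr>"

text \<open>Only used for finite index sets \<open>I\<close>, where the direct sum is the product.\<close>

definition dsum_mod :: "'i set \<Rightarrow> ('i \<Rightarrow> ('t, 'x) module) \<Rightarrow> ('t, 'i \<Rightarrow> 'x) module" where
  "dsum_mod I X = \<lparr>carrier = (\<Pi>\<^sub>E i\<in>I. carrier (X i)), mult = undefined, one = undefined,
     zero = (\<lambda>i\<in>I. \<zero>\<^bsub>X i\<^esub>),
     add = (\<lambda>x y. \<lambda>i\<in>I. x i \<oplus>\<^bsub>X i\<^esub> y i),
     smult = (\<lambda>t x. \<lambda>i\<in>I. t \<odot>\<^bsub>X i\<^esub> x i)\<rparr>"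

definition quot_mod :: "('t, 'x) module \<Rightarrow> 'x set \<Rightarrow> ('t, 'x set) module" where
  "quot_mod X N = \<lparr>carrier = a_rcosets\<^bsub>X\<^esub> N, mult = undefined, one = undefined,
     zero = N,
     add = (\<lambda>C D. C <+>\<^bsub>X\<^esub> D),
     smult = (\<lambda>t C. \<Union>x\<in>C. N +>\<^bsub>X\<^esub> (t \<odot>\<^bsub>X\<^esub> x))\<rparr>"

text \<open>\<open>Hom\<^sub>T(X, Y)\<close> for modules over the \<open>K\<close>-algebra \<open>T\<close>, as a \<open>K\<close>-module.\<close>

definition hom_mod ::
  "('k, 't) module \<Rightarrow> ('t, 'x) module \<Rightarrow> ('t, 'y) module \<Rightarrow> ('k, 'x \<Rightarrow> 'y) module" where
  "hom_mod T X Y = \<lparr>carrier = mod_hom T X Y \<inter> extensional (carrier X),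
     mult = undefined, one = undefined,
     zero = (\<lambda>x\<in>carrier X. \<zero>\<^bsub>Y\<^esub>),
     add = (\<lambda>f g. \<lambda>x\<in>carrier X. f x \<oplus>\<^bsub>Y\<^esub> g x),
     smult = (\<lambda>k f. \<lambda>x\<in>carrier X. k \<odot>\<^bsub>k_res T Y\<^esub> f x)\<rparr>"


section \<open>Tensor products\<close>

definition free_mod :: "('k, 'r) ring_scheme \<Rightarrow> 's set \<Rightarrow> ('k, 's \<Rightarrow> 'k) module" where
  "free_mod K S = \<lparr>carrier = {\<phi>. (\<forall>s\<in>S. \<phi> s \<in> carrier K) \<and> (\<forall>s. s \<notin> S \<longrightarrow> \<phi> s = \<zero>\<^bsub>K\<^esub>) \<and>
                        finite {s. \<phi> s \<noteq> \<zero>\<^bsub>K\<^esub>}},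
     mult = undefined, one = undefined,
     zero = (\<lambda>_. \<zero>\<^bsub>K\<^esub>),
     add = (\<lambda>\<phi> \<psi> s. \<phi> s \<oplus>\<^bsub>K\<^esub> \<psi> s),
     smult = (\<lambda>k \<phi> s. k \<otimes>\<^bsub>K\<^esub> \<phi> s)\<rparr>"

definition basis_elt :: "('k, 'r) ring_scheme \<Rightarrow> 's \<Rightarrow> 's \<Rightarrow> 'k" where
  "basis_elt K s = (\<lambda>s'. if s' = s then \<one>\<^bsub>K\<^esub> else \<zero>\<^bsub>K\<^esub>)"

definition gen_submod :: "('k, 'r) ring_scheme \<Rightarrow> ('k, 'x) module \<Rightarrow> 'x set \<Rightarrow> 'x set" where
  "gen_submod K X R = \<Inter>{N. submodule N K X \<and> R \<subseteq> N}"

definition pres_mod ::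
  "('k, 'r) ring_scheme \<Rightarrow> 's set \<Rightarrow> ('s \<Rightarrow> 'k) set \<Rightarrow> ('k, ('s \<Rightarrow> 'k) set) module" where
  "pres_mod K S R = quot_mod (free_mod K S) (gen_submod K (free_mod K S) R)"

definition pres_gen ::
  "('k, 'r) ring_scheme \<Rightarrow> 's set \<Rightarrow> ('s \<Rightarrow> 'k) set \<Rightarrow> 's \<Rightarrow> ('s \<Rightarrow> 'k) set" where
  "pres_gen K S R s = gen_submod K (free_mod K S) R +>\<^bsub>free_mod K S\<^esub> basis_elt K s"

text \<open>\<open>lift K Y g\<close> is the \<open>K\<close>-linear map from a presented module to \<open>Y\<close> that sends the class of
  each generator \<open>s\<close> to \<open>g s\<close>; it is only used when \<open>g\<close> respects the relations.\<close>

definition lift ::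
  "('k, 'r) ring_scheme \<Rightarrow> ('k, 'y) module \<Rightarrow> ('s \<Rightarrow> 'y) \<Rightarrow> ('s \<Rightarrow> 'k) set \<Rightarrow> 'y" where
  "lift K Y g C = the_elem ((\<lambda>\<phi>. \<Oplus>\<^bsub>Y\<^esub>s\<in>{s. \<phi> s \<noteq> \<zero>\<^bsub>K\<^esub>}. \<phi> s \<odot>\<^bsub>Y\<^esub> g s) ` C)"

subsection \<open>The tensor product over \<open>K\<close>\<close>

definition tens_rels ::
  "('k, 'r) ring_scheme \<Rightarrow> ('k, 'x) module \<Rightarrow> ('k, 'y) module \<Rightarrow> ('x \<times> 'y \<Rightarrow> 'k) set" where
  "tens_rels K X Y = (let F = free_mod K (carrier X \<times> carrier Y); e = basis_elt K in
     {e (x \<oplus>\<^bsub>X\<^esub> x', y) \<ominus>\<^bsub>F\<^esub> (e (x, y) \<oplus>\<^bsub>F\<^esub> e (x', y)) | x x' y.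
        x \<in> carrier X \<and> x' \<in> carrier X \<and> y \<in> carrier Y} \<union>
     {e (x, y \<oplus>\<^bsub>Y\<^esub> y') \<ominus>\<^bsub>F\<^esub> (e (x, y) \<oplus>\<^bsub>F\<^esub> e (x, y')) | x y y'.
        x \<in> carrier X \<and> y \<in> carrier Y \<and> y' \<in> carrier Y} \<union>
     {e (k \<odot>\<^bsub>X\<^esub> x, y) \<ominus>\<^bsub>F\<^esub> (k \<odot>\<^bsub>F\<^esub> e (x, y)) | k x y.
        k \<in> carrier K \<and> x \<in> carrier X \<and> y \<in> carrier Y} \<union>
     {e (x, k \<odot>\<^bsub>Y\<^esub> y) \<ominus>\<^bsub>F\<^esub> (k \<odot>\<^bsub>F\<^esub> e (x, y)) | k x y.
        k \<in> carrier K \<and> x \<in> carrier X \<and> y \<in> carrier Y})"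

definition tens ::
  "('k, 'r) ring_scheme \<Rightarrow> ('k, 'x) module \<Rightarrow> ('k, 'y) module \<Rightarrow> ('k, ('x \<times> 'y \<Rightarrow> 'k) set) module"
  where "tens K X Y = pres_mod K (carrier X \<times> carrier Y) (tens_rels K X Y)"

definition tens_pure ::
  "('k, 'r) ring_scheme \<Rightarrow> ('k, 'x) module \<Rightarrow> ('k, 'y) module \<Rightarrow> 'x \<Rightarrow> 'y \<Rightarrow> ('x \<times> 'y \<Rightarrow> 'k) set"
  where "tens_pure K X Y x y = pres_gen K (carrier X \<times> carrier Y) (tens_rels K X Y) (x, y)"

definition tens_map ::
  "('k, 'r) ring_scheme \<Rightarrow> ('k, 'x') module \<Rightarrow> ('k, 'y') module \<Rightarrow> ('x \<Rightarrow> 'x') \<Rightarrow> ('y \<Rightarrow> 'y') \<Rightarrow>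
     ('x \<times> 'y \<Rightarrow> 'k) set \<Rightarrow> ('x' \<times> 'y' \<Rightarrow> 'k) set" where
  "tens_map K X' Y' f g = lift K (tens K X' Y') (\<lambda>(x, y). tens_pure K X' Y' (f x) (g y))"

definition tens_alg ::
  "('k, 'r) ring_scheme \<Rightarrow> ('k, 'a) module \<Rightarrow> ('k, 'b) module \<Rightarrow> ('k, ('a \<times> 'b \<Rightarrow> 'k) set) module"
  where "tens_alg K S T = (tens K S T)\<lparr>
     mult := \<lambda>u v. lift K (tens K S T) (\<lambda>(s, t). lift K (tens K S T)
               (\<lambda>(s', t'). tens_pure K S T (s \<otimes>\<^bsub>S\<^esub> s') (t \<otimes>\<^bsub>T\<^esub> t')) v) u,
     one := tens_pure K S T \<one>\<^bsub>S\<^esub> \<one>\<^bsub>T\<^esub>\<rparr>"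

text \<open>The algebra \<open>S \<otimes> T\<^sup>o\<close>, and the \<open>S \<otimes> T\<^sup>o\<close>-module given by commuting left \<open>S\<close>- and right
  \<open>T\<close>-actions on a \<open>K\<close>-module.\<close>

definition env_alg ::
  "('k, 'r) ring_scheme \<Rightarrow> ('k, 'a) module \<Rightarrow> ('k, 'b) module \<Rightarrow> ('k, ('a \<times> 'b \<Rightarrow> 'k) set) module"
  where "env_alg K S T = tens_alg K S (op_alg T)"

definition bimod ::
  "('k, 'r) ring_scheme \<Rightarrow> ('k, 'x) module \<Rightarrow> ('a \<Rightarrow> 'x \<Rightarrow> 'x) \<Rightarrow> ('x \<Rightarrow> 'b \<Rightarrow> 'x) \<Rightarrow>
     (('a \<times> 'b \<Rightarrow> 'k) set, 'x) module" where
  "bimod K X l r = with_smult X (\<lambda>t x. lift K X (\<lambda>(a, b). r (l a x) b) t)"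

subsection \<open>The tensor product over a \<open>K\<close>-algebra\<close>

text \<open>\<open>X \<otimes>\<^sub>T Y\<close> for a \<open>K\<close>-module \<open>X\<close> with right \<open>T\<close>-action \<open>r\<close> and a left \<open>T\<close>-module \<open>Y\<close>.\<close>

definition btens_rels ::
  "('k, 'r) ring_scheme \<Rightarrow> ('k, 't) module \<Rightarrow> ('k, 'x) module \<Rightarrow> ('x \<Rightarrow> 't \<Rightarrow> 'x) \<Rightarrow> ('t, 'y) module
     \<Rightarrow> ('x \<times> 'y \<Rightarrow> 'k) set" where
  "btens_rels K T X r Y = tens_rels K X (k_res T Y) \<union>
     {basis_elt K (r x t, y) \<ominus>\<^bsub>free_mod K (carrier X \<times> carrier Y)\<^esub> basis_elt K (x, t \<odot>\<^bsub>Y\<^esub> y) | x t y.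
        x \<in> carrier X \<and> t \<in> carrier T \<and> y \<in> carrier Y}"

definition btens ::
  "('k, 'r) ring_scheme \<Rightarrow> ('k, 't) module \<Rightarrow> ('k, 'x) module \<Rightarrow> ('x \<Rightarrow> 't \<Rightarrow> 'x) \<Rightarrow> ('t, 'y) module
     \<Rightarrow> ('k, ('x \<times> 'y \<Rightarrow> 'k) set) module" where
  "btens K T X r Y = pres_mod K (carrier X \<times> carrier Y) (btens_rels K T X r Y)"

definition btens_pure ::
  "('k, 'r) ring_scheme \<Rightarrow> ('k, 't) module \<Rightarrow> ('k, 'x) module \<Rightarrow> ('x \<Rightarrow> 't \<Rightarrow> 'x) \<Rightarrow> ('t, 'y) module
     \<Rightarrow> 'x \<Rightarrow> 'y \<Rightarrow> ('x \<times> 'y \<Rightarrow> 'k) set" where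
  "btens_pure K T X r Y x y = pres_gen K (carrier X \<times> carrier Y) (btens_rels K T X r Y) (x, y)"

subsection \<open>Tensor powers\<close>

text \<open>\<open>T\<^sup>\<otimes>\<^sup>m\<close>, generated by the lists of length \<open>m\<close> over \<open>T\<close>.\<close>

definition tlists :: "('k, 'a) module \<Rightarrow> nat \<Rightarrow> 'a list set" where
  "tlists T m = {xs. length xs = m \<and> set xs \<subseteq> carrier T}"

definition tpow_rels :: "('k, 'r) ring_scheme \<Rightarrow> ('k, 'a) module \<Rightarrow> nat \<Rightarrow> ('a list \<Rightarrow> 'k) set" where
  "tpow_rels K T m = (let F = free_mod K (tlists T m); e = basis_elt K in
     {e (us @ (x \<oplus>\<^bsub>T\<^esub> y) # vs) \<ominus>\<^bsub>F\<^esub> (e (us @ x # vs) \<oplus>\<^bsub>F\<^esub> e (us @ y # vs)) | us x y vs.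
        us @ x # vs \<in> tlists T m \<and> y \<in> carrier T} \<union>
     {e (us @ (k \<odot>\<^bsub>T\<^esub> x) # vs) \<ominus>\<^bsub>F\<^esub> (k \<odot>\<^bsub>F\<^esub> e (us @ x # vs)) | k us x vs.
        k \<in> carrier K \<and> us @ x # vs \<in> tlists T m})"

definition tpow ::
  "('k, 'r) ring_scheme \<Rightarrow> ('k, 'a) module \<Rightarrow> nat \<Rightarrow> ('k, ('a list \<Rightarrow> 'k) set) module" where
  "tpow K T m = pres_mod K (tlists T m) (tpow_rels K T m)"

definition tpow_pure ::
  "('k, 'r) ring_scheme \<Rightarrow> ('k, 'a) module \<Rightarrow> 'a list \<Rightarrow> ('a list \<Rightarrow> 'k) set" where
  "tpow_pure K T xs = pres_gen K (tlists T (length xs)) (tpow_rels K T (length xs)) xs"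

definition tpow_lact ::
  "('k, 'r) ring_scheme \<Rightarrow> ('k, 'a) module \<Rightarrow> nat \<Rightarrow> 'a \<Rightarrow> ('a list \<Rightarrow> 'k) set \<Rightarrow> ('a list \<Rightarrow> 'k) set"
  where "tpow_lact K T m a =
     lift K (tpow K T m) (\<lambda>xs. tpow_pure K T ((a \<otimes>\<^bsub>T\<^esub> hd xs) # tl xs))"

definition tpow_ract ::
  "('k, 'r) ring_scheme \<Rightarrow> ('k, 'a) module \<Rightarrow> nat \<Rightarrow> ('a list \<Rightarrow> 'k) set \<Rightarrow> 'a \<Rightarrow> ('a list \<Rightarrow> 'k) set"
  where "tpow_ract K T m x a =
     lift K (tpow K T m) (\<lambda>xs. tpow_pure K T (butlast xs @ [last xs \<otimes>\<^bsub>T\<^esub> a])) x"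


section \<open>The bar complex\<close>

text \<open>All complexes are indexed by \<^typ>\<open>int\<close> and vanish in negative degrees, except that the
  augmented bar complex \<open>bar_aug K T p\<close> is only used for \<open>p \<ge> -1\<close>.\<close>

abbreviation ksign :: "('k, 'r) ring_scheme \<Rightarrow> nat \<Rightarrow> 'k" where
  "ksign K i \<equiv> (\<ominus>\<^bsub>K\<^esub> \<one>\<^bsub>K\<^esub>) [^]\<^bsub>K\<^esub> i"

definition bar_aug ::
  "('k, 'r) ring_scheme \<Rightarrow> ('k, 'a) module \<Rightarrow> int \<Rightarrow> ('k, ('a list \<Rightarrow> 'k) set) module" where
  "bar_aug K T p = tpow K T (nat (p + 2))"

text \<open>The differential from degree \<open>p \<ge> 0\<close> to degree \<open>p - 1\<close>; for \<open>p = 0\<close> it is the augmentation.\<close>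

definition bar_aug_d ::
  "('k, 'r) ring_scheme \<Rightarrow> ('k, 'a) module \<Rightarrow> int \<Rightarrow> ('a list \<Rightarrow> 'k) set \<Rightarrow> ('a list \<Rightarrow> 'k) set"
  where "bar_aug_d K T p = lift K (bar_aug K T (p - 1))
     (\<lambda>xs. \<Oplus>\<^bsub>bar_aug K T (p - 1)\<^esub>i\<in>{0..nat p}. ksign K i \<odot>\<^bsub>bar_aug K T (p - 1)\<^esub>
        tpow_pure K T (take i xs @ (xs ! i \<otimes>\<^bsub>T\<^esub> xs ! Suc i) # drop (i + 2) xs))"

definition bar ::
  "('k, 'r) ring_scheme \<Rightarrow> ('k, 'a) module \<Rightarrow> int \<Rightarrow>
     (('a \<times> 'a \<Rightarrow> 'k) set, ('a list \<Rightarrow> 'k) set) module" where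
  "bar K T n = (if n < 0 then zero_mod
     else bimod K (bar_aug K T n) (tpow_lact K T (nat (n + 2))) (tpow_ract K T (nat (n + 2))))"

definition bar_d ::
  "('k, 'r) ring_scheme \<Rightarrow> ('k, 'a) module \<Rightarrow> int \<Rightarrow> ('a list \<Rightarrow> 'k) set \<Rightarrow> ('a list \<Rightarrow> 'k) set"
  where "bar_d K T n = (if n \<le> 0 then (\<lambda>_. \<zero>\<^bsub>bar K T (n - 1)\<^esub>) else bar_aug_d K T n)"


section \<open>Cochain complexes\<close>

record ('k, 'x) cochain_complex =
  obj :: "int \<Rightarrow> ('k, 'x) module"
  diff :: "int \<Rightarrow> 'x \<Rightarrow> 'x"

definition prod_cx ::
  "('k, 'x) cochain_complex \<Rightarrow> ('k, 'y) cochain_complex \<Rightarrow> ('k, 'x \<times> 'y) cochain_complex" where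
  "prod_cx X Y = \<lparr>obj = (\<lambda>n. prod_mod (obj X n) (obj Y n)),
     diff = (\<lambda>n (x, y). (diff X n x, diff Y n y))\<rparr>"

definition dsum_cx ::
  "'i set \<Rightarrow> ('i \<Rightarrow> ('k, 'x) cochain_complex) \<Rightarrow> ('k, 'i \<Rightarrow> 'x) cochain_complex" where
  "dsum_cx I X = \<lparr>obj = (\<lambda>n. dsum_mod I (\<lambda>i. obj (X i) n)),
     diff = (\<lambda>n x. \<lambda>i\<in>I. diff (X i) n (x i))\<rparr>"

definition cone_cx ::
  "('k, 'x) cochain_complex \<Rightarrow> ('k, 'y) cochain_complex \<Rightarrow> (int \<Rightarrow> 'x \<Rightarrow> 'y) \<Rightarrow>
     ('k, 'x \<times> 'y) cochain_complex" where
  "cone_cx X Y f = \<lparr>obj = (\<lambda>n. prod_mod (obj X n) (obj Y (n - 1))),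
     diff = (\<lambda>n (x, y). (diff X n x, f n x \<ominus>\<^bsub>obj Y n\<^esub> diff Y (n - 1) y))\<rparr>"

text \<open>\<open>Hom\<^sub>T(C, Y)\<close> for a chain complex \<open>(C, d)\<close>, \<open>d n\<close> going from degree \<open>n\<close> to degree \<open>n - 1\<close>.\<close>

definition hom_cx ::
  "('k, 't) module \<Rightarrow> (int \<Rightarrow> ('t, 'x) module) \<Rightarrow> (int \<Rightarrow> 'x \<Rightarrow> 'x) \<Rightarrow> ('t, 'y) module \<Rightarrow>
     ('k, 'x \<Rightarrow> 'y) cochain_complex" where
  "hom_cx T C d Y = \<lparr>obj = (\<lambda>n. hom_mod T (C n) Y),
     diff = (\<lambda>n f. \<lambda>x\<in>carrier (C (n + 1)). f (d (n + 1) x))\<rparr>"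

definition coboundaries :: "('k, 'x) cochain_complex \<Rightarrow> int \<Rightarrow> 'x set" where
  "coboundaries X n = diff X (n - 1) ` carrier (obj X (n - 1))"

definition cocycle_mod :: "('k, 'x) cochain_complex \<Rightarrow> int \<Rightarrow> ('k, 'x) module" where
  "cocycle_mod X n =
     (obj X n)\<lparr>carrier := {x \<in> carrier (obj X n). diff X n x = \<zero>\<^bsub>obj X (n + 1)\<^esub>}\<rparr>"

definition cohomology :: "('k, 'x) cochain_complex \<Rightarrow> int \<Rightarrow> ('k, 'x set) module" where
  "cohomology X n = quot_mod (cocycle_mod X n) (coboundaries X n)"

text \<open>The map into the cohomology of \<open>Y\<close> induced by a cochain map \<open>\<phi>\<close> into \<open>Y\<close>.\<close>

definition cohomology_map ::
  "('k, 'y) cochain_complex \<Rightarrow> (int \<Rightarrow> 'x \<Rightarrow> 'y) \<Rightarrow> int \<Rightarrow> 'x set \<Rightarrow> 'y set" where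
  "cohomology_map Y \<phi> n C = (\<Union>x\<in>C. coboundaries Y n +>\<^bsub>obj Y n\<^esub> \<phi> n x)"

definition exact_at ::
  "('k, 'r) ring_scheme \<Rightarrow> ('k, 'x) module \<Rightarrow> ('x \<Rightarrow> 'y) \<Rightarrow> ('k, 'y) module \<Rightarrow> ('y \<Rightarrow> 'z) \<Rightarrow>
     ('k, 'z) module \<Rightarrow> bool" where
  "exact_at K X f Y g Z \<longleftrightarrow> module K X \<and> module K Y \<and> module K Z \<and>
     f \<in> mod_hom K X Y \<and> g \<in> mod_hom K Y Z \<and> f ` carrier X = {y \<in> carrier Y. g y = \<zero>\<^bsub>Z\<^esub>}"


section \<open>Hochschild cochains\<close>

definition hoch_cx ::
  "('k, 'r) ring_scheme \<Rightarrow> ('k, 'a) module \<Rightarrow> (('a \<times> 'a \<Rightarrow> 'k) set, 'y) module \<Rightarrow>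
     ('k, ('a list \<Rightarrow> 'k) set \<Rightarrow> 'y) cochain_complex" where
  "hoch_cx K T \<Lambda> = hom_cx (env_alg K T T) (bar K T) (bar_d K T) \<Lambda>"

definition regular_bimod ::
  "('k, 'r) ring_scheme \<Rightarrow> ('k, 'a) module \<Rightarrow> (('a \<times> 'a \<Rightarrow> 'k) set, 'a) module" where
  "regular_bimod K T = bimod K T (mult T) (mult T)"

text \<open>An \<open>A \<otimes> B\<^sup>o\<close>-module as a left \<open>A\<close>-module and as a left \<open>B\<^sup>o\<close>-module.\<close>

definition res_A ::
  "('k, 'r) ring_scheme \<Rightarrow> ('k, 'a) module \<Rightarrow> ('k, 'b) module \<Rightarrow> (('a \<times> 'b \<Rightarrow> 'k) set, 'm) module
     \<Rightarrow> ('a, 'm) module" where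
  "res_A K A B M = with_smult M (\<lambda>a m. tens_pure K A (op_alg B) a \<one>\<^bsub>B\<^esub> \<odot>\<^bsub>M\<^esub> m)"

definition res_Bo ::
  "('k, 'r) ring_scheme \<Rightarrow> ('k, 'a) module \<Rightarrow> ('k, 'b) module \<Rightarrow> (('a \<times> 'b \<Rightarrow> 'k) set, 'm) module
     \<Rightarrow> ('b, 'm) module" where
  "res_Bo K A B M = with_smult M (\<lambda>b m. tens_pure K A (op_alg B) \<one>\<^bsub>A\<^esub> b \<odot>\<^bsub>M\<^esub> m)"

text \<open>\<open>End\<^bsub>B\<^sup>o\<^esub>(M)\<close> as an \<open>A \<otimes> A\<^sup>o\<close>-module via the ring homomorphism \<open>A \<rightarrow> End\<^bsub>B\<^sup>o\<^esub>(M)\<close>, that is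
  \<open>(a f a')(m) = a f(a' m)\<close>.\<close>

definition End_Bo ::
  "('k, 'r) ring_scheme \<Rightarrow> ('k, 'a) module \<Rightarrow> ('k, 'b) module \<Rightarrow> (('a \<times> 'b \<Rightarrow> 'k) set, 'm) module
     \<Rightarrow> (('a \<times> 'a \<Rightarrow> 'k) set, 'm \<Rightarrow> 'm) module" where
  "End_Bo K A B M = bimod K (hom_mod (op_alg B) (res_Bo K A B M) (res_Bo K A B M))
     (\<lambda>a f. \<lambda>m\<in>carrier M. a \<odot>\<^bsub>res_A K A B M\<^esub> f m)
     (\<lambda>f a. \<lambda>m\<in>carrier M. f (a \<odot>\<^bsub>res_A K A B M\<^esub> m))"

text \<open>\<open>End\<^sub>A(M)\<close> as a \<open>B \<otimes> B\<^sup>o\<close>-module via the ring homomorphism \<open>B \<rightarrow> End\<^sub>A(M)\<^sup>o\<close>, that is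
  \<open>(b f b')(m) = f(m b) b'\<close>.\<close>

definition End_A ::
  "('k, 'r) ring_scheme \<Rightarrow> ('k, 'a) module \<Rightarrow> ('k, 'b) module \<Rightarrow> (('a \<times> 'b \<Rightarrow> 'k) set, 'm) module
     \<Rightarrow> (('b \<times> 'b \<Rightarrow> 'k) set, 'm \<Rightarrow> 'm) module" where
  "End_A K A B M = bimod K (hom_mod A (res_A K A B M) (res_A K A B M))
     (\<lambda>b f. \<lambda>m\<in>carrier M. f (b \<odot>\<^bsub>res_Bo K A B M\<^esub> m))
     (\<lambda>f b. \<lambda>m\<in>carrier M. b \<odot>\<^bsub>res_Bo K A B M\<^esub> f m)"

definition alpha_map ::
  "('k, 'r) ring_scheme \<Rightarrow> ('k, 'a) module \<Rightarrow> ('k, 'b) module \<Rightarrow> (('a \<times> 'b \<Rightarrow> 'k) set, 'm) module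
     \<Rightarrow> int \<Rightarrow> (('a list \<Rightarrow> 'k) set \<Rightarrow> 'a) \<Rightarrow> ('a list \<Rightarrow> 'k) set \<Rightarrow> 'm \<Rightarrow> 'm" where
  "alpha_map K A B M n f =
     (\<lambda>c\<in>carrier (bar K A n). \<lambda>m\<in>carrier M. f c \<odot>\<^bsub>res_A K A B M\<^esub> m)"

definition beta_map ::
  "('k, 'r) ring_scheme \<Rightarrow> ('k, 'a) module \<Rightarrow> ('k, 'b) module \<Rightarrow> (('a \<times> 'b \<Rightarrow> 'k) set, 'm) module
     \<Rightarrow> int \<Rightarrow> (('b list \<Rightarrow> 'k) set \<Rightarrow> 'b) \<Rightarrow> ('b list \<Rightarrow> 'k) set \<Rightarrow> 'm \<Rightarrow> 'm" where
  "beta_map K A B M n f =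
     (\<lambda>c\<in>carrier (bar K B n). \<lambda>m\<in>carrier M. f c \<odot>\<^bsub>res_Bo K A B M\<^esub> m)"


section \<open>The triangular complex\<close>

type_synonym ('k, 'a, 'b) tri_elt =
  "int \<times> int \<Rightarrow> (('a list \<Rightarrow> 'k) set \<times> ('b list \<Rightarrow> 'k) set \<Rightarrow> 'k) set"

definition tri_index :: "int \<Rightarrow> (int \<times> int) set" where
  "tri_index n = {(p, q). p \<ge> -1 \<and> q \<ge> -1 \<and> p + q = n - 1 \<and> (p, q) \<noteq> (-1, -1)}"

definition tri_summand ::
  "('k, 'r) ring_scheme \<Rightarrow> ('k, 'a) module \<Rightarrow> ('k, 'b) module \<Rightarrow> int \<times> int \<Rightarrow>
     ('k, (('a list \<Rightarrow> 'k) set \<times> ('b list \<Rightarrow> 'k) set \<Rightarrow> 'k) set) module" where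
  "tri_summand K A B = (\<lambda>(p, q). tens K (bar_aug K A p) (bar_aug K (op_alg B) q))"

definition tri ::
  "('k, 'r) ring_scheme \<Rightarrow> ('k, 'a) module \<Rightarrow> ('k, 'b) module \<Rightarrow> int \<Rightarrow>
     ('k, ('k, 'a, 'b) tri_elt) module" where
  "tri K A B n = dsum_mod (tri_index n) (tri_summand K A B)"

definition tri_d ::
  "('k, 'r) ring_scheme \<Rightarrow> ('k, 'a) module \<Rightarrow> ('k, 'b) module \<Rightarrow> int \<Rightarrow>
     ('k, 'a, 'b) tri_elt \<Rightarrow> ('k, 'a, 'b) tri_elt" where
  "tri_d K A B n c = (\<lambda>(p, q)\<in>tri_index (n - 1).
     tens_map K (bar_aug K A p) (bar_aug K (op_alg B) q) (bar_aug_d K A (p + 1)) id (c (p + 1, q))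
     \<oplus>\<^bsub>tri_summand K A B (p, q)\<^esub>
     ksign K (nat (p + 1)) \<odot>\<^bsub>tri_summand K A B (p, q)\<^esub>
     tens_map K (bar_aug K A p) (bar_aug K (op_alg B) q)
       id (bar_aug_d K (op_alg B) (q + 1)) (c (p, q + 1)))"

text \<open>The left and right actions of \<open>A \<otimes> B\<^sup>o\<close>.\<close>

definition tri_lact ::
  "('k, 'r) ring_scheme \<Rightarrow> ('k, 'a) module \<Rightarrow> ('k, 'b) module \<Rightarrow> int \<Rightarrow> ('a \<times> 'b \<Rightarrow> 'k) set \<Rightarrow>
     ('k, 'a, 'b) tri_elt \<Rightarrow> ('k, 'a, 'b) tri_elt" where
  "tri_lact K A B n t c = (\<lambda>(p, q)\<in>tri_index n. lift K (tri_summand K A B (p, q))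
     (\<lambda>(a, b). tens_map K (bar_aug K A p) (bar_aug K (op_alg B) q)
        (tpow_lact K A (nat (p + 2)) a) (tpow_lact K (op_alg B) (nat (q + 2)) b) (c (p, q))) t)"

definition tri_ract ::
  "('k, 'r) ring_scheme \<Rightarrow> ('k, 'a) module \<Rightarrow> ('k, 'b) module \<Rightarrow> int \<Rightarrow>
     ('k, 'a, 'b) tri_elt \<Rightarrow> ('a \<times> 'b \<Rightarrow> 'k) set \<Rightarrow> ('k, 'a, 'b) tri_elt" where
  "tri_ract K A B n c t = (\<lambda>(p, q)\<in>tri_index n. lift K (tri_summand K A B (p, q))
     (\<lambda>(a, b). tens_map K (bar_aug K A p) (bar_aug K (op_alg B) q)
        (\<lambda>x. tpow_ract K A (nat (p + 2)) x a) (\<lambda>y. tpow_ract K (op_alg B) (nat (q + 2)) y b)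
        (c (p, q))) t)"

definition tri_incl ::
  "('k, 'r) ring_scheme \<Rightarrow> ('k, 'a) module \<Rightarrow> ('k, 'b) module \<Rightarrow> int \<Rightarrow> int \<times> int \<Rightarrow>
     (('a list \<Rightarrow> 'k) set \<times> ('b list \<Rightarrow> 'k) set \<Rightarrow> 'k) set \<Rightarrow> ('k, 'a, 'b) tri_elt" where
  "tri_incl K A B n i x = (\<lambda>j\<in>tri_index n. if j = i then x else \<zero>\<^bsub>tri_summand K A B j\<^esub>)"

definition tri_tens_pure ::
  "('k, 'r) ring_scheme \<Rightarrow> ('k, 'a) module \<Rightarrow> ('k, 'b) module \<Rightarrow> (('a \<times> 'b \<Rightarrow> 'k) set, 'm) module \<Rightarrow>
     int \<Rightarrow> ('k, 'a, 'b) tri_elt \<Rightarrow> 'm \<Rightarrow> (('k, 'a, 'b) tri_elt \<times> 'm \<Rightarrow> 'k) set" where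
  "tri_tens_pure K A B M n = btens_pure K (env_alg K A B) (tri K A B n) (tri_ract K A B n) M"

definition tri_tens ::
  "('k, 'r) ring_scheme \<Rightarrow> ('k, 'a) module \<Rightarrow> ('k, 'b) module \<Rightarrow> (('a \<times> 'b \<Rightarrow> 'k) set, 'm) module \<Rightarrow>
     int \<Rightarrow> (('a \<times> 'b \<Rightarrow> 'k) set, (('k, 'a, 'b) tri_elt \<times> 'm \<Rightarrow> 'k) set) module" where
  "tri_tens K A B M n = (let X = btens K (env_alg K A B) (tri K A B n) (tri_ract K A B n) M in
     with_smult X (\<lambda>t. lift K X (\<lambda>(c, m). tri_tens_pure K A B M n (tri_lact K A B n t c) m)))"

definition tri_tens_d ::
  "('k, 'r) ring_scheme \<Rightarrow> ('k, 'a) module \<Rightarrow> ('k, 'b) module \<Rightarrow> (('a \<times> 'b \<Rightarrow> 'k) set, 'm) module \<Rightarrow>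
     int \<Rightarrow> (('k, 'a, 'b) tri_elt \<times> 'm \<Rightarrow> 'k) set \<Rightarrow> (('k, 'a, 'b) tri_elt \<times> 'm \<Rightarrow> 'k) set" where
  "tri_tens_d K A B M n =
     lift K (btens K (env_alg K A B) (tri K A B (n - 1)) (tri_ract K A B (n - 1)) M)
       (\<lambda>(c, m). tri_tens_pure K A B M (n - 1) (tri_d K A B n c) m)"

definition tri_cx ::
  "('k, 'r) ring_scheme \<Rightarrow> ('k, 'a) module \<Rightarrow> ('k, 'b) module \<Rightarrow> (('a \<times> 'b \<Rightarrow> 'k) set, 'm) module \<Rightarrow>
     ('k, (('k, 'a, 'b) tri_elt \<times> 'm \<Rightarrow> 'k) set \<Rightarrow> 'm) cochain_complex" where
  "tri_cx K A B M = hom_cx (env_alg K A B) (tri_tens K A B M) (tri_tens_d K A B M) M"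

text \<open>The identification of \<open>C\<^sup>A\<^sub>n \<otimes>\<^sub>A M\<close> with the summand \<open>q = -1\<close> sends \<open>c \<otimes> m\<close> to \<open>(c \<otimes> 1) \<otimes> m\<close>;
  restriction to this summand is followed by the adjunction.\<close>

definition iA_map ::
  "('k, 'r) ring_scheme \<Rightarrow> ('k, 'a) module \<Rightarrow> ('k, 'b) module \<Rightarrow> (('a \<times> 'b \<Rightarrow> 'k) set, 'm) module \<Rightarrow>
     int \<Rightarrow> ((('k, 'a, 'b) tri_elt \<times> 'm \<Rightarrow> 'k) set \<Rightarrow> 'm) \<Rightarrow> ('a list \<Rightarrow> 'k) set \<Rightarrow> 'm \<Rightarrow> 'm" where
  "iA_map K A B M n f = (\<lambda>c\<in>carrier (bar K A n). \<lambda>m\<in>carrier M.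
     f (tri_tens_pure K A B M n
         (tri_incl K A B n (n, -1)
           (tens_pure K (bar_aug K A n) (bar_aug K (op_alg B) (-1))
             c (tpow_pure K (op_alg B) [\<one>\<^bsub>B\<^esub>]))) m))"

text \<open>\<open>C\<^sup>B\<close> and \<open>C\<^bsub>B\<^sup>o\<^esub>\<close> are identified by reversing tensors. Reversal exchanges the faces \<open>i\<close> and
  \<open>n - i\<close>, so the sign \<open>(-1)^(n(n+1)/2)\<close> is needed for this to be an isomorphism of complexes.\<close>

definition bar_rev ::
  "('k, 'r) ring_scheme \<Rightarrow> ('k, 'b) module \<Rightarrow> int \<Rightarrow> ('b list \<Rightarrow> 'k) set \<Rightarrow> ('b list \<Rightarrow> 'k) set"
  where "bar_rev K B n c =
     ksign K (nat (n * (n + 1) div 2)) \<odot>\<^bsub>bar_aug K (op_alg B) n\<^esub>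
     lift K (bar_aug K (op_alg B) n) (\<lambda>xs. tpow_pure K (op_alg B) (rev xs)) c"

definition iB_map ::
  "('k, 'r) ring_scheme \<Rightarrow> ('k, 'a) module \<Rightarrow> ('k, 'b) module \<Rightarrow> (('a \<times> 'b \<Rightarrow> 'k) set, 'm) module \<Rightarrow>
     int \<Rightarrow> ((('k, 'a, 'b) tri_elt \<times> 'm \<Rightarrow> 'k) set \<Rightarrow> 'm) \<Rightarrow> ('b list \<Rightarrow> 'k) set \<Rightarrow> 'm \<Rightarrow> 'm" where
  "iB_map K A B M n f = (\<lambda>c\<in>carrier (bar K B n). \<lambda>m\<in>carrier M.
     f (tri_tens_pure K A B M n
         (tri_incl K A B n (-1, n)
           (tens_pure K (bar_aug K A (-1)) (bar_aug K (op_alg B) n)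
             (tpow_pure K A [\<one>\<^bsub>A\<^esub>]) (bar_rev K B n c))) m))"


section \<open>Modified cohomology\<close>

text \<open>A finite family of \<open>A \<otimes> B\<^sup>o\<close>-modules is a map \<open>M\<close> on a finite index set, and its subfamilies
  are given by subsets \<open>F\<close> of the index set.\<close>

definition lam_source where
  "lam_source K A B M F = prod_cx (hoch_cx K A (regular_bimod K A))
     (prod_cx (dsum_cx F (\<lambda>L. tri_cx K A B (M L))) (hoch_cx K B (regular_bimod K B)))"

definition lam_target where
  "lam_target K A B M F = prod_cx (dsum_cx F (\<lambda>L. hoch_cx K A (End_Bo K A B (M L))))
     (dsum_cx F (\<lambda>L. hoch_cx K B (End_A K A B (M L))))"

definition lam_map where
  "lam_map K A B M F n = (\<lambda>(x, t, y).
     (\<lambda>L\<in>F. alpha_map K A B (M L) n x \<oplus>\<^bsub>obj (hoch_cx K A (End_Bo K A B (M L))) n\<^esub>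
             iA_map K A B (M L) n (t L),
      \<lambda>L\<in>F. beta_map K A B (M L) n y \<oplus>\<^bsub>obj (hoch_cx K B (End_A K A B (M L))) n\<^esub>
             iB_map K A B (M L) n (t L)))"

definition modified_cx where
  "modified_cx K A B M F =
     cone_cx (lam_source K A B M F) (lam_target K A B M F) (lam_map K A B M F)"

definition modified_cohomology where
  "modified_cohomology K A B M F = cohomology (modified_cx K A B M F)"

text \<open>\<open>\<rho>\<^bsub>F,E\<^esub>\<close>; its source is the cohomology of the family indexed by \<open>E \<supseteq> F\<close>.\<close>

definition rho where
  "rho K A B M F = cohomology_map (modified_cx K A B M F)
     (\<lambda>n ((x, t, y), (u, v)). ((x, restrict t F, y), (restrict u F, restrict v F)))"

end

theory Submission
  imports Defs
begin

text \<open>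
  A family \<open>F\<close> enters the complex whose cohomology is \<open>\<H>\<^sup>*F\<close> only as an index set: a cochain has two
  components that do not depend on \<open>F\<close>, in the Hochschild complexes of \<open>A\<close> and \<open>B\<close>, and for each \<open>L \<in> F\<close>
  three components attached to \<open>L\<close>. The differential at \<open>L\<close> involves only \<open>L\<close> and the two fixed
  components. So restricting families is a map of complexes, cochains for \<open>F\<close> and for \<open>G\<close> that agree on
  \<open>F \<inter> G\<close> glue to a unique cochain for \<open>F \<union> G\<close>, and every cochain for \<open>F \<inter> G\<close> extends by zero to one for
  \<open>F\<close> (\<open>gluing_data.cartesian\<close>). In other words
  \<open>0 \<rightarrow> C(F \<union> G) \<rightarrow> C(F) \<times> C(G) \<rightarrow> C(F \<inter> G) \<rightarrow> 0\<close> is a short exact sequence of complexes, and the asserted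
  sequence is its long exact cohomology sequence (\<open>cartesian_square.mayer_vietoris\<close>).

  The substance lies in showing that the objects named here are complexes of \<open>K\<close>-modules and that the
  map whose cone is taken is a chain map. Tensor products are modules given by generators and relations,
  so maps out of them are lifts of multilinear maps and equalities between such maps are checked on pure
  tensors (\<open>lift_eval\<close>, \<open>pres_hom_eq\<close>). Four points then carry the construction.

  The bar differential squares to zero. Prepending the unit is a contracting homotopy of the augmented
  bar complex, and together with the linearity of the differential over the left action it gives the
  claim by induction on the degree (\<open>bar_sum_sum\<close>).

  The triangular complex is the total complex of a double complex \<open>C\<^sup>A \<otimes> C\<^bsub>B\<^sup>o\<^esub>\<close> of bimodules
  (\<open>tri_d_d\<close>). Its differential is linear for both actions of \<open>A \<otimes> B\<^sup>o\<close>, so it survives tensoring with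
  \<open>M\<close> and taking equivariant maps into \<open>M\<close> (\<open>tri_cx_cochain\<close>).

  The maps \<open>\<alpha>\<close> and \<open>\<beta>\<close> are compositions with homomorphisms of coefficient bimodules
  (\<open>alpha_chain_map\<close>, \<open>beta_chain_map\<close>).

  The maps \<open>i\<^sup>A\<close> and \<open>i\<^sup>B\<close> are restrictions along the inclusions of the two edges \<open>q = -1\<close> and \<open>p = -1\<close> of
  the triangular complex, followed by an adjunction (\<open>edge_chain_map\<close>). On the second edge the bar
  complex of \<open>B\<close> is compared with that of \<open>B\<^sup>o\<close> by reversing tensors, with the sign \<open>(-1)^(n(n+1)/2)\<close> that
  makes reversal commute with the differentials (\<open>bar_rev_d\<close>).
\<close>

section \<open>Modules and linear maps\<close>

lemma with_smult_simps [simp]: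
  "carrier (with_smult X act) = carrier X" "zero (with_smult X act) = zero X"
  "add (with_smult X act) = add X" "smult (with_smult X act) = act"
  by (simp_all add: with_smult_def)

lemma op_alg_simps [simp]:
  "carrier (op_alg T) = carrier T" "zero (op_alg T) = zero T" "one (op_alg T) = one T"
  "add (op_alg T) = add T" "smult (op_alg T) = smult T"
  "x \<otimes>\<^bsub>op_alg T\<^esub> y = y \<otimes>\<^bsub>T\<^esub> x"
  by (simp_all add: op_alg_def)

lemma prod_mod_simps [simp]:
  "carrier (prod_mod X Y) = carrier X \<times> carrier Y"
  "zero (prod_mod X Y) = (\<zero>\<^bsub>X\<^esub>, \<zero>\<^bsub>Y\<^esub>)"
  "(x, y) \<oplus>\<^bsub>prod_mod X Y\<^esub> (x', y') = (x \<oplus>\<^bsub>X\<^esub> x', y \<oplus>\<^bsub>Y\<^esub> y')"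
  "t \<odot>\<^bsub>prod_mod X Y\<^esub> (x, y) = (t \<odot>\<^bsub>X\<^esub> x, t \<odot>\<^bsub>Y\<^esub> y)"
  by (simp_all add: prod_mod_def)

lemma dsum_mod_simps [simp]:
  "carrier (dsum_mod I X) = (\<Pi>\<^sub>E i\<in>I. carrier (X i))"
  "zero (dsum_mod I X) = (\<lambda>i\<in>I. \<zero>\<^bsub>X i\<^esub>)"
  "u \<oplus>\<^bsub>dsum_mod I X\<^esub> v = (\<lambda>i\<in>I. u i \<oplus>\<^bsub>X i\<^esub> v i)"
  "t \<odot>\<^bsub>dsum_mod I X\<^esub> u = (\<lambda>i\<in>I. t \<odot>\<^bsub>X i\<^esub> u i)"
  by (simp_all add: dsum_mod_def)

lemma k_res_simps [simp]:
  "carrier (k_res T X) = carrier X" "zero (k_res T X) = zero X" "add (k_res T X) = add X"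
  "k \<odot>\<^bsub>k_res T X\<^esub> x = (k \<odot>\<^bsub>T\<^esub> \<one>\<^bsub>T\<^esub>) \<odot>\<^bsub>X\<^esub> x"
  by (simp_all add: k_res_def)

lemma zero_mod_simps [simp]:
  "carrier zero_mod = {undefined}" "zero zero_mod = undefined"
  "x \<oplus>\<^bsub>zero_mod\<^esub> y = undefined" "t \<odot>\<^bsub>zero_mod\<^esub> y = undefined"
  by (simp_all add: zero_mod_def)

lemma abelian_group_cong:
  assumes "abelian_group X" and "carrier Y = carrier X" "zero Y = zero X" "add Y = add X"
  shows "abelian_group Y"
  by (rule abelian_groupI) (use abelian_groupE[OF assms(1)] assms(2-) in auto)

lemma module_cong:
  assumes "module K X" and "carrier Y = carrier X" "zero Y = zero X" "add Y = add X"
    and "\<And>k x. k \<in> carrier K \<Longrightarrow> x \<in> carrier X \<Longrightarrow> k \<odot>\<^bsub>Y\<^esub> x = k \<odot>\<^bsub>X\<^esub> x"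
  shows "module K Y"
proof -
  interpret X: module K X by fact
  show ?thesis
    by (rule moduleI[OF X.R.cring_axioms abelian_group_cong[OF X.abelian_group_axioms assms(2-4)]])
       (use assms in \<open>auto simp: X.smult_l_distr X.smult_r_distr X.smult_assoc1\<close>)
qed

lemma zero_mod_abelian_group: "abelian_group zero_mod"
  by (rule abelian_groupI) auto

lemma mod_homI:
  assumes "\<And>x. x \<in> carrier X \<Longrightarrow> f x \<in> carrier Y"
    and "\<And>x y. x \<in> carrier X \<Longrightarrow> y \<in> carrier X \<Longrightarrow> f (x \<oplus>\<^bsub>X\<^esub> y) = f x \<oplus>\<^bsub>Y\<^esub> f y"
    and "\<And>t x. t \<in> carrier T \<Longrightarrow> x \<in> carrier X \<Longrightarrow> f (t \<odot>\<^bsub>X\<^esub> x) = t \<odot>\<^bsub>Y\<^esub> f x"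
  shows "f \<in> mod_hom T X Y"
  using assms by (auto simp: mod_hom_def)

lemma mod_hom_closed: "f \<in> mod_hom T X Y \<Longrightarrow> x \<in> carrier X \<Longrightarrow> f x \<in> carrier Y"
  by (auto simp: mod_hom_def)

lemma mod_hom_add:
  "f \<in> mod_hom T X Y \<Longrightarrow> x \<in> carrier X \<Longrightarrow> y \<in> carrier X \<Longrightarrow> f (x \<oplus>\<^bsub>X\<^esub> y) = f x \<oplus>\<^bsub>Y\<^esub> f y"
  by (auto simp: mod_hom_def)

lemma mod_hom_smult:
  "f \<in> mod_hom T X Y \<Longrightarrow> t \<in> carrier T \<Longrightarrow> x \<in> carrier X \<Longrightarrow> f (t \<odot>\<^bsub>X\<^esub> x) = t \<odot>\<^bsub>Y\<^esub> f x"
  by (auto simp: mod_hom_def)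

lemma additive_zero:
  assumes "abelian_group X" "abelian_group Y"
    and "f \<zero>\<^bsub>X\<^esub> \<in> carrier Y" "f (\<zero>\<^bsub>X\<^esub> \<oplus>\<^bsub>X\<^esub> \<zero>\<^bsub>X\<^esub>) = f \<zero>\<^bsub>X\<^esub> \<oplus>\<^bsub>Y\<^esub> f \<zero>\<^bsub>X\<^esub>"
  shows "f \<zero>\<^bsub>X\<^esub> = \<zero>\<^bsub>Y\<^esub>"
proof -
  interpret X: abelian_group X by fact
  interpret Y: abelian_group Y by fact
  show ?thesis using assms(3,4) Y.add.r_cancel_one by simp
qed

lemma mod_hom_zero:
  assumes "f \<in> mod_hom T X Y" "abelian_group X" "abelian_group Y"
  shows "f \<zero>\<^bsub>X\<^esub> = \<zero>\<^bsub>Y\<^esub>"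
  by (rule additive_zero)
     (use assms in \<open>auto simp: mod_hom_add mod_hom_closed abelian_groupE(2)\<close>)

lemma mod_hom_neg:
  assumes f: "f \<in> mod_hom T X Y" and ab: "abelian_group X" "abelian_group Y" and x: "x \<in> carrier X"
  shows "f (\<ominus>\<^bsub>X\<^esub> x) = \<ominus>\<^bsub>Y\<^esub> f x"
proof -
  interpret X: abelian_group X by fact
  interpret Y: abelian_group Y by fact
  have "f (\<ominus>\<^bsub>X\<^esub> x) \<oplus>\<^bsub>Y\<^esub> f x = f (\<ominus>\<^bsub>X\<^esub> x \<oplus>\<^bsub>X\<^esub> x)"
    using x by (simp add: mod_hom_add[OF f])
  also have "\<dots> = \<zero>\<^bsub>Y\<^esub>" using x mod_hom_zero[OF f ab] by (simp add: X.l_neg)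
  finally show ?thesis using x by (simp add: Y.minus_equality mod_hom_closed[OF f])
qed

lemma mod_hom_minus:
  assumes f: "f \<in> mod_hom T X Y" and ab: "abelian_group X" "abelian_group Y"
    and x: "x \<in> carrier X" "y \<in> carrier X"
  shows "f (x \<ominus>\<^bsub>X\<^esub> y) = f x \<ominus>\<^bsub>Y\<^esub> f y"
  using x ab by (simp add: a_minus_def mod_hom_add[OF f] mod_hom_neg[OF f]
    abelian_group.a_inv_closed)

lemma mod_hom_finsum:
  assumes f: "f \<in> mod_hom T X Y" and ab: "abelian_group X" "abelian_group Y"
    and A: "finite A" "g \<in> A \<rightarrow> carrier X"
  shows "f (\<Oplus>\<^bsub>X\<^esub>i\<in>A. g i) = (\<Oplus>\<^bsub>Y\<^esub>i\<in>A. f (g i))"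
proof -
  interpret X: abelian_group X by fact
  interpret Y: abelian_group Y by fact
  show ?thesis using A
    by (induction A rule: finite_induct)
       (auto simp: mod_hom_zero[OF f ab] mod_hom_add[OF f] mod_hom_closed[OF f] Pi_def)
qed

lemma mod_hom_comp:
  "f \<in> mod_hom T X Y \<Longrightarrow> g \<in> mod_hom T Y Z \<Longrightarrow> (\<lambda>x. g (f x)) \<in> mod_hom T X Z"
  by (auto simp: mod_hom_def Pi_def)

lemma mod_hom_ident: "(\<lambda>x. x) \<in> mod_hom T X X"
  by (auto simp: mod_hom_def)

lemma mod_hom_id: "id \<in> mod_hom T X X"
  by (auto simp: mod_hom_def)

lemma mod_hom_cong:
  assumes "f \<in> mod_hom T X Y" "\<And>x. x \<in> carrier X \<Longrightarrow> g x = f x" "module T X"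
  shows "g \<in> mod_hom T X Y"
proof -
  interpret X: module T X by fact
  show ?thesis using assms(1,2) by (auto simp: mod_hom_def)
qed

lemma (in abelian_group) add_swap:
  assumes "a \<in> carrier G" "b \<in> carrier G" "c \<in> carrier G" "d \<in> carrier G"
  shows "(a \<oplus> b) \<oplus> (c \<oplus> d) = (a \<oplus> c) \<oplus> (b \<oplus> d)"
  using assms by (simp add: a_ac)

lemma mod_hom_plus:
  assumes "module K Y" "f \<in> mod_hom K X Y" "g \<in> mod_hom K X Y"
  shows "(\<lambda>x. f x \<oplus>\<^bsub>Y\<^esub> g x) \<in> mod_hom K X Y"
proof -
  interpret Y: module K Y by fact
  show ?thesis
    by (rule mod_homI)
       (auto simp: mod_hom_closed[OF assms(2)] mod_hom_closed[OF assms(3)] mod_hom_add[OF assms(2)]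
         mod_hom_add[OF assms(3)] mod_hom_smult[OF assms(2)] mod_hom_smult[OF assms(3)]
         Y.smult_r_distr Y.add_swap)
qed

lemma (in module) smult_swap:
  "a \<in> carrier R \<Longrightarrow> b \<in> carrier R \<Longrightarrow> x \<in> carrier M \<Longrightarrow> a \<odot>\<^bsub>M\<^esub> (b \<odot>\<^bsub>M\<^esub> x) = b \<odot>\<^bsub>M\<^esub> (a \<odot>\<^bsub>M\<^esub> x)"
  by (metis smult_assoc1 R.m_comm)

lemma mod_hom_scale:
  assumes "module K Y" "f \<in> mod_hom K X Y" "k \<in> carrier K"
  shows "(\<lambda>x. k \<odot>\<^bsub>Y\<^esub> f x) \<in> mod_hom K X Y"
proof -
  interpret Y: module K Y by fact
  show ?thesis
    by (rule mod_homI)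
       (use assms(3) in \<open>auto simp: mod_hom_closed[OF assms(2)] mod_hom_add[OF assms(2)]
          mod_hom_smult[OF assms(2)] Y.smult_r_distr Y.smult_swap\<close>)
qed

lemma mod_hom_const_zero:
  assumes "module K Y" shows "(\<lambda>x. \<zero>\<^bsub>Y\<^esub>) \<in> mod_hom K X Y"
proof -
  interpret Y: module K Y by fact
  show ?thesis by (rule mod_homI) auto
qed

lemma mod_hom_sum:
  assumes "module K Y" "finite A" "\<And>i. i \<in> A \<Longrightarrow> f i \<in> mod_hom K X Y"
  shows "(\<lambda>x. \<Oplus>\<^bsub>Y\<^esub>i\<in>A. f i x) \<in> mod_hom K X Y"
proof -
  interpret Y: module K Y by fact
  have cl: "\<And>i x. i \<in> A \<Longrightarrow> x \<in> carrier X \<Longrightarrow> f i x \<in> carrier Y"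
    by (rule mod_hom_closed[OF assms(3)])
  show ?thesis
  proof (rule mod_homI)
    fix x y assume x: "x \<in> carrier X" "y \<in> carrier X"
    have "(\<Oplus>\<^bsub>Y\<^esub>i\<in>A. f i (x \<oplus>\<^bsub>X\<^esub> y)) = (\<Oplus>\<^bsub>Y\<^esub>i\<in>A. f i x \<oplus>\<^bsub>Y\<^esub> f i y)"
      by (rule Y.finsum_cong') (use x cl in \<open>auto simp: mod_hom_add[OF assms(3)]\<close>)
    also have "\<dots> = (\<Oplus>\<^bsub>Y\<^esub>i\<in>A. f i x) \<oplus>\<^bsub>Y\<^esub> (\<Oplus>\<^bsub>Y\<^esub>i\<in>A. f i y)"
      by (rule Y.finsum_addf) (use x cl in auto)
    finally show "(\<Oplus>\<^bsub>Y\<^esub>i\<in>A. f i (x \<oplus>\<^bsub>X\<^esub> y)) = \<dots>" .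
  next
    fix t x assume t: "t \<in> carrier K" and x: "x \<in> carrier X"
    have "(\<Oplus>\<^bsub>Y\<^esub>i\<in>A. f i (t \<odot>\<^bsub>X\<^esub> x)) = (\<Oplus>\<^bsub>Y\<^esub>i\<in>A. t \<odot>\<^bsub>Y\<^esub> f i x)"
      by (rule Y.finsum_cong') (use t x cl in \<open>auto simp: mod_hom_smult[OF assms(3)]\<close>)
    then show "(\<Oplus>\<^bsub>Y\<^esub>i\<in>A. f i (t \<odot>\<^bsub>X\<^esub> x)) = t \<odot>\<^bsub>Y\<^esub> (\<Oplus>\<^bsub>Y\<^esub>i\<in>A. f i x)"
      using t x cl by (simp add: Y.finsum_smult_ldistr[OF assms(2)])
  next
    fix x assume "x \<in> carrier X"
    then show "(\<Oplus>\<^bsub>Y\<^esub>i\<in>A. f i x) \<in> carrier Y" using cl by (intro Y.finsum_closed) simp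
  qed
qed

lemma prod_mod_module:
  assumes "module K X" "module K Y" shows "module K (prod_mod X Y)"
proof -
  interpret X: module K X by fact
  interpret Y: module K Y by fact
  have "abelian_group (prod_mod X Y)"
  proof (rule abelian_groupI)
    fix u assume "u \<in> carrier (prod_mod X Y)"
    then show "\<exists>v\<in>carrier (prod_mod X Y). v \<oplus>\<^bsub>prod_mod X Y\<^esub> u = \<zero>\<^bsub>prod_mod X Y\<^esub>"
      by (intro bexI[of _ "(\<ominus>\<^bsub>X\<^esub> fst u, \<ominus>\<^bsub>Y\<^esub> snd u)"]) (auto simp: X.l_neg Y.l_neg)
  qed (auto simp: X.a_ac Y.a_ac)
  then show ?thesis
    by (rule moduleI[OF X.R.cring_axioms])
       (auto simp: X.smult_l_distr X.smult_r_distr X.smult_assoc1 Y.smult_l_distr Y.smult_r_distr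
         Y.smult_assoc1)
qed

lemma dsum_mod_module:
  assumes K: "cring K" and X: "\<And>i. i \<in> I \<Longrightarrow> module K (X i)" shows "module K (dsum_mod I X)"
proof -
  have ab: "\<And>i. i \<in> I \<Longrightarrow> abelian_group (X i)" using X by (auto simp: module_def)
  note s = abelian_groupE[OF ab] module.smult_closed[OF X]
  have "abelian_group (dsum_mod I X)"
  proof (rule abelian_groupI)
    fix u assume "u \<in> carrier (dsum_mod I X)"
    then show "\<exists>v\<in>carrier (dsum_mod I X). v \<oplus>\<^bsub>dsum_mod I X\<^esub> u = \<zero>\<^bsub>dsum_mod I X\<^esub>"
      by (intro bexI[of _ "\<lambda>i\<in>I. \<ominus>\<^bsub>X i\<^esub> u i"])
         (auto simp: fun_eq_iff PiE_iff abelian_group.l_neg[OF ab] abelian_group.a_inv_closed[OF ab])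
  next
    fix u assume "u \<in> carrier (dsum_mod I X)"
    then show "\<zero>\<^bsub>dsum_mod I X\<^esub> \<oplus>\<^bsub>dsum_mod I X\<^esub> u = u"
      by (auto simp: fun_eq_iff PiE_iff extensional_def s(2,5))
  next
    fix u v w assume "u \<in> carrier (dsum_mod I X)" "v \<in> carrier (dsum_mod I X)" "w \<in> carrier (dsum_mod I X)"
    then show "u \<oplus>\<^bsub>dsum_mod I X\<^esub> v \<oplus>\<^bsub>dsum_mod I X\<^esub> w = u \<oplus>\<^bsub>dsum_mod I X\<^esub> (v \<oplus>\<^bsub>dsum_mod I X\<^esub> w)"
      by (auto simp: fun_eq_iff s(3) PiE_iff)
  next
    fix u v assume "u \<in> carrier (dsum_mod I X)" "v \<in> carrier (dsum_mod I X)"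
    then show "u \<oplus>\<^bsub>dsum_mod I X\<^esub> v = v \<oplus>\<^bsub>dsum_mod I X\<^esub> u"
      by (auto simp: fun_eq_iff s(4) PiE_iff)
  qed (auto simp: s(1,2) PiE_iff)
  then show ?thesis
    by (rule moduleI[OF K])
       (auto simp: fun_eq_iff s(1) module.smult_closed[OF X] PiE_iff extensional_def module.smult_l_distr[OF X] module.smult_r_distr[OF X]
         module.smult_assoc1[OF X] module.smult_one[OF X])
qed

lemma dsum_eqI:
  "u \<in> (\<Pi>\<^sub>E i\<in>I. Y i) \<Longrightarrow> v \<in> (\<Pi>\<^sub>E i\<in>I. Z i) \<Longrightarrow> (\<And>i. i \<in> I \<Longrightarrow> u i = v i) \<Longrightarrow> u = v"
  by (rule PiE_ext[where k=I and s="\<lambda>i. UNIV"]) (auto simp: PiE_def)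

section \<open>Quotients and presented modules\<close>

lemma r_coset_cong:
  "add X = add Y \<Longrightarrow> N +>\<^bsub>X\<^esub> x = N +>\<^bsub>Y\<^esub> x"
  by (simp add: a_r_coset_def')

context
  fixes K :: "('k, 'r) ring_scheme" and X :: "('k, 'x) module" and N :: "'x set"
  assumes X: "module K X" and N: "submodule N K X"
begin

interpretation X: module K X by (rule X)

interpretation N: abelian_subgroup N X
  using N by (intro abelian_subgroupI3 additive_subgroupI X.abelian_group_axioms)
    (simp add: submodule_def)

lemma quot_carrier: "carrier (quot_mod X N) = (\<lambda>x. N +>\<^bsub>X\<^esub> x) ` carrier X"
  by (auto simp: quot_mod_def A_RCOSETS_def')

lemma quot_closed: "x \<in> carrier X \<Longrightarrow> N +>\<^bsub>X\<^esub> x \<in> carrier (quot_mod X N)"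
  by (auto simp: quot_carrier)

lemma quot_eq_iff:
  assumes "x \<in> carrier X" "y \<in> carrier X"
  shows "N +>\<^bsub>X\<^esub> x = N +>\<^bsub>X\<^esub> y \<longleftrightarrow> x \<ominus>\<^bsub>X\<^esub> y \<in> N"
proof
  assume "N +>\<^bsub>X\<^esub> x = N +>\<^bsub>X\<^esub> y"
  then have "x \<in> N +>\<^bsub>X\<^esub> y" using N.a_rcos_self assms by blast
  then show "x \<ominus>\<^bsub>X\<^esub> y \<in> N" using N.a_rcos_module assms by (simp add: a_minus_def)
next
  assume "x \<ominus>\<^bsub>X\<^esub> y \<in> N"
  then have "x \<in> N +>\<^bsub>X\<^esub> y" using N.a_rcos_module assms by (simp add: a_minus_def)
  then show "N +>\<^bsub>X\<^esub> x = N +>\<^bsub>X\<^esub> y" using N.a_repr_independence' assms by blast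
qed

lemma quot_zero: "\<zero>\<^bsub>quot_mod X N\<^esub> = N +>\<^bsub>X\<^esub> \<zero>\<^bsub>X\<^esub>"
  by (simp add: quot_mod_def N.a_rcos_const)

lemma quot_add:
  "x \<in> carrier X \<Longrightarrow> y \<in> carrier X \<Longrightarrow>
    (N +>\<^bsub>X\<^esub> x) \<oplus>\<^bsub>quot_mod X N\<^esub> (N +>\<^bsub>X\<^esub> y) = N +>\<^bsub>X\<^esub> (x \<oplus>\<^bsub>X\<^esub> y)"
  by (simp add: quot_mod_def N.a_rcos_sum)

lemma coset_elt:
  assumes "x \<in> carrier X" "y \<in> N +>\<^bsub>X\<^esub> x"
  shows "y \<in> carrier X" "N +>\<^bsub>X\<^esub> y = N +>\<^bsub>X\<^esub> x" "y \<ominus>\<^bsub>X\<^esub> x \<in> N"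
  using N.a_elemrcos_carrier[OF assms] N.a_repr_independence'[OF assms(2,1)]
    N.a_rcos_module_imp[OF assms]
  by (simp_all add: a_minus_def)

lemma coset_self: "x \<in> carrier X \<Longrightarrow> x \<in> N +>\<^bsub>X\<^esub> x"
  by (rule N.a_rcos_self)

lemma quot_smult:
  assumes "k \<in> carrier K" "x \<in> carrier X"
  shows "k \<odot>\<^bsub>quot_mod X N\<^esub> (N +>\<^bsub>X\<^esub> x) = N +>\<^bsub>X\<^esub> (k \<odot>\<^bsub>X\<^esub> x)"
proof -
  have "N +>\<^bsub>X\<^esub> (k \<odot>\<^bsub>X\<^esub> y) = N +>\<^bsub>X\<^esub> (k \<odot>\<^bsub>X\<^esub> x)" if y: "y \<in> N +>\<^bsub>X\<^esub> x" for y
  proof -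
    note c = coset_elt[OF assms(2) y]
    have "k \<odot>\<^bsub>X\<^esub> y \<ominus>\<^bsub>X\<^esub> k \<odot>\<^bsub>X\<^esub> x = k \<odot>\<^bsub>X\<^esub> (y \<ominus>\<^bsub>X\<^esub> x)"
      using assms c by (simp add: a_minus_def X.smult_r_distr X.smult_r_minus)
    also have "\<dots> \<in> N" using N c assms by (simp add: submodule.smult_closed)
    finally show ?thesis using assms c by (simp add: quot_eq_iff)
  qed
  then have "(\<Union>y\<in>N +>\<^bsub>X\<^esub> x. N +>\<^bsub>X\<^esub> (k \<odot>\<^bsub>X\<^esub> y)) = (\<Union>y\<in>N +>\<^bsub>X\<^esub> x. N +>\<^bsub>X\<^esub> (k \<odot>\<^bsub>X\<^esub> x))"
    by (intro SUP_cong refl)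
  also have "\<dots> = N +>\<^bsub>X\<^esub> (k \<odot>\<^bsub>X\<^esub> x)"
    using coset_self[OF assms(2)] by blast
  finally show ?thesis by (simp add: quot_mod_def)
qed

lemma quot_cases:
  assumes "C \<in> carrier (quot_mod X N)"
  obtains x where "x \<in> carrier X" "C = N +>\<^bsub>X\<^esub> x"
  using assms unfolding quot_carrier by blast

lemma quot_mod_module: "module K (quot_mod X N)"
proof (rule moduleI[OF X.R.cring_axioms])
  let ?Q = "quot_mod X N"
  show "abelian_group ?Q"
  proof (rule abelian_groupI)
    fix C assume "C \<in> carrier ?Q"
    then obtain x where x: "x \<in> carrier X" "C = N +>\<^bsub>X\<^esub> x" by (rule quot_cases)
    have "(N +>\<^bsub>X\<^esub> (\<ominus>\<^bsub>X\<^esub> x)) \<oplus>\<^bsub>?Q\<^esub> C = \<zero>\<^bsub>?Q\<^esub>"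
      unfolding x(2) quot_zero using x(1) by (simp only: quot_add X.a_inv_closed X.l_neg)
    then show "\<exists>D\<in>carrier ?Q. D \<oplus>\<^bsub>?Q\<^esub> C = \<zero>\<^bsub>?Q\<^esub>"
      using quot_closed X.a_inv_closed x(1) by blast
    show "\<zero>\<^bsub>?Q\<^esub> \<oplus>\<^bsub>?Q\<^esub> C = C"
      unfolding x(2) quot_zero using x(1) by (simp only: quot_add X.zero_closed X.l_zero)
    fix D assume "D \<in> carrier ?Q"
    then obtain y where y: "y \<in> carrier X" "D = N +>\<^bsub>X\<^esub> y" by (rule quot_cases)
    show "C \<oplus>\<^bsub>?Q\<^esub> D \<in> carrier ?Q"
      unfolding x(2) y(2) using x(1) y(1) by (simp only: quot_add X.a_closed quot_closed)
    show "C \<oplus>\<^bsub>?Q\<^esub> D = D \<oplus>\<^bsub>?Q\<^esub> C"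
      unfolding x(2) y(2) using x(1) y(1) by (simp only: quot_add X.a_comm)
    fix E assume "E \<in> carrier ?Q"
    then obtain z where z: "z \<in> carrier X" "E = N +>\<^bsub>X\<^esub> z" by (rule quot_cases)
    show "C \<oplus>\<^bsub>?Q\<^esub> D \<oplus>\<^bsub>?Q\<^esub> E = C \<oplus>\<^bsub>?Q\<^esub> (D \<oplus>\<^bsub>?Q\<^esub> E)"
      unfolding x(2) y(2) z(2) using x(1) y(1) z(1) by (simp only: quot_add X.a_assoc X.a_closed)
  next
    show "\<zero>\<^bsub>?Q\<^esub> \<in> carrier ?Q" unfolding quot_zero by (rule quot_closed) (rule X.zero_closed)
  qed
  fix a C assume a: "a \<in> carrier K" and "C \<in> carrier ?Q"
  then obtain x where x: "x \<in> carrier X" "C = N +>\<^bsub>X\<^esub> x" by (blast elim: quot_cases)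
  show "a \<odot>\<^bsub>?Q\<^esub> C \<in> carrier ?Q"
    unfolding x(2) using a x(1) by (simp only: quot_smult X.smult_closed quot_closed)
  fix b assume b: "b \<in> carrier K"
  show "(a \<oplus>\<^bsub>K\<^esub> b) \<odot>\<^bsub>?Q\<^esub> C = a \<odot>\<^bsub>?Q\<^esub> C \<oplus>\<^bsub>?Q\<^esub> b \<odot>\<^bsub>?Q\<^esub> C"
    unfolding x(2) using a b x(1)
    by (simp only: quot_smult X.smult_closed quot_add X.smult_l_distr X.R.add.m_closed)
  show "(a \<otimes>\<^bsub>K\<^esub> b) \<odot>\<^bsub>?Q\<^esub> C = a \<odot>\<^bsub>?Q\<^esub> (b \<odot>\<^bsub>?Q\<^esub> C)"
    unfolding x(2) using a b x(1)
    by (simp only: quot_smult X.smult_closed X.smult_assoc1 X.R.m_closed)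
next
  let ?Q = "quot_mod X N"
  fix a C D assume a: "a \<in> carrier K" and "C \<in> carrier ?Q" "D \<in> carrier ?Q"
  then obtain x y where x: "x \<in> carrier X" "C = N +>\<^bsub>X\<^esub> x" and y: "y \<in> carrier X" "D = N +>\<^bsub>X\<^esub> y"
    by (blast elim: quot_cases)
  show "a \<odot>\<^bsub>?Q\<^esub> (C \<oplus>\<^bsub>?Q\<^esub> D) = a \<odot>\<^bsub>?Q\<^esub> C \<oplus>\<^bsub>?Q\<^esub> a \<odot>\<^bsub>?Q\<^esub> D"
    unfolding x(2) y(2) using a x(1) y(1)
    by (simp only: quot_smult X.smult_closed quot_add X.smult_r_distr X.a_closed)
next
  fix C assume "C \<in> carrier (quot_mod X N)"
  then obtain x where x: "x \<in> carrier X" "C = N +>\<^bsub>X\<^esub> x" by (rule quot_cases)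
  show "\<one>\<^bsub>K\<^esub> \<odot>\<^bsub>quot_mod X N\<^esub> C = C"
    unfolding x(2) using x(1) by (simp only: quot_smult X.smult_one X.R.one_closed)
qed

lemma quot_proj_hom: "(\<lambda>x. N +>\<^bsub>X\<^esub> x) \<in> mod_hom K X (quot_mod X N)"
  by (rule mod_homI) (auto simp: quot_closed quot_add quot_smult)

end

lemma (in abelian_group) minus_eq_zeroD:
  assumes "x \<ominus> y = \<zero>" "x \<in> carrier G" "y \<in> carrier G" shows "x = y"
  using minus_equality[of x "\<ominus> y"] assms by (simp add: a_minus_def)

lemma (in abelian_group) minus_zero: "x \<in> carrier G \<Longrightarrow> x \<ominus> \<zero> = x"
  by (simp add: a_minus_def)

lemma kernel_submodule:
  assumes "module K X" "module K Y" "f \<in> mod_hom K X Y"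
  shows "submodule {x \<in> carrier X. f x = \<zero>\<^bsub>Y\<^esub>} K X"
proof -
  interpret X: module K X by fact
  interpret Y: module K Y by fact
  note ab = X.abelian_group_axioms Y.abelian_group_axioms
  show ?thesis
    by (rule X.submoduleI)
       (auto simp: mod_hom_zero[OF assms(3) ab] mod_hom_neg[OF assms(3) ab] mod_hom_add[OF assms(3)]
         mod_hom_smult[OF assms(3)])
qed

lemma gen_submod_submodule:
  assumes X: "module K X" and R: "R \<subseteq> carrier X"
  shows "submodule (gen_submod K X R) K X"
proof -
  interpret X: module K X by fact
  have c: "gen_submod K X R \<subseteq> carrier X"
    using R X.carrier_is_submodule by (auto simp: gen_submod_def)
  have z: "\<zero>\<^bsub>X\<^esub> \<in> H" if "submodule H K X" for H
    using subgroup.one_closed[OF submodule.axioms(1)[OF that]] by simp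
  show ?thesis
    by (rule X.submoduleI) (use c z X.submoduleE in \<open>auto simp: gen_submod_def\<close>)
qed

lemma gen_submod_incl: "R \<subseteq> gen_submod K X R"
  by (auto simp: gen_submod_def)

lemma gen_submod_least: "submodule N K X \<Longrightarrow> R \<subseteq> N \<Longrightarrow> gen_submod K X R \<subseteq> N"
  by (auto simp: gen_submod_def)

lemma free_mod_simps [simp]:
  "zero (free_mod K S) = (\<lambda>_. \<zero>\<^bsub>K\<^esub>)"
  "add (free_mod K S) = (\<lambda>\<phi> \<psi> s. \<phi> s \<oplus>\<^bsub>K\<^esub> \<psi> s)"
  "smult (free_mod K S) = (\<lambda>k \<phi> s. k \<otimes>\<^bsub>K\<^esub> \<phi> s)"
  by (simp_all add: free_mod_def)

lemma free_carrier:
  "\<phi> \<in> carrier (free_mod K S) \<longleftrightarrow> (\<forall>s\<in>S. \<phi> s \<in> carrier K) \<and> (\<forall>s. s \<notin> S \<longrightarrow> \<phi> s = \<zero>\<^bsub>K\<^esub>) \<and>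
     finite {s. \<phi> s \<noteq> \<zero>\<^bsub>K\<^esub>}"
  by (simp add: free_mod_def)

definition lin_ext ::
  "('k, 'r) ring_scheme \<Rightarrow> ('k, 'y) module \<Rightarrow> ('s \<Rightarrow> 'y) \<Rightarrow> ('s \<Rightarrow> 'k) \<Rightarrow> 'y" where
  "lin_ext K Y g \<phi> = (\<Oplus>\<^bsub>Y\<^esub>s\<in>{s. \<phi> s \<noteq> \<zero>\<^bsub>K\<^esub>}. \<phi> s \<odot>\<^bsub>Y\<^esub> g s)"

definition respects_rels where
  "respects_rels K Y S R g \<longleftrightarrow> g \<in> S \<rightarrow> carrier Y \<and> (\<forall>r\<in>R. lin_ext K Y g r = \<zero>\<^bsub>Y\<^esub>)"

context
  fixes K :: "('k, 'r) ring_scheme"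
  assumes K: "cring K"
begin

interpretation K: cring K by (rule K)

lemma free_module: "module K (free_mod K S)"
proof -
  have c: "\<phi> s \<in> carrier K" if "\<phi> \<in> carrier (free_mod K S)" for \<phi> s
    using that by (cases "s \<in> S") (auto simp: free_carrier)
  have f: "finite {s. \<phi> s \<oplus>\<^bsub>K\<^esub> \<psi> s \<noteq> \<zero>\<^bsub>K\<^esub>}"
    if "\<phi> \<in> carrier (free_mod K S)" "\<psi> \<in> carrier (free_mod K S)" for \<phi> \<psi>
  proof (rule finite_subset)
    show "{s. \<phi> s \<oplus>\<^bsub>K\<^esub> \<psi> s \<noteq> \<zero>\<^bsub>K\<^esub>} \<subseteq> {s. \<phi> s \<noteq> \<zero>\<^bsub>K\<^esub>} \<union> {s. \<psi> s \<noteq> \<zero>\<^bsub>K\<^esub>}" by auto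
  qed (use that in \<open>auto simp: free_carrier\<close>)
  have g: "finite {s. k \<otimes>\<^bsub>K\<^esub> \<phi> s \<noteq> \<zero>\<^bsub>K\<^esub>}"
    if "\<phi> \<in> carrier (free_mod K S)" "k \<in> carrier K" for \<phi> k
  proof (rule finite_subset)
    show "{s. k \<otimes>\<^bsub>K\<^esub> \<phi> s \<noteq> \<zero>\<^bsub>K\<^esub>} \<subseteq> {s. \<phi> s \<noteq> \<zero>\<^bsub>K\<^esub>}" using that(2) by auto
  qed (use that in \<open>auto simp: free_carrier\<close>)
  have "abelian_group (free_mod K S)"
  proof (rule abelian_groupI)
    fix \<phi> assume \<phi>: "\<phi> \<in> carrier (free_mod K S)"
    have "(\<lambda>s. \<ominus>\<^bsub>K\<^esub> \<phi> s) \<in> carrier (free_mod K S)"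
    proof -
      have "{s. \<ominus>\<^bsub>K\<^esub> \<phi> s \<noteq> \<zero>\<^bsub>K\<^esub>} \<subseteq> {s. \<phi> s \<noteq> \<zero>\<^bsub>K\<^esub>}" by auto
      then show ?thesis using \<phi> by (auto simp: free_carrier intro: finite_subset)
    qed
    then show "\<exists>\<psi>\<in>carrier (free_mod K S). \<psi> \<oplus>\<^bsub>free_mod K S\<^esub> \<phi> = \<zero>\<^bsub>free_mod K S\<^esub>"
      by (rule bexI[rotated]) (auto simp: K.l_neg c[OF \<phi>])
  next
    fix \<phi> \<psi> assume \<phi>: "\<phi> \<in> carrier (free_mod K S)" "\<psi> \<in> carrier (free_mod K S)"
    show "\<phi> \<oplus>\<^bsub>free_mod K S\<^esub> \<psi> \<in> carrier (free_mod K S)"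
      using f[OF \<phi>] \<phi> by (simp add: free_carrier)
    show "\<phi> \<oplus>\<^bsub>free_mod K S\<^esub> \<psi> = \<psi> \<oplus>\<^bsub>free_mod K S\<^esub> \<phi>"
      using c[OF \<phi>(1)] c[OF \<phi>(2)] by (simp add: fun_eq_iff K.a_comm)
  qed (auto simp: c K.a_assoc, auto simp: free_carrier)
  then show ?thesis
  proof (rule moduleI[OF K])
    fix k \<phi> assume k: "k \<in> carrier K" and \<phi>: "\<phi> \<in> carrier (free_mod K S)"
    show "k \<odot>\<^bsub>free_mod K S\<^esub> \<phi> \<in> carrier (free_mod K S)"
      using g[OF \<phi> k] k \<phi> by (simp add: free_carrier)
  qed (auto simp: c K.l_distr K.r_distr K.m_assoc)
qed

lemma free_closed: "\<phi> \<in> carrier (free_mod K S) \<Longrightarrow> \<phi> s \<in> carrier K"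
  by (cases "s \<in> S") (auto simp: free_carrier)

lemma basis_closed: "s \<in> S \<Longrightarrow> basis_elt K s \<in> carrier (free_mod K S)"
proof -
  have "{t. basis_elt K s t \<noteq> \<zero>\<^bsub>K\<^esub>} \<subseteq> {s}" by (auto simp: basis_elt_def)
  then have "finite {t. basis_elt K s t \<noteq> \<zero>\<^bsub>K\<^esub>}" by (rule finite_subset) simp
  then show "s \<in> S \<Longrightarrow> ?thesis" by (auto simp: free_carrier basis_elt_def)
qed

text \<open>A finitely supported function is a finite sum of multiples of basis elements; the induction runs over
  the size of the support.\<close>

lemma free_induct [consumes 1, case_names zero gen add]:
  assumes "\<phi> \<in> carrier (free_mod K S)"
    and zero: "P (\<lambda>_. \<zero>\<^bsub>K\<^esub>)"
    and gen: "\<And>k s. k \<in> carrier K \<Longrightarrow> s \<in> S \<Longrightarrow> P (k \<odot>\<^bsub>free_mod K S\<^esub> basis_elt K s)"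
    and add: "\<And>\<phi> \<psi>. \<phi> \<in> carrier (free_mod K S) \<Longrightarrow> \<psi> \<in> carrier (free_mod K S) \<Longrightarrow> P \<phi> \<Longrightarrow> P \<psi> \<Longrightarrow>
      P (\<phi> \<oplus>\<^bsub>free_mod K S\<^esub> \<psi>)"
  shows "P \<phi>"
proof -
  interpret F: module K "free_mod K S" by (rule free_module)
  have "P \<phi>" if "finite A" "{s. \<phi> s \<noteq> \<zero>\<^bsub>K\<^esub>} \<subseteq> A" "\<phi> \<in> carrier (free_mod K S)" for A \<phi>
    using that
  proof (induction A arbitrary: \<phi> rule: finite_induct)
    case empty
    then have "\<phi> = (\<lambda>_. \<zero>\<^bsub>K\<^esub>)" by auto
    then show ?case using zero by simp
  next
    case (insert a A)
    show ?case
    proof (cases "a \<in> S")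
      case True
      let ?\<psi> = "\<phi>(a := \<zero>\<^bsub>K\<^esub>)"
      have "{s. ?\<psi> s \<noteq> \<zero>\<^bsub>K\<^esub>} \<subseteq> {s. \<phi> s \<noteq> \<zero>\<^bsub>K\<^esub>}" by auto
      then have \<psi>: "?\<psi> \<in> carrier (free_mod K S)"
        using insert.prems(2) by (auto simp: free_carrier intro: finite_subset)
      have e: "\<phi> a \<odot>\<^bsub>free_mod K S\<^esub> basis_elt K a \<in> carrier (free_mod K S)"
        by (rule F.smult_closed[OF free_closed[OF insert.prems(2)] basis_closed[OF True]])
      have "P ?\<psi>" by (rule insert.IH[OF _ \<psi>]) (use insert.prems in auto)
      moreover have "P (\<phi> a \<odot>\<^bsub>free_mod K S\<^esub> basis_elt K a)"
        by (rule gen[OF free_closed[OF insert.prems(2)] True])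
      ultimately have "P (?\<psi> \<oplus>\<^bsub>free_mod K S\<^esub> \<phi> a \<odot>\<^bsub>free_mod K S\<^esub> basis_elt K a)"
        using \<psi> e by (intro add)
      also have "?\<psi> \<oplus>\<^bsub>free_mod K S\<^esub> \<phi> a \<odot>\<^bsub>free_mod K S\<^esub> basis_elt K a = \<phi>"
        by (auto simp: fun_eq_iff basis_elt_def free_closed[OF insert.prems(2)])
      finally show ?thesis .
    next
      case False
      then have "\<phi> a = \<zero>\<^bsub>K\<^esub>" using insert.prems by (simp add: free_carrier)
      then show ?thesis using insert.prems insert.IH by blast
    qed
  qed
  from this[of "{s. \<phi> s \<noteq> \<zero>\<^bsub>K\<^esub>}"] assms(1) show ?thesis by (simp add: free_carrier)
qed

lemma lin_ext_superset:
  assumes Y: "module K Y" and g: "g \<in> S \<rightarrow> carrier Y" and \<phi>: "\<phi> \<in> carrier (free_mod K S)"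
    and A: "finite A" "{s. \<phi> s \<noteq> \<zero>\<^bsub>K\<^esub>} \<subseteq> A" "A \<subseteq> S"
  shows "lin_ext K Y g \<phi> = (\<Oplus>\<^bsub>Y\<^esub>s\<in>A. \<phi> s \<odot>\<^bsub>Y\<^esub> g s)"
proof -
  interpret Y: module K Y by fact
  have c: "s \<in> A \<Longrightarrow> \<phi> s \<odot>\<^bsub>Y\<^esub> g s \<in> carrier Y" for s
    using g A(3) free_closed[OF \<phi>] by (intro Y.smult_closed) auto
  show ?thesis unfolding lin_ext_def
    by (rule Y.add.finprod_mono_neutral_cong_left) (use c A g in \<open>auto intro!: Y.smult_l_null\<close>)
qed

lemma lin_ext_hom:
  assumes Y: "module K Y" and g: "g \<in> S \<rightarrow> carrier Y"
  shows "lin_ext K Y g \<in> mod_hom K (free_mod K S) Y"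
proof -
  interpret Y: module K Y by fact
  interpret F: module K "free_mod K S" by (rule free_module)
  have supp: "finite {s. \<phi> s \<noteq> \<zero>\<^bsub>K\<^esub>}" "{s. \<phi> s \<noteq> \<zero>\<^bsub>K\<^esub>} \<subseteq> S" if "\<phi> \<in> carrier (free_mod K S)" for \<phi>
    using that by (auto simp: free_carrier)
  have c: "s \<in> S \<Longrightarrow> \<phi> s \<odot>\<^bsub>Y\<^esub> g s \<in> carrier Y" if "\<phi> \<in> carrier (free_mod K S)" for \<phi> s
    using g free_closed[OF that] by (intro Y.smult_closed) auto
  show ?thesis
  proof (rule mod_homI)
    fix \<phi> assume \<phi>: "\<phi> \<in> carrier (free_mod K S)"
    show "lin_ext K Y g \<phi> \<in> carrier Y"
      unfolding lin_ext_def using c[OF \<phi>] supp[OF \<phi>] by (intro Y.finsum_closed) auto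
  next
    fix \<phi> \<psi> assume \<phi>: "\<phi> \<in> carrier (free_mod K S)" and \<psi>: "\<psi> \<in> carrier (free_mod K S)"
    let ?A = "{s. \<phi> s \<noteq> \<zero>\<^bsub>K\<^esub>} \<union> {s. \<psi> s \<noteq> \<zero>\<^bsub>K\<^esub>}"
    have A: "finite ?A" "?A \<subseteq> S" using supp[OF \<phi>] supp[OF \<psi>] by auto
    note sup = lin_ext_superset[OF Y g _ A(1) _ A(2)]
    have "lin_ext K Y g (\<phi> \<oplus>\<^bsub>free_mod K S\<^esub> \<psi>) = (\<Oplus>\<^bsub>Y\<^esub>s\<in>?A. (\<phi> \<oplus>\<^bsub>free_mod K S\<^esub> \<psi>) s \<odot>\<^bsub>Y\<^esub> g s)"
      by (rule sup[OF F.a_closed[OF \<phi> \<psi>]]) auto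
    also have "\<dots> = (\<Oplus>\<^bsub>Y\<^esub>s\<in>?A. \<phi> s \<odot>\<^bsub>Y\<^esub> g s \<oplus>\<^bsub>Y\<^esub> \<psi> s \<odot>\<^bsub>Y\<^esub> g s)"
    proof (rule Y.finsum_cong')
      fix s assume "s \<in> ?A"
      then have "g s \<in> carrier Y" using g A by auto
      then show "(\<phi> \<oplus>\<^bsub>free_mod K S\<^esub> \<psi>) s \<odot>\<^bsub>Y\<^esub> g s = \<phi> s \<odot>\<^bsub>Y\<^esub> g s \<oplus>\<^bsub>Y\<^esub> \<psi> s \<odot>\<^bsub>Y\<^esub> g s"
        using free_closed[OF \<phi>] free_closed[OF \<psi>] by (simp add: Y.smult_l_distr)
    qed (use c[OF \<phi>] c[OF \<psi>] A in \<open>auto intro!: Y.a_closed\<close>)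
    also have "\<dots> = (\<Oplus>\<^bsub>Y\<^esub>s\<in>?A. \<phi> s \<odot>\<^bsub>Y\<^esub> g s) \<oplus>\<^bsub>Y\<^esub> (\<Oplus>\<^bsub>Y\<^esub>s\<in>?A. \<psi> s \<odot>\<^bsub>Y\<^esub> g s)"
      by (rule Y.finsum_addf) (use c[OF \<phi>] c[OF \<psi>] A in auto)
    also have "\<dots> = lin_ext K Y g \<phi> \<oplus>\<^bsub>Y\<^esub> lin_ext K Y g \<psi>"
      by (subst (1 2) sup) (use \<phi> \<psi> in auto)
    finally show "lin_ext K Y g (\<phi> \<oplus>\<^bsub>free_mod K S\<^esub> \<psi>) = lin_ext K Y g \<phi> \<oplus>\<^bsub>Y\<^esub> lin_ext K Y g \<psi>" .
  next
    fix k \<phi> assume k: "k \<in> carrier K" and \<phi>: "\<phi> \<in> carrier (free_mod K S)"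
    note A = supp[OF \<phi>]
    have "lin_ext K Y g (k \<odot>\<^bsub>free_mod K S\<^esub> \<phi>)
        = (\<Oplus>\<^bsub>Y\<^esub>s\<in>{s. \<phi> s \<noteq> \<zero>\<^bsub>K\<^esub>}. (k \<odot>\<^bsub>free_mod K S\<^esub> \<phi>) s \<odot>\<^bsub>Y\<^esub> g s)"
      by (rule lin_ext_superset[OF Y g F.smult_closed[OF k \<phi>] A(1) _ A(2)]) (use k in auto)
    also have "\<dots> = (\<Oplus>\<^bsub>Y\<^esub>s\<in>{s. \<phi> s \<noteq> \<zero>\<^bsub>K\<^esub>}. k \<odot>\<^bsub>Y\<^esub> (\<phi> s \<odot>\<^bsub>Y\<^esub> g s))"
    proof (rule Y.finsum_cong')
      fix s assume "s \<in> {s. \<phi> s \<noteq> \<zero>\<^bsub>K\<^esub>}"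
      then have "g s \<in> carrier Y" using g A by auto
      then show "(k \<odot>\<^bsub>free_mod K S\<^esub> \<phi>) s \<odot>\<^bsub>Y\<^esub> g s = k \<odot>\<^bsub>Y\<^esub> (\<phi> s \<odot>\<^bsub>Y\<^esub> g s)"
        using free_closed[OF \<phi>] k by (simp add: Y.smult_assoc1)
    qed (use c[OF \<phi>] k A in \<open>auto intro: Y.smult_closed[OF k]\<close>)
    also have "\<dots> = k \<odot>\<^bsub>Y\<^esub> lin_ext K Y g \<phi>"
      unfolding lin_ext_def by (subst Y.finsum_smult_ldistr) (use A k c[OF \<phi>] in auto)
    finally show "lin_ext K Y g (k \<odot>\<^bsub>free_mod K S\<^esub> \<phi>) = k \<odot>\<^bsub>Y\<^esub> lin_ext K Y g \<phi>" .
  qed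
qed

lemma lin_ext_basis:
  assumes Y: "module K Y" and g: "g \<in> S \<rightarrow> carrier Y" and s: "s \<in> S"
  shows "lin_ext K Y g (basis_elt K s) = g s"
proof -
  interpret Y: module K Y by fact
  have gs: "g s \<in> carrier Y" using g s by auto
  have "lin_ext K Y g (basis_elt K s) = (\<Oplus>\<^bsub>Y\<^esub>t\<in>{s}. basis_elt K s t \<odot>\<^bsub>Y\<^esub> g t)"
    by (rule lin_ext_superset[OF Y g basis_closed[OF s]]) (use s in \<open>auto simp: basis_elt_def\<close>)
  also have "\<dots> = g s"
    using gs by (subst Y.finsum_insert) (auto simp: basis_elt_def)
  finally show ?thesis .
qed

subsection \<open>Modules given by generators and relations\<close>

context
  fixes S :: "'s set" and R :: "('s \<Rightarrow> 'k) set"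
  assumes R: "R \<subseteq> carrier (free_mod K S)"
begin

interpretation F: module K "free_mod K S" by (rule free_module)

private abbreviation "N \<equiv> gen_submod K (free_mod K S) R"

lemmas N_sub = gen_submod_submodule[OF free_module R]

lemma pres_module: "module K (pres_mod K S R)"
  unfolding pres_mod_def by (rule quot_mod_module[OF free_module N_sub])

lemma pres_gen_closed: "s \<in> S \<Longrightarrow> pres_gen K S R s \<in> carrier (pres_mod K S R)"
  unfolding pres_mod_def pres_gen_def
  by (rule quot_closed[OF free_module N_sub basis_closed])

lemma pres_proj_hom: "(\<lambda>\<phi>. N +>\<^bsub>free_mod K S\<^esub> \<phi>) \<in> mod_hom K (free_mod K S) (pres_mod K S R)"
  unfolding pres_mod_def by (rule quot_proj_hom[OF free_module N_sub])

lemma pres_induct [consumes 1, case_names zero gen add]: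
  assumes C: "C \<in> carrier (pres_mod K S R)"
    and zero: "P \<zero>\<^bsub>pres_mod K S R\<^esub>"
    and gen: "\<And>k s. k \<in> carrier K \<Longrightarrow> s \<in> S \<Longrightarrow> P (k \<odot>\<^bsub>pres_mod K S R\<^esub> pres_gen K S R s)"
    and add: "\<And>u v. u \<in> carrier (pres_mod K S R) \<Longrightarrow> v \<in> carrier (pres_mod K S R) \<Longrightarrow> P u \<Longrightarrow> P v \<Longrightarrow>
      P (u \<oplus>\<^bsub>pres_mod K S R\<^esub> v)"
  shows "P C"
proof -
  interpret Q: module K "pres_mod K S R" by (rule pres_module)
  let ?\<pi> = "\<lambda>\<phi>. N +>\<^bsub>free_mod K S\<^esub> \<phi>"
  obtain \<phi> where \<phi>: "\<phi> \<in> carrier (free_mod K S)" and C': "C = ?\<pi> \<phi>"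
    using C unfolding pres_mod_def by (rule quot_cases[OF free_module N_sub])
  from \<phi> have "P (?\<pi> \<phi>)"
  proof (induction rule: free_induct)
    case zero
    show ?case using assms(2) mod_hom_zero[OF pres_proj_hom F.abelian_group_axioms Q.abelian_group_axioms]
      by simp
  next
    case (gen k s)
    show ?case
      using assms(3)[OF gen] mod_hom_smult[OF pres_proj_hom gen(1) basis_closed[OF gen(2)]]
      by (simp add: pres_gen_def)
  next
    case (add \<phi> \<psi>)
    show ?case
      using assms(4)[OF mod_hom_closed[OF pres_proj_hom add(1)] mod_hom_closed[OF pres_proj_hom add(2)] add(3,4)]
        mod_hom_add[OF pres_proj_hom add(1,2)] by simp
  qed
  then show ?thesis by (simp add: C')
qed

lemma pres_hom_eq:
  assumes Y: "module K Y" and f: "f \<in> mod_hom K (pres_mod K S R) Y"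
    and g: "g \<in> mod_hom K (pres_mod K S R) Y"
    and eq: "\<And>s. s \<in> S \<Longrightarrow> f (pres_gen K S R s) = g (pres_gen K S R s)"
    and C: "C \<in> carrier (pres_mod K S R)"
  shows "f C = g C"
proof -
  interpret Q: module K "pres_mod K S R" by (rule pres_module)
  interpret Y: module K Y by fact
  note ab = Q.abelian_group_axioms Y.abelian_group_axioms
  from C show ?thesis
    by (induction rule: pres_induct)
       (simp_all add: mod_hom_zero[OF f ab] mod_hom_zero[OF g ab] mod_hom_add[OF f] mod_hom_add[OF g]
         mod_hom_smult[OF f] mod_hom_smult[OF g] pres_gen_closed eq)
qed

lemma pres_rel:
  assumes "r \<in> R" shows "N +>\<^bsub>free_mod K S\<^esub> r = \<zero>\<^bsub>pres_mod K S R\<^esub>"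
proof -
  have r: "r \<in> carrier (free_mod K S)" using R assms by auto
  have "r \<ominus>\<^bsub>free_mod K S\<^esub> \<zero>\<^bsub>free_mod K S\<^esub> \<in> N"
    using assms gen_submod_incl[of R K "free_mod K S"] F.minus_zero[OF r] by auto
  then show ?thesis
    unfolding pres_mod_def quot_zero[OF free_module N_sub]
    using r by (subst quot_eq_iff[OF free_module N_sub]) (auto simp del: free_mod_simps)
qed

lemma pres_rel_add:
  assumes "basis_elt K a \<ominus>\<^bsub>free_mod K S\<^esub> (basis_elt K b \<oplus>\<^bsub>free_mod K S\<^esub> basis_elt K c) \<in> R"
    and S: "a \<in> S" "b \<in> S" "c \<in> S"
  shows "pres_gen K S R a = pres_gen K S R b \<oplus>\<^bsub>pres_mod K S R\<^esub> pres_gen K S R c"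
proof -
  interpret Q: module K "pres_mod K S R" by (rule pres_module)
  note e = basis_closed[OF S(1)] basis_closed[OF S(2)] basis_closed[OF S(3)]
  have "pres_gen K S R a \<ominus>\<^bsub>pres_mod K S R\<^esub> (pres_gen K S R b \<oplus>\<^bsub>pres_mod K S R\<^esub> pres_gen K S R c)
      = \<zero>\<^bsub>pres_mod K S R\<^esub>"
    unfolding pres_rel[OF assms(1), symmetric]
    using e mod_hom_minus[OF pres_proj_hom F.abelian_group_axioms Q.abelian_group_axioms]
      mod_hom_add[OF pres_proj_hom]
    by (simp add: pres_gen_def del: free_mod_simps)
  then show ?thesis by (rule Q.minus_eq_zeroD) (use S in \<open>auto simp: pres_gen_closed\<close>)
qed

lemma pres_rel_smult:
  assumes "basis_elt K a \<ominus>\<^bsub>free_mod K S\<^esub> (k \<odot>\<^bsub>free_mod K S\<^esub> basis_elt K b) \<in> R"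
    and S: "a \<in> S" "b \<in> S" "k \<in> carrier K"
  shows "pres_gen K S R a = k \<odot>\<^bsub>pres_mod K S R\<^esub> pres_gen K S R b"
proof -
  interpret Q: module K "pres_mod K S R" by (rule pres_module)
  note e = basis_closed[OF S(1)] basis_closed[OF S(2)]
  have "pres_gen K S R a \<ominus>\<^bsub>pres_mod K S R\<^esub> (k \<odot>\<^bsub>pres_mod K S R\<^esub> pres_gen K S R b)
      = \<zero>\<^bsub>pres_mod K S R\<^esub>"
    unfolding pres_rel[OF assms(1), symmetric]
    using e S mod_hom_minus[OF pres_proj_hom F.abelian_group_axioms Q.abelian_group_axioms]
      mod_hom_smult[OF pres_proj_hom]
    by (simp add: pres_gen_def del: free_mod_simps)
  then show ?thesis by (rule Q.minus_eq_zeroD) (use S in \<open>auto simp: pres_gen_closed\<close>)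
qed

lemma pres_rel_eq:
  assumes "basis_elt K a \<ominus>\<^bsub>free_mod K S\<^esub> basis_elt K b \<in> R" and S: "a \<in> S" "b \<in> S"
  shows "pres_gen K S R a = pres_gen K S R b"
proof -
  interpret Q: module K "pres_mod K S R" by (rule pres_module)
  note e = basis_closed[OF S(1)] basis_closed[OF S(2)]
  have "pres_gen K S R a \<ominus>\<^bsub>pres_mod K S R\<^esub> pres_gen K S R b = \<zero>\<^bsub>pres_mod K S R\<^esub>"
    unfolding pres_rel[OF assms(1), symmetric]
    using e S mod_hom_minus[OF pres_proj_hom F.abelian_group_axioms Q.abelian_group_axioms]
    by (simp add: pres_gen_def del: free_mod_simps)
  then show ?thesis by (rule Q.minus_eq_zeroD) (use S in \<open>auto simp: pres_gen_closed\<close>)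
qed

text \<open>The linear extension of \<open>g\<close> is constant on each class: its kernel is a submodule that contains the
  relations, hence the submodule they generate. So the image of a class under it is a singleton, which is
  the situation in which \<open>lift\<close>, defined through \<open>the_elem\<close>, has a meaning.\<close>

lemma lift_eval:
  assumes Y: "module K Y" and g: "respects_rels K Y S R g" and \<phi>: "\<phi> \<in> carrier (free_mod K S)"
  shows "lift K Y g (N +>\<^bsub>free_mod K S\<^esub> \<phi>) = lin_ext K Y g \<phi>"
proof -
  interpret Y: module K Y by fact
  have gS: "g \<in> S \<rightarrow> carrier Y" using g by (simp add: respects_rels_def)
  note h = lin_ext_hom[OF Y gS]
  let ?Z = "{\<phi> \<in> carrier (free_mod K S). lin_ext K Y g \<phi> = \<zero>\<^bsub>Y\<^esub>}"
  have NZ: "N \<subseteq> ?Z"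
    by (rule gen_submod_least[OF kernel_submodule[OF free_module Y h]])
       (use R g in \<open>auto simp: respects_rels_def\<close>)
  have "lin_ext K Y g \<psi> = lin_ext K Y g \<phi>" if "\<psi> \<in> N +>\<^bsub>free_mod K S\<^esub> \<phi>" for \<psi>
  proof -
    note c = coset_elt[OF free_module N_sub \<phi> that]
    have "lin_ext K Y g \<psi> \<ominus>\<^bsub>Y\<^esub> lin_ext K Y g \<phi> = lin_ext K Y g (\<psi> \<ominus>\<^bsub>free_mod K S\<^esub> \<phi>)"
      by (rule mod_hom_minus[OF h F.abelian_group_axioms Y.abelian_group_axioms c(1) \<phi>, symmetric])
    also have "\<dots> = \<zero>\<^bsub>Y\<^esub>" using NZ c(3) by auto
    finally show ?thesis by (rule Y.minus_eq_zeroD) (auto simp: mod_hom_closed[OF h] c(1) \<phi>)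
  qed
  then have "lin_ext K Y g ` (N +>\<^bsub>free_mod K S\<^esub> \<phi>) = {lin_ext K Y g \<phi>}"
    using coset_self[OF free_module N_sub \<phi>] by blast
  then show ?thesis by (simp add: lift_def lin_ext_def[abs_def])
qed

lemma lift_hom:
  assumes Y: "module K Y" and g: "respects_rels K Y S R g"
  shows "lift K Y g \<in> mod_hom K (pres_mod K S R) Y"
proof (rule mod_homI)
  have gS: "g \<in> S \<rightarrow> carrier Y" using g by (simp add: respects_rels_def)
  note h = lin_ext_hom[OF Y gS]
  have cases: "\<exists>\<phi>\<in>carrier (free_mod K S). C = N +>\<^bsub>free_mod K S\<^esub> \<phi>" if "C \<in> carrier (pres_mod K S R)" for C
    using quot_cases[OF free_module N_sub] that unfolding pres_mod_def by metis
  fix C assume "C \<in> carrier (pres_mod K S R)"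
  then obtain \<phi> where \<phi>: "\<phi> \<in> carrier (free_mod K S)" "C = N +>\<^bsub>free_mod K S\<^esub> \<phi>" using cases by blast
  show "lift K Y g C \<in> carrier Y"
    unfolding \<phi>(2) lift_eval[OF Y g \<phi>(1)] by (rule mod_hom_closed[OF h \<phi>(1)])
  { fix D assume "D \<in> carrier (pres_mod K S R)"
    then obtain \<psi> where \<psi>: "\<psi> \<in> carrier (free_mod K S)" "D = N +>\<^bsub>free_mod K S\<^esub> \<psi>" using cases by blast
    show "lift K Y g (C \<oplus>\<^bsub>pres_mod K S R\<^esub> D) = lift K Y g C \<oplus>\<^bsub>Y\<^esub> lift K Y g D"
      unfolding \<phi>(2) \<psi>(2) mod_hom_add[OF pres_proj_hom \<phi>(1) \<psi>(1), symmetric] lift_eval[OF Y g \<phi>(1)]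
        lift_eval[OF Y g \<psi>(1)] lift_eval[OF Y g F.a_closed[OF \<phi>(1) \<psi>(1)]]
      by (rule mod_hom_add[OF h \<phi>(1) \<psi>(1)]) }
  fix k assume k: "k \<in> carrier K"
  show "lift K Y g (k \<odot>\<^bsub>pres_mod K S R\<^esub> C) = k \<odot>\<^bsub>Y\<^esub> lift K Y g C"
    unfolding \<phi>(2) mod_hom_smult[OF pres_proj_hom k \<phi>(1), symmetric] lift_eval[OF Y g \<phi>(1)]
      lift_eval[OF Y g F.smult_closed[OF k \<phi>(1)]]
    by (rule mod_hom_smult[OF h k \<phi>(1)])
qed

lemma lift_gen:
  assumes Y: "module K Y" and g: "respects_rels K Y S R g" and s: "s \<in> S"
  shows "lift K Y g (pres_gen K S R s) = g s"
  unfolding pres_gen_def lift_eval[OF Y g basis_closed[OF s]]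
  by (rule lin_ext_basis[OF Y _ s]) (use g in \<open>simp add: respects_rels_def\<close>)

end

end

definition bilin ::
  "('k, 'r) ring_scheme \<Rightarrow> ('k, 'x) module \<Rightarrow> ('k, 'y) module \<Rightarrow> ('k, 'z) module \<Rightarrow>
    ('x \<Rightarrow> 'y \<Rightarrow> 'z) \<Rightarrow> bool" where
  "bilin K X Y Z b \<longleftrightarrow> (\<forall>y\<in>carrier Y. (\<lambda>x. b x y) \<in> mod_hom K X Z) \<and>
     (\<forall>x\<in>carrier X. b x \<in> mod_hom K Y Z)"

lemma bilinI:
  assumes "\<And>y. y \<in> carrier Y \<Longrightarrow> (\<lambda>x. b x y) \<in> mod_hom K X Z"
    and "\<And>x. x \<in> carrier X \<Longrightarrow> b x \<in> mod_hom K Y Z"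
  shows "bilin K X Y Z b"
  using assms by (simp add: bilin_def)

lemma bilin_homs:
  assumes "bilin K X Y Z b"
  shows "y \<in> carrier Y \<Longrightarrow> (\<lambda>x. b x y) \<in> mod_hom K X Z" "x \<in> carrier X \<Longrightarrow> b x \<in> mod_hom K Y Z"
  using assms by (auto simp: bilin_def)

lemma bilin_closed: "bilin K X Y Z b \<Longrightarrow> x \<in> carrier X \<Longrightarrow> y \<in> carrier Y \<Longrightarrow> b x y \<in> carrier Z"
  by (auto simp: bilin_def mod_hom_closed)

lemma bilin_rules:
  assumes "bilin K X Y Z b"
  shows "x \<in> carrier X \<Longrightarrow> x' \<in> carrier X \<Longrightarrow> y \<in> carrier Y \<Longrightarrow>
      b (x \<oplus>\<^bsub>X\<^esub> x') y = b x y \<oplus>\<^bsub>Z\<^esub> b x' y"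
    and "x \<in> carrier X \<Longrightarrow> y \<in> carrier Y \<Longrightarrow> y' \<in> carrier Y \<Longrightarrow>
      b x (y \<oplus>\<^bsub>Y\<^esub> y') = b x y \<oplus>\<^bsub>Z\<^esub> b x y'"
    and "k \<in> carrier K \<Longrightarrow> x \<in> carrier X \<Longrightarrow> y \<in> carrier Y \<Longrightarrow> b (k \<odot>\<^bsub>X\<^esub> x) y = k \<odot>\<^bsub>Z\<^esub> b x y"
    and "k \<in> carrier K \<Longrightarrow> x \<in> carrier X \<Longrightarrow> y \<in> carrier Y \<Longrightarrow> b x (k \<odot>\<^bsub>Y\<^esub> y) = k \<odot>\<^bsub>Z\<^esub> b x y"
  using mod_hom_add[OF bilin_homs(1)[OF assms]] mod_hom_add[OF bilin_homs(2)[OF assms]]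
    mod_hom_smult[OF bilin_homs(1)[OF assms]] mod_hom_smult[OF bilin_homs(2)[OF assms]] by auto

text \<open>If the data on generators depend linearly on a parameter, so does the lifted map. This is how maps that
  are lifts in one variable and lifts again in another, such as the product of a tensor product of
  algebras or an action of such an algebra, are seen to be bilinear.\<close>

lemma pres_lift_param:
  assumes R: "R \<subseteq> carrier (free_mod K S)" and Z: "module K Z" and V: "module K V"
    and c: "\<And>v. v \<in> carrier V \<Longrightarrow> respects_rels K Z S R (\<lambda>s. c s v)"
    and h: "\<And>s. s \<in> S \<Longrightarrow> c s \<in> mod_hom K V Z"
  shows "bilin K (pres_mod K S R) V Z (\<lambda>u v. lift K Z (\<lambda>s. c s v) u)"
proof -
  have K: "cring K" using Z by (simp add: module_def)
  interpret Z: module K Z by fact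
  interpret V: module K V by fact
  note lh = lift_hom[OF K R Z c] and lg = lift_gen[OF K R Z c]
  show ?thesis
  proof (rule bilinI)
    fix u assume u: "u \<in> carrier (pres_mod K S R)"
    show "(\<lambda>v. lift K Z (\<lambda>s. c s v) u) \<in> mod_hom K V Z"
    proof (rule mod_homI)
      fix v assume v: "v \<in> carrier V"
      show "lift K Z (\<lambda>s. c s v) u \<in> carrier Z" by (rule mod_hom_closed[OF lh[OF v] u])
      { fix w assume w: "w \<in> carrier V"
        show "lift K Z (\<lambda>s. c s (v \<oplus>\<^bsub>V\<^esub> w)) u = lift K Z (\<lambda>s. c s v) u \<oplus>\<^bsub>Z\<^esub> lift K Z (\<lambda>s. c s w) u"
          by (rule pres_hom_eq[OF K R Z lh mod_hom_plus[OF Z lh lh] _ u])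
             (use v w in \<open>auto simp: lg mod_hom_add[OF h]\<close>) }
      fix k assume k: "k \<in> carrier K"
      show "lift K Z (\<lambda>s. c s (k \<odot>\<^bsub>V\<^esub> v)) u = k \<odot>\<^bsub>Z\<^esub> lift K Z (\<lambda>s. c s v) u"
        by (rule pres_hom_eq[OF K R Z lh mod_hom_scale[OF Z lh k] _ u])
           (use k v in \<open>auto simp: lg mod_hom_smult[OF h]\<close>)
    qed
  qed (rule lh)
qed

context
  fixes K :: "('k, 'r) ring_scheme" and S :: "'s set"
  assumes K: "cring K"
begin

interpretation F: module K "free_mod K S" by (rule free_module[OF K])

lemma rel_closed:
  assumes "a \<in> S" "b \<in> S"
  shows "c \<in> S \<Longrightarrow>
      basis_elt K a \<ominus>\<^bsub>free_mod K S\<^esub> (basis_elt K b \<oplus>\<^bsub>free_mod K S\<^esub> basis_elt K c) \<in> carrier (free_mod K S)"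
    and "k \<in> carrier K \<Longrightarrow>
      basis_elt K a \<ominus>\<^bsub>free_mod K S\<^esub> (k \<odot>\<^bsub>free_mod K S\<^esub> basis_elt K b) \<in> carrier (free_mod K S)"
    and "basis_elt K a \<ominus>\<^bsub>free_mod K S\<^esub> basis_elt K b \<in> carrier (free_mod K S)"
  using assms by (auto simp del: free_mod_simps simp: basis_closed[OF K])

lemma lin_ext_rel:
  assumes Z: "module K Z" and g: "g \<in> S \<rightarrow> carrier Z" and ab: "a \<in> S" "b \<in> S"
  shows "c \<in> S \<Longrightarrow> g a = g b \<oplus>\<^bsub>Z\<^esub> g c \<Longrightarrow>
      lin_ext K Z g (basis_elt K a \<ominus>\<^bsub>free_mod K S\<^esub> (basis_elt K b \<oplus>\<^bsub>free_mod K S\<^esub> basis_elt K c)) = \<zero>\<^bsub>Z\<^esub>"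
    and "k \<in> carrier K \<Longrightarrow> g a = k \<odot>\<^bsub>Z\<^esub> g b \<Longrightarrow>
      lin_ext K Z g (basis_elt K a \<ominus>\<^bsub>free_mod K S\<^esub> (k \<odot>\<^bsub>free_mod K S\<^esub> basis_elt K b)) = \<zero>\<^bsub>Z\<^esub>"
    and "g a = g b \<Longrightarrow> lin_ext K Z g (basis_elt K a \<ominus>\<^bsub>free_mod K S\<^esub> basis_elt K b) = \<zero>\<^bsub>Z\<^esub>"
proof -
  interpret Z: module K Z by fact
  note h = lin_ext_hom[OF K Z g] and e = basis_closed[OF K] and le = lin_ext_basis[OF K Z g]
  note hm = mod_hom_minus[OF h F.abelian_group_axioms Z.abelian_group_axioms]
  have gc: "\<And>s. s \<in> S \<Longrightarrow> g s \<in> carrier Z" using g by auto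
  have mz: "\<And>z. z \<in> carrier Z \<Longrightarrow> z \<ominus>\<^bsub>Z\<^esub> z = \<zero>\<^bsub>Z\<^esub>" by (simp add: a_minus_def Z.r_neg)
  show "c \<in> S \<Longrightarrow> g a = g b \<oplus>\<^bsub>Z\<^esub> g c \<Longrightarrow>
      lin_ext K Z g (basis_elt K a \<ominus>\<^bsub>free_mod K S\<^esub> (basis_elt K b \<oplus>\<^bsub>free_mod K S\<^esub> basis_elt K c)) = \<zero>\<^bsub>Z\<^esub>"
    using ab by (simp del: free_mod_simps add: hm e F.a_closed mod_hom_add[OF h] le mz gc)
  show "k \<in> carrier K \<Longrightarrow> g a = k \<odot>\<^bsub>Z\<^esub> g b \<Longrightarrow>
      lin_ext K Z g (basis_elt K a \<ominus>\<^bsub>free_mod K S\<^esub> (k \<odot>\<^bsub>free_mod K S\<^esub> basis_elt K b)) = \<zero>\<^bsub>Z\<^esub>"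
    using ab by (simp del: free_mod_simps add: hm e F.smult_closed mod_hom_smult[OF h] le mz gc)
  show "g a = g b \<Longrightarrow> lin_ext K Z g (basis_elt K a \<ominus>\<^bsub>free_mod K S\<^esub> basis_elt K b) = \<zero>\<^bsub>Z\<^esub>"
    using ab by (simp del: free_mod_simps add: hm e le mz gc)
qed

end

section \<open>Tensor products of two modules\<close>

lemma bilin_precomp:
  assumes "bilin K X' Y' Z b" "f \<in> mod_hom K X X'" "g \<in> mod_hom K Y Y'"
  shows "bilin K X Y Z (\<lambda>x y. b (f x) (g y))"
proof (rule bilinI)
  fix y assume "y \<in> carrier Y"
  then show "(\<lambda>x. b (f x) (g y)) \<in> mod_hom K X Z"
    by (intro mod_hom_comp[OF assms(2) bilin_homs(1)[OF assms(1)]] mod_hom_closed[OF assms(3)])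
next
  fix x assume "x \<in> carrier X"
  then show "(\<lambda>y. b (f x) (g y)) \<in> mod_hom K Y Z"
    by (intro mod_hom_comp[OF assms(3) bilin_homs(2)[OF assms(1)]] mod_hom_closed[OF assms(2)])
qed

lemma bilin_flip: "bilin K X Y Z b \<Longrightarrow> bilin K Y X Z (\<lambda>y x. b x y)"
  by (auto simp: bilin_def)

context
  fixes K :: "('k, 'r) ring_scheme" and X :: "('k, 'x) module" and Y :: "('k, 'y) module"
  assumes X: "module K X" and Y: "module K Y"
begin

interpretation X: module K X by (rule X)
interpretation Y: module K Y by (rule Y)

lemma tens_rels_closed: "tens_rels K X Y \<subseteq> carrier (free_mod K (carrier X \<times> carrier Y))"
  unfolding tens_rels_def Let_def
  by (intro Un_least subsetI; elim CollectE exE conjE)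
     (simp_all only:, (rule rel_closed[OF X.R.cring_axioms]; simp)+)

lemma tens_module: "module K (tens K X Y)"
  unfolding tens_def by (rule pres_module[OF X.R.cring_axioms tens_rels_closed])

lemma bilin_respects:
  assumes Z: "module K Z" and b: "bilin K X Y Z b"
  shows "respects_rels K Z (carrier X \<times> carrier Y) (tens_rels K X Y) (\<lambda>(x, y). b x y)"
proof -
  have g: "(\<lambda>(x, y). b x y) \<in> carrier X \<times> carrier Y \<rightarrow> carrier Z"
    using bilin_closed[OF b] by auto
  show ?thesis
    unfolding respects_rels_def tens_rels_def Let_def
    apply (intro conjI g ballI)
    apply (elim UnE CollectE exE conjE; simp only:)
    by (rule lin_ext_rel[OF X.R.cring_axioms Z g]; simp add: bilin_rules[OF b])+
qed

lemma tens_lift_hom: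
  assumes Z: "module K Z" and b: "bilin K X Y Z b"
  shows "lift K Z (\<lambda>(x, y). b x y) \<in> mod_hom K (tens K X Y) Z"
  unfolding tens_def by (rule lift_hom[OF X.R.cring_axioms tens_rels_closed Z bilin_respects[OF Z b]])

lemma tens_lift_pure:
  assumes Z: "module K Z" and b: "bilin K X Y Z b" and "x \<in> carrier X" "y \<in> carrier Y"
  shows "lift K Z (\<lambda>(x, y). b x y) (tens_pure K X Y x y) = b x y"
  unfolding tens_pure_def
  by (subst lift_gen[OF X.R.cring_axioms tens_rels_closed Z bilin_respects[OF Z b]])
     (use assms in auto)

lemma tens_pure_closed:
  "x \<in> carrier X \<Longrightarrow> y \<in> carrier Y \<Longrightarrow> tens_pure K X Y x y \<in> carrier (tens K X Y)"
  unfolding tens_pure_def tens_def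
  by (rule pres_gen_closed[OF X.R.cring_axioms tens_rels_closed]) simp

lemma tens_pure_bilin: "bilin K X Y (tens K X Y) (tens_pure K X Y)"
proof (intro bilinI mod_homI tens_pure_closed)
  note add = pres_rel_add[OF X.R.cring_axioms tens_rels_closed, folded tens_def]
    and smult = pres_rel_smult[OF X.R.cring_axioms tens_rels_closed, folded tens_def]
  fix x y assume x: "x \<in> carrier X" and y: "y \<in> carrier Y"
  { fix x' assume x': "x' \<in> carrier X"
    show "tens_pure K X Y (x \<oplus>\<^bsub>X\<^esub> x') y = tens_pure K X Y x y \<oplus>\<^bsub>tens K X Y\<^esub> tens_pure K X Y x' y"
      unfolding tens_pure_def
      by (rule add) (use x x' y in \<open>simp_all add: tens_rels_def Let_def, blast?\<close>) }
  { fix y' assume y': "y' \<in> carrier Y"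
    show "tens_pure K X Y x (y \<oplus>\<^bsub>Y\<^esub> y') = tens_pure K X Y x y \<oplus>\<^bsub>tens K X Y\<^esub> tens_pure K X Y x y'"
      unfolding tens_pure_def
      by (rule add) (use x y y' in \<open>simp_all add: tens_rels_def Let_def, blast?\<close>) }
  { fix k assume k: "k \<in> carrier K"
    show "tens_pure K X Y (k \<odot>\<^bsub>X\<^esub> x) y = k \<odot>\<^bsub>tens K X Y\<^esub> tens_pure K X Y x y"
      unfolding tens_pure_def
      by (rule smult) (use x k y in \<open>simp_all add: tens_rels_def Let_def, blast?\<close>)
    show "tens_pure K X Y x (k \<odot>\<^bsub>Y\<^esub> y) = k \<odot>\<^bsub>tens K X Y\<^esub> tens_pure K X Y x y"
      unfolding tens_pure_def
      by (rule smult) (use x k y in \<open>simp_all add: tens_rels_def Let_def, blast?\<close>) }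
qed

lemma tens_hom_eq:
  assumes "module K Z" "f \<in> mod_hom K (tens K X Y) Z" "g \<in> mod_hom K (tens K X Y) Z"
    and "\<And>x y. x \<in> carrier X \<Longrightarrow> y \<in> carrier Y \<Longrightarrow> f (tens_pure K X Y x y) = g (tens_pure K X Y x y)"
    and "z \<in> carrier (tens K X Y)"
  shows "f z = g z"
  using pres_hom_eq[OF X.R.cring_axioms tens_rels_closed assms(1) assms(2,3)[unfolded tens_def] _
      assms(5)[unfolded tens_def]] assms(4)
  by (auto simp: tens_pure_def)

text \<open>Scalars can be absorbed into the first factor of a pure tensor, so every element of a tensor product
  is a sum of pure tensors.\<close>

lemma tens_induct_aux:
  assumes z: "z \<in> carrier (tens K X Y)"
    and pure: "\<And>x y. x \<in> carrier X \<Longrightarrow> y \<in> carrier Y \<Longrightarrow> P (tens_pure K X Y x y)"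
    and add: "\<And>u v. u \<in> carrier (tens K X Y) \<Longrightarrow> v \<in> carrier (tens K X Y) \<Longrightarrow> P u \<Longrightarrow> P v \<Longrightarrow>
      P (u \<oplus>\<^bsub>tens K X Y\<^esub> v)"
  shows "P z"
proof -
  interpret T: module K "tens K X Y" by (rule tens_module)
  have smult: "k \<odot>\<^bsub>tens K X Y\<^esub> tens_pure K X Y x y = tens_pure K X Y (k \<odot>\<^bsub>X\<^esub> x) y"
    if "k \<in> carrier K" "x \<in> carrier X" "y \<in> carrier Y" for k x y
    using bilin_rules(3)[OF tens_pure_bilin] that by simp
  have "\<zero>\<^bsub>tens K X Y\<^esub> = \<zero>\<^bsub>K\<^esub> \<odot>\<^bsub>tens K X Y\<^esub> tens_pure K X Y \<zero>\<^bsub>X\<^esub> \<zero>\<^bsub>Y\<^esub>"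
    by (simp add: tens_pure_closed)
  then have "P \<zero>\<^bsub>tens K X Y\<^esub>" using pure by (simp add: smult)
  then show ?thesis
    using pres_induct[OF X.R.cring_axioms tens_rels_closed z[unfolded tens_def], folded tens_def, of P]
      add pure smult by (auto simp: tens_pure_def)
qed

lemma tens_lift_param:
  assumes Z: "module K Z" and V: "module K V"
    and b: "\<And>v. v \<in> carrier V \<Longrightarrow> bilin K X Y Z (\<lambda>x y. c x y v)"
    and h: "\<And>x y. x \<in> carrier X \<Longrightarrow> y \<in> carrier Y \<Longrightarrow> c x y \<in> mod_hom K V Z"
  shows "bilin K (tens K X Y) V Z (\<lambda>u v. lift K Z (\<lambda>(x, y). c x y v) u)"
  unfolding tens_def
  using pres_lift_param[OF tens_rels_closed Z V, of "\<lambda>(x, y). c x y"] bilin_respects[OF Z b] h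
  by (auto simp: case_prod_beta')

end

lemmas tens_induct [consumes 3, case_names pure add] = tens_induct_aux

lemma tens_map_hom:
  assumes "module K X" "module K Y" "module K X'" "module K Y'"
    and f: "f \<in> mod_hom K X X'" and g: "g \<in> mod_hom K Y Y'"
  shows "tens_map K X' Y' f g \<in> mod_hom K (tens K X Y) (tens K X' Y')"
  unfolding tens_map_def
  by (rule tens_lift_hom[OF assms(1,2) tens_module[OF assms(3,4)]
        bilin_precomp[OF tens_pure_bilin[OF assms(3,4)] f g]])

lemma tens_map_pure:
  assumes "module K X" "module K Y" "module K X'" "module K Y'"
    and f: "f \<in> mod_hom K X X'" and g: "g \<in> mod_hom K Y Y'"
    and "x \<in> carrier X" "y \<in> carrier Y"
  shows "tens_map K X' Y' f g (tens_pure K X Y x y) = tens_pure K X' Y' (f x) (g y)"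
  unfolding tens_map_def
  by (rule tens_lift_pure[OF assms(1,2) tens_module[OF assms(3,4)]
        bilin_precomp[OF tens_pure_bilin[OF assms(3,4)] f g] assms(7,8)])

text \<open>Applied with the regular or one-sided actions of two algebras as \<open>l\<close> and \<open>r\<close>, this makes the tensor
  product of two modules a module over the tensor product of the algebras.\<close>

lemma tens_map_param:
  assumes "module K X" "module K Y" "module K X'" "module K Y'" "module K P" "module K Q"
    and l: "bilin K P X X' l" and r: "bilin K Q Y Y' r"
    and z: "z \<in> carrier (tens K X Y)"
  shows "bilin K P Q (tens K X' Y') (\<lambda>p q. tens_map K X' Y' (l p) (r q) z)"
proof (rule bilinI)
  note T = tens_module[OF assms(3,4)] and pb = tens_pure_bilin[OF assms(3,4)]
  fix q assume q: "q \<in> carrier Q"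
  note rq = bilin_homs(2)[OF r q]
  have "bilin K (tens K X Y) P (tens K X' Y') (\<lambda>u p. tens_map K X' Y' (l p) (r q) u)"
    unfolding tens_map_def
  proof (rule tens_lift_param[OF assms(1,2) T assms(5)])
    fix p assume "p \<in> carrier P"
    then show "bilin K X Y (tens K X' Y') (\<lambda>x y. tens_pure K X' Y' (l p x) (r q y))"
      by (intro bilin_precomp[OF pb] bilin_homs(2)[OF l] rq)
  next
    fix x y assume "x \<in> carrier X" "y \<in> carrier Y"
    then show "(\<lambda>p. tens_pure K X' Y' (l p x) (r q y)) \<in> mod_hom K P (tens K X' Y')"
      by (intro mod_hom_comp[OF bilin_homs(1)[OF l] bilin_homs(1)[OF pb]] mod_hom_closed[OF rq])
  qed
  then show "(\<lambda>p. tens_map K X' Y' (l p) (r q) z) \<in> mod_hom K P (tens K X' Y')"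
    using z by (rule bilin_homs(2))
next
  note T = tens_module[OF assms(3,4)] and pb = tens_pure_bilin[OF assms(3,4)]
  fix p assume p: "p \<in> carrier P"
  note lp = bilin_homs(2)[OF l p]
  have "bilin K (tens K X Y) Q (tens K X' Y') (\<lambda>u q. tens_map K X' Y' (l p) (r q) u)"
    unfolding tens_map_def
  proof (rule tens_lift_param[OF assms(1,2) T assms(6)])
    fix q assume "q \<in> carrier Q"
    then show "bilin K X Y (tens K X' Y') (\<lambda>x y. tens_pure K X' Y' (l p x) (r q y))"
      by (intro bilin_precomp[OF pb] bilin_homs(2)[OF r] lp)
  next
    fix x y assume "x \<in> carrier X" "y \<in> carrier Y"
    then show "(\<lambda>q. tens_pure K X' Y' (l p x) (r q y)) \<in> mod_hom K Q (tens K X' Y')"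
      by (intro mod_hom_comp[OF bilin_homs(1)[OF r] bilin_homs(2)[OF pb]] mod_hom_closed[OF lp])
  qed
  then show "(\<lambda>q. tens_map K X' Y' (l p) (r q) z) \<in> mod_hom K Q (tens K X' Y')"
    using z by (rule bilin_homs(2))
qed

subsection \<open>The tensor product over an algebra\<close>

context
  fixes K :: "('k, 'r) ring_scheme" and T :: "('k, 't) module" and X :: "('k, 'x) module"
    and r :: "'x \<Rightarrow> 't \<Rightarrow> 'x" and Y :: "('t, 'y) module"
  assumes X: "module K X" and Y: "module K (k_res T Y)"
    and r: "\<And>x t. x \<in> carrier X \<Longrightarrow> t \<in> carrier T \<Longrightarrow> r x t \<in> carrier X"
    and act: "\<And>t y. t \<in> carrier T \<Longrightarrow> y \<in> carrier Y \<Longrightarrow> t \<odot>\<^bsub>Y\<^esub> y \<in> carrier Y"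
begin

interpretation X: module K X by (rule X)
interpretation Y: module K "k_res T Y" by (rule Y)

lemma btens_rels_closed: "btens_rels K T X r Y \<subseteq> carrier (free_mod K (carrier X \<times> carrier Y))"
  using tens_rels_closed[OF X Y] rel_closed(3)[OF X.R.cring_axioms, of _ "carrier X \<times> carrier Y"]
  by (auto simp: btens_rels_def r act)

lemma btens_module: "module K (btens K T X r Y)"
  unfolding btens_def by (rule pres_module[OF X.R.cring_axioms btens_rels_closed])

lemma btens_respects:
  assumes Z: "module K Z" and b: "bilin K X (k_res T Y) Z b"
    and bal: "\<And>x t y. x \<in> carrier X \<Longrightarrow> t \<in> carrier T \<Longrightarrow> y \<in> carrier Y \<Longrightarrow> b (r x t) y = b x (t \<odot>\<^bsub>Y\<^esub> y)"
  shows "respects_rels K Z (carrier X \<times> carrier Y) (btens_rels K T X r Y) (\<lambda>(x, y). b x y)"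
proof -
  have "respects_rels K Z (carrier X \<times> carrier Y) (tens_rels K X (k_res T Y)) (\<lambda>(x, y). b x y)"
    using bilin_respects[OF X Y Z b] by simp
  then show ?thesis
    using lin_ext_rel(3)[OF X.R.cring_axioms Z, of "\<lambda>(x, y). b x y" "carrier X \<times> carrier Y"]
    by (auto simp: respects_rels_def btens_rels_def r act bal)
qed

lemma btens_lift_hom:
  assumes "module K Z" "bilin K X (k_res T Y) Z b"
    and "\<And>x t y. x \<in> carrier X \<Longrightarrow> t \<in> carrier T \<Longrightarrow> y \<in> carrier Y \<Longrightarrow> b (r x t) y = b x (t \<odot>\<^bsub>Y\<^esub> y)"
  shows "lift K Z (\<lambda>(x, y). b x y) \<in> mod_hom K (btens K T X r Y) Z"
  unfolding btens_def
  by (rule lift_hom[OF X.R.cring_axioms btens_rels_closed assms(1) btens_respects[OF assms]])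

lemma btens_lift_pure:
  assumes "module K Z" "bilin K X (k_res T Y) Z b"
    and "\<And>x t y. x \<in> carrier X \<Longrightarrow> t \<in> carrier T \<Longrightarrow> y \<in> carrier Y \<Longrightarrow> b (r x t) y = b x (t \<odot>\<^bsub>Y\<^esub> y)"
    and "x \<in> carrier X" "y \<in> carrier Y"
  shows "lift K Z (\<lambda>(x, y). b x y) (btens_pure K T X r Y x y) = b x y"
  unfolding btens_pure_def
  by (subst lift_gen[OF X.R.cring_axioms btens_rels_closed assms(1) btens_respects[OF assms(1-3)]])
     (use assms(4,5) in auto)

lemma btens_pure_closed:
  "x \<in> carrier X \<Longrightarrow> y \<in> carrier Y \<Longrightarrow> btens_pure K T X r Y x y \<in> carrier (btens K T X r Y)"
  unfolding btens_pure_def btens_def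
  by (rule pres_gen_closed[OF X.R.cring_axioms btens_rels_closed]) simp

lemma btens_pure_balanced:
  assumes "x \<in> carrier X" "t \<in> carrier T" "y \<in> carrier Y"
  shows "btens_pure K T X r Y (r x t) y = btens_pure K T X r Y x (t \<odot>\<^bsub>Y\<^esub> y)"
  unfolding btens_pure_def
  by (rule pres_rel_eq[OF X.R.cring_axioms btens_rels_closed])
     (use assms in \<open>auto simp: btens_rels_def r act\<close>)

lemma btens_pure_bilin: "bilin K X (k_res T Y) (btens K T X r Y) (btens_pure K T X r Y)"
proof (intro bilinI mod_homI)
  note add = pres_rel_add[OF X.R.cring_axioms btens_rels_closed, folded btens_def]
    and smult = pres_rel_smult[OF X.R.cring_axioms btens_rels_closed, folded btens_def]
  have sub: "tens_rels K X (k_res T Y) \<subseteq> btens_rels K T X r Y" by (auto simp: btens_rels_def)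
  fix x y assume x: "x \<in> carrier X" and y: "y \<in> carrier (k_res T Y)"
  then show "btens_pure K T X r Y x y \<in> carrier (btens K T X r Y)" "btens_pure K T X r Y x y \<in> carrier (btens K T X r Y)"
    by (simp_all add: btens_pure_closed)
  { fix x' assume x': "x' \<in> carrier X"
    show "btens_pure K T X r Y (x \<oplus>\<^bsub>X\<^esub> x') y = btens_pure K T X r Y x y \<oplus>\<^bsub>btens K T X r Y\<^esub> btens_pure K T X r Y x' y"
      unfolding btens_pure_def
      by (rule add, rule subsetD[OF sub]) (use x x' y in \<open>simp_all add: tens_rels_def Let_def, blast?\<close>) }
  { fix y' assume y': "y' \<in> carrier (k_res T Y)"
    show "btens_pure K T X r Y x (y \<oplus>\<^bsub>k_res T Y\<^esub> y') = btens_pure K T X r Y x y \<oplus>\<^bsub>btens K T X r Y\<^esub> btens_pure K T X r Y x y'"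
      unfolding btens_pure_def
      by (rule add, rule subsetD[OF sub])
        (use x y y' Y.a_closed in \<open>simp_all add: tens_rels_def Let_def, blast?\<close>) }
  { fix k assume k: "k \<in> carrier K"
    show "btens_pure K T X r Y (k \<odot>\<^bsub>X\<^esub> x) y = k \<odot>\<^bsub>btens K T X r Y\<^esub> btens_pure K T X r Y x y"
      unfolding btens_pure_def
      by (rule smult, rule subsetD[OF sub]) (use x k y in \<open>simp_all add: tens_rels_def Let_def, blast?\<close>)
    show "btens_pure K T X r Y x (k \<odot>\<^bsub>k_res T Y\<^esub> y) = k \<odot>\<^bsub>btens K T X r Y\<^esub> btens_pure K T X r Y x y"
      unfolding btens_pure_def
      by (rule smult, rule subsetD[OF sub])
        (use x k y Y.smult_closed[OF k y] in \<open>simp_all add: tens_rels_def Let_def, blast?\<close>) }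
qed

lemma btens_hom_eq:
  assumes "module K Z" "f \<in> mod_hom K (btens K T X r Y) Z" "g \<in> mod_hom K (btens K T X r Y) Z"
    and "\<And>x y. x \<in> carrier X \<Longrightarrow> y \<in> carrier Y \<Longrightarrow>
      f (btens_pure K T X r Y x y) = g (btens_pure K T X r Y x y)"
    and "z \<in> carrier (btens K T X r Y)"
  shows "f z = g z"
  using pres_hom_eq[OF X.R.cring_axioms btens_rels_closed assms(1) assms(2,3)[unfolded btens_def] _
      assms(5)[unfolded btens_def]] assms(4)
  by (auto simp: btens_pure_def)

end

section \<open>Algebras, bimodules and modules of homomorphisms\<close>

text \<open>This is what an algebra and its enveloping algebra share, and what a module of equivariant maps needs
  of the acting object to become a \<open>K\<close>-module: the action of \<open>k\<close> is that of \<open>k \<cdot> 1\<close>, and it commutes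
  with the action of every other element.\<close>

definition central_unit :: "('k, 'r) ring_scheme \<Rightarrow> ('k, 't) module \<Rightarrow> bool" where
  "central_unit K T \<longleftrightarrow> module K T \<and> \<one>\<^bsub>T\<^esub> \<in> carrier T \<and>
     (\<forall>k\<in>carrier K. \<forall>t\<in>carrier T. (k \<odot>\<^bsub>T\<^esub> \<one>\<^bsub>T\<^esub>) \<otimes>\<^bsub>T\<^esub> t = k \<odot>\<^bsub>T\<^esub> t \<and> t \<otimes>\<^bsub>T\<^esub> (k \<odot>\<^bsub>T\<^esub> \<one>\<^bsub>T\<^esub>) = k \<odot>\<^bsub>T\<^esub> t)"

lemma k_algebra_op:
  assumes "k_algebra K T" shows "k_algebra K (op_alg T)"
proof -
  interpret T: k_algebra K T by fact
  have m: "module K (op_alg T)"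
    by (rule module_cong[OF T.module_axioms]) simp_all
  interpret O: module K "op_alg T" by (rule m)
  have "ring (op_alg T)"
    by (rule ringI[OF O.abelian_group_axioms])
       (auto intro!: monoidI simp: T.A.l_distr T.A.r_distr T.A.m_assoc)
  then show ?thesis
    by (intro k_algebra.intro m k_algebra_axioms.intro)
       (auto simp: T.smult_mult_left T.smult_mult_right)
qed

lemma k_algebra_module: "k_algebra K T \<Longrightarrow> module K T"
  by (simp add: k_algebra_def)

lemma k_algebra_central:
  assumes "k_algebra K T" shows "central_unit K T"
proof -
  interpret T: k_algebra K T by fact
  show ?thesis
    by (auto simp: central_unit_def T.module_axioms T.smult_mult_left T.smult_mult_right)
qed

lemma mult_bilin:
  assumes "k_algebra K T" shows "bilin K T T T (mult T)"
proof -
  interpret T: k_algebra K T by fact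
  show ?thesis
    by (intro bilinI mod_homI) (auto simp: T.A.l_distr T.A.r_distr T.smult_mult_left T.smult_mult_right)
qed

context
  fixes K :: "('k, 'r) ring_scheme" and S :: "('k, 'a) module" and T :: "('k, 'b) module"
  assumes S: "k_algebra K S" and T: "k_algebra K T"
begin

interpretation S: k_algebra K S by (rule S)
interpretation T: k_algebra K T by (rule T)

lemma tens_alg_simps:
  "carrier (tens_alg K S T) = carrier (tens K S T)" "add (tens_alg K S T) = add (tens K S T)"
  "zero (tens_alg K S T) = zero (tens K S T)" "smult (tens_alg K S T) = smult (tens K S T)"
  "one (tens_alg K S T) = tens_pure K S T \<one>\<^bsub>S\<^esub> \<one>\<^bsub>T\<^esub>"
  by (simp_all add: tens_alg_def)

lemma tens_alg_mult_eq:
  "mult (tens_alg K S T) = (\<lambda>u v. lift K (tens K S T) (\<lambda>(s, t). tens_map K S T (mult S s) (mult T t) v) u)"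
  by (simp add: tens_alg_def tens_map_def)

lemma tens_alg_mult_bilin: "bilin K (tens K S T) (tens K S T) (tens K S T) (mult (tens_alg K S T))"
  unfolding tens_alg_mult_eq
proof (rule tens_lift_param)
  note m = S.module_axioms T.module_axioms
  fix v assume "v \<in> carrier (tens K S T)"
  then show "bilin K S T (tens K S T) (\<lambda>s t. tens_map K S T (mult S s) (mult T t) v)"
    by (intro tens_map_param[OF m m m] mult_bilin S T)
next
  fix s t assume "s \<in> carrier S" "t \<in> carrier T"
  then show "tens_map K S T (mult S s) (mult T t) \<in> mod_hom K (tens K S T) (tens K S T)"
    by (intro tens_map_hom S.module_axioms T.module_axioms bilin_homs(2)[OF mult_bilin] S T)
qed (intro tens_module S.module_axioms T.module_axioms)+

lemma tens_alg_mult_pure: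
  assumes "s \<in> carrier S" "s' \<in> carrier S" "t \<in> carrier T" "t' \<in> carrier T"
  shows "tens_pure K S T s t \<otimes>\<^bsub>tens_alg K S T\<^esub> tens_pure K S T s' t' =
    tens_pure K S T (s \<otimes>\<^bsub>S\<^esub> s') (t \<otimes>\<^bsub>T\<^esub> t')"
proof -
  note m = S.module_axioms T.module_axioms
  have v: "tens_pure K S T s' t' \<in> carrier (tens K S T)" using assms by (intro tens_pure_closed m)
  show ?thesis
    unfolding tens_alg_mult_eq
    by (subst tens_lift_pure[OF m tens_module[OF m] tens_map_param[OF m m m mult_bilin mult_bilin v]])
       (use assms in \<open>auto simp: S T tens_map_pure[OF m m bilin_homs(2)[OF mult_bilin] bilin_homs(2)[OF mult_bilin]]\<close>)
qed

lemma tens_alg_module: "module K (tens_alg K S T)"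
  by (rule module_cong[OF tens_module[OF S.module_axioms T.module_axioms]]) (simp_all add: tens_alg_simps)

lemma tens_alg_central: "central_unit K (tens_alg K S T)"
proof -
  note m = S.module_axioms T.module_axioms
  interpret X: module K "tens K S T" by (rule tens_module[OF m])
  have one: "\<one>\<^bsub>tens_alg K S T\<^esub> \<in> carrier (tens K S T)"
    by (simp add: tens_alg_simps tens_pure_closed[OF m])
  have l: "\<one>\<^bsub>tens_alg K S T\<^esub> \<otimes>\<^bsub>tens_alg K S T\<^esub> u = u" if u: "u \<in> carrier (tens K S T)" for u
    by (rule tens_hom_eq[OF m X.module_axioms bilin_homs(2)[OF tens_alg_mult_bilin one] mod_hom_ident _ u])
       (simp add: tens_alg_simps tens_alg_mult_pure)
  have r: "u \<otimes>\<^bsub>tens_alg K S T\<^esub> \<one>\<^bsub>tens_alg K S T\<^esub> = u" if u: "u \<in> carrier (tens K S T)" for u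
    by (rule tens_hom_eq[OF m X.module_axioms bilin_homs(1)[OF tens_alg_mult_bilin one] mod_hom_ident _ u])
       (simp add: tens_alg_simps tens_alg_mult_pure)
  show ?thesis
    using one l r bilin_rules(3,4)[OF tens_alg_mult_bilin]
    by (simp add: central_unit_def tens_alg_module) (simp add: tens_alg_simps)
qed

end

lemma env_alg_simps:
  assumes "k_algebra K S" "k_algebra K T"
  shows "carrier (env_alg K S T) = carrier (tens K S (op_alg T))"
    "add (env_alg K S T) = add (tens K S (op_alg T))"
    "zero (env_alg K S T) = zero (tens K S (op_alg T))"
    "smult (env_alg K S T) = smult (tens K S (op_alg T))"
    "one (env_alg K S T) = tens_pure K S (op_alg T) \<one>\<^bsub>S\<^esub> \<one>\<^bsub>T\<^esub>"
  using tens_alg_simps[OF assms(1) k_algebra_op[OF assms(2)]] by (simp_all add: env_alg_def)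

lemma env_alg_central: "k_algebra K S \<Longrightarrow> k_algebra K T \<Longrightarrow> central_unit K (env_alg K S T)"
  unfolding env_alg_def by (intro tens_alg_central k_algebra_op)

subsection \<open>Bimodules\<close>

context
  fixes K :: "('k, 'r) ring_scheme" and S :: "('k, 'a) module" and T :: "('k, 'b) module"
    and X :: "('k, 'x) module" and l :: "'a \<Rightarrow> 'x \<Rightarrow> 'x" and r :: "'x \<Rightarrow> 'b \<Rightarrow> 'x"
  assumes S: "k_algebra K S" and T: "k_algebra K T" and X: "module K X"
    and l: "bilin K S X X l" and r: "bilin K X T X r"
begin

interpretation S: k_algebra K S by (rule S)
interpretation T: k_algebra K T by (rule T)
interpretation O: k_algebra K "op_alg T" by (rule k_algebra_op[OF T])
interpretation X: module K X by (rule X)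

lemma biact_bilin: 
  assumes "x \<in> carrier X" shows "bilin K S (op_alg T) X (\<lambda>a b. r (l a x) b)"
proof (rule bilinI)
  fix b assume "b \<in> carrier (op_alg T)"
  then show "(\<lambda>a. r (l a x) b) \<in> mod_hom K S X"
    using mod_hom_comp[OF bilin_homs(1)[OF l assms] bilin_homs(1)[OF r]] by simp
next
  fix a assume "a \<in> carrier S"
  then have "r (l a x) \<in> mod_hom K T X"
    by (intro bilin_homs(2)[OF r] bilin_closed[OF l] assms)
  then show "r (l a x) \<in> mod_hom K (op_alg T) X" by (simp add: mod_hom_def)
qed

lemma bimod_bilin: "bilin K (tens K S (op_alg T)) X X (smult (bimod K X l r))"
  unfolding bimod_def with_smult_simps
proof (rule tens_lift_param[OF S.module_axioms O.module_axioms X X])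
  fix a b assume "a \<in> carrier S" "b \<in> carrier (op_alg T)"
  then show "(\<lambda>x. r (l a x) b) \<in> mod_hom K X X"
    using mod_hom_comp[OF bilin_homs(2)[OF l] bilin_homs(1)[OF r]] by simp
qed (rule biact_bilin)

lemma bimod_pure:
  assumes "a \<in> carrier S" "b \<in> carrier T" "x \<in> carrier X"
  shows "tens_pure K S (op_alg T) a b \<odot>\<^bsub>bimod K X l r\<^esub> x = r (l a x) b"
  unfolding bimod_def with_smult_simps
  by (rule tens_lift_pure[OF S.module_axioms O.module_axioms X biact_bilin])
     (use assms in auto)

lemma bimod_simps:
  "carrier (bimod K X l r) = carrier X" "zero (bimod K X l r) = zero X" "add (bimod K X l r) = add X"
  by (simp_all add: bimod_def)

lemma bimod_abelian_group: "abelian_group (bimod K X l r)"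
  by (rule abelian_group_cong[OF X.abelian_group_axioms]) (simp_all add: bimod_simps)

lemma bimod_smult_closed:
  "t \<in> carrier (env_alg K S T) \<Longrightarrow> x \<in> carrier X \<Longrightarrow> t \<odot>\<^bsub>bimod K X l r\<^esub> x \<in> carrier X"
  using bilin_closed[OF bimod_bilin] by (simp add: env_alg_simps[OF S T])

text \<open>Both sides of the equivariance equation are additive in the acting element, and pure tensors
  generate the enveloping algebra additively, so it is enough to test pure tensors.\<close>

lemma bimod_mod_homI:
  assumes Z: "abelian_group Z" and closed: "\<And>x. x \<in> carrier X \<Longrightarrow> f x \<in> carrier Z"
    and add: "\<And>x y. x \<in> carrier X \<Longrightarrow> y \<in> carrier X \<Longrightarrow> f (x \<oplus>\<^bsub>X\<^esub> y) = f x \<oplus>\<^bsub>Z\<^esub> f y"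
    and distr: "\<And>s t z. s \<in> carrier (env_alg K S T) \<Longrightarrow> t \<in> carrier (env_alg K S T) \<Longrightarrow> z \<in> carrier Z \<Longrightarrow>
      (s \<oplus>\<^bsub>env_alg K S T\<^esub> t) \<odot>\<^bsub>Z\<^esub> z = s \<odot>\<^bsub>Z\<^esub> z \<oplus>\<^bsub>Z\<^esub> t \<odot>\<^bsub>Z\<^esub> z"
    and pure: "\<And>a b x. a \<in> carrier S \<Longrightarrow> b \<in> carrier T \<Longrightarrow> x \<in> carrier X \<Longrightarrow>
      f (r (l a x) b) = tens_pure K S (op_alg T) a b \<odot>\<^bsub>Z\<^esub> f x"
  shows "f \<in> mod_hom (env_alg K S T) (bimod K X l r) Z"
proof (rule mod_homI)
  note m = S.module_axioms O.module_axioms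
  fix t x assume t: "t \<in> carrier (env_alg K S T)" and x: "x \<in> carrier (bimod K X l r)"
  from t have t': "t \<in> carrier (tens K S (op_alg T))" by (simp add: env_alg_simps[OF S T])
  from m t' show "f (t \<odot>\<^bsub>bimod K X l r\<^esub> x) = t \<odot>\<^bsub>Z\<^esub> f x"
  proof (induction rule: tens_induct)
    case (pure a b)
    then show ?case using x by (simp add: bimod_simps bimod_pure assms(5))
  next
    case (add u v)
    then show ?case using x distr[of u v "f x"] closed
      by (simp add: bimod_simps bilin_rules(1)[OF bimod_bilin] assms(3) bilin_closed[OF bimod_bilin]
          env_alg_simps[OF S T])
  qed
qed (use closed add in \<open>auto simp: bimod_simps\<close>)

text \<open>The module laws that are not additive in the acting elements follow by induction from those for pure
  tensors, and for these they are the associativity and the commutation of the two one-sided actions.\<close>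

lemma bimod_left_module:
  assumes "\<And>a a' x. a \<in> carrier S \<Longrightarrow> a' \<in> carrier S \<Longrightarrow> x \<in> carrier X \<Longrightarrow> l (a \<otimes>\<^bsub>S\<^esub> a') x = l a (l a' x)"
    and "\<And>b b' x. b \<in> carrier T \<Longrightarrow> b' \<in> carrier T \<Longrightarrow> x \<in> carrier X \<Longrightarrow> r x (b \<otimes>\<^bsub>T\<^esub> b') = r (r x b) b'"
    and "\<And>a b x. a \<in> carrier S \<Longrightarrow> b \<in> carrier T \<Longrightarrow> x \<in> carrier X \<Longrightarrow> r (l a x) b = l a (r x b)"
    and "\<And>x. x \<in> carrier X \<Longrightarrow> l \<one>\<^bsub>S\<^esub> x = x" "\<And>x. x \<in> carrier X \<Longrightarrow> r x \<one>\<^bsub>T\<^esub> = x"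
  shows "left_module (env_alg K S T) (bimod K X l r)"
proof (intro left_module.intro left_module_axioms.intro bimod_abelian_group)
  note m = S.module_axioms O.module_axioms
  note c = bimod_simps env_alg_simps[OF S T]
  note cl = bilin_closed[OF bimod_bilin] bilin_closed[OF l] bilin_closed[OF r]
  note mb = tens_alg_mult_bilin[OF S k_algebra_op[OF T], folded env_alg_def]
  fix s x assume s: "s \<in> carrier (env_alg K S T)" and x: "x \<in> carrier (bimod K X l r)"
  show "s \<odot>\<^bsub>bimod K X l r\<^esub> x \<in> carrier (bimod K X l r)"
    using s x bimod_smult_closed by (simp add: c)
  { fix y assume "y \<in> carrier (bimod K X l r)"
    then show "s \<odot>\<^bsub>bimod K X l r\<^esub> (x \<oplus>\<^bsub>bimod K X l r\<^esub> y) =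
        s \<odot>\<^bsub>bimod K X l r\<^esub> x \<oplus>\<^bsub>bimod K X l r\<^esub> s \<odot>\<^bsub>bimod K X l r\<^esub> y"
      using s x by (simp add: c bilin_rules[OF bimod_bilin]) }
  fix t assume t: "t \<in> carrier (env_alg K S T)"
  show "(s \<oplus>\<^bsub>env_alg K S T\<^esub> t) \<odot>\<^bsub>bimod K X l r\<^esub> x =
      s \<odot>\<^bsub>bimod K X l r\<^esub> x \<oplus>\<^bsub>bimod K X l r\<^esub> t \<odot>\<^bsub>bimod K X l r\<^esub> x"
    using s t x by (simp add: c bilin_rules[OF bimod_bilin])
  have s': "s \<in> carrier (tens K S (op_alg T))" and t': "t \<in> carrier (tens K S (op_alg T))"
    and x': "x \<in> carrier X" using s t x by (simp_all add: c)
  from m s' show "(s \<otimes>\<^bsub>env_alg K S T\<^esub> t) \<odot>\<^bsub>bimod K X l r\<^esub> x = s \<odot>\<^bsub>bimod K X l r\<^esub> (t \<odot>\<^bsub>bimod K X l r\<^esub> x)"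
  proof (induction rule: tens_induct)
    case (pure a b)
    note p = tens_pure_closed[OF m pure]
    from m t' show ?case
    proof (induction rule: tens_induct)
      case (pure a' b')
      then show ?case
        using \<open>a \<in> carrier S\<close> \<open>b \<in> carrier (op_alg T)\<close> x'
          tens_alg_mult_pure[OF S k_algebra_op[OF T], folded env_alg_def]
        by (simp add: bimod_pure cl assms)
    next
      case (add u v)
      then show ?case using p x'
        by (simp add: bilin_rules[OF mb] bilin_rules[OF bimod_bilin] bilin_closed[OF mb] cl)
    qed
  next
    case (add u v)
    then show ?case using t' x'
      by (simp add: bilin_rules[OF mb] bilin_rules[OF bimod_bilin] bilin_closed[OF mb] cl)
  qed
next
  fix x assume "x \<in> carrier (bimod K X l r)"
  then show "\<one>\<^bsub>env_alg K S T\<^esub> \<odot>\<^bsub>bimod K X l r\<^esub> x = x"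
    by (simp add: bimod_simps env_alg_simps[OF S T] bimod_pure assms)
qed

lemma bimod_k_res:
  assumes "k \<in> carrier K" "x \<in> carrier X" "\<And>x. x \<in> carrier X \<Longrightarrow> l \<one>\<^bsub>S\<^esub> x = x" "\<And>x. x \<in> carrier X \<Longrightarrow> r x \<one>\<^bsub>T\<^esub> = x"
  shows "k \<odot>\<^bsub>k_res (env_alg K S T) (bimod K X l r)\<^esub> x = k \<odot>\<^bsub>X\<^esub> x"
proof -
  note m = S.module_axioms O.module_axioms
  have "\<one>\<^bsub>env_alg K S T\<^esub> \<in> carrier (tens K S (op_alg T))"
    unfolding env_alg_simps[OF S T] by (rule tens_pure_closed[OF m]) auto
  then show ?thesis using assms
    by (simp add: bilin_rules(3)[OF bimod_bilin] env_alg_simps[OF S T] bimod_pure)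
qed

end

subsection \<open>Modules of homomorphisms\<close>

lemma k_res_module:
  assumes K: "cring K" and T: "central_unit K T" and Y: "left_module T Y"
  shows "module K (k_res T Y)"
proof (rule moduleI[OF K])
  interpret Y: left_module T Y by fact
  interpret T: module K T using T by (simp add: central_unit_def)
  show "abelian_group (k_res T Y)"
    by (rule abelian_group_cong[OF Y.abelian_group_axioms]) simp_all
  have one: "\<one>\<^bsub>T\<^esub> \<in> carrier T" using T by (simp add: central_unit_def)
  fix a x assume a: "a \<in> carrier K" and x: "x \<in> carrier (k_res T Y)"
  show "a \<odot>\<^bsub>k_res T Y\<^esub> x \<in> carrier (k_res T Y)" using a x one by (simp add: Y.smult_closed)
  { fix y assume "y \<in> carrier (k_res T Y)"
    then show "a \<odot>\<^bsub>k_res T Y\<^esub> (x \<oplus>\<^bsub>k_res T Y\<^esub> y) = a \<odot>\<^bsub>k_res T Y\<^esub> x \<oplus>\<^bsub>k_res T Y\<^esub> a \<odot>\<^bsub>k_res T Y\<^esub> y"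
      using a x one by (simp add: Y.smult_r_distr) }
  fix b assume b: "b \<in> carrier K"
  show "(a \<oplus>\<^bsub>K\<^esub> b) \<odot>\<^bsub>k_res T Y\<^esub> x = a \<odot>\<^bsub>k_res T Y\<^esub> x \<oplus>\<^bsub>k_res T Y\<^esub> b \<odot>\<^bsub>k_res T Y\<^esub> x"
    using a b x one by (simp add: Y.smult_l_distr T.smult_l_distr)
  have "(a \<odot>\<^bsub>T\<^esub> \<one>\<^bsub>T\<^esub>) \<otimes>\<^bsub>T\<^esub> (b \<odot>\<^bsub>T\<^esub> \<one>\<^bsub>T\<^esub>) = a \<odot>\<^bsub>T\<^esub> (b \<odot>\<^bsub>T\<^esub> \<one>\<^bsub>T\<^esub>)"
    using T a b one by (simp add: central_unit_def T.smult_swap)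
  then show "(a \<otimes>\<^bsub>K\<^esub> b) \<odot>\<^bsub>k_res T Y\<^esub> x = a \<odot>\<^bsub>k_res T Y\<^esub> (b \<odot>\<^bsub>k_res T Y\<^esub> x)"
    using a b x one by (simp add: T.smult_assoc1 Y.smult_assoc[symmetric])
next
  interpret Y: left_module T Y by fact
  interpret T: module K T using T by (simp add: central_unit_def)
  fix x assume "x \<in> carrier (k_res T Y)"
  then show "\<one>\<^bsub>K\<^esub> \<odot>\<^bsub>k_res T Y\<^esub> x = x"
    using T by (simp add: central_unit_def Y.smult_one)
qed

lemma hom_mod_simps [simp]:
  "carrier (hom_mod T X Y) = mod_hom T X Y \<inter> extensional (carrier X)"
  "zero (hom_mod T X Y) = (\<lambda>x\<in>carrier X. \<zero>\<^bsub>Y\<^esub>)"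
  "f \<oplus>\<^bsub>hom_mod T X Y\<^esub> g = (\<lambda>x\<in>carrier X. f x \<oplus>\<^bsub>Y\<^esub> g x)"
  "k \<odot>\<^bsub>hom_mod T X Y\<^esub> f = (\<lambda>x\<in>carrier X. k \<odot>\<^bsub>k_res T Y\<^esub> f x)"
  by (simp_all add: hom_mod_def)

lemma left_module_zero:
  assumes "left_module T Y" "t \<in> carrier T" shows "t \<odot>\<^bsub>Y\<^esub> \<zero>\<^bsub>Y\<^esub> = \<zero>\<^bsub>Y\<^esub>"
proof -
  interpret Y: left_module T Y by fact
  show ?thesis
    using Y.smult_r_distr[OF assms(2) Y.zero_closed Y.zero_closed] Y.smult_closed[OF assms(2) Y.zero_closed]
    by (intro additive_zero[where f = "smult Y t", OF Y.abelian_group_axioms Y.abelian_group_axioms])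
qed

lemma left_module_neg:
  assumes "left_module T Y" "t \<in> carrier T" "y \<in> carrier Y"
  shows "t \<odot>\<^bsub>Y\<^esub> (\<ominus>\<^bsub>Y\<^esub> y) = \<ominus>\<^bsub>Y\<^esub> (t \<odot>\<^bsub>Y\<^esub> y)"
proof -
  interpret Y: left_module T Y by fact
  have "t \<odot>\<^bsub>Y\<^esub> (\<ominus>\<^bsub>Y\<^esub> y) \<oplus>\<^bsub>Y\<^esub> t \<odot>\<^bsub>Y\<^esub> y = \<zero>\<^bsub>Y\<^esub>"
    using assms Y.smult_r_distr[OF assms(2), of "\<ominus>\<^bsub>Y\<^esub> y" y] left_module_zero[OF assms(1,2)]
    by (simp add: Y.l_neg)
  then show ?thesis using assms by (simp add: Y.minus_equality Y.smult_closed)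
qed

text \<open>The only point that is not formal is that a scalar multiple of an equivariant map is again
  equivariant; it holds because the scalar acts through a central element.\<close>

lemma hom_mod_module:
  assumes K: "cring K" and T: "central_unit K T" and Y: "left_module T Y"
    and X: "abelian_group X" and act: "\<And>t x. t \<in> carrier T \<Longrightarrow> x \<in> carrier X \<Longrightarrow> t \<odot>\<^bsub>X\<^esub> x \<in> carrier X"
  shows "module K (hom_mod T X Y)"
proof -
  interpret Y: left_module T Y by fact
  interpret X: abelian_group X by fact
  interpret T: module K T using T by (simp add: central_unit_def)
  interpret R: module K "k_res T Y" by (rule k_res_module) fact+
  have one: "\<one>\<^bsub>T\<^esub> \<in> carrier T" using T by (simp add: central_unit_def)
  note ext = extensionalityI[where A = "carrier X"]
  note cl = mod_hom_closed Y.smult_closed act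
  have z: "(\<lambda>x\<in>carrier X. \<zero>\<^bsub>Y\<^esub>) \<in> mod_hom T X Y"
    by (rule mod_homI) (auto simp: act left_module_zero[OF Y])
  have a: "(\<lambda>x\<in>carrier X. f x \<oplus>\<^bsub>Y\<^esub> g x) \<in> mod_hom T X Y"
    if "f \<in> mod_hom T X Y" "g \<in> mod_hom T X Y" for f g
    by (rule mod_homI)
       (use that in \<open>auto simp: act mod_hom_closed Y.smult_closed mod_hom_add mod_hom_smult Y.smult_r_distr Y.add_swap\<close>)
  have n: "(\<lambda>x\<in>carrier X. \<ominus>\<^bsub>Y\<^esub> f x) \<in> mod_hom T X Y" if "f \<in> mod_hom T X Y" for f
    by (rule mod_homI)
       (use that in \<open>auto simp: act mod_hom_closed mod_hom_add mod_hom_smult left_module_neg[OF Y] Y.minus_add\<close>)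
  have comm: "(k \<odot>\<^bsub>T\<^esub> \<one>\<^bsub>T\<^esub>) \<odot>\<^bsub>Y\<^esub> (t \<odot>\<^bsub>Y\<^esub> y) = t \<odot>\<^bsub>Y\<^esub> ((k \<odot>\<^bsub>T\<^esub> \<one>\<^bsub>T\<^esub>) \<odot>\<^bsub>Y\<^esub> y)"
    if "k \<in> carrier K" "t \<in> carrier T" "y \<in> carrier Y" for k t y
    using that T one by (simp add: Y.smult_assoc[symmetric] central_unit_def)
  have s: "(\<lambda>x\<in>carrier X. (k \<odot>\<^bsub>T\<^esub> \<one>\<^bsub>T\<^esub>) \<odot>\<^bsub>Y\<^esub> f x) \<in> mod_hom T X Y" if "f \<in> mod_hom T X Y" "k \<in> carrier K" for f k
    by (rule mod_homI)
       (use that one in \<open>auto simp: act mod_hom_closed Y.smult_closed mod_hom_add mod_hom_smult Y.smult_r_distr comm\<close>)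
  have "abelian_group (hom_mod T X Y)"
  proof (rule abelian_groupI)
    fix f assume f: "f \<in> carrier (hom_mod T X Y)"
    then have fc: "\<And>x. x \<in> carrier X \<Longrightarrow> f x \<in> carrier Y" by (auto intro: mod_hom_closed)
    show "\<exists>g\<in>carrier (hom_mod T X Y). g \<oplus>\<^bsub>hom_mod T X Y\<^esub> f = \<zero>\<^bsub>hom_mod T X Y\<^esub>"
      by (rule bexI[of _ "\<lambda>x\<in>carrier X. \<ominus>\<^bsub>Y\<^esub> f x"])
         (use n f in \<open>auto simp: fc Y.l_neg intro!: ext\<close>)
    show "\<zero>\<^bsub>hom_mod T X Y\<^esub> \<oplus>\<^bsub>hom_mod T X Y\<^esub> f = f"
      using f by (auto simp: fc intro!: ext)
    fix g assume g: "g \<in> carrier (hom_mod T X Y)"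
    then have gc: "\<And>x. x \<in> carrier X \<Longrightarrow> g x \<in> carrier Y" by (auto intro: mod_hom_closed)
    show "f \<oplus>\<^bsub>hom_mod T X Y\<^esub> g \<in> carrier (hom_mod T X Y)" using a f g by simp
    show "f \<oplus>\<^bsub>hom_mod T X Y\<^esub> g = g \<oplus>\<^bsub>hom_mod T X Y\<^esub> f"
      by (auto simp: fc gc Y.a_comm intro!: ext)
    fix h assume h: "h \<in> carrier (hom_mod T X Y)"
    then have hc: "\<And>x. x \<in> carrier X \<Longrightarrow> h x \<in> carrier Y" by (auto intro: mod_hom_closed)
    show "f \<oplus>\<^bsub>hom_mod T X Y\<^esub> g \<oplus>\<^bsub>hom_mod T X Y\<^esub> h = f \<oplus>\<^bsub>hom_mod T X Y\<^esub> (g \<oplus>\<^bsub>hom_mod T X Y\<^esub> h)"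
      by (auto simp: fc gc hc Y.a_assoc intro!: ext)
  next
    show "\<zero>\<^bsub>hom_mod T X Y\<^esub> \<in> carrier (hom_mod T X Y)" using z by simp
  qed
  then show ?thesis
  proof (rule moduleI[OF K])
    fix k f assume k: "k \<in> carrier K" and f: "f \<in> carrier (hom_mod T X Y)"
    then have fc: "\<And>x. x \<in> carrier X \<Longrightarrow> f x \<in> carrier Y" by (auto intro: mod_hom_closed)
    note R' = R.smult_l_distr[simplified] R.smult_r_distr[simplified] R.smult_assoc1[simplified]
      R.smult_one[simplified] R.smult_closed[simplified]
    show "k \<odot>\<^bsub>hom_mod T X Y\<^esub> f \<in> carrier (hom_mod T X Y)" using s f k by simp
    { fix m assume "m \<in> carrier K"
      then show "(k \<oplus>\<^bsub>K\<^esub> m) \<odot>\<^bsub>hom_mod T X Y\<^esub> f = k \<odot>\<^bsub>hom_mod T X Y\<^esub> f \<oplus>\<^bsub>hom_mod T X Y\<^esub> m \<odot>\<^bsub>hom_mod T X Y\<^esub> f"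
        "(k \<otimes>\<^bsub>K\<^esub> m) \<odot>\<^bsub>hom_mod T X Y\<^esub> f = k \<odot>\<^bsub>hom_mod T X Y\<^esub> (m \<odot>\<^bsub>hom_mod T X Y\<^esub> f)"
        using k by (auto simp: fc R' intro!: ext) }
    fix g assume g: "g \<in> carrier (hom_mod T X Y)"
    then have gc: "\<And>x. x \<in> carrier X \<Longrightarrow> g x \<in> carrier Y" by (auto intro: mod_hom_closed)
    show "k \<odot>\<^bsub>hom_mod T X Y\<^esub> (f \<oplus>\<^bsub>hom_mod T X Y\<^esub> g) = k \<odot>\<^bsub>hom_mod T X Y\<^esub> f \<oplus>\<^bsub>hom_mod T X Y\<^esub> k \<odot>\<^bsub>hom_mod T X Y\<^esub> g"
      using k by (auto simp: fc gc R' intro!: ext)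
  next
    fix f assume f: "f \<in> carrier (hom_mod T X Y)"
    then have fc: "\<And>x. x \<in> carrier X \<Longrightarrow> f x \<in> carrier Y" by (auto intro: mod_hom_closed)
    show "\<one>\<^bsub>K\<^esub> \<odot>\<^bsub>hom_mod T X Y\<^esub> f = f"
      using f by (auto simp: fc R.smult_one[simplified] intro!: ext)
  qed
qed

section \<open>Tensor powers\<close>

definition multilin ::
  "('k, 'r) ring_scheme \<Rightarrow> ('k, 'a) module \<Rightarrow> nat \<Rightarrow> ('k, 'z) module \<Rightarrow> ('a list \<Rightarrow> 'z) \<Rightarrow> bool" where
  "multilin K T m Z g \<longleftrightarrow> g \<in> tlists T m \<rightarrow> carrier Z \<and>
     (\<forall>us vs. set us \<subseteq> carrier T \<longrightarrow> set vs \<subseteq> carrier T \<longrightarrow> length us + Suc (length vs) = m \<longrightarrow>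
        (\<lambda>x. g (us @ x # vs)) \<in> mod_hom K T Z)"

lemma tlists_split [simp]:
  "us @ x # vs \<in> tlists T m \<longleftrightarrow>
     length us + Suc (length vs) = m \<and> set us \<subseteq> carrier T \<and> x \<in> carrier T \<and> set vs \<subseteq> carrier T"
  by (auto simp: tlists_def)

lemma multilin_slot:
  "multilin K T m Z g \<Longrightarrow> us @ x # vs \<in> tlists T m \<Longrightarrow> (\<lambda>x. g (us @ x # vs)) \<in> mod_hom K T Z"
  by (auto simp: multilin_def)

lemma multilin_closed: "multilin K T m Z g \<Longrightarrow> xs \<in> tlists T m \<Longrightarrow> g xs \<in> carrier Z"
  by (auto simp: multilin_def)

lemma multilin_add:
  assumes "multilin K T m Z g" "us @ x # vs \<in> tlists T m" "y \<in> carrier T"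
  shows "g (us @ (x \<oplus>\<^bsub>T\<^esub> y) # vs) = g (us @ x # vs) \<oplus>\<^bsub>Z\<^esub> g (us @ y # vs)"
  using mod_hom_add[OF multilin_slot[OF assms(1,2)]] assms(2,3) by simp

lemma multilin_smult:
  assumes "multilin K T m Z g" "us @ x # vs \<in> tlists T m" "k \<in> carrier K"
  shows "g (us @ (k \<odot>\<^bsub>T\<^esub> x) # vs) = k \<odot>\<^bsub>Z\<^esub> g (us @ x # vs)"
  using mod_hom_smult[OF multilin_slot[OF assms(1,2)] assms(3)] assms(2) by simp

lemma multilin_scale:
  assumes "module K Z" "multilin K T m Z g" "k \<in> carrier K"
  shows "multilin K T m Z (\<lambda>xs. k \<odot>\<^bsub>Z\<^esub> g xs)"
proof -
  interpret Z: module K Z by fact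
  show ?thesis
    using assms(2) by (auto simp: multilin_def Pi_def intro!: mod_hom_scale[OF assms(1) _ assms(3)] assms(3))
qed

lemma multilin_sum:
  assumes "module K Z" "finite A" "\<And>i. i \<in> A \<Longrightarrow> multilin K T m Z (g i)"
  shows "multilin K T m Z (\<lambda>xs. \<Oplus>\<^bsub>Z\<^esub>i\<in>A. g i xs)"
proof -
  interpret Z: module K Z by fact
  have "(\<lambda>xs. \<Oplus>\<^bsub>Z\<^esub>i\<in>A. g i xs) \<in> tlists T m \<rightarrow> carrier Z"
  proof
    fix xs assume "xs \<in> tlists T m"
    then show "(\<Oplus>\<^bsub>Z\<^esub>i\<in>A. g i xs) \<in> carrier Z"
      using multilin_closed[OF assms(3)] by (intro Z.finsum_closed) auto
  qed
  then show ?thesis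
    using assms(3) unfolding multilin_def by (auto intro!: mod_hom_sum[OF assms(1,2)])
qed

context
  fixes K :: "('k, 'r) ring_scheme" and T :: "('k, 'a) module" and m :: nat
  assumes T: "module K T"
begin

interpretation T: module K T by (rule T)

lemma tpow_rels_closed: "tpow_rels K T m \<subseteq> carrier (free_mod K (tlists T m))"
  unfolding tpow_rels_def Let_def
  by (intro Un_least subsetI; elim CollectE exE conjE)
     (simp_all only:, (rule rel_closed[OF T.R.cring_axioms]; simp)+)

lemma tpow_module: "module K (tpow K T m)"
  unfolding tpow_def by (rule pres_module[OF T.R.cring_axioms tpow_rels_closed])

lemma multilin_respects:
  assumes Z: "module K Z" and g: "multilin K T m Z g"
  shows "respects_rels K Z (tlists T m) (tpow_rels K T m) g"
proof -
  have gS: "g \<in> tlists T m \<rightarrow> carrier Z" using g by (simp add: multilin_def)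
  show ?thesis
    unfolding respects_rels_def tpow_rels_def Let_def
    apply (intro conjI gS ballI)
    apply (elim UnE CollectE exE conjE; simp only:)
    by (rule lin_ext_rel[OF T.R.cring_axioms Z gS];
        simp add: multilin_add[OF g] multilin_smult[OF g])+
qed

lemma tpow_lift_hom:
  assumes "module K Z" "multilin K T m Z g" shows "lift K Z g \<in> mod_hom K (tpow K T m) Z"
  unfolding tpow_def
  by (rule lift_hom[OF T.R.cring_axioms tpow_rels_closed assms(1) multilin_respects[OF assms]])

lemma tpow_pure_eq: "xs \<in> tlists T m \<Longrightarrow> tpow_pure K T xs = pres_gen K (tlists T m) (tpow_rels K T m) xs"
  by (simp add: tpow_pure_def tlists_def)

lemma tpow_lift_pure:
  assumes "module K Z" "multilin K T m Z g" "xs \<in> tlists T m"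
  shows "lift K Z g (tpow_pure K T xs) = g xs"
  unfolding tpow_pure_eq[OF assms(3)]
  by (rule lift_gen[OF T.R.cring_axioms tpow_rels_closed assms(1) multilin_respects[OF assms(1,2)] assms(3)])

lemma tpow_pure_closed: "xs \<in> tlists T m \<Longrightarrow> tpow_pure K T xs \<in> carrier (tpow K T m)"
  unfolding tpow_def by (simp add: tpow_pure_eq pres_gen_closed[OF T.R.cring_axioms tpow_rels_closed])

lemma tpow_pure_multilin: "multilin K T m (tpow K T m) (tpow_pure K T)"
  unfolding multilin_def
proof (intro conjI allI impI)
  fix us vs assume uv: "set us \<subseteq> carrier T" "set vs \<subseteq> carrier T" "length us + Suc (length vs) = m"
  show "(\<lambda>x. tpow_pure K T (us @ x # vs)) \<in> mod_hom K T (tpow K T m)"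
  proof (rule mod_homI)
    note add = pres_rel_add[OF T.R.cring_axioms tpow_rels_closed, folded tpow_def]
      and smult = pres_rel_smult[OF T.R.cring_axioms tpow_rels_closed, folded tpow_def]
    fix x assume x: "x \<in> carrier T"
    show "tpow_pure K T (us @ x # vs) \<in> carrier (tpow K T m)"
      using uv x by (intro tpow_pure_closed) simp
    { fix y assume y: "y \<in> carrier T"
      have "pres_gen K (tlists T m) (tpow_rels K T m) (us @ (x \<oplus>\<^bsub>T\<^esub> y) # vs) =
          pres_gen K (tlists T m) (tpow_rels K T m) (us @ x # vs) \<oplus>\<^bsub>tpow K T m\<^esub>
          pres_gen K (tlists T m) (tpow_rels K T m) (us @ y # vs)"
      proof (rule add)
        have "us @ x # vs \<in> tlists T m \<and> y \<in> carrier T" using uv x y by simp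
        then show "basis_elt K (us @ (x \<oplus>\<^bsub>T\<^esub> y) # vs) \<ominus>\<^bsub>free_mod K (tlists T m)\<^esub>
          (basis_elt K (us @ x # vs) \<oplus>\<^bsub>free_mod K (tlists T m)\<^esub> basis_elt K (us @ y # vs)) \<in> tpow_rels K T m"
          unfolding tpow_rels_def Let_def by blast
      qed (use uv x y in auto)
      then show "tpow_pure K T (us @ (x \<oplus>\<^bsub>T\<^esub> y) # vs) =
          tpow_pure K T (us @ x # vs) \<oplus>\<^bsub>tpow K T m\<^esub> tpow_pure K T (us @ y # vs)"
        using uv x y by (simp add: tpow_pure_eq) }
    fix k assume k: "k \<in> carrier K"
    have "pres_gen K (tlists T m) (tpow_rels K T m) (us @ (k \<odot>\<^bsub>T\<^esub> x) # vs) =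
        k \<odot>\<^bsub>tpow K T m\<^esub> pres_gen K (tlists T m) (tpow_rels K T m) (us @ x # vs)"
    proof (rule smult)
      have "k \<in> carrier K \<and> us @ x # vs \<in> tlists T m" using uv x k by simp
      then show "basis_elt K (us @ (k \<odot>\<^bsub>T\<^esub> x) # vs) \<ominus>\<^bsub>free_mod K (tlists T m)\<^esub>
        (k \<odot>\<^bsub>free_mod K (tlists T m)\<^esub> basis_elt K (us @ x # vs)) \<in> tpow_rels K T m"
        unfolding tpow_rels_def Let_def by blast
    qed (use uv x k in auto)
    then show "tpow_pure K T (us @ (k \<odot>\<^bsub>T\<^esub> x) # vs) = k \<odot>\<^bsub>tpow K T m\<^esub> tpow_pure K T (us @ x # vs)"
      using uv x k by (simp add: tpow_pure_eq)
  qed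
qed (use tpow_pure_closed in auto)

lemma tpow_hom_eq:
  assumes "module K Z" "f \<in> mod_hom K (tpow K T m) Z" "g \<in> mod_hom K (tpow K T m) Z"
    and "\<And>xs. xs \<in> tlists T m \<Longrightarrow> f (tpow_pure K T xs) = g (tpow_pure K T xs)"
    and "z \<in> carrier (tpow K T m)"
  shows "f z = g z"
  using pres_hom_eq[OF T.R.cring_axioms tpow_rels_closed assms(1) assms(2,3)[unfolded tpow_def] _
      assms(5)[unfolded tpow_def]] assms(4)
  by (auto simp: tpow_pure_eq)

lemma tpow_lift_param:
  assumes Z: "module K Z" and V: "module K V"
    and b: "\<And>v. v \<in> carrier V \<Longrightarrow> multilin K T m Z (\<lambda>xs. c xs v)"
    and h: "\<And>xs. xs \<in> tlists T m \<Longrightarrow> c xs \<in> mod_hom K V Z"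
  shows "bilin K (tpow K T m) V Z (\<lambda>u v. lift K Z (\<lambda>xs. c xs v) u)"
  unfolding tpow_def
  using pres_lift_param[OF tpow_rels_closed Z V multilin_respects[OF Z b] h] by blast

end

text \<open>Faces, outer multiplications, the insertion of a unit and reversal are all induced by operations on
  lists, and in each of them one fixed slot of the argument passes through a linear map into one slot of
  the value. That is the reason for their multilinearity, isolated here once.\<close>

lemma multilin_pure:
  assumes T: "module K T" and T': "module K T'"
    and closed: "\<And>xs. xs \<in> tlists T m \<Longrightarrow> h xs \<in> tlists T' m'"
    and slot: "\<And>us x vs. us @ x # vs \<in> tlists T m \<Longrightarrow>
      \<exists>us' vs' \<phi>. \<phi> \<in> mod_hom K T T' \<and> (\<forall>y\<in>carrier T. h (us @ y # vs) = us' @ \<phi> y # vs')"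
  shows "multilin K T m (tpow K T' m') (\<lambda>xs. tpow_pure K T' (h xs))"
  unfolding multilin_def
proof (intro conjI allI impI)
  interpret T: module K T by fact
  fix us vs assume uv: "set us \<subseteq> carrier T" "set vs \<subseteq> carrier T" "length us + Suc (length vs) = m"
  then have t: "us @ \<zero>\<^bsub>T\<^esub> # vs \<in> tlists T m" by simp
  obtain us' vs' \<phi> where \<phi>: "\<phi> \<in> mod_hom K T T'" and h: "\<forall>y\<in>carrier T. h (us @ y # vs) = us' @ \<phi> y # vs'"
    using slot[OF t] by blast
  have "us' @ \<phi> \<zero>\<^bsub>T\<^esub> # vs' \<in> tlists T' m'" using closed[OF t] h by (metis T.zero_closed)
  note s = mod_hom_comp[OF \<phi> multilin_slot[OF tpow_pure_multilin[OF T'] this]]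
  show "(\<lambda>x. tpow_pure K T' (h (us @ x # vs))) \<in> mod_hom K T (tpow K T' m')"
    by (rule mod_hom_cong[OF s _ T]) (use h in simp)
qed (use tpow_pure_closed[OF T'] closed in auto)

section \<open>The bar complex\<close>

definition face :: "('k, 'a) module \<Rightarrow> nat \<Rightarrow> 'a list \<Rightarrow> 'a list" where
  "face T i xs = take i xs @ (xs ! i \<otimes>\<^bsub>T\<^esub> xs ! Suc i) # drop (i + 2) xs"

definition lmul :: "('k, 'a) module \<Rightarrow> 'a \<Rightarrow> 'a list \<Rightarrow> 'a list" where
  "lmul T a xs = (a \<otimes>\<^bsub>T\<^esub> hd xs) # tl xs"

definition rmul :: "('k, 'a) module \<Rightarrow> 'a list \<Rightarrow> 'a \<Rightarrow> 'a list" where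
  "rmul T xs a = butlast xs @ [last xs \<otimes>\<^bsub>T\<^esub> a]"

definition bar_face_sum ::
  "('k, 'r) ring_scheme \<Rightarrow> ('k, 'a) module \<Rightarrow> nat \<Rightarrow> ('a list \<Rightarrow> 'k) set \<Rightarrow> ('a list \<Rightarrow> 'k) set" where
  "bar_face_sum K T n = lift K (tpow K T (n + 1))
     (\<lambda>xs. \<Oplus>\<^bsub>tpow K T (n + 1)\<^esub>i\<in>{0..n}. ksign K i \<odot>\<^bsub>tpow K T (n + 1)\<^esub> tpow_pure K T (face T i xs))"

definition unit_cons ::
  "('k, 'r) ring_scheme \<Rightarrow> ('k, 'a) module \<Rightarrow> nat \<Rightarrow> ('a list \<Rightarrow> 'k) set \<Rightarrow> ('a list \<Rightarrow> 'k) set" where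
  "unit_cons K T m = lift K (tpow K T (Suc m)) (\<lambda>xs. tpow_pure K T (\<one>\<^bsub>T\<^esub> # xs))"

lemma bar_aug_d_eq: "bar_aug_d K T (int n) = bar_face_sum K T n"
proof -
  have "nat (int n - 1 + 2) = n + 1" by simp
  then show ?thesis unfolding bar_aug_d_def bar_aug_def bar_face_sum_def face_def by simp
qed

lemma tlists_Suc: "xs \<in> tlists T (Suc m) \<longleftrightarrow> (\<exists>y ys. xs = y # ys \<and> y \<in> carrier T \<and> ys \<in> tlists T m)"
  by (cases xs) (auto simp: tlists_def)

lemma tlists_Suc_snoc: "xs \<in> tlists T (Suc m) \<longleftrightarrow> (\<exists>y ys. xs = ys @ [y] \<and> y \<in> carrier T \<and> ys \<in> tlists T m)"
  by (cases xs rule: rev_cases) (auto simp: tlists_def)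

context
  fixes K :: "('k, 'r) ring_scheme" and T :: "('k, 'a) module"
  assumes T: "k_algebra K T"
begin

interpretation T: k_algebra K T by (rule T)

lemma face_closed: "i \<le> n \<Longrightarrow> xs \<in> tlists T (n + 2) \<Longrightarrow> face T i xs \<in> tlists T (n + 1)"
proof -
  assume i: "i \<le> n" and xs: "xs \<in> tlists T (n + 2)"
  then have "xs ! i \<in> carrier T" "xs ! Suc i \<in> carrier T"
    by (auto simp: tlists_def intro!: subsetD[of "set xs" "carrier T"])
  then show ?thesis using i xs set_take_subset[of i xs] set_drop_subset[of "i + 2" xs]
    unfolding face_def tlists_split by (auto simp: tlists_def)
qed

text \<open>A slot outside the two that are multiplied is kept, and one of these two passes through left or right
  multiplication by the other.\<close>

lemma face_slot:
  assumes i: "i \<le> n" and xs: "us @ x # vs \<in> tlists T (n + 2)"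
  shows "\<exists>us' vs' \<phi>. \<phi> \<in> mod_hom K T T \<and> (\<forall>y\<in>carrier T. face T i (us @ y # vs) = us' @ \<phi> y # vs')"
proof -
  consider "Suc i < length us" | "Suc i = length us" | "i = length us" | "i > length us" by linarith
  then show ?thesis
  proof cases
    case 1
    then have "face T i (us @ y # vs) = face T i us @ y # vs" for y
      by (simp add: face_def nth_append)
    then show ?thesis using mod_hom_ident by blast
  next
    case 2
    then obtain us' u where us: "us = us' @ [u]" by (cases us rule: rev_cases) auto
    have "face T i (us @ y # vs) = us' @ (u \<otimes>\<^bsub>T\<^esub> y) # vs" for y
      using 2 by (simp add: us face_def nth_append)
    moreover have "mult T u \<in> mod_hom K T T"
      using xs us by (intro bilin_homs(2)[OF mult_bilin[OF T]]) auto
    ultimately show ?thesis by blast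
  next
    case 3
    then obtain v vs' where vs: "vs = v # vs'" using xs i by (cases vs) auto
    have "face T i (us @ y # vs) = us @ (y \<otimes>\<^bsub>T\<^esub> v) # vs'" for y
      using 3 by (simp add: vs face_def nth_append)
    moreover have "(\<lambda>y. y \<otimes>\<^bsub>T\<^esub> v) \<in> mod_hom K T T"
      using xs vs by (intro bilin_homs(1)[OF mult_bilin[OF T]]) auto
    ultimately show ?thesis by blast
  next
    case 4
    then obtain j where j: "i = length us + Suc j" using less_imp_Suc_add by fastforce
    have "face T i (us @ y # vs) = us @ y # face T j vs" for y
      by (simp add: j face_def nth_append eval_nat_numeral)
    then show ?thesis using mod_hom_ident by blast
  qed
qed

lemma face_multilin:
  "i \<le> n \<Longrightarrow> multilin K T (n + 2) (tpow K T (n + 1)) (\<lambda>xs. tpow_pure K T (face T i xs))"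
  by (rule multilin_pure[OF T.module_axioms T.module_axioms face_closed face_slot])

lemma ksign_closed: "ksign K i \<in> carrier K"
  by simp

lemma bar_sum_multilin:
  "multilin K T (n + 2) (tpow K T (n + 1))
     (\<lambda>xs. \<Oplus>\<^bsub>tpow K T (n + 1)\<^esub>i\<in>{0..n}. ksign K i \<odot>\<^bsub>tpow K T (n + 1)\<^esub> tpow_pure K T (face T i xs))"
  by (intro multilin_sum multilin_scale face_multilin tpow_module T.module_axioms ksign_closed) auto

lemma bar_sum_hom: "bar_face_sum K T n \<in> mod_hom K (tpow K T (n + 2)) (tpow K T (n + 1))"
  unfolding bar_face_sum_def by (rule tpow_lift_hom[OF T.module_axioms tpow_module[OF T.module_axioms] bar_sum_multilin])

lemma bar_sum_pure:
  "xs \<in> tlists T (n + 2) \<Longrightarrow> bar_face_sum K T n (tpow_pure K T xs) =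
     (\<Oplus>\<^bsub>tpow K T (n + 1)\<^esub>i\<in>{0..n}. ksign K i \<odot>\<^bsub>tpow K T (n + 1)\<^esub> tpow_pure K T (face T i xs))"
  unfolding bar_face_sum_def by (rule tpow_lift_pure[OF T.module_axioms tpow_module[OF T.module_axioms] bar_sum_multilin])

lemma lmul_closed: "a \<in> carrier T \<Longrightarrow> xs \<in> tlists T (Suc m) \<Longrightarrow> lmul T a xs \<in> tlists T (Suc m)"
  by (auto simp: tlists_Suc lmul_def)

lemma rmul_closed: "a \<in> carrier T \<Longrightarrow> xs \<in> tlists T (Suc m) \<Longrightarrow> rmul T xs a \<in> tlists T (Suc m)"
  unfolding tlists_Suc_snoc rmul_def by auto

lemma lmul_multilin:
  assumes a: "a \<in> carrier T"
  shows "multilin K T (Suc m) (tpow K T (Suc m)) (\<lambda>xs. tpow_pure K T (lmul T a xs))"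
proof (rule multilin_pure[OF T.module_axioms T.module_axioms lmul_closed[OF a]])
  fix us x vs assume t: "us @ x # vs \<in> tlists T (Suc m)"
  show "\<exists>us' vs' \<phi>. \<phi> \<in> mod_hom K T T \<and> (\<forall>y\<in>carrier T. lmul T a (us @ y # vs) = us' @ \<phi> y # vs')"
  proof (cases us)
    case Nil
    then have "lmul T a (us @ y # vs) = [] @ (a \<otimes>\<^bsub>T\<^esub> y) # vs" for y by (simp add: lmul_def)
    then show ?thesis using bilin_homs(2)[OF mult_bilin[OF T] a] by blast
  next
    case (Cons u us')
    then have "lmul T a (us @ y # vs) = ((a \<otimes>\<^bsub>T\<^esub> u) # us') @ y # vs" for y by (simp add: lmul_def)
    then show ?thesis using mod_hom_ident by blast
  qed
qed

lemma rmul_multilin: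
  assumes a: "a \<in> carrier T"
  shows "multilin K T (Suc m) (tpow K T (Suc m)) (\<lambda>xs. tpow_pure K T (rmul T xs a))"
proof (rule multilin_pure[OF T.module_axioms T.module_axioms rmul_closed[OF a]])
  fix us x vs assume t: "us @ x # vs \<in> tlists T (Suc m)"
  show "\<exists>us' vs' \<phi>. \<phi> \<in> mod_hom K T T \<and> (\<forall>y\<in>carrier T. rmul T (us @ y # vs) a = us' @ \<phi> y # vs')"
  proof (cases vs rule: rev_cases)
    case Nil
    then have "rmul T (us @ y # vs) a = us @ (y \<otimes>\<^bsub>T\<^esub> a) # []" for y by (simp add: rmul_def)
    then show ?thesis using bilin_homs(1)[OF mult_bilin[OF T] a] by blast
  next
    case (snoc vs' v)
    then have "rmul T (us @ y # vs) a = us @ y # (vs' @ [v \<otimes>\<^bsub>T\<^esub> a])" for y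
      by (simp add: rmul_def butlast_append)
    then show ?thesis using mod_hom_ident by blast
  qed
qed

lemma tpow_lact_eq: "tpow_lact K T m a = lift K (tpow K T m) (\<lambda>xs. tpow_pure K T (lmul T a xs))"
  by (simp add: tpow_lact_def lmul_def)

lemma tpow_ract_eq: "tpow_ract K T m x a = lift K (tpow K T m) (\<lambda>xs. tpow_pure K T (rmul T xs a)) x"
  by (simp add: tpow_ract_def rmul_def)

lemma tpow_lact_pure:
  "a \<in> carrier T \<Longrightarrow> xs \<in> tlists T (Suc m) \<Longrightarrow>
    tpow_lact K T (Suc m) a (tpow_pure K T xs) = tpow_pure K T (lmul T a xs)"
  unfolding tpow_lact_eq by (rule tpow_lift_pure[OF T.module_axioms tpow_module[OF T.module_axioms] lmul_multilin])

lemma tpow_ract_pure: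
  "a \<in> carrier T \<Longrightarrow> xs \<in> tlists T (Suc m) \<Longrightarrow>
    tpow_ract K T (Suc m) (tpow_pure K T xs) a = tpow_pure K T (rmul T xs a)"
  unfolding tpow_ract_eq by (rule tpow_lift_pure[OF T.module_axioms tpow_module[OF T.module_axioms] rmul_multilin])

lemma tpow_lact_bilin: "bilin K T (tpow K T (Suc m)) (tpow K T (Suc m)) (tpow_lact K T (Suc m))"
proof -
  have "bilin K (tpow K T (Suc m)) T (tpow K T (Suc m)) (\<lambda>u a. tpow_lact K T (Suc m) a u)"
    unfolding tpow_lact_eq
  proof (rule tpow_lift_param[OF T.module_axioms tpow_module[OF T.module_axioms] T.module_axioms lmul_multilin])
    fix xs assume "xs \<in> tlists T (Suc m)"
    then obtain y ys where xs: "xs = y # ys" "y \<in> carrier T" "ys \<in> tlists T m" by (auto simp: tlists_Suc)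
    then have t: "[] @ y # ys \<in> tlists T (Suc m)" by (simp add: tlists_def)
    show "(\<lambda>a. tpow_pure K T (lmul T a xs)) \<in> mod_hom K T (tpow K T (Suc m))"
      using mod_hom_comp[OF bilin_homs(1)[OF mult_bilin[OF T] xs(2)] multilin_slot[OF tpow_pure_multilin[OF T.module_axioms] t]]
      by (simp add: lmul_def xs)
  qed
  then show ?thesis by (rule bilin_flip)
qed

lemma tpow_ract_bilin: "bilin K (tpow K T (Suc m)) T (tpow K T (Suc m)) (tpow_ract K T (Suc m))"
  unfolding tpow_ract_eq
proof (rule tpow_lift_param[OF T.module_axioms tpow_module[OF T.module_axioms] T.module_axioms rmul_multilin])
  fix xs assume "xs \<in> tlists T (Suc m)"
  then obtain y ys where xs: "xs = ys @ [y]" "y \<in> carrier T" "ys \<in> tlists T m" by (auto simp: tlists_Suc_snoc)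
  then have t: "ys @ y # [] \<in> tlists T (Suc m)" by (simp add: tlists_def)
  show "(\<lambda>a. tpow_pure K T (rmul T xs a)) \<in> mod_hom K T (tpow K T (Suc m))"
    using mod_hom_comp[OF bilin_homs(2)[OF mult_bilin[OF T] xs(2)] multilin_slot[OF tpow_pure_multilin[OF T.module_axioms] t]]
    by (simp add: rmul_def xs)
qed

lemma face_lmul:
  assumes "i \<le> n" "xs \<in> tlists T (n + 2)" "a \<in> carrier T"
  shows "face T i (lmul T a xs) = lmul T a (face T i xs)"
proof -
  obtain x y ys where xs: "xs = x # y # ys" "x \<in> carrier T" "y \<in> carrier T"
    using assms(2) by (auto simp: tlists_Suc)
  show ?thesis using assms xs by (cases i) (auto simp: face_def lmul_def T.A.m_assoc)
qed

lemma face_rmul: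
  assumes "i \<le> n" "xs \<in> tlists T (n + 2)" "a \<in> carrier T"
  shows "face T i (rmul T xs a) = rmul T (face T i xs) a"
proof -
  obtain x y ys where xs: "xs = ys @ [x, y]" "x \<in> carrier T" "y \<in> carrier T" "length ys = n"
  proof -
    have "xs \<in> tlists T (Suc (Suc n))" using assms(2) by simp
    then obtain y ys where y: "xs = ys @ [y]" "y \<in> carrier T" "ys \<in> tlists T (Suc n)"
      unfolding tlists_Suc_snoc[of xs] by blast
    then obtain x zs where "ys = zs @ [x]" "x \<in> carrier T" "zs \<in> tlists T n"
      unfolding tlists_Suc_snoc[of ys] by blast
    then show ?thesis using y that[of zs x y] by (simp add: tlists_def)
  qed
  show ?thesis
  proof (cases "i = n")
    case True
    then show ?thesis using assms xs by (simp add: face_def rmul_def T.A.m_assoc nth_append butlast_append)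
  next
    case False
    then show ?thesis using assms xs
      by (cases "Suc i = n") (auto simp: face_def rmul_def nth_append butlast_append)
  qed
qed

text \<open>Left multiplication changes the first slot only and therefore commutes with every face, with the face
  \<open>0\<close> by associativity.\<close>

lemma bar_sum_lact:
  assumes a: "a \<in> carrier T" and z: "z \<in> carrier (tpow K T (n + 2))"
  shows "bar_face_sum K T n (tpow_lact K T (n + 2) a z) = tpow_lact K T (n + 1) a (bar_face_sum K T n z)"
proof (rule tpow_hom_eq[OF T.module_axioms tpow_module[OF T.module_axioms] _ _ _ z])
  interpret P: module K "tpow K T (n + 1)" by (rule tpow_module[OF T.module_axioms])
  have l: "tpow_lact K T (Suc m) a \<in> mod_hom K (tpow K T (Suc m)) (tpow K T (Suc m))" for m
    by (rule bilin_homs(2)[OF tpow_lact_bilin a])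
  show "(\<lambda>z. bar_face_sum K T n (tpow_lact K T (n + 2) a z)) \<in> mod_hom K (tpow K T (n + 2)) (tpow K T (n + 1))"
    using mod_hom_comp[OF l[of "Suc n"]] bar_sum_hom[of n] by simp
  show "(\<lambda>z. tpow_lact K T (n + 1) a (bar_face_sum K T n z)) \<in> mod_hom K (tpow K T (n + 2)) (tpow K T (n + 1))"
    using mod_hom_comp[OF bar_sum_hom] l[of n] by simp
  fix xs assume xs: "xs \<in> tlists T (n + 2)"
  have fc: "i \<in> {0..n} \<Longrightarrow> tpow_pure K T (face T i xs) \<in> carrier (tpow K T (n + 1))" for i
    by (rule tpow_pure_closed[OF T.module_axioms face_closed[OF _ xs]]) simp
  have fc': "i \<in> {0..n} \<Longrightarrow> tpow_pure K T (lmul T a (face T i xs)) \<in> carrier (tpow K T (n + 1))" for i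
    using lmul_closed[OF a, of _ n] face_closed[OF _ xs] by (intro tpow_pure_closed[OF T.module_axioms]) simp
  have "tpow_lact K T (n + 1) a (bar_face_sum K T n (tpow_pure K T xs)) =
      (\<Oplus>\<^bsub>tpow K T (n + 1)\<^esub>i\<in>{0..n}. tpow_lact K T (n + 1) a (ksign K i \<odot>\<^bsub>tpow K T (n + 1)\<^esub> tpow_pure K T (face T i xs)))"
    unfolding bar_sum_pure[OF xs]
    by (rule mod_hom_finsum) (use l[of n] fc P.abelian_group_axioms P.smult_closed in auto)
  also have "\<dots> = (\<Oplus>\<^bsub>tpow K T (n + 1)\<^esub>i\<in>{0..n}. ksign K i \<odot>\<^bsub>tpow K T (n + 1)\<^esub> tpow_pure K T (face T i (lmul T a xs)))"
  proof (rule P.finsum_cong')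
    fix i assume i: "i \<in> {0..n}"
    show "tpow_lact K T (n + 1) a (ksign K i \<odot>\<^bsub>tpow K T (n + 1)\<^esub> tpow_pure K T (face T i xs)) =
        ksign K i \<odot>\<^bsub>tpow K T (n + 1)\<^esub> tpow_pure K T (face T i (lmul T a xs))"
      using i mod_hom_smult[OF l[of n], of "ksign K i" "tpow_pure K T (face T i xs)"] fc[OF i]
        tpow_lact_pure[OF a, of "face T i xs" n] face_closed[OF _ xs, of i] face_lmul[OF _ xs a, of i]
      by simp
  qed (use fc' face_lmul[OF _ xs a] P.smult_closed in auto)
  also have "\<dots> = bar_face_sum K T n (tpow_lact K T (n + 2) a (tpow_pure K T xs))"
    using bar_sum_pure[of "lmul T a xs" n] lmul_closed[OF a, of xs "n + 1"] tpow_lact_pure[OF a, of xs "n + 1"] xs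
    by simp
  finally show "bar_face_sum K T n (tpow_lact K T (n + 2) a (tpow_pure K T xs)) =
    tpow_lact K T (n + 1) a (bar_face_sum K T n (tpow_pure K T xs))" ..
qed

lemma bar_sum_ract:
  assumes a: "a \<in> carrier T" and z: "z \<in> carrier (tpow K T (n + 2))"
  shows "bar_face_sum K T n (tpow_ract K T (n + 2) z a) = tpow_ract K T (n + 1) (bar_face_sum K T n z) a"
proof (rule tpow_hom_eq[OF T.module_axioms tpow_module[OF T.module_axioms] _ _ _ z])
  interpret P: module K "tpow K T (n + 1)" by (rule tpow_module[OF T.module_axioms])
  have l: "(\<lambda>z. tpow_ract K T (Suc m) z a) \<in> mod_hom K (tpow K T (Suc m)) (tpow K T (Suc m))" for m
    by (rule bilin_homs(1)[OF tpow_ract_bilin a])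
  show "(\<lambda>z. bar_face_sum K T n (tpow_ract K T (n + 2) z a)) \<in> mod_hom K (tpow K T (n + 2)) (tpow K T (n + 1))"
    using mod_hom_comp[OF l[of "Suc n"]] bar_sum_hom[of n] by simp
  show "(\<lambda>z. tpow_ract K T (n + 1) (bar_face_sum K T n z) a) \<in> mod_hom K (tpow K T (n + 2)) (tpow K T (n + 1))"
    using mod_hom_comp[OF bar_sum_hom] l[of n] by simp
  fix xs assume xs: "xs \<in> tlists T (n + 2)"
  have fc: "i \<in> {0..n} \<Longrightarrow> tpow_pure K T (face T i xs) \<in> carrier (tpow K T (n + 1))" for i
    by (rule tpow_pure_closed[OF T.module_axioms face_closed[OF _ xs]]) simp
  have fc': "i \<in> {0..n} \<Longrightarrow> tpow_pure K T (rmul T (face T i xs) a) \<in> carrier (tpow K T (n + 1))" for i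
    using rmul_closed[OF a, of _ n] face_closed[OF _ xs] by (intro tpow_pure_closed[OF T.module_axioms]) simp
  have "tpow_ract K T (n + 1) (bar_face_sum K T n (tpow_pure K T xs)) a =
      (\<Oplus>\<^bsub>tpow K T (n + 1)\<^esub>i\<in>{0..n}. tpow_ract K T (n + 1) (ksign K i \<odot>\<^bsub>tpow K T (n + 1)\<^esub> tpow_pure K T (face T i xs)) a)"
    unfolding bar_sum_pure[OF xs]
    by (rule mod_hom_finsum) (use l[of n] fc P.abelian_group_axioms P.smult_closed in auto)
  also have "\<dots> = (\<Oplus>\<^bsub>tpow K T (n + 1)\<^esub>i\<in>{0..n}. ksign K i \<odot>\<^bsub>tpow K T (n + 1)\<^esub> tpow_pure K T (face T i (rmul T xs a)))"
  proof (rule P.finsum_cong')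
    fix i assume i: "i \<in> {0..n}"
    show "tpow_ract K T (n + 1) (ksign K i \<odot>\<^bsub>tpow K T (n + 1)\<^esub> tpow_pure K T (face T i xs)) a =
        ksign K i \<odot>\<^bsub>tpow K T (n + 1)\<^esub> tpow_pure K T (face T i (rmul T xs a))"
      using i mod_hom_smult[OF l[of n], of "ksign K i" "tpow_pure K T (face T i xs)"] fc[OF i]
        tpow_ract_pure[OF a, of "face T i xs" n] face_closed[OF _ xs, of i] face_rmul[OF _ xs a, of i]
      by simp
  qed (use fc' face_rmul[OF _ xs a] P.smult_closed in auto)
  also have "\<dots> = bar_face_sum K T n (tpow_ract K T (n + 2) (tpow_pure K T xs) a)"
    using bar_sum_pure[of "rmul T xs a" n] rmul_closed[OF a, of xs "n + 1"] tpow_ract_pure[OF a, of xs "n + 1"] xs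
    by simp
  finally show "bar_face_sum K T n (tpow_ract K T (n + 2) (tpow_pure K T xs) a) =
    tpow_ract K T (n + 1) (bar_face_sum K T n (tpow_pure K T xs)) a" ..
qed

end

lemma nat_plus_2: "nat (int n + 2) = Suc (Suc n)" "nat (int n - 1 + 2) = Suc n" "nat (1 + int n) = Suc n"
  by simp_all

context
  fixes K :: "('k, 'r) ring_scheme" and T :: "('k, 'a) module"
  assumes T: "k_algebra K T"
begin

interpretation T: k_algebra K T by (rule T)

lemma unit_cons_multilin:
  "multilin K T m (tpow K T (Suc m)) (\<lambda>xs. tpow_pure K T (\<one>\<^bsub>T\<^esub> # xs))"
proof (rule multilin_pure[OF T.module_axioms T.module_axioms])
  fix us x vs
  have "\<one>\<^bsub>T\<^esub> # (us @ y # vs) = (\<one>\<^bsub>T\<^esub> # us) @ y # vs" for y by simp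
  then show "\<exists>us' vs' \<phi>. \<phi> \<in> mod_hom K T T \<and> (\<forall>y\<in>carrier T. \<one>\<^bsub>T\<^esub> # us @ y # vs = us' @ \<phi> y # vs')"
    using mod_hom_ident by blast
qed (auto simp: tlists_def)

lemma unit_cons_hom: "unit_cons K T m \<in> mod_hom K (tpow K T m) (tpow K T (Suc m))"
  unfolding unit_cons_def by (rule tpow_lift_hom[OF T.module_axioms tpow_module[OF T.module_axioms] unit_cons_multilin])

lemma unit_cons_pure: "xs \<in> tlists T m \<Longrightarrow> unit_cons K T m (tpow_pure K T xs) = tpow_pure K T (\<one>\<^bsub>T\<^esub> # xs)"
  unfolding unit_cons_def by (rule tpow_lift_pure[OF T.module_axioms tpow_module[OF T.module_axioms] unit_cons_multilin])

lemma bar_sum_hom': "bar_face_sum K T n \<in> mod_hom K (tpow K T (Suc (Suc n))) (tpow K T (Suc n))"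
  using bar_sum_hom[OF T, of n] by simp

lemma bar_unit_cons_0:
  assumes z: "z \<in> carrier (tpow K T 1)"
  shows "bar_face_sum K T 0 (unit_cons K T 1 z) = z"
proof (rule tpow_hom_eq[OF T.module_axioms tpow_module[OF T.module_axioms] _ mod_hom_ident _ z])
  interpret P: module K "tpow K T (Suc 0)" by (rule tpow_module[OF T.module_axioms])
  show "(\<lambda>z. bar_face_sum K T 0 (unit_cons K T 1 z)) \<in> mod_hom K (tpow K T 1) (tpow K T 1)"
    using mod_hom_comp[OF unit_cons_hom[of 1]] bar_sum_hom[OF T, of 0] by (simp add: numeral_2_eq_2)
  fix xs assume xs: "xs \<in> tlists T 1"
  then obtain x where x: "xs = [x]" "x \<in> carrier T" by (auto simp: tlists_def length_Suc_conv)
  have "tpow_pure K T [x] \<in> carrier (tpow K T 1)" using xs x by (intro tpow_pure_closed[OF T.module_axioms]) simp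
  moreover have "[\<one>\<^bsub>T\<^esub>, x] \<in> tlists T (0 + 2)" using x by (simp add: tlists_def)
  ultimately show "bar_face_sum K T 0 (unit_cons K T 1 (tpow_pure K T xs)) = tpow_pure K T xs"
    using x bar_sum_pure[OF T, of "[\<one>\<^bsub>T\<^esub>, x]" 0] unit_cons_pure[OF xs]
    by (simp add: face_def)
qed

text \<open>Prepending the unit is a contracting homotopy \<open>h\<close> of the augmented bar complex: face \<open>0\<close> of
  \<open>1 # xs\<close> is \<open>xs\<close>, and face \<open>i + 1\<close> of it is \<open>1\<close> prepended to face \<open>i\<close> of \<open>xs\<close> with the opposite sign,
  so \<open>d h + h d = 1\<close>.\<close>

lemma bar_unit_cons:
  assumes z: "z \<in> carrier (tpow K T (Suc (Suc n)))"
  shows "bar_face_sum K T (Suc n) (unit_cons K T (Suc (Suc n)) z) \<oplus>\<^bsub>tpow K T (Suc (Suc n))\<^esub>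
    unit_cons K T (Suc n) (bar_face_sum K T n z) = z"
proof (rule tpow_hom_eq[OF T.module_axioms tpow_module[OF T.module_axioms] mod_hom_plus[OF tpow_module[OF T.module_axioms]] mod_hom_ident _ z])
  interpret P: module K "tpow K T (Suc (Suc n))" by (rule tpow_module[OF T.module_axioms])
  interpret Q: module K "tpow K T (Suc n)" by (rule tpow_module[OF T.module_axioms])
  show "(\<lambda>z. bar_face_sum K T (Suc n) (unit_cons K T (Suc (Suc n)) z))
      \<in> mod_hom K (tpow K T (Suc (Suc n))) (tpow K T (Suc (Suc n)))"
    by (rule mod_hom_comp[OF unit_cons_hom bar_sum_hom'])
  show "(\<lambda>z. unit_cons K T (Suc n) (bar_face_sum K T n z))
      \<in> mod_hom K (tpow K T (Suc (Suc n))) (tpow K T (Suc (Suc n)))"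
    by (rule mod_hom_comp[OF bar_sum_hom' unit_cons_hom])
  fix xs assume xs: "xs \<in> tlists T (Suc (Suc n))"
  then obtain x ys where x: "xs = x # ys" "x \<in> carrier T" by (auto simp: tlists_Suc)
  let ?P = "tpow K T (Suc (Suc n))" and ?Q = "tpow K T (Suc n)"
  have xs1: "\<one>\<^bsub>T\<^esub> # xs \<in> tlists T (Suc n + 2)" using xs by (simp add: tlists_def)
  have fc: "tpow_pure K T (face T i xs) \<in> carrier ?Q" if "i \<in> {0..n}" for i
    using face_closed[OF T, of i n xs] that xs by (intro tpow_pure_closed[OF T.module_axioms]) simp
  have ft: "face T i xs \<in> tlists T (Suc n)" if "i \<in> {0..n}" for i
    using face_closed[OF T, of i n xs] that xs by simp
  have uc: "unit_cons K T (Suc n) (tpow_pure K T (face T i xs)) = tpow_pure K T (\<one>\<^bsub>T\<^esub> # face T i xs)"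
    if "i \<in> {0..n}" for i by (rule unit_cons_pure[OF ft[OF that]])
  have ucc: "tpow_pure K T (\<one>\<^bsub>T\<^esub> # face T i xs) \<in> carrier ?P" if "i \<in> {0..n}" for i
    using ft[OF that] by (intro tpow_pure_closed[OF T.module_axioms]) (auto simp: tlists_def)
  have px: "tpow_pure K T xs \<in> carrier ?P" by (rule tpow_pure_closed[OF T.module_axioms xs])
  have f0: "face T 0 (\<one>\<^bsub>T\<^esub> # xs) = xs" using x by (simp add: face_def)
  have fS: "face T (Suc i) (\<one>\<^bsub>T\<^esub> # xs) = \<one>\<^bsub>T\<^esub> # face T i xs" for i by (simp add: face_def)
  define g where "g i = ksign K i \<odot>\<^bsub>?P\<^esub> tpow_pure K T (face T i (\<one>\<^bsub>T\<^esub> # xs))" for i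
  have gS: "g (Suc i) = \<ominus>\<^bsub>?P\<^esub> (ksign K i \<odot>\<^bsub>?P\<^esub> tpow_pure K T (\<one>\<^bsub>T\<^esub> # face T i xs))" if "i \<in> {0..n}" for i
    using ucc[OF that] by (simp add: g_def fS P.smult_l_minus T.R.r_minus)
  have gc: "g i \<in> carrier ?P" if "i \<in> {0..Suc n}" for i
    using that ucc px by (cases i) (auto simp: g_def f0 fS)
  have "bar_face_sum K T (Suc n) (unit_cons K T (Suc (Suc n)) (tpow_pure K T xs)) = (\<Oplus>\<^bsub>?P\<^esub>i\<in>{..Suc n}. g i)"
    using bar_sum_pure[OF T xs1] by (simp add: unit_cons_pure[OF xs] g_def atLeast0AtMost)
  also have "\<dots> = (\<Oplus>\<^bsub>?P\<^esub>i\<in>{..n}. g (Suc i)) \<oplus>\<^bsub>?P\<^esub> g 0"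
    by (rule P.finsum_Suc2) (use gc in auto)
  also have "g 0 = tpow_pure K T xs" using px by (simp add: g_def f0)
  finally have 1: "bar_face_sum K T (Suc n) (unit_cons K T (Suc (Suc n)) (tpow_pure K T xs)) =
    (\<Oplus>\<^bsub>?P\<^esub>i\<in>{..n}. g (Suc i)) \<oplus>\<^bsub>?P\<^esub> tpow_pure K T xs" .
  have "unit_cons K T (Suc n) (bar_face_sum K T n (tpow_pure K T xs)) =
      unit_cons K T (Suc n) (\<Oplus>\<^bsub>?Q\<^esub>i\<in>{..n}. ksign K i \<odot>\<^bsub>?Q\<^esub> tpow_pure K T (face T i xs))"
    using bar_sum_pure[OF T, of xs n] xs by (simp add: atLeast0AtMost)
  also have "\<dots> = (\<Oplus>\<^bsub>?P\<^esub>i\<in>{..n}. unit_cons K T (Suc n) (ksign K i \<odot>\<^bsub>?Q\<^esub> tpow_pure K T (face T i xs)))"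
    by (rule mod_hom_finsum[OF unit_cons_hom Q.abelian_group_axioms P.abelian_group_axioms]) (use fc in auto)
  also have "\<dots> = (\<Oplus>\<^bsub>?P\<^esub>i\<in>{..n}. ksign K i \<odot>\<^bsub>?P\<^esub> tpow_pure K T (\<one>\<^bsub>T\<^esub> # face T i xs))"
    by (rule P.finsum_cong') (use fc uc ucc in \<open>auto simp: mod_hom_smult[OF unit_cons_hom]\<close>)
  finally have 2: "unit_cons K T (Suc n) (bar_face_sum K T n (tpow_pure K T xs)) =
    (\<Oplus>\<^bsub>?P\<^esub>i\<in>{..n}. ksign K i \<odot>\<^bsub>?P\<^esub> tpow_pure K T (\<one>\<^bsub>T\<^esub> # face T i xs))" .
  have "(\<Oplus>\<^bsub>?P\<^esub>i\<in>{..n}. g (Suc i)) \<oplus>\<^bsub>?P\<^esub> (\<Oplus>\<^bsub>?P\<^esub>i\<in>{..n}. ksign K i \<odot>\<^bsub>?P\<^esub> tpow_pure K T (\<one>\<^bsub>T\<^esub> # face T i xs)) =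
      (\<Oplus>\<^bsub>?P\<^esub>i\<in>{..n}. g (Suc i) \<oplus>\<^bsub>?P\<^esub> ksign K i \<odot>\<^bsub>?P\<^esub> tpow_pure K T (\<one>\<^bsub>T\<^esub> # face T i xs))"
    by (rule P.finsum_addf[symmetric]) (use gc ucc in auto)
  also have "\<dots> = (\<Oplus>\<^bsub>?P\<^esub>i\<in>{..n}. \<zero>\<^bsub>?P\<^esub>)"
    by (rule P.finsum_cong') (use ucc in \<open>auto simp: gS P.l_neg\<close>)
  finally have 3: "(\<Oplus>\<^bsub>?P\<^esub>i\<in>{..n}. g (Suc i)) \<oplus>\<^bsub>?P\<^esub>
      (\<Oplus>\<^bsub>?P\<^esub>i\<in>{..n}. ksign K i \<odot>\<^bsub>?P\<^esub> tpow_pure K T (\<one>\<^bsub>T\<^esub> # face T i xs)) = \<zero>\<^bsub>?P\<^esub>" by simp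
  have c1: "(\<Oplus>\<^bsub>?P\<^esub>i\<in>{..n}. g (Suc i)) \<in> carrier ?P" using gc by (intro P.finsum_closed) auto
  have c2: "(\<Oplus>\<^bsub>?P\<^esub>i\<in>{..n}. ksign K i \<odot>\<^bsub>?P\<^esub> tpow_pure K T (\<one>\<^bsub>T\<^esub> # face T i xs)) \<in> carrier ?P"
    using ucc by (intro P.finsum_closed) auto
  show "bar_face_sum K T (Suc n) (unit_cons K T (Suc (Suc n)) (tpow_pure K T xs)) \<oplus>\<^bsub>?P\<^esub>
      unit_cons K T (Suc n) (bar_face_sum K T n (tpow_pure K T xs)) = tpow_pure K T xs"
    unfolding 1 2 using 3 c1 c2 px by (simp add: P.a_ac)
qed

text \<open>Every pure tensor is \<open>x \<cdot> h w\<close> with \<open>h\<close> the insertion of a unit, and \<open>d\<close> is linear over the left action,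
  so \<open>d d = 0\<close> need only be checked on the image of \<open>h\<close>. There \<open>d d h w = d (w - h d w)\<close>, which vanishes
  as soon as \<open>d h d = d\<close>. This avoids the double sum over pairs of faces.\<close>

lemma bar_sum_sum_step:
  assumes h: "\<And>w. w \<in> carrier (tpow K T (Suc (Suc n))) \<Longrightarrow>
      bar_face_sum K T n (unit_cons K T (Suc n) (bar_face_sum K T n w)) = bar_face_sum K T n w"
    and z: "z \<in> carrier (tpow K T (Suc (Suc (Suc n))))"
  shows "bar_face_sum K T n (bar_face_sum K T (Suc n) z) = \<zero>\<^bsub>tpow K T (Suc n)\<^esub>"
proof (rule tpow_hom_eq[OF T.module_axioms tpow_module[OF T.module_axioms] mod_hom_comp[OF bar_sum_hom' bar_sum_hom']
      mod_hom_const_zero[OF tpow_module[OF T.module_axioms]] _ z])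
  interpret P: module K "tpow K T (Suc n)" by (rule tpow_module[OF T.module_axioms])
  interpret Q: module K "tpow K T (Suc (Suc n))" by (rule tpow_module[OF T.module_axioms])
  fix xs assume xs: "xs \<in> tlists T (Suc (Suc (Suc n)))"
  then obtain x ys where x: "xs = x # ys" "x \<in> carrier T" "ys \<in> tlists T (Suc (Suc n))"
    by (auto simp: tlists_Suc[of xs])
  let ?w = "tpow_pure K T ys" and ?L = "\<lambda>m. tpow_lact K T (Suc m) x"
  let ?hw = "unit_cons K T (Suc (Suc n)) ?w"
  have w: "?w \<in> carrier (tpow K T (Suc (Suc n)))" by (rule tpow_pure_closed[OF T.module_axioms x(3)])
  have hw: "?hw \<in> carrier (tpow K T (Suc (Suc (Suc n))))" by (rule mod_hom_closed[OF unit_cons_hom w])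
  have dhw: "bar_face_sum K T (Suc n) ?hw \<in> carrier (tpow K T (Suc (Suc n)))"
    by (rule mod_hom_closed[OF bar_sum_hom' hw])
  have hdw: "unit_cons K T (Suc n) (bar_face_sum K T n ?w) \<in> carrier (tpow K T (Suc (Suc n)))"
    by (rule mod_hom_closed[OF unit_cons_hom mod_hom_closed[OF bar_sum_hom' w]])
  have "\<one>\<^bsub>T\<^esub> # ys \<in> tlists T (Suc (Suc (Suc n)))" using x by (simp add: tlists_def)
  then have e: "tpow_pure K T xs = ?L (Suc (Suc n)) ?hw"
    using tpow_lact_pure[OF T x(2), of "\<one>\<^bsub>T\<^esub> # ys" "Suc (Suc n)"] x
    by (simp add: unit_cons_pure lmul_def)
  have "bar_face_sum K T n (bar_face_sum K T (Suc n) ?hw) \<oplus>\<^bsub>tpow K T (Suc n)\<^esub> bar_face_sum K T n ?w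
      = bar_face_sum K T n (bar_face_sum K T (Suc n) ?hw \<oplus>\<^bsub>tpow K T (Suc (Suc n))\<^esub> unit_cons K T (Suc n) (bar_face_sum K T n ?w))"
    by (subst mod_hom_add[OF bar_sum_hom' dhw hdw]) (simp add: h[OF w])
  also have "\<dots> = bar_face_sum K T n ?w" by (simp add: bar_unit_cons[OF w])
  finally have z: "bar_face_sum K T n (bar_face_sum K T (Suc n) ?hw) = \<zero>\<^bsub>tpow K T (Suc n)\<^esub>"
    using mod_hom_closed[OF bar_sum_hom' dhw] mod_hom_closed[OF bar_sum_hom' w]
    by (metis P.add.r_cancel_one)
  have "bar_face_sum K T n (bar_face_sum K T (Suc n) (tpow_pure K T xs)) =
      ?L n (bar_face_sum K T n (bar_face_sum K T (Suc n) ?hw))"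
    unfolding e using bar_sum_lact[OF T x(2), of ?hw "Suc n"] bar_sum_lact[OF T x(2), of _ n] hw dhw by simp
  also have "\<dots> = \<zero>\<^bsub>tpow K T (Suc n)\<^esub>"
    unfolding z by (rule mod_hom_zero[OF bilin_homs(2)[OF tpow_lact_bilin[OF T] x(2)]
        P.abelian_group_axioms P.abelian_group_axioms])
  finally show "bar_face_sum K T n (bar_face_sum K T (Suc n) (tpow_pure K T xs)) = \<zero>\<^bsub>tpow K T (Suc n)\<^esub>" .
qed

text \<open>The identity \<open>d h d = d\<close> asked for by the previous lemma follows in turn from \<open>d d = 0\<close> one degree
  lower.\<close>

lemma bar_sum_sum:
  "z \<in> carrier (tpow K T (Suc (Suc (Suc n)))) \<Longrightarrow>
    bar_face_sum K T n (bar_face_sum K T (Suc n) z) = \<zero>\<^bsub>tpow K T (Suc n)\<^esub>"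
proof (induction n arbitrary: z)
  case 0
  then show ?case
  proof (intro bar_sum_sum_step)
    fix w assume "w \<in> carrier (tpow K T (Suc (Suc 0)))"
    then have "bar_face_sum K T 0 w \<in> carrier (tpow K T 1)"
      using mod_hom_closed[OF bar_sum_hom'[of 0]] by simp
    then show "bar_face_sum K T 0 (unit_cons K T (Suc 0) (bar_face_sum K T 0 w)) = bar_face_sum K T 0 w"
      using bar_unit_cons_0 by simp
  qed
next
  case (Suc n)
  show ?case
  proof (rule bar_sum_sum_step[OF _ Suc.prems])
    fix w assume w: "w \<in> carrier (tpow K T (Suc (Suc (Suc n))))"
    interpret P: module K "tpow K T (Suc n)" by (rule tpow_module[OF T.module_axioms])
    interpret Q: module K "tpow K T (Suc (Suc n))" by (rule tpow_module[OF T.module_axioms])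
    let ?u = "bar_face_sum K T (Suc n) w"
    have u: "?u \<in> carrier (tpow K T (Suc (Suc n)))" by (rule mod_hom_closed[OF bar_sum_hom' w])
    have "bar_face_sum K T n ?u = \<zero>\<^bsub>tpow K T (Suc n)\<^esub>" by (rule Suc.IH[OF w])
    then have "unit_cons K T (Suc n) (bar_face_sum K T n ?u) = \<zero>\<^bsub>tpow K T (Suc (Suc n))\<^esub>"
      using mod_hom_zero[OF unit_cons_hom P.abelian_group_axioms Q.abelian_group_axioms] by simp
    then show "bar_face_sum K T (Suc n) (unit_cons K T (Suc (Suc n)) ?u) = ?u"
      using bar_unit_cons[OF u] mod_hom_closed[OF bar_sum_hom' mod_hom_closed[OF unit_cons_hom u]]
      by simp
  qed
qed

end

section \<open>Cochain complexes of homomorphisms\<close>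

definition cochain :: "('k, 'r) ring_scheme \<Rightarrow> ('k, 'x) cochain_complex \<Rightarrow> bool" where
  "cochain K X \<longleftrightarrow> (\<forall>n. module K (obj X n) \<and> diff X n \<in> mod_hom K (obj X n) (obj X (n + 1)) \<and>
     (\<forall>x\<in>carrier (obj X n). diff X (n + 1) (diff X n x) = \<zero>\<^bsub>obj X (n + 1 + 1)\<^esub>))"

definition chain_map ::
  "('k, 'r) ring_scheme \<Rightarrow> ('k, 'x) cochain_complex \<Rightarrow> ('k, 'y) cochain_complex \<Rightarrow> (int \<Rightarrow> 'x \<Rightarrow> 'y) \<Rightarrow> bool"
  where "chain_map K X Y f \<longleftrightarrow> (\<forall>n. f n \<in> mod_hom K (obj X n) (obj Y n) \<and>
     (\<forall>x\<in>carrier (obj X n). f (n + 1) (diff X n x) = diff Y n (f n x)))"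

lemma cochainD:
  assumes "cochain K X"
  shows "module K (obj X n)" "diff X n \<in> mod_hom K (obj X n) (obj X (n + 1))"
    "x \<in> carrier (obj X n) \<Longrightarrow> diff X (n + 1) (diff X n x) = \<zero>\<^bsub>obj X (n + 1 + 1)\<^esub>"
  using assms by (auto simp: cochain_def)

lemma chain_mapD:
  assumes "chain_map K X Y f"
  shows "f n \<in> mod_hom K (obj X n) (obj Y n)"
    "x \<in> carrier (obj X n) \<Longrightarrow> f (n + 1) (diff X n x) = diff Y n (f n x)"
  using assms by (auto simp: chain_map_def)

text \<open>Stability of the carrier under the action is what keeps an equivariant map equivariant when it is
  cut off outside the carrier. The terms of the bar and of the triangular complex, including the zero
  terms in negative degrees, are treated uniformly in this form.\<close>

definition operates :: "('k, 't) module \<Rightarrow> ('t, 'x) module \<Rightarrow> bool" where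
  "operates T X \<longleftrightarrow> abelian_group X \<and> (\<forall>t\<in>carrier T. \<forall>x\<in>carrier X. t \<odot>\<^bsub>X\<^esub> x \<in> carrier X)"

lemma restrict_mod_hom:
  assumes "operates T X" "f \<in> mod_hom T X Y"
  shows "restrict f (carrier X) \<in> mod_hom T X Y"
proof -
  interpret X: abelian_group X using assms by (simp add: operates_def)
  show ?thesis using assms by (auto simp: mod_hom_def operates_def)
qed

lemma hom_cx_simps:
  "obj (hom_cx T C d Y) n = hom_mod T (C n) Y"
  "diff (hom_cx T C d Y) n f = (\<lambda>x\<in>carrier (C (n + 1)). f (d (n + 1) x))"
  by (simp_all add: hom_cx_def)

lemma hom_cx_cochain:
  assumes K: "cring K" and T: "central_unit K T" and Y: "left_module T Y"
    and C: "\<And>n. operates T (C n)" and d: "\<And>n. d (n + 1) \<in> mod_hom T (C (n + 1)) (C n)"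
    and dd: "\<And>n x. x \<in> carrier (C (n + 1 + 1)) \<Longrightarrow> d (n + 1) (d (n + 1 + 1) x) = \<zero>\<^bsub>C n\<^esub>"
  shows "cochain K (hom_cx T C d Y)"
  unfolding cochain_def
proof (intro allI conjI ballI)
  fix n :: int
  interpret Y: left_module T Y by fact
  have ab: "abelian_group (C n)" for n using C by (simp add: operates_def)
  show "module K (obj (hom_cx T C d Y) n)"
    unfolding hom_cx_simps using C[of n] by (intro hom_mod_module K T Y) (auto simp: operates_def)
  show "diff (hom_cx T C d Y) n \<in> mod_hom K (obj (hom_cx T C d Y) n) (obj (hom_cx T C d Y) (n + 1))"
  proof (rule mod_homI)
    fix f assume f: "f \<in> carrier (obj (hom_cx T C d Y) n)"
    have "(\<lambda>x. f (d (n + 1) x)) \<in> mod_hom T (C (n + 1)) Y"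
      using f by (intro mod_hom_comp[OF d]) (simp add: hom_cx_simps)
    then show "diff (hom_cx T C d Y) n f \<in> carrier (obj (hom_cx T C d Y) (n + 1))"
      using restrict_mod_hom[OF C] by (simp add: hom_cx_simps)
  qed (auto simp: hom_cx_simps mod_hom_closed[OF d])
  fix f assume f: "f \<in> carrier (obj (hom_cx T C d Y) n)"
  have "f \<zero>\<^bsub>C n\<^esub> = \<zero>\<^bsub>Y\<^esub>"
    using f by (intro mod_hom_zero[where T = T, OF _ ab Y.abelian_group_axioms]) (simp add: hom_cx_simps)
  note z = this
  show "diff (hom_cx T C d Y) (n + 1) (diff (hom_cx T C d Y) n f) = \<zero>\<^bsub>obj (hom_cx T C d Y) (n + 1 + 1)\<^esub>"
    unfolding hom_cx_simps hom_mod_simps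
  proof (rule restrict_ext)
    fix x assume x: "x \<in> carrier (C (n + 1 + 1))"
    show "(\<lambda>x\<in>carrier (C (n + 1)). f (d (n + 1) x)) (d (n + 1 + 1) x) = \<zero>\<^bsub>Y\<^esub>"
      unfolding restrict_apply'[OF mod_hom_closed[OF d x]] dd[OF x] by (rule z)
  qed
qed

lemma hom_cx_postcomp:
  assumes C: "\<And>n. operates T (C n)" and d: "\<And>n. d (n + 1) \<in> mod_hom T (C (n + 1)) (C n)"
    and u: "u \<in> mod_hom T Y Z" and T: "central_unit K T" and Y: "left_module T Y"
  shows "chain_map K (hom_cx T C d Y) (hom_cx T C d Z) (\<lambda>n f. \<lambda>c\<in>carrier (C n). u (f c))"
  unfolding chain_map_def hom_cx_simps
proof (intro allI conjI ballI)
  fix n :: int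
  interpret Y: left_module T Y by fact
  interpret T: module K T using T by (simp add: central_unit_def)
  show "(\<lambda>f. \<lambda>c\<in>carrier (C n). u (f c)) \<in> mod_hom K (hom_mod T (C n) Y) (hom_mod T (C n) Z)"
  proof (rule mod_homI)
    fix f assume f: "f \<in> carrier (hom_mod T (C n) Y)"
    have "(\<lambda>c. u (f c)) \<in> mod_hom T (C n) Z"
      using f by (intro mod_hom_comp[OF _ u]) simp
    then show "(\<lambda>c\<in>carrier (C n). u (f c)) \<in> carrier (hom_mod T (C n) Z)"
      using restrict_mod_hom[OF C] by simp
  next
    fix f g assume "f \<in> carrier (hom_mod T (C n) Y)" "g \<in> carrier (hom_mod T (C n) Y)"
    then show "(\<lambda>c\<in>carrier (C n). u ((f \<oplus>\<^bsub>hom_mod T (C n) Y\<^esub> g) c)) =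
      (\<lambda>c\<in>carrier (C n). u (f c)) \<oplus>\<^bsub>hom_mod T (C n) Z\<^esub> (\<lambda>c\<in>carrier (C n). u (g c))"
      by (auto simp: fun_eq_iff mod_hom_add[OF u] mod_hom_closed)
  next
    fix k f assume "k \<in> carrier K" "f \<in> carrier (hom_mod T (C n) Y)"
    then show "(\<lambda>c\<in>carrier (C n). u ((k \<odot>\<^bsub>hom_mod T (C n) Y\<^esub> f) c)) =
      k \<odot>\<^bsub>hom_mod T (C n) Z\<^esub> (\<lambda>c\<in>carrier (C n). u (f c))"
      using T by (auto simp: fun_eq_iff mod_hom_smult[OF u] mod_hom_closed central_unit_def)
  qed
qed (auto simp: fun_eq_iff mod_hom_closed[OF d])

section \<open>The bar complex as a complex of bimodules\<close>

lemma int_ge_m1_cases: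
  assumes "-1 \<le> (p::int)" obtains n :: nat where "p = int n - 1" "p + 1 = int n" "nat (p + 2) = Suc n"
    "nat (p + 1 + 2) = Suc (Suc n)" "nat (p + 1 + 1 + 2) = Suc (Suc (Suc n))" "p + 1 + 1 = int (Suc n)"
    "nat (p + 1) = n"
proof -
  have "p = int (nat (p + 1)) - 1" using assms by simp
  then show ?thesis using assms that[of "nat (p + 1)"] by simp
qed

context
  fixes K :: "('k, 'r) ring_scheme" and T :: "('k, 'a) module"
  assumes T: "k_algebra K T"
begin

interpretation T: k_algebra K T by (rule T)

lemma bar_aug_module: "module K (bar_aug K T p)"
  unfolding bar_aug_def by (rule tpow_module[OF T.module_axioms])

lemma bar_aug_d_hom:
  assumes "-1 \<le> p" shows "bar_aug_d K T (p + 1) \<in> mod_hom K (bar_aug K T (p + 1)) (bar_aug K T p)"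
proof -
  obtain n where n: "p + 1 = int n" "nat (p + 2) = Suc n" "nat (p + 1 + 2) = Suc (Suc n)"
    using assms by (rule int_ge_m1_cases)
  show ?thesis using bar_sum_hom'[OF T, of n]
    unfolding bar_aug_def n(2,3) unfolding n(1) bar_aug_d_eq .
qed

lemma bar_aug_d_d:
  assumes "-1 \<le> p" "z \<in> carrier (bar_aug K T (p + 1 + 1))"
  shows "bar_aug_d K T (p + 1) (bar_aug_d K T (p + 1 + 1) z) = \<zero>\<^bsub>bar_aug K T p\<^esub>"
proof -
  obtain n where n: "p + 1 = int n" "nat (p + 2) = Suc n" "nat (p + 1 + 1 + 2) = Suc (Suc (Suc n))"
    "p + 1 + 1 = int (Suc n)" using assms(1) by (rule int_ge_m1_cases)
  show ?thesis using assms(2) bar_sum_sum[OF T, of z n]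
    unfolding bar_aug_def n(2,3) unfolding n(4) unfolding n(1) bar_aug_d_eq by blast
qed

lemma bar_aug_lact_bilin:
  assumes "-1 \<le> p" shows "bilin K T (bar_aug K T p) (bar_aug K T p) (tpow_lact K T (nat (p + 2)))"
proof -
  obtain n where n: "nat (p + 2) = Suc n" using assms by (rule int_ge_m1_cases)
  show ?thesis unfolding bar_aug_def n by (rule tpow_lact_bilin[OF T])
qed

lemma bar_aug_ract_bilin:
  assumes "-1 \<le> p" shows "bilin K (bar_aug K T p) T (bar_aug K T p) (tpow_ract K T (nat (p + 2)))"
proof -
  obtain n where n: "nat (p + 2) = Suc n" using assms by (rule int_ge_m1_cases)
  show ?thesis unfolding bar_aug_def n by (rule tpow_ract_bilin[OF T])
qed

lemma bar_aug_d_lact: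
  assumes "-1 \<le> p" "a \<in> carrier T" "z \<in> carrier (bar_aug K T (p + 1))"
  shows "bar_aug_d K T (p + 1) (tpow_lact K T (nat (p + 1 + 2)) a z) =
    tpow_lact K T (nat (p + 2)) a (bar_aug_d K T (p + 1) z)"
proof -
  obtain n where n: "p + 1 = int n" "nat (p + 2) = Suc n" "nat (p + 1 + 2) = Suc (Suc n)"
    using assms(1) by (rule int_ge_m1_cases)
  show ?thesis using assms(3) bar_sum_lact[OF T assms(2), of z n]
    unfolding bar_aug_def n(2,3) unfolding n(1) bar_aug_d_eq by simp
qed

lemma bar_aug_d_ract:
  assumes "-1 \<le> p" "a \<in> carrier T" "z \<in> carrier (bar_aug K T (p + 1))"
  shows "bar_aug_d K T (p + 1) (tpow_ract K T (nat (p + 1 + 2)) z a) =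
    tpow_ract K T (nat (p + 2)) (bar_aug_d K T (p + 1) z) a"
proof -
  obtain n where n: "p + 1 = int n" "nat (p + 2) = Suc n" "nat (p + 1 + 2) = Suc (Suc n)"
    using assms(1) by (rule int_ge_m1_cases)
  show ?thesis using assms(3) bar_sum_ract[OF T assms(2), of z n]
    unfolding bar_aug_def n(2,3) unfolding n(1) bar_aug_d_eq by simp
qed

lemma tpow_lact_ract:
  assumes "a \<in> carrier T" "b \<in> carrier T" "z \<in> carrier (tpow K T (Suc m))"
  shows "tpow_lact K T (Suc m) a (tpow_ract K T (Suc m) z b) =
    tpow_ract K T (Suc m) (tpow_lact K T (Suc m) a z) b"
proof (rule tpow_hom_eq[OF T.module_axioms tpow_module[OF T.module_axioms]
    mod_hom_comp[OF bilin_homs(1)[OF tpow_ract_bilin[OF T] assms(2)] bilin_homs(2)[OF tpow_lact_bilin[OF T] assms(1)]]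
    mod_hom_comp[OF bilin_homs(2)[OF tpow_lact_bilin[OF T] assms(1)] bilin_homs(1)[OF tpow_ract_bilin[OF T] assms(2)]]
    _ assms(3)])
  fix xs assume xs: "xs \<in> tlists T (Suc m)"
  then have "lmul T a (rmul T xs b) = rmul T (lmul T a xs) b"
    using assms(1,2) T.A.m_assoc by (cases xs) (auto simp: lmul_def rmul_def tlists_def)
  then show "tpow_lact K T (Suc m) a (tpow_ract K T (Suc m) (tpow_pure K T xs) b) =
    tpow_ract K T (Suc m) (tpow_lact K T (Suc m) a (tpow_pure K T xs)) b"
    using xs assms(1,2)
    by (simp add: tpow_lact_pure[OF T] tpow_ract_pure[OF T] lmul_closed[OF T] rmul_closed[OF T])
qed

lemma bar_nonneg: 
  "0 \<le> n \<Longrightarrow> bar K T n = bimod K (bar_aug K T n) (tpow_lact K T (nat (n + 2))) (tpow_ract K T (nat (n + 2)))"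
  by (simp add: bar_def)

lemma bar_neg: "n < 0 \<Longrightarrow> bar K T n = zero_mod"
  by (simp add: bar_def)

lemma bar_simps:
  assumes "0 \<le> n"
  shows "carrier (bar K T n) = carrier (bar_aug K T n)" "add (bar K T n) = add (bar_aug K T n)"
    "zero (bar K T n) = zero (bar_aug K T n)"
  using assms by (simp_all add: bar_nonneg bimod_def)

lemma bar_operates: "operates (env_alg K T T) (bar K T n)"
proof (cases "n < 0")
  case True
  then show ?thesis by (simp add: bar_neg operates_def zero_mod_abelian_group)
next
  case False
  then have n: "0 \<le> n" "-1 \<le> n" by auto
  note b = bar_aug_module bar_aug_lact_bilin[OF n(2)] bar_aug_ract_bilin[OF n(2)]
  show ?thesis
    unfolding bar_nonneg[OF n(1)] operates_def
    using bimod_abelian_group[OF T T b] bimod_smult_closed[OF T T b] by (auto simp: bimod_simps[OF T T b])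
qed

lemma bar_pure:
  assumes "0 \<le> n" "a \<in> carrier T" "b \<in> carrier T" "x \<in> carrier (bar_aug K T n)"
  shows "tens_pure K T (op_alg T) a b \<odot>\<^bsub>bar K T n\<^esub> x =
    tpow_ract K T (nat (n + 2)) (tpow_lact K T (nat (n + 2)) a x) b"
proof -
  have n: "-1 \<le> n" using assms by simp
  show ?thesis unfolding bar_nonneg[OF assms(1)]
    by (rule bimod_pure[OF T T bar_aug_module bar_aug_lact_bilin[OF n] bar_aug_ract_bilin[OF n] assms(2-4)])
qed

text \<open>A pure tensor acts on a bar term by multiplying its two outer slots, so equivariance of a map out
  of the bar complex is a statement about these multiplications.\<close>

lemma bar_mod_homI:
  assumes n: "0 \<le> n" and Z: "abelian_group Z"
    and closed: "\<And>x. x \<in> carrier (bar_aug K T n) \<Longrightarrow> f x \<in> carrier Z"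
    and add: "\<And>x y. x \<in> carrier (bar_aug K T n) \<Longrightarrow> y \<in> carrier (bar_aug K T n) \<Longrightarrow>
      f (x \<oplus>\<^bsub>bar_aug K T n\<^esub> y) = f x \<oplus>\<^bsub>Z\<^esub> f y"
    and distr: "\<And>s t z. s \<in> carrier (env_alg K T T) \<Longrightarrow> t \<in> carrier (env_alg K T T) \<Longrightarrow> z \<in> carrier Z \<Longrightarrow>
      (s \<oplus>\<^bsub>env_alg K T T\<^esub> t) \<odot>\<^bsub>Z\<^esub> z = s \<odot>\<^bsub>Z\<^esub> z \<oplus>\<^bsub>Z\<^esub> t \<odot>\<^bsub>Z\<^esub> z"
    and pure: "\<And>a b x. a \<in> carrier T \<Longrightarrow> b \<in> carrier T \<Longrightarrow> x \<in> carrier (bar_aug K T n) \<Longrightarrow>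
      f (tpow_ract K T (nat (n + 2)) (tpow_lact K T (nat (n + 2)) a x) b) = tens_pure K T (op_alg T) a b \<odot>\<^bsub>Z\<^esub> f x"
  shows "f \<in> mod_hom (env_alg K T T) (bar K T n) Z"
proof -
  have n': "-1 \<le> n" using n by simp
  show ?thesis unfolding bar_nonneg[OF n]
    by (rule bimod_mod_homI[OF T T bar_aug_module bar_aug_lact_bilin[OF n'] bar_aug_ract_bilin[OF n'] Z
        closed add distr pure])
qed

lemma bar_d_simps:
  "n < 0 \<Longrightarrow> bar_d K T (n + 1) x = \<zero>\<^bsub>bar K T n\<^esub>" "0 \<le> n \<Longrightarrow> bar_d K T (n + 1) = bar_aug_d K T (n + 1)"
  by (simp_all add: bar_d_def)

lemma bar_d_hom: "bar_d K T (n + 1) \<in> mod_hom (env_alg K T T) (bar K T (n + 1)) (bar K T n)"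
proof (cases "n < 0")
  case True
  then show ?thesis by (intro mod_homI) (auto simp: bar_d_simps bar_neg)
next
  case False
  then have n: "0 \<le> n" "-1 \<le> n" "0 \<le> n + 1" "-1 \<le> n + 1" by auto
  note b = bar_aug_module bar_aug_lact_bilin[OF n(2)] bar_aug_ract_bilin[OF n(2)]
  note b' = bilin_closed[OF bar_aug_lact_bilin[OF n(4)]]
  note d = bar_aug_d_hom[OF n(2)]
  show ?thesis
    unfolding bar_d_simps(2)[OF n(1)]
  proof (rule bar_mod_homI[OF n(3)])
    show "abelian_group (bar K T n)" using bar_operates[of n] by (simp add: operates_def)
    fix s t z assume "s \<in> carrier (env_alg K T T)" "t \<in> carrier (env_alg K T T)" "z \<in> carrier (bar K T n)"
    then show "(s \<oplus>\<^bsub>env_alg K T T\<^esub> t) \<odot>\<^bsub>bar K T n\<^esub> z = s \<odot>\<^bsub>bar K T n\<^esub> z \<oplus>\<^bsub>bar K T n\<^esub> t \<odot>\<^bsub>bar K T n\<^esub> z"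
      unfolding bar_nonneg[OF n(1)]
      by (simp add: bimod_simps[OF T T b] env_alg_simps[OF T T] bilin_rules[OF bimod_bilin[OF T T b]])
  next
    fix a b x assume x: "a \<in> carrier T" "b \<in> carrier T" "x \<in> carrier (bar_aug K T (n + 1))"
    show "bar_aug_d K T (n + 1) (tpow_ract K T (nat (n + 1 + 2)) (tpow_lact K T (nat (n + 1 + 2)) a x) b) =
        tens_pure K T (op_alg T) a b \<odot>\<^bsub>bar K T n\<^esub> bar_aug_d K T (n + 1) x"
      unfolding bar_aug_d_ract[OF n(2) x(2) b'[OF x(1,3)]] bar_aug_d_lact[OF n(2) x(1,3)]
      by (rule bar_pure[OF n(1) x(1,2) mod_hom_closed[OF d x(3)], symmetric])
  qed (auto simp: bar_simps[OF n(1)] mod_hom_closed[OF d] mod_hom_add[OF d])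
qed

lemma bar_d_d:
  assumes "x \<in> carrier (bar K T (n + 1 + 1))"
  shows "bar_d K T (n + 1) (bar_d K T (n + 1 + 1) x) = \<zero>\<^bsub>bar K T n\<^esub>"
proof (cases "n < 0")
  case True
  then show ?thesis by (simp add: bar_d_simps)
next
  case False
  then have n: "0 \<le> n" "-1 \<le> n" "0 \<le> n + 1" "0 \<le> n + 1 + 1" by auto
  show ?thesis
    using assms unfolding bar_d_simps(2)[OF n(1)] bar_d_simps(2)[OF n(3)] bar_simps[OF n(1)] bar_simps[OF n(4)]
    by (rule bar_aug_d_d[OF n(2)])
qed

lemma hoch_cochain:
  assumes "left_module (env_alg K T T) \<Lambda>" shows "cochain K (hoch_cx K T \<Lambda>)"
  unfolding hoch_cx_def
  by (rule hom_cx_cochain[where C = "bar K T" and d = "bar_d K T", OF T.R.cring_axioms env_alg_central[OF T T] assms bar_operates bar_d_hom bar_d_d])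

lemma regular_left_module: "left_module (env_alg K T T) (regular_bimod K T)"
  unfolding regular_bimod_def
  by (rule bimod_left_module[OF T T T.module_axioms mult_bilin[OF T] mult_bilin[OF T]]) (auto simp: T.A.m_assoc)

end

section \<open>Endomorphism bimodules\<close>

lemma mod_hom_op [simp]: "mod_hom K (op_alg T) Y = mod_hom K T Y" "mod_hom K X (op_alg T) = mod_hom K X T"
  by (simp_all add: mod_hom_def)

lemma bilin_op [simp]: "bilin K (op_alg T) X Y = bilin K T X Y" "bilin K X (op_alg T) Y = bilin K X T Y"
  by (simp_all add: bilin_def fun_eq_iff)

text \<open>The setting of both endomorphism bimodules: \<open>P\<close> acts on the \<open>Q\<close>-linear endomorphisms of \<open>N\<close> through its
  own action on \<open>N\<close>. It is used with \<open>P\<close>, \<open>Q\<close> being \<open>A\<close>, \<open>B\<^sup>o\<close> and with the roles exchanged. The last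
  conjunct says that the two \<open>K\<close>-module structures of \<open>N\<close> agree.\<close>

definition commuting_modules ::
  "('k, 'r) ring_scheme \<Rightarrow> ('k, 'p) module \<Rightarrow> ('k, 'q) module \<Rightarrow> ('t, 'm) module \<Rightarrow>
    ('p \<Rightarrow> 'm \<Rightarrow> 'm) \<Rightarrow> ('q \<Rightarrow> 'm \<Rightarrow> 'm) \<Rightarrow> bool" where
  "commuting_modules K P Q N U V \<longleftrightarrow> k_algebra K P \<and> k_algebra K Q \<and>
     left_module P (with_smult N U) \<and> left_module Q (with_smult N V) \<and>
     (\<forall>p\<in>carrier P. \<forall>q\<in>carrier Q. \<forall>m\<in>carrier N. U p (V q m) = V q (U p m)) \<and>
     (\<forall>k\<in>carrier K. \<forall>m\<in>carrier N. U (k \<odot>\<^bsub>P\<^esub> \<one>\<^bsub>P\<^esub>) m = V (k \<odot>\<^bsub>Q\<^esub> \<one>\<^bsub>Q\<^esub>) m)"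

context
  fixes K :: "('k, 'r) ring_scheme" and P :: "('k, 'p) module" and Q :: "('k, 'q) module"
    and N :: "('t, 'm) module" and U :: "'p \<Rightarrow> 'm \<Rightarrow> 'm" and V :: "'q \<Rightarrow> 'm \<Rightarrow> 'm"
  assumes cm: "commuting_modules K P Q N U V"
begin

private lemma
  shows P: "k_algebra K P" and Q: "k_algebra K Q"
    and U: "left_module P (with_smult N U)" and V: "left_module Q (with_smult N V)"
    and UV: "\<And>p q m. p \<in> carrier P \<Longrightarrow> q \<in> carrier Q \<Longrightarrow> m \<in> carrier N \<Longrightarrow> U p (V q m) = V q (U p m)"
    and k: "\<And>k m. k \<in> carrier K \<Longrightarrow> m \<in> carrier N \<Longrightarrow> U (k \<odot>\<^bsub>P\<^esub> \<one>\<^bsub>P\<^esub>) m = V (k \<odot>\<^bsub>Q\<^esub> \<one>\<^bsub>Q\<^esub>) m"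
  using cm by (simp_all add: commuting_modules_def)

interpretation P: k_algebra K P by (rule P)
interpretation Q: k_algebra K Q by (rule Q)
interpretation U: left_module P "with_smult N U" by (rule U)
interpretation V: left_module Q "with_smult N V" by (rule V)

private abbreviation "E \<equiv> hom_mod Q (with_smult N V) (with_smult N V)"

private lemmas Us = U.smult_closed[simplified] U.smult_l_distr[simplified] U.smult_r_distr[simplified]
  U.smult_assoc[simplified] U.smult_one[simplified]
private lemmas Vs = V.smult_closed[simplified] V.smult_l_distr[simplified] V.smult_r_distr[simplified]
  V.smult_assoc[simplified] V.smult_one[simplified]

lemma End_module: "module K E"
  using Vs by (intro hom_mod_module P.R.cring_axioms k_algebra_central Q V V.abelian_group_axioms) simp

private lemma N_closed: "x \<in> carrier N \<Longrightarrow> y \<in> carrier N \<Longrightarrow> x \<oplus>\<^bsub>N\<^esub> y \<in> carrier N"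
  using U.a_closed by simp

private lemma E_rules:
  assumes "f \<in> carrier E"
  shows "m \<in> carrier N \<Longrightarrow> f m \<in> carrier N"
    "m \<in> carrier N \<Longrightarrow> m' \<in> carrier N \<Longrightarrow> f (m \<oplus>\<^bsub>N\<^esub> m') = f m \<oplus>\<^bsub>N\<^esub> f m'"
    "q \<in> carrier Q \<Longrightarrow> m \<in> carrier N \<Longrightarrow> f (V q m) = V q (f m)"
  using assms by (auto simp: mod_hom_def)

private lemma E_I:
  assumes "f \<in> extensional (carrier N)" "\<And>m. m \<in> carrier N \<Longrightarrow> f m \<in> carrier N"
    "\<And>m m'. m \<in> carrier N \<Longrightarrow> m' \<in> carrier N \<Longrightarrow> f (m \<oplus>\<^bsub>N\<^esub> m') = f m \<oplus>\<^bsub>N\<^esub> f m'"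
    "\<And>q m. q \<in> carrier Q \<Longrightarrow> m \<in> carrier N \<Longrightarrow> f (V q m) = V q (f m)"
  shows "f \<in> carrier E"
  using assms by (auto simp: mod_hom_def)

private lemma U_k: "k \<in> carrier K \<Longrightarrow> p \<in> carrier P \<Longrightarrow> m \<in> carrier N \<Longrightarrow>
    U (k \<odot>\<^bsub>P\<^esub> p) m = V (k \<odot>\<^bsub>Q\<^esub> \<one>\<^bsub>Q\<^esub>) (U p m)"
proof -
  assume a: "k \<in> carrier K" "p \<in> carrier P" "m \<in> carrier N"
  then have "U (k \<odot>\<^bsub>P\<^esub> p) m = U ((k \<odot>\<^bsub>P\<^esub> \<one>\<^bsub>P\<^esub>) \<otimes>\<^bsub>P\<^esub> p) m" by (simp add: P.smult_mult_left)
  also have "\<dots> = U (k \<odot>\<^bsub>P\<^esub> \<one>\<^bsub>P\<^esub>) (U p m)" using a by (simp add: Us)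
  finally show ?thesis using a by (simp add: k Us)
qed

lemma End_post_closed:
  "p \<in> carrier P \<Longrightarrow> f \<in> carrier E \<Longrightarrow> (\<lambda>m\<in>carrier N. U p (f m)) \<in> carrier E"
  by (rule E_I) (simp_all add: E_rules Us Vs N_closed UV)

lemma End_pre_closed:
  "p \<in> carrier P \<Longrightarrow> f \<in> carrier E \<Longrightarrow> (\<lambda>m\<in>carrier N. f (U p m)) \<in> carrier E"
  by (rule E_I) (simp_all add: E_rules Us Vs N_closed UV)

lemma End_unit_closed: "p \<in> carrier P \<Longrightarrow> (\<lambda>m\<in>carrier N. U p m) \<in> carrier E"
  by (rule E_I) (simp_all add: E_rules Us Vs N_closed UV)

lemma End_post_bilin: "bilin K P E E (\<lambda>p f. \<lambda>m\<in>carrier N. U p (f m))"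
proof (intro bilinI mod_homI)
  fix p p' f assume a: "p \<in> carrier P" "p' \<in> carrier P" "f \<in> carrier E"
  show "(\<lambda>m\<in>carrier N. U (p \<oplus>\<^bsub>P\<^esub> p') (f m)) = (\<lambda>m\<in>carrier N. U p (f m)) \<oplus>\<^bsub>E\<^esub> (\<lambda>m\<in>carrier N. U p' (f m))"
    unfolding hom_mod_simps with_smult_simps by (rule restrict_ext) (use a in \<open>simp add: E_rules(1)[OF a(3)] Us\<close>)
next
  fix p k f assume a: "k \<in> carrier K" "p \<in> carrier P" "f \<in> carrier E"
  show "(\<lambda>m\<in>carrier N. U (k \<odot>\<^bsub>P\<^esub> p) (f m)) = k \<odot>\<^bsub>E\<^esub> (\<lambda>m\<in>carrier N. U p (f m))"
    unfolding hom_mod_simps with_smult_simps by (rule restrict_ext) (use a in \<open>simp add: E_rules(1)[OF a(3)] U_k\<close>)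
next
  fix p f g assume a: "p \<in> carrier P" "f \<in> carrier E" "g \<in> carrier E"
  show "(\<lambda>m\<in>carrier N. U p ((f \<oplus>\<^bsub>E\<^esub> g) m)) = (\<lambda>m\<in>carrier N. U p (f m)) \<oplus>\<^bsub>E\<^esub> (\<lambda>m\<in>carrier N. U p (g m))"
    unfolding hom_mod_simps with_smult_simps by (rule restrict_ext) (use a in \<open>simp add: E_rules(1)[OF a(2)] E_rules(1)[OF a(3)] Us\<close>)
next
  fix p k f assume a: "k \<in> carrier K" "p \<in> carrier P" "f \<in> carrier E"
  show "(\<lambda>m\<in>carrier N. U p ((k \<odot>\<^bsub>E\<^esub> f) m)) = k \<odot>\<^bsub>E\<^esub> (\<lambda>m\<in>carrier N. U p (f m))"
    unfolding hom_mod_simps with_smult_simps by (rule restrict_ext) (use a in \<open>simp add: E_rules(1)[OF a(3)] UV\<close>)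
qed (rule End_post_closed; assumption)+

lemma End_pre_bilin: "bilin K P E E (\<lambda>p f. \<lambda>m\<in>carrier N. f (U p m))"
proof (intro bilinI mod_homI)
  fix p p' f assume a: "p \<in> carrier P" "p' \<in> carrier P" "f \<in> carrier E"
  show "(\<lambda>m\<in>carrier N. f (U (p \<oplus>\<^bsub>P\<^esub> p') m)) = (\<lambda>m\<in>carrier N. f (U p m)) \<oplus>\<^bsub>E\<^esub> (\<lambda>m\<in>carrier N. f (U p' m))"
    unfolding hom_mod_simps with_smult_simps by (rule restrict_ext) (use a in \<open>simp add: E_rules(2)[OF a(3)] Us\<close>)
next
  fix p k f assume a: "k \<in> carrier K" "p \<in> carrier P" "f \<in> carrier E"
  show "(\<lambda>m\<in>carrier N. f (U (k \<odot>\<^bsub>P\<^esub> p) m)) = k \<odot>\<^bsub>E\<^esub> (\<lambda>m\<in>carrier N. f (U p m))"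
    unfolding hom_mod_simps with_smult_simps by (rule restrict_ext) (use a in \<open>simp add: E_rules(3)[OF a(3)] Us U_k\<close>)
next
  fix p f g assume a: "p \<in> carrier P" "f \<in> carrier E" "g \<in> carrier E"
  show "(\<lambda>m\<in>carrier N. (f \<oplus>\<^bsub>E\<^esub> g) (U p m)) = (\<lambda>m\<in>carrier N. f (U p m)) \<oplus>\<^bsub>E\<^esub> (\<lambda>m\<in>carrier N. g (U p m))"
    unfolding hom_mod_simps with_smult_simps by (rule restrict_ext) (use a in \<open>simp add: Us\<close>)
next
  fix p k f assume a: "k \<in> carrier K" "p \<in> carrier P" "f \<in> carrier E"
  show "(\<lambda>m\<in>carrier N. (k \<odot>\<^bsub>E\<^esub> f) (U p m)) = k \<odot>\<^bsub>E\<^esub> (\<lambda>m\<in>carrier N. f (U p m))"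
    unfolding hom_mod_simps with_smult_simps by (rule restrict_ext) (use a in \<open>simp add: Us\<close>)
qed (rule End_pre_closed; assumption)+

lemma End_laws:
  assumes f: "f \<in> carrier E" and p: "p \<in> carrier P" "p' \<in> carrier P"
  shows "(\<lambda>m\<in>carrier N. U (p \<otimes>\<^bsub>P\<^esub> p') (f m)) = (\<lambda>m\<in>carrier N. U p ((\<lambda>m\<in>carrier N. U p' (f m)) m))"
    "(\<lambda>m\<in>carrier N. f (U (p \<otimes>\<^bsub>P\<^esub> p') m)) = (\<lambda>m\<in>carrier N. (\<lambda>m\<in>carrier N. f (U p m)) (U p' m))"
    "(\<lambda>m\<in>carrier N. (\<lambda>m\<in>carrier N. U p (f m)) (U p' m)) = (\<lambda>m\<in>carrier N. U p ((\<lambda>m\<in>carrier N. f (U p' m)) m))"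
proof -
  show "(\<lambda>m\<in>carrier N. U (p \<otimes>\<^bsub>P\<^esub> p') (f m)) = (\<lambda>m\<in>carrier N. U p ((\<lambda>m\<in>carrier N. U p' (f m)) m))"
    by (rule restrict_ext) (use p in \<open>simp add: E_rules(1)[OF f] Us\<close>)
  show "(\<lambda>m\<in>carrier N. f (U (p \<otimes>\<^bsub>P\<^esub> p') m)) = (\<lambda>m\<in>carrier N. (\<lambda>m\<in>carrier N. f (U p m)) (U p' m))"
    by (rule restrict_ext) (use p in \<open>simp add: Us\<close>)
  show "(\<lambda>m\<in>carrier N. (\<lambda>m\<in>carrier N. U p (f m)) (U p' m)) = (\<lambda>m\<in>carrier N. U p ((\<lambda>m\<in>carrier N. f (U p' m)) m))"
    by (rule restrict_ext) (use p in \<open>simp add: Us\<close>)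
qed

lemma End_unit_laws:
  assumes f: "f \<in> carrier E"
  shows "(\<lambda>m\<in>carrier N. U \<one>\<^bsub>P\<^esub> (f m)) = f" "(\<lambda>m\<in>carrier N. f (U \<one>\<^bsub>P\<^esub> m)) = f"
proof -
  have e: "f \<in> extensional (carrier N)" using f by simp
  show "(\<lambda>m\<in>carrier N. U \<one>\<^bsub>P\<^esub> (f m)) = f" "(\<lambda>m\<in>carrier N. f (U \<one>\<^bsub>P\<^esub> m)) = f"
    by (rule extensionalityI[OF restrict_extensional e]; simp add: E_rules(1)[OF f] Us)+
qed

end

section \<open>The two one-sided structures of a bimodule\<close>

lemma res_simps:
  "res_A K A B M = with_smult M (smult (res_A K A B M))"
  "res_Bo K A B M = with_smult M (smult (res_Bo K A B M))"
  "a \<odot>\<^bsub>res_A K A B M\<^esub> m = tens_pure K A (op_alg B) a \<one>\<^bsub>B\<^esub> \<odot>\<^bsub>M\<^esub> m"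
  "b \<odot>\<^bsub>res_Bo K A B M\<^esub> m = tens_pure K A (op_alg B) \<one>\<^bsub>A\<^esub> b \<odot>\<^bsub>M\<^esub> m"
  by (simp_all add: res_A_def res_Bo_def)

context
  fixes K :: "('k, 'r) ring_scheme" and A :: "('k, 'a) module" and B :: "('k, 'b) module"
    and M :: "(('a \<times> 'b \<Rightarrow> 'k) set, 'm) module"
  assumes A: "k_algebra K A" and B: "k_algebra K B" and M: "left_module (env_alg K A B) M"
begin

interpretation A: k_algebra K A by (rule A)
interpretation B: k_algebra K B by (rule B)
interpretation O: k_algebra K "op_alg B" by (rule k_algebra_op[OF B])
interpretation M: left_module "env_alg K A B" M by (rule M)

private lemmas mAB = A.module_axioms O.module_axioms
private abbreviation "pu \<equiv> tens_pure K A (op_alg B)"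

lemma env_pure_closed: "a \<in> carrier A \<Longrightarrow> b \<in> carrier B \<Longrightarrow> pu a b \<in> carrier (env_alg K A B)"
  using tens_pure_closed[OF mAB] by (simp add: env_alg_simps[OF A B])

lemma env_pure_mult:
  assumes "a \<in> carrier A" "a' \<in> carrier A" "b \<in> carrier B" "b' \<in> carrier B" "m \<in> carrier M"
  shows "pu a b \<odot>\<^bsub>M\<^esub> (pu a' b' \<odot>\<^bsub>M\<^esub> m) = pu (a \<otimes>\<^bsub>A\<^esub> a') (b' \<otimes>\<^bsub>B\<^esub> b) \<odot>\<^bsub>M\<^esub> m"
  using assms tens_alg_mult_pure[OF A k_algebra_op[OF B], folded env_alg_def]
  by (simp add: M.smult_assoc[symmetric] env_pure_closed)

private lemma pu_rules:
  "a \<in> carrier A \<Longrightarrow> a' \<in> carrier A \<Longrightarrow> b \<in> carrier B \<Longrightarrow> pu (a \<oplus>\<^bsub>A\<^esub> a') b = pu a b \<oplus>\<^bsub>env_alg K A B\<^esub> pu a' b"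
  "a \<in> carrier A \<Longrightarrow> b \<in> carrier B \<Longrightarrow> b' \<in> carrier B \<Longrightarrow> pu a (b \<oplus>\<^bsub>B\<^esub> b') = pu a b \<oplus>\<^bsub>env_alg K A B\<^esub> pu a b'"
  "k \<in> carrier K \<Longrightarrow> a \<in> carrier A \<Longrightarrow> b \<in> carrier B \<Longrightarrow> pu (k \<odot>\<^bsub>A\<^esub> a) b = k \<odot>\<^bsub>env_alg K A B\<^esub> pu a b"
  "k \<in> carrier K \<Longrightarrow> a \<in> carrier A \<Longrightarrow> b \<in> carrier B \<Longrightarrow> pu a (k \<odot>\<^bsub>B\<^esub> b) = k \<odot>\<^bsub>env_alg K A B\<^esub> pu a b"
  using bilin_rules[OF tens_pure_bilin[OF mAB]] by (simp_all add: env_alg_simps[OF A B])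

lemma res_A_left_module: "left_module A (res_A K A B M)"
  unfolding res_A_def
  by (intro left_module.intro left_module_axioms.intro abelian_group_cong[OF M.abelian_group_axioms])
     (simp_all add: M.smult_closed env_pure_closed pu_rules M.smult_l_distr M.smult_r_distr env_pure_mult
       M.smult_one[unfolded env_alg_simps[OF A B]])

lemma res_Bo_left_module: "left_module (op_alg B) (res_Bo K A B M)"
  unfolding res_Bo_def
  by (intro left_module.intro left_module_axioms.intro abelian_group_cong[OF M.abelian_group_axioms])
     (simp_all add: M.smult_closed env_pure_closed pu_rules M.smult_l_distr M.smult_r_distr env_pure_mult
       M.smult_one[unfolded env_alg_simps[OF A B]])

lemma res_commute:
  "a \<in> carrier A \<Longrightarrow> b \<in> carrier B \<Longrightarrow> m \<in> carrier M \<Longrightarrow>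
    a \<odot>\<^bsub>res_A K A B M\<^esub> (b \<odot>\<^bsub>res_Bo K A B M\<^esub> m) = b \<odot>\<^bsub>res_Bo K A B M\<^esub> (a \<odot>\<^bsub>res_A K A B M\<^esub> m)"
  by (simp add: res_simps(3,4) env_pure_mult)

lemma res_k:
  "k \<in> carrier K \<Longrightarrow> m \<in> carrier M \<Longrightarrow>
    (k \<odot>\<^bsub>A\<^esub> \<one>\<^bsub>A\<^esub>) \<odot>\<^bsub>res_A K A B M\<^esub> m = (k \<odot>\<^bsub>B\<^esub> \<one>\<^bsub>B\<^esub>) \<odot>\<^bsub>res_Bo K A B M\<^esub> m"
  by (simp add: res_simps(3,4) pu_rules)

lemma res_k_env:
  "k \<in> carrier K \<Longrightarrow> (k \<odot>\<^bsub>A\<^esub> \<one>\<^bsub>A\<^esub>) \<odot>\<^bsub>res_A K A B M\<^esub> m = (k \<odot>\<^bsub>env_alg K A B\<^esub> \<one>\<^bsub>env_alg K A B\<^esub>) \<odot>\<^bsub>M\<^esub> m"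
  "k \<in> carrier K \<Longrightarrow> (k \<odot>\<^bsub>B\<^esub> \<one>\<^bsub>B\<^esub>) \<odot>\<^bsub>res_Bo K A B M\<^esub> m = (k \<odot>\<^bsub>env_alg K A B\<^esub> \<one>\<^bsub>env_alg K A B\<^esub>) \<odot>\<^bsub>M\<^esub> m"
  by (simp_all add: res_simps(3,4) pu_rules) (simp_all add: env_alg_simps[OF A B])

lemma res_left_modules:
  "left_module A (with_smult M (smult (res_A K A B M)))"
  "left_module (op_alg B) (with_smult M (smult (res_Bo K A B M)))"
  using res_A_left_module res_Bo_left_module by (simp_all add: res_simps(1,2)[symmetric])

text \<open>The actions of \<open>a \<otimes> 1\<close> and \<open>1 \<otimes> b\<close> commute since both products are \<open>a \<otimes> b\<close>.\<close>

lemma res_commuting: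
  "commuting_modules K A (op_alg B) M (smult (res_A K A B M)) (smult (res_Bo K A B M))"
  "commuting_modules K (op_alg B) A M (smult (res_Bo K A B M)) (smult (res_A K A B M))"
  using A k_algebra_op[OF B] res_left_modules
  by (simp_all add: commuting_modules_def res_commute res_k)

private lemmas Bo_ctx = res_commuting(1)
private lemmas A_ctx = res_commuting(2)

private abbreviation "EBo \<equiv> hom_mod (op_alg B) (res_Bo K A B M) (res_Bo K A B M)"
private abbreviation "EA \<equiv> hom_mod A (res_A K A B M) (res_A K A B M)"

lemmas End_Bo_facts =
  End_module[OF Bo_ctx, folded res_simps(1,2)]
  End_post_bilin[OF Bo_ctx, folded res_simps(1,2)]
  End_pre_bilin[OF Bo_ctx, folded res_simps(1,2), THEN bilin_flip]

lemmas End_A_facts =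
  End_module[OF A_ctx, folded res_simps(1,2)]
  End_pre_bilin[OF A_ctx, folded res_simps(1,2), simplified bilin_op]
  End_post_bilin[OF A_ctx, folded res_simps(1,2), THEN bilin_flip, simplified bilin_op]

lemma End_Bo_left_module: "left_module (env_alg K A A) (End_Bo K A B M)"
  unfolding End_Bo_def
  by (rule bimod_left_module[OF A A End_Bo_facts]; rule End_laws[OF Bo_ctx, folded res_simps(1,2)] End_unit_laws[OF Bo_ctx, folded res_simps(1,2)]; assumption)

lemma End_A_left_module: "left_module (env_alg K B B) (End_A K A B M)"
  unfolding End_A_def
proof (rule bimod_left_module[OF B B End_A_facts])
  note laws = End_laws[OF A_ctx, folded res_simps(1,2), simplified op_alg_simps]
  fix f b b' assume f: "f \<in> carrier EA" and b: "b \<in> carrier B" and b': "b' \<in> carrier B"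
  show "(\<lambda>m\<in>carrier M. f ((b \<otimes>\<^bsub>B\<^esub> b') \<odot>\<^bsub>res_Bo K A B M\<^esub> m)) =
      (\<lambda>m\<in>carrier M. (\<lambda>m\<in>carrier M. f (b' \<odot>\<^bsub>res_Bo K A B M\<^esub> m)) (b \<odot>\<^bsub>res_Bo K A B M\<^esub> m))"
    by (rule laws(2)[OF f b' b])
  show "(\<lambda>m\<in>carrier M. (b \<otimes>\<^bsub>B\<^esub> b') \<odot>\<^bsub>res_Bo K A B M\<^esub> f m) =
      (\<lambda>m\<in>carrier M. b' \<odot>\<^bsub>res_Bo K A B M\<^esub> (\<lambda>m\<in>carrier M. b \<odot>\<^bsub>res_Bo K A B M\<^esub> f m) m)"
    by (rule laws(1)[OF f b' b])
  show "(\<lambda>m\<in>carrier M. b' \<odot>\<^bsub>res_Bo K A B M\<^esub> (\<lambda>m\<in>carrier M. f (b \<odot>\<^bsub>res_Bo K A B M\<^esub> m)) m) =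
      (\<lambda>m\<in>carrier M. (\<lambda>m\<in>carrier M. b' \<odot>\<^bsub>res_Bo K A B M\<^esub> f m) (b \<odot>\<^bsub>res_Bo K A B M\<^esub> m))"
    by (rule laws(3)[OF f b' b, symmetric])
next
  note laws = End_unit_laws[OF A_ctx, folded res_simps(1,2), simplified op_alg_simps]
  fix f assume f: "f \<in> carrier EA"
  show "(\<lambda>m\<in>carrier M. f (\<one>\<^bsub>B\<^esub> \<odot>\<^bsub>res_Bo K A B M\<^esub> m)) = f" by (rule laws(2)[OF f])
  show "(\<lambda>m\<in>carrier M. \<one>\<^bsub>B\<^esub> \<odot>\<^bsub>res_Bo K A B M\<^esub> f m) = f" by (rule laws(1)[OF f])
qed

lemma res_more_simps [simp]:
  "carrier (res_A K A B M) = carrier M" "add (res_A K A B M) = add M" "zero (res_A K A B M) = zero M"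
  "carrier (res_Bo K A B M) = carrier M" "add (res_Bo K A B M) = add M" "zero (res_Bo K A B M) = zero M"
  by (simp_all add: res_A_def res_Bo_def)

text \<open>The structure map of \<open>M\<close> is a homomorphism of bimodules because \<open>a (a' (b m)) = (a a' b) m\<close>.\<close>

lemma alpha_unit_hom:
  "(\<lambda>a. \<lambda>m\<in>carrier M. a \<odot>\<^bsub>res_A K A B M\<^esub> m)
    \<in> mod_hom (env_alg K A A) (regular_bimod K A) (End_Bo K A B M)"
  unfolding regular_bimod_def
proof (rule bimod_mod_homI[OF A A A.module_axioms mult_bilin[OF A] mult_bilin[OF A]])
  interpret L: left_module "env_alg K A A" "End_Bo K A B M" by (rule End_Bo_left_module)
  interpret R: left_module A "res_A K A B M" by (rule res_A_left_module)
  note R' = R.smult_closed[simplified] R.smult_l_distr[simplified] R.smult_assoc[simplified]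
  note c = bimod_simps[OF A A End_Bo_facts]
  note cl = End_unit_closed[OF Bo_ctx, folded res_simps(1,2)]
  show "abelian_group (End_Bo K A B M)" by (rule L.abelian_group_axioms)
  fix x assume x: "x \<in> carrier A"
  show "(\<lambda>m\<in>carrier M. x \<odot>\<^bsub>res_A K A B M\<^esub> m) \<in> carrier (End_Bo K A B M)"
    unfolding End_Bo_def c by (rule cl[OF x])
  { fix y assume y: "y \<in> carrier A"
    show "(\<lambda>m\<in>carrier M. (x \<oplus>\<^bsub>A\<^esub> y) \<odot>\<^bsub>res_A K A B M\<^esub> m) = (\<lambda>m\<in>carrier M. x \<odot>\<^bsub>res_A K A B M\<^esub> m)
        \<oplus>\<^bsub>End_Bo K A B M\<^esub> (\<lambda>m\<in>carrier M. y \<odot>\<^bsub>res_A K A B M\<^esub> m)"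
      unfolding End_Bo_def c hom_mod_simps res_more_simps
      by (rule restrict_ext) (use x y in \<open>simp add: R'\<close>) }
  fix a b assume a: "a \<in> carrier A" and b: "b \<in> carrier A"
  show "(\<lambda>m\<in>carrier M. (a \<otimes>\<^bsub>A\<^esub> x \<otimes>\<^bsub>A\<^esub> b) \<odot>\<^bsub>res_A K A B M\<^esub> m) =
      tens_pure K A (op_alg A) a b \<odot>\<^bsub>End_Bo K A B M\<^esub> (\<lambda>m\<in>carrier M. x \<odot>\<^bsub>res_A K A B M\<^esub> m)"
    unfolding End_Bo_def bimod_pure[OF A A End_Bo_facts a b cl[OF x]]
    by (rule restrict_ext) (use a b x in \<open>simp add: R'\<close>)
qed (auto simp: left_module.smult_l_distr[OF End_Bo_left_module])

text \<open>Right multiplication by \<open>B\<close> reverses products, and so does the bimodule structure chosen on the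
  endomorphisms.\<close>

lemma beta_unit_hom:
  "(\<lambda>b. \<lambda>m\<in>carrier M. b \<odot>\<^bsub>res_Bo K A B M\<^esub> m)
    \<in> mod_hom (env_alg K B B) (regular_bimod K B) (End_A K A B M)"
  unfolding regular_bimod_def
proof (rule bimod_mod_homI[OF B B B.module_axioms mult_bilin[OF B] mult_bilin[OF B]])
  interpret L: left_module "env_alg K B B" "End_A K A B M" by (rule End_A_left_module)
  interpret R: left_module "op_alg B" "res_Bo K A B M" by (rule res_Bo_left_module)
  note R' = R.smult_closed[simplified] R.smult_l_distr[simplified] R.smult_assoc[simplified]
  note c = bimod_simps[OF B B End_A_facts]
  note cl = End_unit_closed[OF A_ctx, folded res_simps(1,2), simplified op_alg_simps]
  show "abelian_group (End_A K A B M)" by (rule L.abelian_group_axioms)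
  fix x assume x: "x \<in> carrier B"
  show "(\<lambda>m\<in>carrier M. x \<odot>\<^bsub>res_Bo K A B M\<^esub> m) \<in> carrier (End_A K A B M)"
    unfolding End_A_def c by (rule cl[OF x])
  { fix y assume y: "y \<in> carrier B"
    show "(\<lambda>m\<in>carrier M. (x \<oplus>\<^bsub>B\<^esub> y) \<odot>\<^bsub>res_Bo K A B M\<^esub> m) = (\<lambda>m\<in>carrier M. x \<odot>\<^bsub>res_Bo K A B M\<^esub> m)
        \<oplus>\<^bsub>End_A K A B M\<^esub> (\<lambda>m\<in>carrier M. y \<odot>\<^bsub>res_Bo K A B M\<^esub> m)"
      unfolding End_A_def c hom_mod_simps res_more_simps
      by (rule restrict_ext) (use x y in \<open>simp add: R'\<close>) }
  fix a b assume a: "a \<in> carrier B" and b: "b \<in> carrier B"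
  show "(\<lambda>m\<in>carrier M. (a \<otimes>\<^bsub>B\<^esub> x \<otimes>\<^bsub>B\<^esub> b) \<odot>\<^bsub>res_Bo K A B M\<^esub> m) =
      tens_pure K B (op_alg B) a b \<odot>\<^bsub>End_A K A B M\<^esub> (\<lambda>m\<in>carrier M. x \<odot>\<^bsub>res_Bo K A B M\<^esub> m)"
    unfolding End_A_def bimod_pure[OF B B End_A_facts a b cl[OF x]]
    by (rule restrict_ext) (use a b x in \<open>simp add: R'\<close>)
qed (auto simp: left_module.smult_l_distr[OF End_A_left_module])

text \<open>A homomorphism of coefficient bimodules induces a map of Hochschild complexes by composition.\<close>

lemma alpha_chain_map:
  "chain_map K (hoch_cx K A (regular_bimod K A)) (hoch_cx K A (End_Bo K A B M)) (alpha_map K A B M)"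
  unfolding hoch_cx_def alpha_map_def[abs_def]
  by (rule hom_cx_postcomp[where C = "bar K A" and d = "bar_d K A", OF bar_operates[OF A] bar_d_hom[OF A] alpha_unit_hom env_alg_central[OF A A]
        regular_left_module[OF A]])

lemma beta_chain_map:
  "chain_map K (hoch_cx K B (regular_bimod K B)) (hoch_cx K B (End_A K A B M)) (beta_map K A B M)"
  unfolding hoch_cx_def beta_map_def[abs_def]
  by (rule hom_cx_postcomp[where C = "bar K B" and d = "bar_d K B", OF bar_operates[OF B] bar_d_hom[OF B] beta_unit_hom env_alg_central[OF B B]
        regular_left_module[OF B]])

end

section \<open>Reversal of tensors\<close>

definition tpow_rev ::
  "('k, 'r) ring_scheme \<Rightarrow> ('k, 'b) module \<Rightarrow> nat \<Rightarrow> ('b list \<Rightarrow> 'k) set \<Rightarrow> ('b list \<Rightarrow> 'k) set" where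
  "tpow_rev K B m = lift K (tpow K (op_alg B) m) (\<lambda>xs. tpow_pure K (op_alg B) (rev xs))"

context
  fixes K :: "('k, 'r) ring_scheme" and B :: "('k, 'b) module"
  assumes B: "k_algebra K B"
begin

interpretation B: k_algebra K B by (rule B)
interpretation O: k_algebra K "op_alg B" by (rule k_algebra_op[OF B])

private lemmas B_mod = B.module_axioms and Bo_mod = O.module_axioms and Bo_alg = k_algebra_op[OF B]

lemma tlists_op [simp]: "tlists (op_alg B) m = tlists B m"
  by (simp add: tlists_def)

lemma rev_multilin: "multilin K B m (tpow K (op_alg B) m) (\<lambda>xs. tpow_pure K (op_alg B) (rev xs))"
proof (rule multilin_pure[OF B_mod Bo_mod])
  fix us vs :: "'b list" and x
  have "rev (us @ y # vs) = rev vs @ y # rev us" for y by simp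
  then show "\<exists>us' vs' \<phi>. \<phi> \<in> mod_hom K B (op_alg B) \<and> (\<forall>y\<in>carrier B. rev (us @ y # vs) = us' @ \<phi> y # vs')"
    using mod_hom_ident[of K B] by (simp del: rev_append) blast
qed (auto simp: tlists_def)

lemma tpow_rev_hom: "tpow_rev K B m \<in> mod_hom K (tpow K B m) (tpow K (op_alg B) m)"
  unfolding tpow_rev_def by (rule tpow_lift_hom[OF B_mod tpow_module[OF Bo_mod] rev_multilin])

lemma tpow_rev_pure: "xs \<in> tlists B m \<Longrightarrow> tpow_rev K B m (tpow_pure K B xs) = tpow_pure K (op_alg B) (rev xs)"
  unfolding tpow_rev_def by (rule tpow_lift_pure[OF B_mod tpow_module[OF Bo_mod] rev_multilin])

lemma rev_tlists: "xs \<in> tlists B m \<Longrightarrow> rev xs \<in> tlists B m"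
  by (simp add: tlists_def)

lemma tpow_rev_lact:
  assumes b: "b \<in> carrier B" and z: "z \<in> carrier (tpow K B (Suc m))"
  shows "tpow_rev K B (Suc m) (tpow_lact K B (Suc m) b z) =
    tpow_ract K (op_alg B) (Suc m) (tpow_rev K B (Suc m) z) b"
proof (rule tpow_hom_eq[OF B_mod tpow_module[OF Bo_mod]
    mod_hom_comp[OF bilin_homs(2)[OF tpow_lact_bilin[OF B] b] tpow_rev_hom]
    mod_hom_comp[OF tpow_rev_hom bilin_homs(1)[OF tpow_ract_bilin[OF Bo_alg, simplified bilin_op] b]] _ z])
  fix xs assume xs: "xs \<in> tlists B (Suc m)"
  then have "rev (lmul B b xs) = rmul (op_alg B) (rev xs) b"
    by (auto simp: tlists_Suc lmul_def rmul_def)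
  then show "tpow_rev K B (Suc m) (tpow_lact K B (Suc m) b (tpow_pure K B xs)) =
      tpow_ract K (op_alg B) (Suc m) (tpow_rev K B (Suc m) (tpow_pure K B xs)) b"
    using xs b tpow_ract_pure[OF Bo_alg, of b "rev xs" m]
    by (simp add: tpow_lact_pure[OF B] lmul_closed[OF B] tpow_rev_pure rev_tlists)
qed

lemma tpow_rev_ract:
  assumes b: "b \<in> carrier B" and z: "z \<in> carrier (tpow K B (Suc m))"
  shows "tpow_rev K B (Suc m) (tpow_ract K B (Suc m) z b) =
    tpow_lact K (op_alg B) (Suc m) b (tpow_rev K B (Suc m) z)"
proof (rule tpow_hom_eq[OF B_mod tpow_module[OF Bo_mod]
    mod_hom_comp[OF bilin_homs(1)[OF tpow_ract_bilin[OF B] b] tpow_rev_hom]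
    mod_hom_comp[OF tpow_rev_hom bilin_homs(2)[OF tpow_lact_bilin[OF Bo_alg, simplified bilin_op] b]] _ z])
  fix xs assume xs: "xs \<in> tlists B (Suc m)"
  then have "rev (rmul B xs b) = lmul (op_alg B) b (rev xs)"
    by (auto simp: tlists_Suc_snoc lmul_def rmul_def)
  then show "tpow_rev K B (Suc m) (tpow_ract K B (Suc m) (tpow_pure K B xs) b) =
      tpow_lact K (op_alg B) (Suc m) b (tpow_rev K B (Suc m) (tpow_pure K B xs))"
    using xs b tpow_lact_pure[OF Bo_alg, of b "rev xs" m]
    by (simp add: tpow_ract_pure[OF B] rmul_closed[OF B] tpow_rev_pure rev_tlists)
qed

lemma face_rev:
  assumes "i \<le> n" "xs \<in> tlists B (n + 2)"
  shows "face (op_alg B) i (rev xs) = rev (face B (n - i) xs)"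
  using assms by (simp add: face_def tlists_def take_rev drop_rev rev_nth Suc_diff_le)

lemma ksign_simps:
  "ksign K i \<otimes>\<^bsub>K\<^esub> ksign K i = \<one>\<^bsub>K\<^esub>"
  "ksign K (i + j) = ksign K i \<otimes>\<^bsub>K\<^esub> ksign K j"
  "j \<le> n \<Longrightarrow> ksign K (n - j) = ksign K n \<otimes>\<^bsub>K\<^esub> ksign K j"
proof -
  show 1: "ksign K i \<otimes>\<^bsub>K\<^esub> ksign K i = \<one>\<^bsub>K\<^esub>" for i
  proof (induction i)
    case (Suc i)
    have "ksign K (Suc i) \<otimes>\<^bsub>K\<^esub> ksign K (Suc i) = ksign K i \<otimes>\<^bsub>K\<^esub> ksign K i \<otimes>\<^bsub>K\<^esub> ((\<ominus>\<^bsub>K\<^esub> \<one>\<^bsub>K\<^esub>) \<otimes>\<^bsub>K\<^esub> (\<ominus>\<^bsub>K\<^esub> \<one>\<^bsub>K\<^esub>))"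
      by (simp add: B.R.m_ac del: B.R.l_minus B.R.r_minus)
    also have "(\<ominus>\<^bsub>K\<^esub> \<one>\<^bsub>K\<^esub>) \<otimes>\<^bsub>K\<^esub> (\<ominus>\<^bsub>K\<^esub> \<one>\<^bsub>K\<^esub>) = \<one>\<^bsub>K\<^esub>" by (simp add: B.R.l_minus B.R.r_minus)
    finally show ?case using Suc by simp
  qed simp
  show 2: "ksign K (i + j) = ksign K i \<otimes>\<^bsub>K\<^esub> ksign K j" for i j
    by (simp add: B.R.nat_pow_mult)
  show "ksign K (n - j) = ksign K n \<otimes>\<^bsub>K\<^esub> ksign K j" if "j \<le> n"
    using 2[of "n - j" j] 1[of j] that by (simp add: B.R.m_assoc)
qed

lemma ksign_cancel: "ksign K (i + j) \<otimes>\<^bsub>K\<^esub> ksign K j = ksign K i"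
  unfolding ksign_simps(2)
  by (subst B.R.m_assoc[OF ksign_closed[OF B] ksign_closed[OF B] ksign_closed[OF B]])
     (simp add: ksign_simps(1))

text \<open>Reversal exchanges the faces \<open>i\<close> and \<open>n - i\<close>, whose signs differ by \<open>(-1)^n\<close>.\<close>

lemma bar_sum_rev:
  assumes z: "z \<in> carrier (tpow K B (Suc (Suc n)))"
  shows "bar_face_sum K (op_alg B) n (tpow_rev K B (Suc (Suc n)) z) =
    ksign K n \<odot>\<^bsub>tpow K (op_alg B) (Suc n)\<^esub> tpow_rev K B (Suc n) (bar_face_sum K B n z)"
proof (rule tpow_hom_eq[OF B_mod tpow_module[OF Bo_mod] mod_hom_comp[OF tpow_rev_hom bar_sum_hom'[OF Bo_alg]]
    mod_hom_scale[OF tpow_module[OF Bo_mod] mod_hom_comp[OF bar_sum_hom'[OF B] tpow_rev_hom] ksign_closed[OF B]] _ z])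
  let ?P = "tpow K (op_alg B) (Suc n)" and ?Q = "tpow K B (Suc n)"
  interpret P: module K ?P by (rule tpow_module[OF Bo_mod])
  interpret Q: module K ?Q by (rule tpow_module[OF B_mod])
  fix xs assume xs: "xs \<in> tlists B (Suc (Suc n))"
  have ft: "face B i xs \<in> tlists B (Suc n)" if "i \<in> {0..n}" for i
    using face_closed[OF B, of i n xs] that xs by simp
  define p where "p i = tpow_pure K (op_alg B) (rev (face B i xs))" for i
  have pc: "p i \<in> carrier ?P" if "i \<in> {0..n}" for i
    unfolding p_def using rev_tlists[OF ft[OF that]] by (intro tpow_pure_closed[OF Bo_mod]) simp
  have fc: "tpow_pure K B (face B i xs) \<in> carrier ?Q" if "i \<in> {0..n}" for i
    by (rule tpow_pure_closed[OF B_mod ft[OF that]])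
  have "bar_face_sum K (op_alg B) n (tpow_rev K B (Suc (Suc n)) (tpow_pure K B xs)) =
      (\<Oplus>\<^bsub>?P\<^esub>i\<in>{0..n}. ksign K i \<odot>\<^bsub>?P\<^esub> tpow_pure K (op_alg B) (face (op_alg B) i (rev xs)))"
    using bar_sum_pure[OF Bo_alg, of "rev xs" n] rev_tlists[OF xs] xs by (simp add: tpow_rev_pure)
  also have "\<dots> = (\<Oplus>\<^bsub>?P\<^esub>i\<in>{0..n}. ksign K (n - (n - i)) \<odot>\<^bsub>?P\<^esub> p (n - i))"
    by (rule P.finsum_cong') (use pc xs in \<open>auto simp: p_def face_rev\<close>)
  also have "\<dots> = (\<Oplus>\<^bsub>?P\<^esub>j\<in>(\<lambda>i. n - i) ` {0..n}. ksign K (n - j) \<odot>\<^bsub>?P\<^esub> p j)"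
    by (rule P.finsum_reindex[symmetric]) (use pc in \<open>auto simp: inj_on_def\<close>)
  also have "(\<lambda>i. n - i) ` {0..n} = {0..n}"
  proof -
    have "j \<in> (\<lambda>i. n - i) ` {0..n}" if "j \<le> n" for j
      using that by (intro image_eqI[of _ _ "n - j"]) auto
    then show ?thesis by auto
  qed
  also have "(\<Oplus>\<^bsub>?P\<^esub>j\<in>{0..n}. ksign K (n - j) \<odot>\<^bsub>?P\<^esub> p j) = (\<Oplus>\<^bsub>?P\<^esub>j\<in>{0..n}. ksign K n \<odot>\<^bsub>?P\<^esub> (ksign K j \<odot>\<^bsub>?P\<^esub> p j))"
    by (rule P.finsum_cong') (use pc in \<open>auto simp: ksign_simps(3) P.smult_assoc1\<close>)
  also have "\<dots> = ksign K n \<odot>\<^bsub>?P\<^esub> (\<Oplus>\<^bsub>?P\<^esub>j\<in>{0..n}. ksign K j \<odot>\<^bsub>?P\<^esub> p j)"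
    by (rule P.finsum_smult_ldistr[symmetric]) (use pc in auto)
  also have "(\<Oplus>\<^bsub>?P\<^esub>j\<in>{0..n}. ksign K j \<odot>\<^bsub>?P\<^esub> p j) =
      (\<Oplus>\<^bsub>?P\<^esub>j\<in>{0..n}. tpow_rev K B (Suc n) (ksign K j \<odot>\<^bsub>?Q\<^esub> tpow_pure K B (face B j xs)))"
    by (rule P.finsum_cong')
       (use fc ft pc in \<open>auto simp: mod_hom_smult[OF tpow_rev_hom] tpow_rev_pure p_def intro!: mod_hom_closed[OF tpow_rev_hom]\<close>)
  also have "\<dots> = tpow_rev K B (Suc n) (\<Oplus>\<^bsub>?Q\<^esub>j\<in>{0..n}. ksign K j \<odot>\<^bsub>?Q\<^esub> tpow_pure K B (face B j xs))"
    by (rule mod_hom_finsum[OF tpow_rev_hom Q.abelian_group_axioms P.abelian_group_axioms, symmetric])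
       (use fc in auto)
  also have "(\<Oplus>\<^bsub>?Q\<^esub>j\<in>{0..n}. ksign K j \<odot>\<^bsub>?Q\<^esub> tpow_pure K B (face B j xs)) = bar_face_sum K B n (tpow_pure K B xs)"
    using bar_sum_pure[OF B, of xs n] xs by simp
  finally show "bar_face_sum K (op_alg B) n (tpow_rev K B (Suc (Suc n)) (tpow_pure K B xs)) =
    ksign K n \<odot>\<^bsub>?P\<^esub> tpow_rev K B (Suc n) (bar_face_sum K B n (tpow_pure K B xs))" .
qed

lemma bar_rev_eq:
  "bar_rev K B (int n) c = ksign K (n * (n + 1) div 2) \<odot>\<^bsub>tpow K (op_alg B) (Suc (Suc n))\<^esub> tpow_rev K B (Suc (Suc n)) c"
proof -
  have "nat (int n * (int n + 1) div 2) = n * (n + 1) div 2"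
    by (simp add: nat_div_distrib nat_mult_distrib nat_add_distrib)
  then show ?thesis by (simp add: bar_rev_def bar_aug_def tpow_rev_def nat_plus_2 del: mult_Suc_right)
qed

lemma bar_rev_hom:
  assumes "0 \<le> n" shows "bar_rev K B n \<in> mod_hom K (bar_aug K B n) (bar_aug K (op_alg B) n)"
proof -
  obtain k where n: "n = int k" using assms nonneg_int_cases by blast
  show ?thesis
    unfolding n bar_rev_eq[abs_def] bar_aug_def nat_plus_2
    by (rule mod_hom_scale[OF tpow_module[OF Bo_mod] tpow_rev_hom ksign_closed[OF B]])
qed

lemma bar_rev_lact:
  assumes "0 \<le> n" "b \<in> carrier B" "z \<in> carrier (bar_aug K B n)"
  shows "bar_rev K B n (tpow_lact K B (nat (n + 2)) b z) = tpow_ract K (op_alg B) (nat (n + 2)) (bar_rev K B n z) b"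
proof -
  obtain k where n: "n = int k" using assms(1) nonneg_int_cases by blast
  have z: "z \<in> carrier (tpow K B (Suc (Suc k)))" using assms(3) unfolding n bar_aug_def nat_plus_2 .
  show ?thesis
    unfolding n bar_rev_eq nat_plus_2 tpow_rev_lact[OF assms(2) z]
    using z assms(2) by (subst bilin_rules(3)[OF tpow_ract_bilin[OF Bo_alg]]) (auto simp: mod_hom_closed[OF tpow_rev_hom])
qed

lemma bar_rev_ract:
  assumes "0 \<le> n" "b \<in> carrier B" "z \<in> carrier (bar_aug K B n)"
  shows "bar_rev K B n (tpow_ract K B (nat (n + 2)) z b) = tpow_lact K (op_alg B) (nat (n + 2)) b (bar_rev K B n z)"
proof -
  obtain k where n: "n = int k" using assms(1) nonneg_int_cases by blast
  have z: "z \<in> carrier (tpow K B (Suc (Suc k)))" using assms(3) unfolding n bar_aug_def nat_plus_2 .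
  show ?thesis
    unfolding n bar_rev_eq nat_plus_2 tpow_rev_ract[OF assms(2) z]
    using z assms(2) by (subst bilin_rules(4)[OF tpow_lact_bilin[OF Bo_alg]]) (auto simp: mod_hom_closed[OF tpow_rev_hom])
qed

text \<open>The signs \<open>(-1)^(n(n+1)/2)\<close> in consecutive degrees differ by \<open>(-1)^n\<close>, which is the sign by which plain
  reversal fails to commute with the differential.\<close>

lemma bar_rev_d:
  assumes "0 \<le> n" "z \<in> carrier (bar_aug K B (n + 1))"
  shows "bar_aug_d K (op_alg B) (n + 1) (bar_rev K B (n + 1) z) = bar_rev K B n (bar_aug_d K B (n + 1) z)"
proof -
  obtain k where n: "n = int k" using assms(1) nonneg_int_cases by blast
  have n1: "n + 1 = int (Suc k)" using n by simp
  have z: "z \<in> carrier (tpow K B (Suc (Suc (Suc k))))" using assms(2) unfolding n1 bar_aug_def nat_plus_2 .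
  interpret P: module K "tpow K (op_alg B) (Suc (Suc k))" by (rule tpow_module[OF Bo_mod])
  \<comment> \<open>The exponents of consecutive reversal signs differ by the degree.\<close>
  have "Suc k * (Suc k + 1) = k * (k + 1) + 2 * (k + 1)" by simp
  then have t: "Suc k * (Suc k + 1) div 2 = k * (k + 1) div 2 + Suc k" by (simp only: div_mult_self2)
  have w: "tpow_rev K B (Suc (Suc k)) (bar_face_sum K B (Suc k) z) \<in> carrier (tpow K (op_alg B) (Suc (Suc k)))"
    by (rule mod_hom_closed[OF tpow_rev_hom mod_hom_closed[OF bar_sum_hom'[OF B] z]])
  have "bar_aug_d K (op_alg B) (n + 1) (bar_rev K B (n + 1) z) =
      ksign K (k * (k + 1) div 2 + Suc k) \<odot>\<^bsub>tpow K (op_alg B) (Suc (Suc k))\<^esub>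
        (ksign K (Suc k) \<odot>\<^bsub>tpow K (op_alg B) (Suc (Suc k))\<^esub> tpow_rev K B (Suc (Suc k)) (bar_face_sum K B (Suc k) z))"
    unfolding n1 bar_aug_d_eq bar_rev_eq t
    by (subst mod_hom_smult[OF bar_sum_hom'[OF Bo_alg]]) (auto simp: mod_hom_closed[OF tpow_rev_hom z] bar_sum_rev[OF z] ksign_closed[OF B])
  also have "\<dots> = ksign K (k * (k + 1) div 2) \<odot>\<^bsub>tpow K (op_alg B) (Suc (Suc k))\<^esub>
      tpow_rev K B (Suc (Suc k)) (bar_face_sum K B (Suc k) z)"
    unfolding P.smult_assoc1[OF ksign_closed[OF B] ksign_closed[OF B] w, symmetric] ksign_cancel ..
  also have "\<dots> = bar_rev K B n (bar_aug_d K B (n + 1) z)"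
    unfolding n1 bar_aug_d_eq unfolding n bar_rev_eq ..
  finally show ?thesis .
qed

end

lemma bar_aug_lact_ract:
  assumes T: "k_algebra K T" and p: "-1 \<le> p"
    and a: "a \<in> carrier T" "b \<in> carrier T" and z: "z \<in> carrier (bar_aug K T p)"
  shows "tpow_lact K T (nat (p + 2)) a (tpow_ract K T (nat (p + 2)) z b) =
    tpow_ract K T (nat (p + 2)) (tpow_lact K T (nat (p + 2)) a z) b"
proof -
  obtain n where n: "nat (p + 2) = Suc n" using p by (rule int_ge_m1_cases)
  show ?thesis using z unfolding bar_aug_def n by (rule tpow_lact_ract[OF T a])
qed

section \<open>The triangular complex\<close>

text \<open>The action of a tensor product of two algebras on a tensor product of modules. The left and the right
  action on a summand of the triangular complex are both of this form.\<close>

definition tens_act ::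
  "('k, 'r) ring_scheme \<Rightarrow> ('k, 'x) module \<Rightarrow> ('k, 'y) module \<Rightarrow> ('p \<Rightarrow> 'x \<Rightarrow> 'x) \<Rightarrow> ('q \<Rightarrow> 'y \<Rightarrow> 'y) \<Rightarrow>
    ('p \<times> 'q \<Rightarrow> 'k) set \<Rightarrow> ('x \<times> 'y \<Rightarrow> 'k) set \<Rightarrow> ('x \<times> 'y \<Rightarrow> 'k) set" where
  "tens_act K X Y l r t z = lift K (tens K X Y) (\<lambda>(p, q). tens_map K X Y (l p) (r q) z) t"

lemma tens_map_commute:
  assumes eq: "\<And>x. x \<in> carrier X \<Longrightarrow> f1' (f1 x) = f2' (f2 x)" "\<And>y. y \<in> carrier Y \<Longrightarrow> g1' (g1 y) = g2' (g2 y)"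
    and mods: "module K X" "module K Y" "module K X1" "module K Y1" "module K X2" "module K Y2" "module K Z" "module K W"
    and f: "f1 \<in> mod_hom K X X1" "g1 \<in> mod_hom K Y Y1" "f1' \<in> mod_hom K X1 Z" "g1' \<in> mod_hom K Y1 W"
    and g: "f2 \<in> mod_hom K X X2" "g2 \<in> mod_hom K Y Y2" "f2' \<in> mod_hom K X2 Z" "g2' \<in> mod_hom K Y2 W"
    and z: "z \<in> carrier (tens K X Y)"
  shows "tens_map K Z W f1' g1' (tens_map K X1 Y1 f1 g1 z) = tens_map K Z W f2' g2' (tens_map K X2 Y2 f2 g2 z)"
proof -
  note m = mods
  note h1 = tens_map_hom[OF m(1,2,3,4) f(1,2)] tens_map_hom[OF m(3,4,7,8) f(3,4)]
  note h2 = tens_map_hom[OF m(1,2,5,6) g(1,2)] tens_map_hom[OF m(5,6,7,8) g(3,4)]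
  show ?thesis
  proof (rule tens_hom_eq[OF m(1,2) tens_module[OF m(7,8)] mod_hom_comp[OF h1] mod_hom_comp[OF h2] _ z])
    fix x y assume "x \<in> carrier X" "y \<in> carrier Y"
    then show "tens_map K Z W f1' g1' (tens_map K X1 Y1 f1 g1 (tens_pure K X Y x y)) =
        tens_map K Z W f2' g2' (tens_map K X2 Y2 f2 g2 (tens_pure K X Y x y))"
      by (simp add: tens_map_pure[OF m(1,2,3,4) f(1,2)] tens_map_pure[OF m(3,4,7,8) f(3,4)]
          tens_map_pure[OF m(1,2,5,6) g(1,2)] tens_map_pure[OF m(5,6,7,8) g(3,4)]
          mod_hom_closed[OF f(1)] mod_hom_closed[OF f(2)] mod_hom_closed[OF g(1)] mod_hom_closed[OF g(2)] eq)
  qed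
qed

lemma tens_act_bilin:
  assumes m: "module K P" "module K Q" "module K X" "module K Y"
    and l: "bilin K P X X l" and r: "bilin K Q Y Y r"
  shows "bilin K (tens K P Q) (tens K X Y) (tens K X Y) (tens_act K X Y l r)"
  unfolding tens_act_def[abs_def]
  by (intro tens_lift_param[OF m(1,2) tens_module[OF m(3,4)] tens_module[OF m(3,4)]]
      tens_map_param[OF m(3,4,3,4,1,2) l r] tens_map_hom[OF m(3,4,3,4)] bilin_homs(2)[OF l] bilin_homs(2)[OF r])

lemma tens_act_pure:
  assumes m: "module K P" "module K Q" "module K X" "module K Y"
    and l: "bilin K P X X l" and r: "bilin K Q Y Y r"
    and e: "p \<in> carrier P" "q \<in> carrier Q" "z \<in> carrier (tens K X Y)"
  shows "tens_act K X Y l r (tens_pure K P Q p q) z = tens_map K X Y (l p) (r q) z"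
  unfolding tens_act_def
  by (rule tens_lift_pure[OF m(1,2) tens_module[OF m(3,4)] tens_map_param[OF m(3,4,3,4,1,2) l r e(3)] e(1,2)])

lemma tens_act_natural:
  assumes fl: "\<And>p x. p \<in> carrier P \<Longrightarrow> x \<in> carrier X \<Longrightarrow> f (l p x) = l' p (f x)"
    and gr: "\<And>q y. q \<in> carrier Q \<Longrightarrow> y \<in> carrier Y \<Longrightarrow> g (r q y) = r' q (g y)"
    and m: "module K P" "module K Q" "module K X" "module K Y" "module K X'" "module K Y'"
    and l: "bilin K P X X l" and r: "bilin K Q Y Y r" and l': "bilin K P X' X' l'" and r': "bilin K Q Y' Y' r'"
    and f: "f \<in> mod_hom K X X'" and g: "g \<in> mod_hom K Y Y'"
    and t: "t \<in> carrier (tens K P Q)" and z: "z \<in> carrier (tens K X Y)"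
  shows "tens_map K X' Y' f g (tens_act K X Y l r t z) = tens_act K X' Y' l' r' t (tens_map K X' Y' f g z)"
proof -
  note h = tens_map_hom[OF m(3,4,5,6) f g]
  note b = tens_act_bilin[OF m(1,2,3,4) l r] and b' = tens_act_bilin[OF m(1,2,5,6) l' r']
  show ?thesis
  proof (rule tens_hom_eq[OF m(1,2) tens_module[OF m(5,6)] mod_hom_comp[OF bilin_homs(1)[OF b z] h]
      bilin_homs(1)[OF b' mod_hom_closed[OF h z]] _ t])
    fix p q assume p: "p \<in> carrier P" and q: "q \<in> carrier Q"
    show "tens_map K X' Y' f g (tens_act K X Y l r (tens_pure K P Q p q) z) =
        tens_act K X' Y' l' r' (tens_pure K P Q p q) (tens_map K X' Y' f g z)"
      unfolding tens_act_pure[OF m(1,2,3,4) l r p q z] tens_act_pure[OF m(1,2,5,6) l' r' p q mod_hom_closed[OF h z]]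
      by (rule tens_map_commute[OF fl[OF p] gr[OF q] m(3,4,3,4,5,6,5,6) bilin_homs(2)[OF l p] bilin_homs(2)[OF r q] f g f g
            bilin_homs(2)[OF l' p] bilin_homs(2)[OF r' q] z])
  qed
qed

text \<open>Additivity in both acting elements reduces the claim to pure tensors \<open>p \<otimes> q\<close> and \<open>p' \<otimes> q'\<close>, where it
  is the commutation of the actions on each factor.\<close>

lemma tens_act_commute:
  assumes ll: "\<And>p p' x. p \<in> carrier P \<Longrightarrow> p' \<in> carrier P \<Longrightarrow> x \<in> carrier X \<Longrightarrow> l p (l' p' x) = l' p' (l p x)"
    and rr: "\<And>q q' y. q \<in> carrier Q \<Longrightarrow> q' \<in> carrier Q \<Longrightarrow> y \<in> carrier Y \<Longrightarrow> r q (r' q' y) = r' q' (r q y)"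
    and m: "module K P" "module K Q" "module K X" "module K Y"
    and l: "bilin K P X X l" and r: "bilin K Q Y Y r" and l': "bilin K P X X l'" and r': "bilin K Q Y Y r'"
    and t: "t \<in> carrier (tens K P Q)" "t' \<in> carrier (tens K P Q)" and z: "z \<in> carrier (tens K X Y)"
  shows "tens_act K X Y l r t (tens_act K X Y l' r' t' z) = tens_act K X Y l' r' t' (tens_act K X Y l r t z)"
proof -
  note b = tens_act_bilin[OF m l r] and b' = tens_act_bilin[OF m l' r']
  note z' = bilin_closed[OF b' t(2) z]
  show ?thesis
  proof (rule tens_hom_eq[OF m(1,2) tens_module[OF m(3,4)] bilin_homs(1)[OF b z']
      mod_hom_comp[OF bilin_homs(1)[OF b z] bilin_homs(2)[OF b' t(2)]] _ t(1)])
    fix p q assume p: "p \<in> carrier P" and q: "q \<in> carrier Q"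
    show "tens_act K X Y l r (tens_pure K P Q p q) (tens_act K X Y l' r' t' z) =
        tens_act K X Y l' r' t' (tens_act K X Y l r (tens_pure K P Q p q) z)"
      unfolding tens_act_pure[OF m l r p q z'] tens_act_pure[OF m l r p q z]
      by (rule tens_act_natural[OF ll[OF p] rr[OF q] m m(3,4) l' r' l' r' bilin_homs(2)[OF l p] bilin_homs(2)[OF r q]
            t(2) z])
  qed
qed

lemma dsum_homI:
  assumes "\<And>i. i \<in> I \<Longrightarrow> f i \<in> mod_hom K X (Y i)"
  shows "(\<lambda>c. \<lambda>i\<in>I. f i c) \<in> mod_hom K X (dsum_mod I Y)"
  by (rule mod_homI)
     (auto simp: fun_eq_iff mod_hom_closed[OF assms] mod_hom_add[OF assms] mod_hom_smult[OF assms])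

lemma dsum_proj: "i \<in> I \<Longrightarrow> (\<lambda>c. c i) \<in> mod_hom K (dsum_mod I Y) (Y i)"
  by (rule mod_homI) auto

lemma tri_index_D:
  assumes "(p, q) \<in> tri_index n"
  shows "-1 \<le> p" "-1 \<le> q" "(p + 1, q) \<in> tri_index (n + 1)" "(p, q + 1) \<in> tri_index (n + 1)"
  using assms by (auto simp: tri_index_def)

context
  fixes K :: "('k, 'r) ring_scheme" and A :: "('k, 'a) module" and B :: "('k, 'b) module"
  assumes A: "k_algebra K A" and B: "k_algebra K B"
begin

interpretation A: k_algebra K A by (rule A)
interpretation B: k_algebra K B by (rule B)
interpretation O: k_algebra K "op_alg B" by (rule k_algebra_op[OF B])

private lemmas Op = k_algebra_op[OF B]
private lemmas mA = A.module_axioms and mO = O.module_axioms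
private lemmas mX = bar_aug_module[OF A] and mY = bar_aug_module[OF Op]

private abbreviation "SM p q \<equiv> tens K (bar_aug K A p) (bar_aug K (op_alg B) q)"
private abbreviation "d1 p q \<equiv> tens_map K (bar_aug K A p) (bar_aug K (op_alg B) q) (bar_aug_d K A (p + 1)) id"
private abbreviation "d2 p q \<equiv> tens_map K (bar_aug K A p) (bar_aug K (op_alg B) q) id (bar_aug_d K (op_alg B) (q + 1))"
private abbreviation "actL p q \<equiv> tens_act K (bar_aug K A p) (bar_aug K (op_alg B) q)
  (tpow_lact K A (nat (p + 2))) (tpow_lact K (op_alg B) (nat (q + 2)))"
private abbreviation "actR p q \<equiv> tens_act K (bar_aug K A p) (bar_aug K (op_alg B) q)
  (\<lambda>a x. tpow_ract K A (nat (p + 2)) x a) (\<lambda>b y. tpow_ract K (op_alg B) (nat (q + 2)) y b)"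

lemma tri_summand_module: "module K (SM p q)"
  by (rule tens_module[OF mX mY])

lemma tri_summand_eq: "tri_summand K A B (p, q) = SM p q"
  by (simp add: tri_summand_def)

lemma tri_module: "module K (tri K A B n)"
  unfolding tri_def by (rule dsum_mod_module[OF A.R.cring_axioms]) (auto simp: tri_summand_def tri_summand_module)

lemma tri_closed:
  "c \<in> carrier (tri K A B n) \<Longrightarrow> (p, q) \<in> tri_index n \<Longrightarrow> c (p, q) \<in> carrier (SM p q)"
  using PiE_mem[of c "tri_index n" "\<lambda>i. carrier (tri_summand K A B i)" "(p, q)"]
  by (simp add: tri_def tri_summand_eq)

lemma tri_eqI:
  assumes "c \<in> carrier (tri K A B n)" "c' \<in> carrier (tri K A B n)"
    "\<And>p q. (p, q) \<in> tri_index n \<Longrightarrow> c (p, q) = c' (p, q)"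
  shows "c = c'"
  using assms unfolding tri_def dsum_mod_simps by (intro dsum_eqI) auto

lemma tri_zero: "(p, q) \<in> tri_index n \<Longrightarrow> \<zero>\<^bsub>tri K A B n\<^esub> (p, q) = \<zero>\<^bsub>SM p q\<^esub>"
  by (simp add: tri_def tri_summand_def)

lemma tri_homI:
  assumes "\<And>p q. (p, q) \<in> tri_index n \<Longrightarrow> f p q \<in> mod_hom K X (SM p q)"
  shows "(\<lambda>c. \<lambda>(p, q)\<in>tri_index n. f p q c) \<in> mod_hom K X (tri K A B n)"
proof -
  have "(\<lambda>c. \<lambda>i\<in>tri_index n. (\<lambda>(p, q). f p q) i c) \<in> mod_hom K X (tri K A B n)"
    unfolding tri_def by (rule dsum_homI) (use assms in \<open>auto simp: tri_summand_def\<close>)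
  then show ?thesis by (simp add: case_prod_beta')
qed

lemma tri_proj: "(p, q) \<in> tri_index n \<Longrightarrow> (\<lambda>c. c (p, q)) \<in> mod_hom K (tri K A B n) (SM p q)"
  using dsum_proj[of "(p, q)" "tri_index n" K "tri_summand K A B"] by (simp add: tri_def tri_summand_eq)

lemma actL_bilin: "-1 \<le> p \<Longrightarrow> -1 \<le> q \<Longrightarrow> bilin K (tens K A (op_alg B)) (SM p q) (SM p q) (actL p q)"
  by (intro tens_act_bilin mA mO mX mY bar_aug_lact_bilin A Op)

lemma actR_bilin: "-1 \<le> p \<Longrightarrow> -1 \<le> q \<Longrightarrow> bilin K (tens K A (op_alg B)) (SM p q) (SM p q) (actR p q)"
  by (intro tens_act_bilin mA mO mX mY bilin_flip[OF bar_aug_ract_bilin] A Op)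

lemma actLR:
  assumes pq: "-1 \<le> p" "-1 \<le> q" and t: "t \<in> carrier (tens K A (op_alg B))" "t' \<in> carrier (tens K A (op_alg B))"
    and z: "z \<in> carrier (SM p q)"
  shows "actL p q t (actR p q t' z) = actR p q t' (actL p q t z)"
  by (rule tens_act_commute[OF bar_aug_lact_ract[OF A pq(1)] bar_aug_lact_ract[OF Op pq(2)] mA mO mX mY
        bar_aug_lact_bilin[OF A pq(1)] bar_aug_lact_bilin[OF Op pq(2)]
        bilin_flip[OF bar_aug_ract_bilin[OF A pq(1)]] bilin_flip[OF bar_aug_ract_bilin[OF Op pq(2)]] t z])

lemma d1_hom: "-1 \<le> p \<Longrightarrow> d1 p q \<in> mod_hom K (SM (p + 1) q) (SM p q)"
  by (intro tens_map_hom mX mY bar_aug_d_hom[OF A] mod_hom_id)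

lemma d2_hom: "-1 \<le> q \<Longrightarrow> d2 p q \<in> mod_hom K (SM p (q + 1)) (SM p q)"
  by (intro tens_map_hom mX mY bar_aug_d_hom[OF Op] mod_hom_id)

lemma d1_actL:
  assumes pq: "-1 \<le> p" "-1 \<le> q" and t: "t \<in> carrier (tens K A (op_alg B))" and z: "z \<in> carrier (SM (p + 1) q)"
  shows "d1 p q (actL (p + 1) q t z) = actL p q t (d1 p q z)"
proof -
  have p1: "-1 \<le> p + 1" using pq by simp
  show ?thesis
    by (rule tens_act_natural[OF bar_aug_d_lact[OF A pq(1)] _ mA mO mX mY mX mY bar_aug_lact_bilin[OF A p1] bar_aug_lact_bilin[OF Op pq(2)]
          bar_aug_lact_bilin[OF A pq(1)] bar_aug_lact_bilin[OF Op pq(2)] bar_aug_d_hom[OF A pq(1)] mod_hom_id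
          t z]) auto
qed

lemma d2_actL:
  assumes pq: "-1 \<le> p" "-1 \<le> q" and t: "t \<in> carrier (tens K A (op_alg B))" and z: "z \<in> carrier (SM p (q + 1))"
  shows "d2 p q (actL p (q + 1) t z) = actL p q t (d2 p q z)"
proof -
  have q1: "-1 \<le> q + 1" using pq by simp
  show ?thesis
    by (rule tens_act_natural[OF _ bar_aug_d_lact[OF Op pq(2)] mA mO mX mY mX mY bar_aug_lact_bilin[OF A pq(1)] bar_aug_lact_bilin[OF Op q1]
          bar_aug_lact_bilin[OF A pq(1)] bar_aug_lact_bilin[OF Op pq(2)] mod_hom_id bar_aug_d_hom[OF Op pq(2)]
          t z]) auto
qed

lemma d1_actR:
  assumes pq: "-1 \<le> p" "-1 \<le> q" and t: "t \<in> carrier (tens K A (op_alg B))" and z: "z \<in> carrier (SM (p + 1) q)"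
  shows "d1 p q (actR (p + 1) q t z) = actR p q t (d1 p q z)"
proof -
  have p1: "-1 \<le> p + 1" using pq by simp
  show ?thesis
    by (rule tens_act_natural[OF bar_aug_d_ract[OF A pq(1)] _ mA mO mX mY mX mY
          bilin_flip[OF bar_aug_ract_bilin[OF A p1]] bilin_flip[OF bar_aug_ract_bilin[OF Op pq(2)]]
          bilin_flip[OF bar_aug_ract_bilin[OF A pq(1)]] bilin_flip[OF bar_aug_ract_bilin[OF Op pq(2)]]
          bar_aug_d_hom[OF A pq(1)] mod_hom_id t z]) auto
qed

lemma d2_actR:
  assumes pq: "-1 \<le> p" "-1 \<le> q" and t: "t \<in> carrier (tens K A (op_alg B))" and z: "z \<in> carrier (SM p (q + 1))"
  shows "d2 p q (actR p (q + 1) t z) = actR p q t (d2 p q z)"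
proof -
  have q1: "-1 \<le> q + 1" using pq by simp
  show ?thesis
    by (rule tens_act_natural[OF _ bar_aug_d_ract[OF Op pq(2)] mA mO mX mY mX mY
          bilin_flip[OF bar_aug_ract_bilin[OF A pq(1)]] bilin_flip[OF bar_aug_ract_bilin[OF Op q1]]
          bilin_flip[OF bar_aug_ract_bilin[OF A pq(1)]] bilin_flip[OF bar_aug_ract_bilin[OF Op pq(2)]]
          mod_hom_id bar_aug_d_hom[OF Op pq(2)] t z]) auto
qed

text \<open>Both composites are \<open>d \<otimes> d\<close>; all signs of the double complex are carried by the total differential.\<close>

lemma d1_d2:
  assumes pq: "-1 \<le> p" "-1 \<le> q" and z: "z \<in> carrier (SM (p + 1) (q + 1))"
  shows "d1 p q (d2 (p + 1) q z) = d2 p q (d1 p (q + 1) z)"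
  by (rule tens_map_commute[OF _ _ mX mY mX mY mX mY mX mY mod_hom_id bar_aug_d_hom[OF Op pq(2)]
        bar_aug_d_hom[OF A pq(1)] mod_hom_id bar_aug_d_hom[OF A pq(1)] mod_hom_id mod_hom_id
        bar_aug_d_hom[OF Op pq(2)] z]) auto

lemma d1_d1:
  assumes pq: "-1 \<le> p" and z: "z \<in> carrier (SM (p + 1 + 1) q)"
  shows "d1 p q (d1 (p + 1) q z) = \<zero>\<^bsub>SM p q\<^esub>"
proof -
  interpret S: module K "SM p q" by (rule tri_summand_module)
  have p1: "-1 \<le> p + 1" using pq by simp
  note pb = tens_pure_bilin[OF mX mY, of p q]
  show ?thesis
  proof (rule tens_hom_eq[OF mX mY tri_summand_module mod_hom_comp[OF d1_hom[OF p1] d1_hom[OF pq]]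
      mod_hom_const_zero[OF tri_summand_module] _ z])
    fix x y assume x: "x \<in> carrier (bar_aug K A (p + 1 + 1))" and y: "y \<in> carrier (bar_aug K (op_alg B) q)"
    show "d1 p q (d1 (p + 1) q (tens_pure K (bar_aug K A (p + 1 + 1)) (bar_aug K (op_alg B) q) x y)) = \<zero>\<^bsub>SM p q\<^esub>"
      unfolding tens_map_pure[OF mX mY mX mY bar_aug_d_hom[OF A p1] mod_hom_id x y]
        tens_map_pure[OF mX mY mX mY bar_aug_d_hom[OF A pq] mod_hom_id mod_hom_closed[OF bar_aug_d_hom[OF A p1] x]
          mod_hom_closed[OF mod_hom_id y]] bar_aug_d_d[OF A pq x]
      by (rule mod_hom_zero[OF bilin_homs(1)[OF pb], OF _ module.axioms(2)[OF mX] S.abelian_group_axioms])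
         (use y in simp)
  qed
qed

lemma d2_d2:
  assumes pq: "-1 \<le> q" and z: "z \<in> carrier (SM p (q + 1 + 1))"
  shows "d2 p q (d2 p (q + 1) z) = \<zero>\<^bsub>SM p q\<^esub>"
proof -
  interpret S: module K "SM p q" by (rule tri_summand_module)
  have q1: "-1 \<le> q + 1" using pq by simp
  note pb = tens_pure_bilin[OF mX mY, of p q]
  show ?thesis
  proof (rule tens_hom_eq[OF mX mY tri_summand_module mod_hom_comp[OF d2_hom[OF q1] d2_hom[OF pq]]
      mod_hom_const_zero[OF tri_summand_module] _ z])
    fix x y assume x: "x \<in> carrier (bar_aug K A p)" and y: "y \<in> carrier (bar_aug K (op_alg B) (q + 1 + 1))"
    show "d2 p q (d2 p (q + 1) (tens_pure K (bar_aug K A p) (bar_aug K (op_alg B) (q + 1 + 1)) x y)) = \<zero>\<^bsub>SM p q\<^esub>"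
      unfolding tens_map_pure[OF mX mY mX mY mod_hom_id bar_aug_d_hom[OF Op q1] x y]
        tens_map_pure[OF mX mY mX mY mod_hom_id bar_aug_d_hom[OF Op pq] mod_hom_closed[OF mod_hom_id x]
          mod_hom_closed[OF bar_aug_d_hom[OF Op q1] y]] bar_aug_d_d[OF Op pq y]
      by (rule mod_hom_zero[OF bilin_homs(2)[OF pb], OF _ module.axioms(2)[OF mY] S.abelian_group_axioms])
         (use x in simp)
  qed
qed

lemma tri_d_eq:
  "tri_d K A B (n + 1) c = (\<lambda>(p, q)\<in>tri_index n.
     d1 p q (c (p + 1, q)) \<oplus>\<^bsub>SM p q\<^esub> ksign K (nat (p + 1)) \<odot>\<^bsub>SM p q\<^esub> d2 p q (c (p, q + 1)))"
  by (simp add: tri_d_def tri_summand_def)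

lemma tri_lact_eq: "tri_lact K A B n t c = (\<lambda>(p, q)\<in>tri_index n. actL p q t (c (p, q)))"
  by (simp add: tri_lact_def tri_summand_def tens_act_def)

lemma tri_ract_eq: "tri_ract K A B n c t = (\<lambda>(p, q)\<in>tri_index n. actR p q t (c (p, q)))"
  by (simp add: tri_ract_def tri_summand_def tens_act_def)

lemma tri_d_hom: "tri_d K A B (n + 1) \<in> mod_hom K (tri K A B (n + 1)) (tri K A B n)"
  unfolding tri_d_eq[abs_def]
proof (rule tri_homI)
  fix p q assume "(p, q) \<in> tri_index n"
  note i = tri_index_D[OF this]
  show "(\<lambda>c. d1 p q (c (p + 1, q)) \<oplus>\<^bsub>SM p q\<^esub> ksign K (nat (p + 1)) \<odot>\<^bsub>SM p q\<^esub> d2 p q (c (p, q + 1)))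
      \<in> mod_hom K (tri K A B (n + 1)) (SM p q)"
    by (intro mod_hom_plus mod_hom_scale tri_summand_module mod_hom_comp[OF tri_proj[OF i(3)] d1_hom[OF i(1)]]
        mod_hom_comp[OF tri_proj[OF i(4)] d2_hom[OF i(2)]] ksign_closed[OF A])
qed

lemma tri_lact_bilin: "bilin K (tens K A (op_alg B)) (tri K A B n) (tri K A B n) (tri_lact K A B n)"
  unfolding tri_lact_eq[abs_def]
proof (intro bilinI tri_homI)
  fix c p q assume c: "c \<in> carrier (tri K A B n)" and i: "(p, q) \<in> tri_index n"
  show "(\<lambda>t. actL p q t (c (p, q))) \<in> mod_hom K (tens K A (op_alg B)) (SM p q)"
    by (rule bilin_homs(1)[OF actL_bilin[OF tri_index_D(1,2)[OF i]] tri_closed[OF c i]])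
next
  fix t p q assume t: "t \<in> carrier (tens K A (op_alg B))" and i: "(p, q) \<in> tri_index n"
  show "(\<lambda>c. actL p q t (c (p, q))) \<in> mod_hom K (tri K A B n) (SM p q)"
    by (rule mod_hom_comp[OF tri_proj[OF i] bilin_homs(2)[OF actL_bilin[OF tri_index_D(1,2)[OF i]] t]])
qed

lemma tri_ract_bilin: "bilin K (tri K A B n) (tens K A (op_alg B)) (tri K A B n) (tri_ract K A B n)"
  unfolding tri_ract_eq[abs_def]
proof (intro bilinI tri_homI)
  fix c p q assume c: "c \<in> carrier (tri K A B n)" and i: "(p, q) \<in> tri_index n"
  show "(\<lambda>t. actR p q t (c (p, q))) \<in> mod_hom K (tens K A (op_alg B)) (SM p q)"
    by (rule bilin_homs(1)[OF actR_bilin[OF tri_index_D(1,2)[OF i]] tri_closed[OF c i]])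
next
  fix t p q assume t: "t \<in> carrier (tens K A (op_alg B))" and i: "(p, q) \<in> tri_index n"
  show "(\<lambda>c. actR p q t (c (p, q))) \<in> mod_hom K (tri K A B n) (SM p q)"
    by (rule mod_hom_comp[OF tri_proj[OF i] bilin_homs(2)[OF actR_bilin[OF tri_index_D(1,2)[OF i]] t]])
qed

lemma tri_lact_ract:
  assumes t: "t \<in> carrier (tens K A (op_alg B))" "t' \<in> carrier (tens K A (op_alg B))"
    and c: "c \<in> carrier (tri K A B n)"
  shows "tri_lact K A B n t (tri_ract K A B n c t') = tri_ract K A B n (tri_lact K A B n t c) t'"
proof (rule tri_eqI)
  fix p q assume i: "(p, q) \<in> tri_index n"
  show "tri_lact K A B n t (tri_ract K A B n c t') (p, q) = tri_ract K A B n (tri_lact K A B n t c) t' (p, q)"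
    using i actLR[OF tri_index_D(1,2)[OF i] t tri_closed[OF c i]] by (simp add: tri_lact_eq tri_ract_eq)
qed (intro bilin_closed[OF tri_lact_bilin] bilin_closed[OF tri_ract_bilin] t c)+

lemma tri_d_lact:
  assumes t: "t \<in> carrier (tens K A (op_alg B))" and c: "c \<in> carrier (tri K A B (n + 1))"
  shows "tri_d K A B (n + 1) (tri_lact K A B (n + 1) t c) = tri_lact K A B n t (tri_d K A B (n + 1) c)"
proof (rule tri_eqI)
  fix p q assume i: "(p, q) \<in> tri_index n"
  note j = tri_index_D[OF i]
  note c1 = tri_closed[OF c j(3)] and c2 = tri_closed[OF c j(4)]
  note h1 = mod_hom_closed[OF d1_hom[OF j(1)] c1] and h2 = mod_hom_closed[OF d2_hom[OF j(2)] c2]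
  interpret S: module K "SM p q" by (rule tri_summand_module)
  note b = bilin_homs(2)[OF actL_bilin[OF j(1,2)] t]
  have s: "ksign K (nat (p + 1)) \<odot>\<^bsub>SM p q\<^esub> d2 p q (c (p, q + 1)) \<in> carrier (SM p q)"
    by (rule S.smult_closed[OF ksign_closed[OF A] h2])
  show "tri_d K A B (n + 1) (tri_lact K A B (n + 1) t c) (p, q) = tri_lact K A B n t (tri_d K A B (n + 1) c) (p, q)"
    unfolding tri_d_eq tri_lact_eq using i j(3,4)
    by (simp only: restrict_apply' case_prod_conv d1_actL[OF j(1,2) t c1] d2_actL[OF j(1,2) t c2]
        mod_hom_add[OF b h1 s] mod_hom_smult[OF b ksign_closed[OF A] h2])
qed (intro bilin_closed[OF tri_lact_bilin] mod_hom_closed[OF tri_d_hom] t c)+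

lemma tri_d_ract:
  assumes t: "t \<in> carrier (tens K A (op_alg B))" and c: "c \<in> carrier (tri K A B (n + 1))"
  shows "tri_d K A B (n + 1) (tri_ract K A B (n + 1) c t) = tri_ract K A B n (tri_d K A B (n + 1) c) t"
proof (rule tri_eqI)
  fix p q assume i: "(p, q) \<in> tri_index n"
  note j = tri_index_D[OF i]
  note c1 = tri_closed[OF c j(3)] and c2 = tri_closed[OF c j(4)]
  note h1 = mod_hom_closed[OF d1_hom[OF j(1)] c1] and h2 = mod_hom_closed[OF d2_hom[OF j(2)] c2]
  interpret S: module K "SM p q" by (rule tri_summand_module)
  note b = bilin_homs(2)[OF actR_bilin[OF j(1,2)] t]
  have s: "ksign K (nat (p + 1)) \<odot>\<^bsub>SM p q\<^esub> d2 p q (c (p, q + 1)) \<in> carrier (SM p q)"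
    by (rule S.smult_closed[OF ksign_closed[OF A] h2])
  show "tri_d K A B (n + 1) (tri_ract K A B (n + 1) c t) (p, q) = tri_ract K A B n (tri_d K A B (n + 1) c) t (p, q)"
    unfolding tri_d_eq tri_ract_eq using i j(3,4)
    by (simp only: restrict_apply' case_prod_conv d1_actR[OF j(1,2) t c1] d2_actR[OF j(1,2) t c2]
        mod_hom_add[OF b h1 s] mod_hom_smult[OF b ksign_closed[OF A] h2])
qed (intro bilin_closed[OF tri_ract_bilin] mod_hom_closed[OF tri_d_hom] t c)+

text \<open>In the component \<open>(p, q)\<close> the squares of \<open>d \<otimes> 1\<close> and \<open>1 \<otimes> d\<close> vanish. The two mixed terms are the same
  element with the signs \<open>(-1)^(p+1)\<close> and \<open>(-1)^(p+2)\<close>. The discarded summand \<open>(-1, -1)\<close> lies in degree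
  \<open>-1\<close> and is the component of no element here, so all indices that occur belong to the complex.\<close>

lemma tri_d_d:
  assumes c: "c \<in> carrier (tri K A B (n + 1 + 1))"
  shows "tri_d K A B (n + 1) (tri_d K A B (n + 1 + 1) c) = \<zero>\<^bsub>tri K A B n\<^esub>"
proof (rule tri_eqI)
  interpret T: module K "tri K A B n" by (rule tri_module)
  show "\<zero>\<^bsub>tri K A B n\<^esub> \<in> carrier (tri K A B n)" by simp
  show "tri_d K A B (n + 1) (tri_d K A B (n + 1 + 1) c) \<in> carrier (tri K A B n)"
    by (intro mod_hom_closed[OF tri_d_hom] c)
  fix p q assume i: "(p, q) \<in> tri_index n"
  note j = tri_index_D[OF i]
  note j1 = tri_index_D[OF j(3)] and j2 = tri_index_D[OF j(4)]
  interpret S: module K "SM p q" by (rule tri_summand_module)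
  interpret S1: module K "SM (p + 1) q" by (rule tri_summand_module)
  interpret S2: module K "SM p (q + 1)" by (rule tri_summand_module)
  note u = tri_closed[OF c j1(3)] and v = tri_closed[OF c j1(4)] and w = tri_closed[OF c j2(4)]
  let ?u = "c (p + 1 + 1, q)" and ?v = "c (p + 1, q + 1)" and ?w = "c (p, q + 1 + 1)"
  let ?s = "ksign K (nat (p + 1))" and ?s' = "ksign K (nat (p + 1 + 1))"
  note k = ksign_closed[OF A]
  have s: "?s' = \<ominus>\<^bsub>K\<^esub> ?s"
  proof -
    have "nat (p + 1 + 1) = Suc (nat (p + 1))" using j(1) by simp
    then show ?thesis
      using k[of "nat (p + 1)"] by (simp only: A.R.nat_pow_Suc A.R.r_minus A.R.one_closed A.R.r_one)
  qed
  note h = mod_hom_closed[OF d1_hom[OF j1(1)] u] mod_hom_closed[OF d2_hom[OF j1(2)] v]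
    mod_hom_closed[OF d1_hom[OF j2(1)] v] mod_hom_closed[OF d2_hom[OF j2(2)] w]
  let ?x = "d2 p q (d1 p (q + 1) ?v)"
  have x: "?x \<in> carrier (SM p q)" by (rule mod_hom_closed[OF d2_hom[OF j(2)] h(3)])
  have e1: "d1 p q (d1 (p + 1) q ?u \<oplus>\<^bsub>SM (p + 1) q\<^esub> ?s' \<odot>\<^bsub>SM (p + 1) q\<^esub> d2 (p + 1) q ?v) = ?s' \<odot>\<^bsub>SM p q\<^esub> ?x"
    unfolding mod_hom_add[OF d1_hom[OF j(1)] h(1) S1.smult_closed[OF k h(2)]]
      mod_hom_smult[OF d1_hom[OF j(1)] k h(2)] d1_d1[OF j(1) u] d1_d2[OF j(1,2) v]
    by (rule S.l_zero[OF S.smult_closed[OF k x]])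
  have e2: "d2 p q (d1 p (q + 1) ?v \<oplus>\<^bsub>SM p (q + 1)\<^esub> ?s \<odot>\<^bsub>SM p (q + 1)\<^esub> d2 p (q + 1) ?w) = ?x"
    unfolding mod_hom_add[OF d2_hom[OF j(2)] h(3) S2.smult_closed[OF k h(4)]]
      mod_hom_smult[OF d2_hom[OF j(2)] k h(4)] d2_d2[OF j(2) w]
    by (simp add: x k)
  have "tri_d K A B (n + 1) (tri_d K A B (n + 1 + 1) c) (p, q) = ?s' \<odot>\<^bsub>SM p q\<^esub> ?x \<oplus>\<^bsub>SM p q\<^esub> ?s \<odot>\<^bsub>SM p q\<^esub> ?x"
    unfolding tri_d_eq using i j(3,4) by (simp only: restrict_apply' case_prod_conv e1 e2)
  also have "\<dots> = \<zero>\<^bsub>SM p q\<^esub>"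
    unfolding s using x by (simp add: S.smult_l_minus S.l_neg)
  finally show "tri_d K A B (n + 1) (tri_d K A B (n + 1 + 1) c) (p, q) = \<zero>\<^bsub>tri K A B n\<^esub> (p, q)"
    using i by (simp add: tri_zero)
qed

subsection \<open>Tensoring with a module\<close>

context
  fixes M :: "(('a \<times> 'b \<Rightarrow> 'k) set, 'm) module"
  assumes M: "left_module (env_alg K A B) M"
begin

interpretation M: left_module "env_alg K A B" M by (rule M)

private abbreviation "BT n \<equiv> btens K (env_alg K A B) (tri K A B n) (tri_ract K A B n) M"
private abbreviation "TP n \<equiv> tri_tens_pure K A B M n"

private lemma env: "carrier (env_alg K A B) = carrier (tens K A (op_alg B))"
  by (simp add: env_alg_simps[OF A B])

lemma k_res_M: "module K (k_res (env_alg K A B) M)"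
  by (rule k_res_module[OF A.R.cring_axioms env_alg_central[OF A B] M])

private lemma ract_closed: "c \<in> carrier (tri K A B n) \<Longrightarrow> t \<in> carrier (env_alg K A B) \<Longrightarrow>
    tri_ract K A B n c t \<in> carrier (tri K A B n)"
  by (simp add: env bilin_closed[OF tri_ract_bilin])

private lemmas bt = tri_module k_res_M ract_closed M.smult_closed

lemma tri_btens_module: "module K (BT n)"
  by (rule btens_module[OF bt])

lemma tri_btens_lift:
  assumes "module K Z" "bilin K (tri K A B n) (k_res (env_alg K A B) M) Z b"
    and "\<And>c t m. c \<in> carrier (tri K A B n) \<Longrightarrow> t \<in> carrier (env_alg K A B) \<Longrightarrow> m \<in> carrier M \<Longrightarrow>
      b (tri_ract K A B n c t) m = b c (t \<odot>\<^bsub>M\<^esub> m)"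
  shows "lift K Z (\<lambda>(c, m). b c m) \<in> mod_hom K (BT n) Z"
    and "c \<in> carrier (tri K A B n) \<Longrightarrow> m \<in> carrier M \<Longrightarrow> lift K Z (\<lambda>(c, m). b c m) (TP n c m) = b c m"
  using btens_lift_hom[where r = "tri_ract K A B n" and X = "tri K A B n" and b = b, OF bt assms]
    btens_lift_pure[where r = "tri_ract K A B n" and X = "tri K A B n" and b = b, OF bt assms]
  by (auto simp: tri_tens_pure_def)

lemma tri_tens_pure_bilin: "bilin K (tri K A B n) (k_res (env_alg K A B) M) (BT n) (TP n)"
  unfolding tri_tens_pure_def by (rule btens_pure_bilin[OF bt])

lemma tri_tens_pure_balanced:
  "c \<in> carrier (tri K A B n) \<Longrightarrow> t \<in> carrier (env_alg K A B) \<Longrightarrow> m \<in> carrier M \<Longrightarrow>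
    TP n (tri_ract K A B n c t) m = TP n c (t \<odot>\<^bsub>M\<^esub> m)"
  unfolding tri_tens_pure_def by (rule btens_pure_balanced[OF bt])

lemma tri_tens_simps:
  "carrier (tri_tens K A B M n) = carrier (BT n)" "add (tri_tens K A B M n) = add (BT n)"
  "zero (tri_tens K A B M n) = zero (BT n)"
  by (simp_all add: tri_tens_def Let_def)

lemma tri_tens_smult_eq:
  "smult (tri_tens K A B M n) t = lift K (BT n) (\<lambda>(c, m). TP n (tri_lact K A B n t c) m)"
  by (simp add: tri_tens_def Let_def)

private lemma lact_bilin:
  assumes "t \<in> carrier (env_alg K A B)"
  shows "bilin K (tri K A B n) (k_res (env_alg K A B) M) (BT n) (\<lambda>c m. TP n (tri_lact K A B n t c) m)"
  by (rule bilin_precomp[OF tri_tens_pure_bilin bilin_homs(2)[OF tri_lact_bilin] mod_hom_ident])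
     (use assms in \<open>simp add: env\<close>)

private lemma lact_balanced:
  assumes "t \<in> carrier (env_alg K A B)"
    "c \<in> carrier (tri K A B n)" "t' \<in> carrier (env_alg K A B)" "m \<in> carrier M"
  shows "TP n (tri_lact K A B n t (tri_ract K A B n c t')) m = TP n (tri_lact K A B n t c) (t' \<odot>\<^bsub>M\<^esub> m)"
  using assms tri_tens_pure_balanced[of "tri_lact K A B n t c" n t' m]
  by (simp add: env tri_lact_ract bilin_closed[OF tri_lact_bilin])

lemma tri_tens_smult_hom:
  assumes "t \<in> carrier (env_alg K A B)" shows "smult (tri_tens K A B M n) t \<in> mod_hom K (BT n) (BT n)"
  unfolding tri_tens_smult_eq
  by (rule tri_btens_lift(1)[OF tri_btens_module lact_bilin[OF assms]], rule lact_balanced[OF assms])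

lemma tri_tens_smult_pure:
  assumes "t \<in> carrier (env_alg K A B)" "c \<in> carrier (tri K A B n)" "m \<in> carrier M"
  shows "t \<odot>\<^bsub>tri_tens K A B M n\<^esub> TP n c m = TP n (tri_lact K A B n t c) m"
  unfolding tri_tens_smult_eq
  by (rule tri_btens_lift(2)[OF tri_btens_module lact_bilin[OF assms(1)] _ assms(2,3)], rule lact_balanced[OF assms(1)])

lemma tri_tens_operates: "operates (env_alg K A B) (tri_tens K A B M n)"
proof -
  interpret X: module K "BT n" by (rule tri_btens_module)
  show ?thesis
    unfolding operates_def
    using abelian_group_cong[OF X.abelian_group_axioms tri_tens_simps(1,3,2)]
      mod_hom_closed[OF tri_tens_smult_hom] by (simp add: tri_tens_simps)
qed

private lemma d_bilin:
  "bilin K (tri K A B (n + 1)) (k_res (env_alg K A B) M) (BT n) (\<lambda>c m. TP n (tri_d K A B (n + 1) c) m)"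
  by (rule bilin_precomp[OF tri_tens_pure_bilin tri_d_hom mod_hom_ident])

private lemma d_balanced:
  assumes "c \<in> carrier (tri K A B (n + 1))" "t \<in> carrier (env_alg K A B)" "m \<in> carrier M"
  shows "TP n (tri_d K A B (n + 1) (tri_ract K A B (n + 1) c t)) m = TP n (tri_d K A B (n + 1) c) (t \<odot>\<^bsub>M\<^esub> m)"
  using assms tri_tens_pure_balanced[of "tri_d K A B (n + 1) c" n t m]
  by (simp add: env tri_d_ract mod_hom_closed[OF tri_d_hom])

lemma tri_tens_d_eq: "tri_tens_d K A B M (n + 1) = lift K (BT n) (\<lambda>(c, m). TP n (tri_d K A B (n + 1) c) m)"
  by (simp add: tri_tens_d_def)

lemma tri_tens_d_khom: "tri_tens_d K A B M (n + 1) \<in> mod_hom K (BT (n + 1)) (BT n)"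
  unfolding tri_tens_d_eq
  by (rule tri_btens_lift(1)[OF tri_btens_module d_bilin], rule d_balanced)

lemma tri_tens_d_pure:
  assumes "c \<in> carrier (tri K A B (n + 1))" "m \<in> carrier M"
  shows "tri_tens_d K A B M (n + 1) (TP (n + 1) c m) = TP n (tri_d K A B (n + 1) c) m"
  unfolding tri_tens_d_eq
  by (rule tri_btens_lift(2)[OF tri_btens_module d_bilin _ assms], rule d_balanced)

lemma tri_btens_hom_eq:
  assumes "module K Z" "f \<in> mod_hom K (BT n) Z" "g \<in> mod_hom K (BT n) Z"
    and "\<And>c m. c \<in> carrier (tri K A B n) \<Longrightarrow> m \<in> carrier M \<Longrightarrow> f (TP n c m) = g (TP n c m)"
    and "z \<in> carrier (BT n)"
  shows "f z = g z"
  by (rule btens_hom_eq[OF bt assms(1-3) assms(4)[unfolded tri_tens_pure_def] assms(5)])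

lemma tri_tens_d_hom:
  "tri_tens_d K A B M (n + 1) \<in> mod_hom (env_alg K A B) (tri_tens K A B M (n + 1)) (tri_tens K A B M n)"
proof (rule mod_homI)
  fix t z assume t: "t \<in> carrier (env_alg K A B)" and z: "z \<in> carrier (tri_tens K A B M (n + 1))"
  show "tri_tens_d K A B M (n + 1) (t \<odot>\<^bsub>tri_tens K A B M (n + 1)\<^esub> z) =
      t \<odot>\<^bsub>tri_tens K A B M n\<^esub> tri_tens_d K A B M (n + 1) z"
  proof (rule tri_btens_hom_eq[OF tri_btens_module mod_hom_comp[OF tri_tens_smult_hom[OF t] tri_tens_d_khom]
      mod_hom_comp[OF tri_tens_d_khom tri_tens_smult_hom[OF t]] _ z[unfolded tri_tens_simps]])
    fix c m assume c: "c \<in> carrier (tri K A B (n + 1))" and m: "m \<in> carrier M"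
    have t': "t \<in> carrier (tens K A (op_alg B))" using t by (simp add: env)
    show "tri_tens_d K A B M (n + 1) (t \<odot>\<^bsub>tri_tens K A B M (n + 1)\<^esub> TP (n + 1) c m) =
        t \<odot>\<^bsub>tri_tens K A B M n\<^esub> tri_tens_d K A B M (n + 1) (TP (n + 1) c m)"
      unfolding tri_tens_smult_pure[OF t c m] tri_tens_d_pure[OF c m]
        tri_tens_d_pure[OF bilin_closed[OF tri_lact_bilin t' c] m]
        tri_tens_smult_pure[OF t mod_hom_closed[OF tri_d_hom c] m] tri_d_lact[OF t' c] ..
  qed
qed (auto simp: tri_tens_simps mod_hom_closed[OF tri_tens_d_khom] mod_hom_add[OF tri_tens_d_khom])

lemma tri_tens_d_d:
  assumes "z \<in> carrier (tri_tens K A B M (n + 1 + 1))"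
  shows "tri_tens_d K A B M (n + 1) (tri_tens_d K A B M (n + 1 + 1) z) = \<zero>\<^bsub>tri_tens K A B M n\<^esub>"
  unfolding tri_tens_simps
proof (rule tri_btens_hom_eq[OF tri_btens_module mod_hom_comp[OF tri_tens_d_khom tri_tens_d_khom]
    mod_hom_const_zero[OF tri_btens_module] _ assms[unfolded tri_tens_simps]])
  interpret T: module K "tri K A B n" by (rule tri_module)
  interpret X: module K "BT n" by (rule tri_btens_module)
  fix c m assume c: "c \<in> carrier (tri K A B (n + 1 + 1))" and m: "m \<in> carrier M"
  show "tri_tens_d K A B M (n + 1) (tri_tens_d K A B M (n + 1 + 1) (TP (n + 1 + 1) c m)) = \<zero>\<^bsub>BT n\<^esub>"
    unfolding tri_tens_d_pure[OF c m] tri_tens_d_pure[OF mod_hom_closed[OF tri_d_hom c] m] tri_d_d[OF c]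
    by (rule mod_hom_zero[OF bilin_homs(1)[OF tri_tens_pure_bilin], OF _ T.abelian_group_axioms X.abelian_group_axioms])
       (use m in simp)
qed

lemma tri_cx_cochain: "cochain K (tri_cx K A B M)"
  unfolding tri_cx_def
  by (rule hom_cx_cochain[where C = "tri_tens K A B M" and d = "tri_tens_d K A B M",
        OF A.R.cring_axioms env_alg_central[OF A B] M tri_tens_operates tri_tens_d_hom tri_tens_d_d])

end

end

section \<open>Restriction to the two edges of the triangular complex\<close>

lemma bar_aug_act_one:
  assumes T: "k_algebra K T" and p: "-1 \<le> p" and z: "z \<in> carrier (bar_aug K T p)"
  shows "tpow_lact K T (nat (p + 2)) \<one>\<^bsub>T\<^esub> z = z" "tpow_ract K T (nat (p + 2)) z \<one>\<^bsub>T\<^esub> = z"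
proof -
  interpret T: k_algebra K T by (rule T)
  obtain n where n: "nat (p + 2) = Suc n" using p by (rule int_ge_m1_cases)
  have z': "z \<in> carrier (tpow K T (Suc n))" using z unfolding bar_aug_def n .
  have l1: "lmul T \<one>\<^bsub>T\<^esub> xs = xs" if "xs \<in> tlists T (Suc n)" for xs
    using that by (auto simp: tlists_Suc lmul_def)
  have l2: "rmul T xs \<one>\<^bsub>T\<^esub> = xs" if "xs \<in> tlists T (Suc n)" for xs
    using that by (auto simp: tlists_Suc_snoc rmul_def)
  show "tpow_lact K T (nat (p + 2)) \<one>\<^bsub>T\<^esub> z = z" unfolding n
    by (rule tpow_hom_eq[OF T.module_axioms tpow_module[OF T.module_axioms] bilin_homs(2)[OF tpow_lact_bilin[OF T] T.A.one_closed]
          mod_hom_ident _ z']) (simp add: tpow_lact_pure[OF T] l1)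
  show "tpow_ract K T (nat (p + 2)) z \<one>\<^bsub>T\<^esub> = z" unfolding n
    by (rule tpow_hom_eq[OF T.module_axioms tpow_module[OF T.module_axioms] bilin_homs(1)[OF tpow_ract_bilin[OF T] T.A.one_closed]
          mod_hom_ident _ z']) (simp add: tpow_ract_pure[OF T] l2)
qed

lemma unit_tensor:
  assumes T: "k_algebra K T" and b: "b \<in> carrier T"
  shows "tpow_lact K T (nat (-1 + 2)) b (tpow_pure K T [\<one>\<^bsub>T\<^esub>]) = tpow_pure K T [b]"
    "tpow_ract K T (nat (-1 + 2)) (tpow_pure K T [\<one>\<^bsub>T\<^esub>]) b = tpow_pure K T [b]"
    "tpow_pure K T [b] \<in> carrier (bar_aug K T (-1))"
proof -
  interpret T: k_algebra K T by (rule T)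
  have n: "nat (-1 + 2) = Suc 0" by simp
  have t: "[\<one>\<^bsub>T\<^esub>] \<in> tlists T (Suc 0)" "[b] \<in> tlists T (Suc 0)" using b by (simp_all add: tlists_def)
  show "tpow_lact K T (nat (-1 + 2)) b (tpow_pure K T [\<one>\<^bsub>T\<^esub>]) = tpow_pure K T [b]"
    unfolding n tpow_lact_pure[OF T b t(1)] using b by (simp add: lmul_def)
  show "tpow_ract K T (nat (-1 + 2)) (tpow_pure K T [\<one>\<^bsub>T\<^esub>]) b = tpow_pure K T [b]"
    unfolding n tpow_ract_pure[OF T b t(1)] using b by (simp add: rmul_def)
  show "tpow_pure K T [b] \<in> carrier (bar_aug K T (-1))"
    unfolding bar_aug_def n by (rule tpow_pure_closed[OF T.module_axioms t(2)])
qed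

context
  fixes K :: "('k, 'r) ring_scheme" and A :: "('k, 'a) module" and B :: "('k, 'b) module"
    and M :: "(('a \<times> 'b \<Rightarrow> 'k) set, 'm) module"
  assumes A: "k_algebra K A" and B: "k_algebra K B" and M: "left_module (env_alg K A B) M"
begin

interpretation A: k_algebra K A by (rule A)
interpretation B: k_algebra K B by (rule B)
interpretation O: k_algebra K "op_alg B" by (rule k_algebra_op[OF B])
interpretation M: left_module "env_alg K A B" M by (rule M)

private lemmas Bo = k_algebra_op[OF B]
private lemmas mA' = A.module_axioms and mO' = O.module_axioms
private lemmas mX' = bar_aug_module[OF A] and mY' = bar_aug_module[OF Bo]

private abbreviation "XY p q \<equiv> tens K (bar_aug K A p) (bar_aug K (op_alg B) q)"
private abbreviation "TT n \<equiv> tri_tens K A B M n"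
private abbreviation "mp n \<equiv> tri_tens_pure K A B M n"
private abbreviation "ab \<equiv> tens_pure K A (op_alg B)"
private abbreviation "xy p q \<equiv> tens_pure K (bar_aug K A p) (bar_aug K (op_alg B) q)"
private abbreviation "incl \<equiv> tri_incl K A B"

private lemma ab_closed: "a \<in> carrier A \<Longrightarrow> b \<in> carrier B \<Longrightarrow> ab a b \<in> carrier (tens K A (op_alg B))"
  by (rule tens_pure_closed[OF mA' mO']) auto

lemma tri_incl_hom:
  assumes "(p, q) \<in> tri_index n" shows "incl n (p, q) \<in> mod_hom K (XY p q) (tri K A B n)"
proof -
  have "(\<lambda>x. \<lambda>j\<in>tri_index n. if j = (p, q) then x else \<zero>\<^bsub>tri_summand K A B j\<^esub>)
      \<in> mod_hom K (XY p q) (dsum_mod (tri_index n) (tri_summand K A B))"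
  proof (rule dsum_homI)
    fix j
    have m: "module K (tri_summand K A B j)" by (cases j) (simp add: tri_summand_eq[OF A B] tri_summand_module[OF A B])
    show "(\<lambda>x. if j = (p, q) then x else \<zero>\<^bsub>tri_summand K A B j\<^esub>) \<in> mod_hom K (XY p q) (tri_summand K A B j)"
      using mod_hom_ident[of K "XY p q"] mod_hom_const_zero[OF m]
      by (cases "j = (p, q)") (simp_all add: tri_summand_eq[OF A B])
  qed
  then show ?thesis by (simp add: tri_def tri_incl_def[abs_def])
qed

lemma tri_incl_apply:
  "(p', q') \<in> tri_index n \<Longrightarrow> incl n (p, q) z (p', q') = (if (p', q') = (p, q) then z else \<zero>\<^bsub>XY p' q'\<^esub>)"
  by (simp add: tri_incl_def tri_summand_eq[OF A B])

lemma tri_index_neg: "n < 0 \<Longrightarrow> tri_index n = {}"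
  by (auto simp: tri_index_def)

lemma tri_incl_neg: "n < 0 \<Longrightarrow> incl n i z = \<zero>\<^bsub>tri K A B n\<^esub>"
  by (simp add: tri_incl_def tri_def tri_index_neg restrict_def)

lemma tri_incl_lact:
  assumes i: "(p, q) \<in> tri_index n" and a: "a \<in> carrier A" "b \<in> carrier B"
    and x: "x \<in> carrier (bar_aug K A p)" and y: "y \<in> carrier (bar_aug K (op_alg B) q)"
  shows "tri_lact K A B n (ab a b) (incl n (p, q) (xy p q x y)) =
    incl n (p, q) (xy p q (tpow_lact K A (nat (p + 2)) a x) (tpow_lact K (op_alg B) (nat (q + 2)) b y))"
proof (rule tri_eqI[OF A B])
  note j = tri_index_D(1,2)[OF i]
  note t = ab_closed[OF a]
  note z = tens_pure_closed[OF mX' mY' x y]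
  have b': "b \<in> carrier (op_alg B)" using a by simp
  note z' = tens_pure_closed[OF mX' mY' bilin_closed[OF bar_aug_lact_bilin[OF A j(1)] a(1) x]
    bilin_closed[OF bar_aug_lact_bilin[OF Bo j(2)] b' y]]
  show "tri_lact K A B n (ab a b) (incl n (p, q) (xy p q x y)) \<in> carrier (tri K A B n)"
    by (rule bilin_closed[OF tri_lact_bilin[OF A B] t mod_hom_closed[OF tri_incl_hom[OF i] z]])
  show "incl n (p, q) (xy p q (tpow_lact K A (nat (p + 2)) a x) (tpow_lact K (op_alg B) (nat (q + 2)) b y))
      \<in> carrier (tri K A B n)"
    by (rule mod_hom_closed[OF tri_incl_hom[OF i] z'])
  fix p' q' assume i': "(p', q') \<in> tri_index n"
  note j' = tri_index_D(1,2)[OF i']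
  interpret S: module K "XY p' q'" by (rule tri_summand_module[OF A B])
  show "tri_lact K A B n (ab a b) (incl n (p, q) (xy p q x y)) (p', q') =
      incl n (p, q) (xy p q (tpow_lact K A (nat (p + 2)) a x) (tpow_lact K (op_alg B) (nat (q + 2)) b y)) (p', q')"
  proof (cases "(p', q') = (p, q)")
    case True
    then show ?thesis
      using i tens_act_pure[OF mA' mO' mX' mY' bar_aug_lact_bilin[OF A j(1)] bar_aug_lact_bilin[OF Bo j(2)] a(1) b' z]
        tens_map_pure[OF mX' mY' mX' mY' bilin_homs(2)[OF bar_aug_lact_bilin[OF A j(1)] a(1)]
          bilin_homs(2)[OF bar_aug_lact_bilin[OF Bo j(2)] b'] x y]
      by (simp add: tri_lact_eq[OF A B] tri_incl_apply)
  next
    case False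
    then show ?thesis
      using i' mod_hom_zero[OF bilin_homs(2)[OF actL_bilin[OF A B j'] t] S.abelian_group_axioms S.abelian_group_axioms]
      by (auto simp: tri_lact_eq[OF A B] tri_incl_apply)
  qed
qed

lemma tri_incl_ract:
  assumes i: "(p, q) \<in> tri_index n" and a: "a \<in> carrier A" "b \<in> carrier B"
    and x: "x \<in> carrier (bar_aug K A p)" and y: "y \<in> carrier (bar_aug K (op_alg B) q)"
  shows "tri_ract K A B n (incl n (p, q) (xy p q x y)) (ab a b) =
    incl n (p, q) (xy p q (tpow_ract K A (nat (p + 2)) x a) (tpow_ract K (op_alg B) (nat (q + 2)) y b))"
proof (rule tri_eqI[OF A B])
  note j = tri_index_D(1,2)[OF i]
  note t = ab_closed[OF a]
  note z = tens_pure_closed[OF mX' mY' x y]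
  have b': "b \<in> carrier (op_alg B)" using a by simp
  note bA = bilin_flip[OF bar_aug_ract_bilin[OF A j(1)]] and bB = bilin_flip[OF bar_aug_ract_bilin[OF Bo j(2)]]
  note z' = tens_pure_closed[OF mX' mY' bilin_closed[OF bA a(1) x] bilin_closed[OF bB b' y]]
  show "tri_ract K A B n (incl n (p, q) (xy p q x y)) (ab a b) \<in> carrier (tri K A B n)"
    by (rule bilin_closed[OF tri_ract_bilin[OF A B] mod_hom_closed[OF tri_incl_hom[OF i] z] t])
  show "incl n (p, q) (xy p q (tpow_ract K A (nat (p + 2)) x a) (tpow_ract K (op_alg B) (nat (q + 2)) y b))
      \<in> carrier (tri K A B n)"
    by (rule mod_hom_closed[OF tri_incl_hom[OF i] z'])
  fix p' q' assume i': "(p', q') \<in> tri_index n"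
  note j' = tri_index_D(1,2)[OF i']
  interpret S: module K "XY p' q'" by (rule tri_summand_module[OF A B])
  show "tri_ract K A B n (incl n (p, q) (xy p q x y)) (ab a b) (p', q') =
      incl n (p, q) (xy p q (tpow_ract K A (nat (p + 2)) x a) (tpow_ract K (op_alg B) (nat (q + 2)) y b)) (p', q')"
  proof (cases "(p', q') = (p, q)")
    case True
    then show ?thesis
      using i tens_act_pure[OF mA' mO' mX' mY' bA bB a(1) b' z]
        tens_map_pure[OF mX' mY' mX' mY' bilin_homs(2)[OF bA a(1)] bilin_homs(2)[OF bB b'] x y]
      by (simp add: tri_ract_eq[OF A B] tri_incl_apply)
  next
    case False
    then show ?thesis
      using i' mod_hom_zero[OF bilin_homs(2)[OF actR_bilin[OF A B j'] t] S.abelian_group_axioms S.abelian_group_axioms]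
      by (auto simp: tri_ract_eq[OF A B] tri_incl_apply)
  qed
qed

text \<open>In negative degrees the triangular complex has no summands, so the tensor product over the algebra is
  zero there; the bar complex was set to zero in these degrees by definition.\<close>

lemma tri_tens_neg:
  assumes n: "n < 0" and z: "z \<in> carrier (TT n)" shows "z = \<zero>\<^bsub>TT n\<^esub>"
  unfolding tri_tens_simps[OF A B M]
proof (rule tri_btens_hom_eq[OF A B M tri_btens_module[OF A B M] mod_hom_ident mod_hom_const_zero[OF tri_btens_module[OF A B M]] _
    z[unfolded tri_tens_simps[OF A B M]]])
  interpret T: module K "tri K A B n" by (rule tri_module[OF A B])
  note ab = T.abelian_group_axioms module.axioms(2)[OF tri_btens_module[OF A B M]]
  fix c m assume c: "c \<in> carrier (tri K A B n)" and m: "m \<in> carrier M"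
  have "c = \<zero>\<^bsub>tri K A B n\<^esub>"
    by (rule tri_eqI[OF A B c]) (simp_all add: tri_index_neg[OF n])
  then show "mp n c m = \<zero>\<^bsub>btens K (env_alg K A B) (tri K A B n) (tri_ract K A B n) M\<^esub>"
    using mod_hom_zero[OF bilin_homs(1)[OF tri_tens_pure_bilin[OF A B M]] ab, of m] m by simp
qed

lemma tri_tens_pure_closed: "c \<in> carrier (tri K A B n) \<Longrightarrow> m \<in> carrier M \<Longrightarrow> mp n c m \<in> carrier (TT n)"
  using bilin_closed[OF tri_tens_pure_bilin[OF A B M]] by (simp add: tri_tens_simps[OF A B M])

text \<open>A chain map \<open>J\<close> from the bar complex of \<open>T\<close> into the triangular complex turns a cochain \<open>f\<close> on the
  triangular complex into the Hochschild cochain \<open>c \<mapsto> (m \<mapsto> f (J c \<otimes> m))\<close>: this is restriction along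
  \<open>J\<close> followed by the adjunction between \<open>\<otimes>\<close> and \<open>Hom\<close>. It is isolated from the two edges because the
  compatibility with differentials uses only that \<open>J\<close> is a chain map; the equivariance of the resulting
  cochain depends on the edge and is the premise \<open>hom\<close>.\<close>

lemma edge_chain_map:
  fixes T :: "('k, 't) module" and \<Lambda> :: "(('t \<times> 't \<Rightarrow> 'k) set, 'm \<Rightarrow> 'm) module"
    and J :: "int \<Rightarrow> ('t list \<Rightarrow> 'k) set \<Rightarrow> ('k, 'a, 'b) tri_elt"
  assumes T: "k_algebra K T" and \<Lambda>: "left_module (env_alg K T T) \<Lambda>"
    and zero: "\<zero>\<^bsub>\<Lambda>\<^esub> = (\<lambda>m\<in>carrier M. \<zero>\<^bsub>M\<^esub>)"
    and add: "\<And>f g. f \<oplus>\<^bsub>\<Lambda>\<^esub> g = (\<lambda>m\<in>carrier M. f m \<oplus>\<^bsub>M\<^esub> g m)"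
    and smult: "\<And>k f. k \<in> carrier K \<Longrightarrow> f \<in> carrier \<Lambda> \<Longrightarrow> k \<odot>\<^bsub>k_res (env_alg K T T) \<Lambda>\<^esub> f =
      (\<lambda>m\<in>carrier M. k \<odot>\<^bsub>k_res (env_alg K A B) M\<^esub> f m)"
    and neg: "\<And>n c. n < 0 \<Longrightarrow> J n c = \<zero>\<^bsub>tri K A B n\<^esub>"
    and hom: "\<And>n f. 0 \<le> n \<Longrightarrow> f \<in> mod_hom (env_alg K A B) (TT n) M \<Longrightarrow>
      (\<lambda>c. \<lambda>m\<in>carrier M. f (mp n (J n c) m)) \<in> mod_hom (env_alg K T T) (bar K T n) \<Lambda>"
    and J: "\<And>n c. 0 \<le> n \<Longrightarrow> c \<in> carrier (bar_aug K T n) \<Longrightarrow> J n c \<in> carrier (tri K A B n)"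
    and d: "\<And>n c. 0 \<le> n \<Longrightarrow> c \<in> carrier (bar_aug K T (n + 1)) \<Longrightarrow>
      tri_d K A B (n + 1) (J (n + 1) c) = J n (bar_aug_d K T (n + 1) c)"
  shows "chain_map K (tri_cx K A B M) (hoch_cx K T \<Lambda>)
    (\<lambda>n f. \<lambda>c\<in>carrier (bar K T n). \<lambda>m\<in>carrier M. f (mp n (J n c) m))"
  unfolding chain_map_def tri_cx_def hoch_cx_def
proof (intro allI conjI ballI)
  fix n :: int
  interpret L: left_module "env_alg K T T" \<Lambda> by (rule \<Lambda>)
  let ?\<Phi> = "\<lambda>n f. \<lambda>c\<in>carrier (bar K T n). \<lambda>m\<in>carrier M. f (mp n (J n c) m)"
  have Jc: "J n c \<in> carrier (tri K A B n)" if "c \<in> carrier (bar K T n)" for n c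
  proof (cases "n < 0")
    case True
    interpret R: module K "tri K A B n" by (rule tri_module[OF A B])
    show ?thesis using neg[OF True] by simp
  next
    case False
    then show ?thesis using that J[of n c] by (simp add: bar_simps[OF T])
  qed
  note TPc = tri_tens_pure_closed[OF Jc]
  have f0: "f z = \<zero>\<^bsub>M\<^esub>" if "f \<in> mod_hom (env_alg K A B) (TT n) M" "n < 0" "z \<in> carrier (TT n)" for f n z
  proof -
    have "abelian_group (TT n)" using tri_tens_operates[OF A B M, of n] by (simp add: operates_def)
    then show ?thesis using mod_hom_zero[OF that(1) _ M.abelian_group_axioms] tri_tens_neg[OF that(2,3)] by simp
  qed
  have \<Phi>neg: "(\<lambda>m\<in>carrier M. f (mp n (J n c) m)) = \<zero>\<^bsub>\<Lambda>\<^esub>"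
    if "f \<in> mod_hom (env_alg K A B) (TT n) M" "n < 0" "c \<in> carrier (bar K T n)" for f n c
    unfolding zero by (rule restrict_ext) (rule f0[OF that(1,2) TPc[OF that(3)]])
  have \<Phi>: "(\<lambda>c. \<lambda>m\<in>carrier M. f (mp n (J n c) m)) \<in> mod_hom (env_alg K T T) (bar K T n) \<Lambda>"
    if f: "f \<in> mod_hom (env_alg K A B) (TT n) M" for f n
  proof (cases "n < 0")
    case True
    have "operates (env_alg K T T) (bar K T n)" by (rule bar_operates[OF T])
    then interpret X: abelian_group "bar K T n" by (simp add: operates_def)
    show ?thesis
      using \<Phi>neg[OF f True] bar_operates[OF T, of n] left_module_zero[OF \<Lambda>]
      by (intro mod_homI) (auto simp: operates_def)
  next
    case False
    then show ?thesis using hom f by simp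
  qed
  show "?\<Phi> n \<in> mod_hom K (obj (hom_cx (env_alg K A B) (tri_tens K A B M) (tri_tens_d K A B M) M) n)
      (obj (hom_cx (env_alg K T T) (bar K T) (bar_d K T) \<Lambda>) n)"
    unfolding hom_cx_simps
  proof (rule mod_homI)
    fix f assume f: "f \<in> carrier (hom_mod (env_alg K A B) (TT n) M)"
    show "?\<Phi> n f \<in> carrier (hom_mod (env_alg K T T) (bar K T n) \<Lambda>)"
      using restrict_mod_hom[OF bar_operates[OF T] \<Phi>] f by simp
    { fix g assume g: "g \<in> carrier (hom_mod (env_alg K A B) (TT n) M)"
      show "?\<Phi> n (f \<oplus>\<^bsub>hom_mod (env_alg K A B) (TT n) M\<^esub> g) =
          ?\<Phi> n f \<oplus>\<^bsub>hom_mod (env_alg K T T) (bar K T n) \<Lambda>\<^esub> ?\<Phi> n g"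
        unfolding hom_mod_simps by (rule restrict_ext) (simp add: add TPc cong: restrict_cong) }
    fix k assume k: "k \<in> carrier K"
    show "?\<Phi> n (k \<odot>\<^bsub>hom_mod (env_alg K A B) (TT n) M\<^esub> f) = k \<odot>\<^bsub>hom_mod (env_alg K T T) (bar K T n) \<Lambda>\<^esub> ?\<Phi> n f"
      unfolding hom_mod_simps
    proof (rule restrict_ext)
      fix c assume c: "c \<in> carrier (bar K T n)"
      have cl: "(\<lambda>m\<in>carrier M. f (mp n (J n c) m)) \<in> carrier \<Lambda>"
        using mod_hom_closed[OF \<Phi> c] f by simp
      show "(\<lambda>m\<in>carrier M. (\<lambda>x\<in>carrier (TT n). k \<odot>\<^bsub>k_res (env_alg K A B) M\<^esub> f x) (mp n (J n c) m)) =
          k \<odot>\<^bsub>k_res (env_alg K T T) \<Lambda>\<^esub> ?\<Phi> n f c"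
        unfolding restrict_apply'[OF c] smult[OF k cl]
        by (rule restrict_ext) (simp add: TPc[OF c])
    qed
  qed
  fix f assume "f \<in> carrier (obj (hom_cx (env_alg K A B) (tri_tens K A B M) (tri_tens_d K A B M) M) n)"
  then have f: "f \<in> mod_hom (env_alg K A B) (TT n) M" by (simp add: hom_cx_simps)
  show "?\<Phi> (n + 1) (diff (hom_cx (env_alg K A B) (tri_tens K A B M) (tri_tens_d K A B M) M) n f) =
      diff (hom_cx (env_alg K T T) (bar K T) (bar_d K T) \<Lambda>) n (?\<Phi> n f)"
    unfolding hom_cx_simps
  proof (rule restrict_ext)
    fix c assume c: "c \<in> carrier (bar K T (n + 1))"
    have dc: "bar_d K T (n + 1) c \<in> carrier (bar K T n)" by (rule mod_hom_closed[OF bar_d_hom[OF T] c])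
    have tc: "mp (n + 1) (J (n + 1) c) m \<in> carrier (TT (n + 1))" if "m \<in> carrier M" for m
      by (rule TPc[OF c that])
    have "(\<lambda>m\<in>carrier M. (\<lambda>x\<in>carrier (TT (n + 1)). f (tri_tens_d K A B M (n + 1) x)) (mp (n + 1) (J (n + 1) c) m)) =
        (\<lambda>m\<in>carrier M. f (tri_tens_d K A B M (n + 1) (mp (n + 1) (J (n + 1) c) m)))"
      by (rule restrict_ext) (rule restrict_apply'[OF tc])
    also have "\<dots> = (\<lambda>m\<in>carrier M. f (mp n (J n (bar_d K T (n + 1) c)) m))"
    proof (rule restrict_ext)
      fix m assume m: "m \<in> carrier M"
      show "f (tri_tens_d K A B M (n + 1) (mp (n + 1) (J (n + 1) c) m)) = f (mp n (J n (bar_d K T (n + 1) c)) m)"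
      proof (cases "n < 0")
        case True
        show ?thesis
          unfolding f0[OF f True TPc[OF dc m]]
            f0[OF f True mod_hom_closed[OF tri_tens_d_hom[OF A B M] tc[OF m]]] ..
      next
        case False
        then have n: "0 \<le> n" "0 \<le> n + 1" by auto
        have c': "c \<in> carrier (bar_aug K T (n + 1))" using c unfolding bar_simps[OF T n(2)] .
        show ?thesis
          unfolding tri_tens_d_pure[OF A B M Jc[OF c] m] d[OF n(1) c'] bar_d_simps(2)[OF T n(1)] ..
      qed
    qed
    also have "\<dots> = ?\<Phi> n f (bar_d K T (n + 1) c)" unfolding restrict_apply'[OF dc] ..
    finally show "(\<lambda>m\<in>carrier M. (\<lambda>x\<in>carrier (TT (n + 1)). f (tri_tens_d K A B M (n + 1) x)) (mp (n + 1) (J (n + 1) c) m)) =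
      ?\<Phi> n f (bar_d K T (n + 1) c)" .
  qed
qed

private lemma tri_tens_hom_rules:
  assumes f: "f \<in> mod_hom (env_alg K A B) (TT n) M" and x: "x \<in> carrier (tri K A B n)" and m: "m \<in> carrier M"
  shows "f (mp n x m) \<in> carrier M"
    "x' \<in> carrier (tri K A B n) \<Longrightarrow> f (mp n (x \<oplus>\<^bsub>tri K A B n\<^esub> x') m) = f (mp n x m) \<oplus>\<^bsub>M\<^esub> f (mp n x' m)"
    "m' \<in> carrier M \<Longrightarrow> f (mp n x (m \<oplus>\<^bsub>M\<^esub> m')) = f (mp n x m) \<oplus>\<^bsub>M\<^esub> f (mp n x m')"
    "t \<in> carrier (env_alg K A B) \<Longrightarrow> f (mp n x (t \<odot>\<^bsub>M\<^esub> m)) = f (mp n (tri_ract K A B n x t) m)"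
    "t \<in> carrier (env_alg K A B) \<Longrightarrow> t \<odot>\<^bsub>M\<^esub> f (mp n x m) = f (mp n (tri_lact K A B n t x) m)"
proof -
  note TPb = tri_tens_pure_bilin[OF A B M] and s = tri_tens_simps[OF A B M]
  show "f (mp n x m) \<in> carrier M" by (rule mod_hom_closed[OF f tri_tens_pure_closed[OF x m]])
  show "x' \<in> carrier (tri K A B n) \<Longrightarrow> f (mp n (x \<oplus>\<^bsub>tri K A B n\<^esub> x') m) = f (mp n x m) \<oplus>\<^bsub>M\<^esub> f (mp n x' m)"
    using mod_hom_add[OF f tri_tens_pure_closed[OF x m] tri_tens_pure_closed[OF _ m], of x'] bilin_rules(1)[OF TPb x, of x' m] m
    by (simp add: s)
  show "m' \<in> carrier M \<Longrightarrow> f (mp n x (m \<oplus>\<^bsub>M\<^esub> m')) = f (mp n x m) \<oplus>\<^bsub>M\<^esub> f (mp n x m')"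
    using mod_hom_add[OF f tri_tens_pure_closed[OF x m] tri_tens_pure_closed[OF x], of m'] bilin_rules(2)[OF TPb x, of m m'] m
    by (simp add: s)
  show "t \<in> carrier (env_alg K A B) \<Longrightarrow> f (mp n x (t \<odot>\<^bsub>M\<^esub> m)) = f (mp n (tri_ract K A B n x t) m)"
    using tri_tens_pure_balanced[OF A B M x _ m] by simp
  show "t \<in> carrier (env_alg K A B) \<Longrightarrow> t \<odot>\<^bsub>M\<^esub> f (mp n x m) = f (mp n (tri_lact K A B n t x) m)"
    using mod_hom_smult[OF f _ tri_tens_pure_closed[OF x m]] tri_tens_smult_pure[OF A B M _ x m] by simp
qed

private lemmas env_pu = env_pure_closed[OF A B M]

subsection \<open>The edge given by \<open>A\<close>\<close>

text \<open>The inclusion of the bar complex of \<open>A\<close> as the edge \<open>q = -1\<close>, \<open>c \<mapsto> c \<otimes> 1\<close>.\<close>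

definition edge_A :: "int \<Rightarrow> ('a list \<Rightarrow> 'k) set \<Rightarrow> ('k, 'a, 'b) tri_elt" where
  "edge_A n c = incl n (n, -1) (xy n (-1) c (tpow_pure K (op_alg B) [\<one>\<^bsub>B\<^esub>]))"

private lemmas uB = unit_tensor[OF Bo, simplified op_alg_simps]

private lemma iA: "0 \<le> n \<Longrightarrow> (n, -1) \<in> tri_index n"
  by (simp add: tri_index_def)

lemma edge_A_hom: "0 \<le> n \<Longrightarrow> edge_A n \<in> mod_hom K (bar_aug K A n) (tri K A B n)"
  unfolding edge_A_def[abs_def]
  by (rule mod_hom_comp[OF bilin_homs(1)[OF tens_pure_bilin[OF mX' mY'] uB(3)[OF B.A.one_closed]] tri_incl_hom[OF iA]])

text \<open>The first two equations make the induced cochain \<open>A\<close>-bilinear. The third holds because \<open>b 1 = 1 b\<close>; moved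
  across the tensor product with \<open>M\<close> it says that the value of the cochain on \<open>c\<close> commutes with \<open>b\<close>, so
  that it is an endomorphism over \<open>B\<^sup>o\<close>.\<close>

lemma edge_A_act:
  assumes n: "0 \<le> n" and c: "c \<in> carrier (bar_aug K A n)"
  shows "a \<in> carrier A \<Longrightarrow> tri_lact K A B n (ab a \<one>\<^bsub>B\<^esub>) (edge_A n c) = edge_A n (tpow_lact K A (nat (n + 2)) a c)"
    "a \<in> carrier A \<Longrightarrow> tri_ract K A B n (edge_A n c) (ab a \<one>\<^bsub>B\<^esub>) = edge_A n (tpow_ract K A (nat (n + 2)) c a)"
    "b \<in> carrier B \<Longrightarrow> tri_lact K A B n (ab \<one>\<^bsub>A\<^esub> b) (edge_A n c) = tri_ract K A B n (edge_A n c) (ab \<one>\<^bsub>A\<^esub> b)"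
proof -
  have n': "-1 \<le> n" using n by simp
  note u1 = uB(3)[OF B.A.one_closed]
  show "a \<in> carrier A \<Longrightarrow> tri_lact K A B n (ab a \<one>\<^bsub>B\<^esub>) (edge_A n c) = edge_A n (tpow_lact K A (nat (n + 2)) a c)"
    unfolding edge_A_def using tri_incl_lact[OF iA[OF n] _ B.A.one_closed c u1] uB(1)[OF B.A.one_closed] by simp
  show "a \<in> carrier A \<Longrightarrow> tri_ract K A B n (edge_A n c) (ab a \<one>\<^bsub>B\<^esub>) = edge_A n (tpow_ract K A (nat (n + 2)) c a)"
    unfolding edge_A_def using tri_incl_ract[OF iA[OF n] _ B.A.one_closed c u1] uB(2)[OF B.A.one_closed] by simp
  show "b \<in> carrier B \<Longrightarrow> tri_lact K A B n (ab \<one>\<^bsub>A\<^esub> b) (edge_A n c) = tri_ract K A B n (edge_A n c) (ab \<one>\<^bsub>A\<^esub> b)"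
    unfolding edge_A_def
    using tri_incl_lact[OF iA[OF n] A.A.one_closed _ c u1, of b] tri_incl_ract[OF iA[OF n] A.A.one_closed _ c u1, of b]
      uB(1,2)[of b] by (simp add: bar_aug_act_one[OF A n' c])
qed

text \<open>The component \<open>1 \<otimes> d\<close> of the differential would come from \<open>q = 0\<close>, where an element of the edge vanishes.\<close>

lemma edge_A_d:
  assumes n: "0 \<le> n" and c: "c \<in> carrier (bar_aug K A (n + 1))"
  shows "tri_d K A B (n + 1) (edge_A (n + 1) c) = edge_A n (bar_aug_d K A (n + 1) c)"
proof (rule tri_eqI[OF A B])
  have n1: "0 \<le> n + 1" and n': "-1 \<le> n" using n by auto
  note ec = mod_hom_closed[OF edge_A_hom[OF n1] c]
  note dc = mod_hom_closed[OF bar_aug_d_hom[OF A n'] c]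
  note u1 = uB(3)[OF B.A.one_closed]
  show "tri_d K A B (n + 1) (edge_A (n + 1) c) \<in> carrier (tri K A B n)"
    by (rule mod_hom_closed[OF tri_d_hom[OF A B] ec])
  show "edge_A n (bar_aug_d K A (n + 1) c) \<in> carrier (tri K A B n)"
    by (rule mod_hom_closed[OF edge_A_hom[OF n] dc])
  fix p q assume i: "(p, q) \<in> tri_index n"
  note j = tri_index_D[OF i]
  interpret S: module K "XY p q" by (rule tri_summand_module[OF A B])
  note k = ksign_closed[OF A]
  have e2: "edge_A (n + 1) c (p, q + 1) = \<zero>\<^bsub>XY p (q + 1)\<^esub>"
    unfolding edge_A_def tri_incl_apply[OF j(4)] using j(2) by simp
  have d2: "tens_map K (bar_aug K A p) (bar_aug K (op_alg B) q) id (bar_aug_d K (op_alg B) (q + 1)) (\<zero>\<^bsub>XY p (q + 1)\<^esub>) = \<zero>\<^bsub>XY p q\<^esub>"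
    by (rule mod_hom_zero[OF d2_hom[OF A B j(2)] module.axioms(2)[OF tri_summand_module[OF A B]] S.abelian_group_axioms])
  have e1: "tens_map K (bar_aug K A p) (bar_aug K (op_alg B) q) (bar_aug_d K A (p + 1)) id (edge_A (n + 1) c (p + 1, q)) =
      edge_A n (bar_aug_d K A (n + 1) c) (p, q)"
  proof (cases "p = n")
    case True
    then have q: "q = -1" using i by (simp add: tri_index_def)
    show ?thesis
      unfolding edge_A_def tri_incl_apply[OF j(3)] tri_incl_apply[OF i]
      using tens_map_pure[OF mX' mY' mX' mY' bar_aug_d_hom[OF A n'] mod_hom_id c u1] True q by simp
  next
    case False
    show ?thesis
      unfolding edge_A_def tri_incl_apply[OF j(3)] tri_incl_apply[OF i]
      using False mod_hom_zero[OF d1_hom[OF A B j(1)] module.axioms(2)[OF tri_summand_module[OF A B]] S.abelian_group_axioms]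
      by simp
  qed
  have c1: "edge_A n (bar_aug_d K A (n + 1) c) (p, q) \<in> carrier (XY p q)"
    by (rule tri_closed[OF A B mod_hom_closed[OF edge_A_hom[OF n] dc] i])
  show "tri_d K A B (n + 1) (edge_A (n + 1) c) (p, q) = edge_A n (bar_aug_d K A (n + 1) c) (p, q)"
    unfolding tri_d_eq[OF A B] restrict_apply'[OF i] case_prod_conv e1 e2 d2
    using c1 k by (simp add: S.smult_r_null)
qed

lemma iA_chain_map: "chain_map K (tri_cx K A B M) (hoch_cx K A (End_Bo K A B M)) (iA_map K A B M)"
proof -
  note fcts = End_Bo_facts[OF A B M]
  note bs = bimod_simps[OF A A fcts]
  interpret L: left_module "env_alg K A A" "End_Bo K A B M" by (rule End_Bo_left_module[OF A B M])
  have "chain_map K (tri_cx K A B M) (hoch_cx K A (End_Bo K A B M))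
    (\<lambda>n f. \<lambda>c\<in>carrier (bar K A n). \<lambda>m\<in>carrier M. f (mp n (edge_A n c) m))"
  proof (rule edge_chain_map[OF A End_Bo_left_module[OF A B M]])
    show "\<zero>\<^bsub>End_Bo K A B M\<^esub> = (\<lambda>m\<in>carrier M. \<zero>\<^bsub>M\<^esub>)"
      unfolding End_Bo_def bs by (simp add: res_more_simps[OF A B M])
    show "f \<oplus>\<^bsub>End_Bo K A B M\<^esub> g = (\<lambda>m\<in>carrier M. f m \<oplus>\<^bsub>M\<^esub> g m)" for f g
      unfolding End_Bo_def bs by (simp add: res_more_simps[OF A B M])
    show "k \<odot>\<^bsub>k_res (env_alg K A A) (End_Bo K A B M)\<^esub> f = (\<lambda>m\<in>carrier M. k \<odot>\<^bsub>k_res (env_alg K A B) M\<^esub> f m)"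
      if "k \<in> carrier K" "f \<in> carrier (End_Bo K A B M)" for k f
    proof -
      have f: "f \<in> carrier (hom_mod (op_alg B) (res_Bo K A B M) (res_Bo K A B M))"
        using that(2) unfolding End_Bo_def bs .
      have "k \<odot>\<^bsub>k_res (env_alg K A A) (End_Bo K A B M)\<^esub> f = k \<odot>\<^bsub>hom_mod (op_alg B) (res_Bo K A B M) (res_Bo K A B M)\<^esub> f"
        unfolding End_Bo_def
        by (rule bimod_k_res[OF A A fcts that(1) f]; rule End_unit_laws[OF res_commuting(1)[OF A B M], folded res_simps(1,2)]; assumption)
      then show ?thesis
        using that(1) by (simp add: res_more_simps[OF A B M] res_k_env[OF A B M])
    qed
    show "edge_A n c = \<zero>\<^bsub>tri K A B n\<^esub>" if "n < 0" for n c
      unfolding edge_A_def by (rule tri_incl_neg[OF that])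
    show "edge_A n c \<in> carrier (tri K A B n)" if "0 \<le> n" "c \<in> carrier (bar_aug K A n)" for n c
      by (rule mod_hom_closed[OF edge_A_hom[OF that(1)] that(2)])
    show "tri_d K A B (n + 1) (edge_A (n + 1) c) = edge_A n (bar_aug_d K A (n + 1) c)"
      if "0 \<le> n" "c \<in> carrier (bar_aug K A (n + 1))" for n c by (rule edge_A_d[OF that])
    fix n f assume n: "(0::int) \<le> n" and f: "f \<in> mod_hom (env_alg K A B) (TT n) M"
    have n': "-1 \<le> n" using n by simp
    note R = tri_tens_hom_rules[OF f]
    note ec = mod_hom_closed[OF edge_A_hom[OF n]]
    have cl: "(\<lambda>m\<in>carrier M. f (mp n (edge_A n c) m)) \<in> carrier (hom_mod (op_alg B) (res_Bo K A B M) (res_Bo K A B M))"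
      if c: "c \<in> carrier (bar_aug K A n)" for c
    proof -
      note R = R[OF ec[OF c]]
      have "(\<lambda>m\<in>carrier M. f (mp n (edge_A n c) m)) \<in> mod_hom (op_alg B) (res_Bo K A B M) (res_Bo K A B M)"
        by (rule mod_homI)
           (simp_all add: res_more_simps[OF A B M] R res_simps(4) env_pu M.smult_closed edge_A_act(3)[OF n c])
      then show ?thesis by (simp add: res_more_simps[OF A B M])
    qed
    show "(\<lambda>c. \<lambda>m\<in>carrier M. f (mp n (edge_A n c) m)) \<in> mod_hom (env_alg K A A) (bar K A n) (End_Bo K A B M)"
    proof (rule bar_mod_homI[OF A n L.abelian_group_axioms])
      show "(\<lambda>m\<in>carrier M. f (mp n (edge_A n c) m)) \<in> carrier (End_Bo K A B M)"
        if "c \<in> carrier (bar_aug K A n)" for c unfolding End_Bo_def bs by (rule cl[OF that])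
      show "(\<lambda>m\<in>carrier M. f (mp n (edge_A n (c \<oplus>\<^bsub>bar_aug K A n\<^esub> c')) m)) =
          (\<lambda>m\<in>carrier M. f (mp n (edge_A n c) m)) \<oplus>\<^bsub>End_Bo K A B M\<^esub> (\<lambda>m\<in>carrier M. f (mp n (edge_A n c') m))"
        if "c \<in> carrier (bar_aug K A n)" "c' \<in> carrier (bar_aug K A n)" for c c'
        unfolding End_Bo_def bs hom_mod_simps res_more_simps[OF A B M] mod_hom_add[OF edge_A_hom[OF n] that]
        by (rule restrict_ext) (simp add: R(2)[OF ec[OF that(1)] _ ec[OF that(2)]])
      fix a b c assume a: "a \<in> carrier A" and b: "b \<in> carrier A" and c: "c \<in> carrier (bar_aug K A n)"
      note lc = bilin_closed[OF bar_aug_lact_bilin[OF A n'] a]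
      note rc = bilin_closed[OF bar_aug_ract_bilin[OF A n'] c b]
      show "(\<lambda>m\<in>carrier M. f (mp n (edge_A n (tpow_ract K A (nat (n + 2)) (tpow_lact K A (nat (n + 2)) a c) b)) m)) =
          tens_pure K A (op_alg A) a b \<odot>\<^bsub>End_Bo K A B M\<^esub> (\<lambda>m\<in>carrier M. f (mp n (edge_A n c) m))"
        unfolding End_Bo_def bimod_pure[OF A A fcts a b cl[OF c]] bar_aug_lact_ract[OF A n' a b c, symmetric]
      proof (rule restrict_ext)
        fix m assume m: "m \<in> carrier M"
        have bm: "ab b \<one>\<^bsub>B\<^esub> \<odot>\<^bsub>M\<^esub> m \<in> carrier M" using b m by (simp add: M.smult_closed env_pu)
        have am: "ab a \<one>\<^bsub>B\<^esub> \<odot>\<^bsub>M\<^esub> (f (mp n (edge_A n c) (ab b \<one>\<^bsub>B\<^esub> \<odot>\<^bsub>M\<^esub> m))) =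
            f (mp n (edge_A n (tpow_lact K A (nat (n + 2)) a (tpow_ract K A (nat (n + 2)) c b))) m)"
          using R(4)[OF ec[OF c] m env_pu[OF b B.A.one_closed]] R(5)[OF ec[OF rc] m env_pu[OF a B.A.one_closed]]
          by (simp add: edge_A_act[OF n c] edge_A_act[OF n rc] a b)
        show "f (mp n (edge_A n (tpow_lact K A (nat (n + 2)) a (tpow_ract K A (nat (n + 2)) c b))) m) =
            (\<lambda>m\<in>carrier M. a \<odot>\<^bsub>res_A K A B M\<^esub> (\<lambda>m\<in>carrier M. f (mp n (edge_A n c) m)) m) (b \<odot>\<^bsub>res_A K A B M\<^esub> m)"
          unfolding res_simps(3) using am bm by simp
      qed
    qed (rule L.smult_l_distr)
  qed
  then show ?thesis unfolding edge_A_def iA_map_def[abs_def] .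
qed

subsection \<open>The edge given by \<open>B\<close>\<close>

text \<open>The edge \<open>p = -1\<close> carries the bar complex of \<open>B\<^sup>o\<close>, so the bar complex of \<open>B\<close> enters it through
  reversal. Reversal turns left multiplications into right ones, as the bimodule structure of the
  \<open>A\<close>-linear endomorphisms requires.\<close>

definition edge_B :: "int \<Rightarrow> ('b list \<Rightarrow> 'k) set \<Rightarrow> ('k, 'a, 'b) tri_elt" where
  "edge_B n c = incl n (-1, n) (xy (-1) n (tpow_pure K A [\<one>\<^bsub>A\<^esub>]) (bar_rev K B n c))"

private lemmas uA = unit_tensor[OF A]

private lemma iB: "0 \<le> n \<Longrightarrow> (-1, n) \<in> tri_index n"
  by (simp add: tri_index_def)

lemma edge_B_hom: "0 \<le> n \<Longrightarrow> edge_B n \<in> mod_hom K (bar_aug K B n) (tri K A B n)"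
  unfolding edge_B_def[abs_def]
  by (rule mod_hom_comp[OF bar_rev_hom[OF B] mod_hom_comp[OF bilin_homs(2)[OF tens_pure_bilin[OF mX' mY']
        uA(3)[OF A.A.one_closed]] tri_incl_hom[OF iB]]])

lemma edge_B_act:
  assumes n: "0 \<le> n" and c: "c \<in> carrier (bar_aug K B n)"
  shows "b \<in> carrier B \<Longrightarrow> tri_lact K A B n (ab \<one>\<^bsub>A\<^esub> b) (edge_B n c) = edge_B n (tpow_ract K B (nat (n + 2)) c b)"
    "b \<in> carrier B \<Longrightarrow> tri_ract K A B n (edge_B n c) (ab \<one>\<^bsub>A\<^esub> b) = edge_B n (tpow_lact K B (nat (n + 2)) b c)"
    "a \<in> carrier A \<Longrightarrow> tri_lact K A B n (ab a \<one>\<^bsub>B\<^esub>) (edge_B n c) = tri_ract K A B n (edge_B n c) (ab a \<one>\<^bsub>B\<^esub>)"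
proof -
  have n': "-1 \<le> n" using n by simp
  note u1 = uA(3)[OF A.A.one_closed]
  note rc = mod_hom_closed[OF bar_rev_hom[OF B n] c]
  show "b \<in> carrier B \<Longrightarrow> tri_lact K A B n (ab \<one>\<^bsub>A\<^esub> b) (edge_B n c) = edge_B n (tpow_ract K B (nat (n + 2)) c b)"
    unfolding edge_B_def using tri_incl_lact[OF iB[OF n] A.A.one_closed _ u1 rc, of b] uA(1)[OF A.A.one_closed]
      bar_rev_ract[OF B n _ c, of b] by simp
  show "b \<in> carrier B \<Longrightarrow> tri_ract K A B n (edge_B n c) (ab \<one>\<^bsub>A\<^esub> b) = edge_B n (tpow_lact K B (nat (n + 2)) b c)"
    unfolding edge_B_def using tri_incl_ract[OF iB[OF n] A.A.one_closed _ u1 rc, of b] uA(2)[OF A.A.one_closed]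
      bar_rev_lact[OF B n _ c, of b] by simp
  show "a \<in> carrier A \<Longrightarrow> tri_lact K A B n (ab a \<one>\<^bsub>B\<^esub>) (edge_B n c) = tri_ract K A B n (edge_B n c) (ab a \<one>\<^bsub>B\<^esub>)"
    unfolding edge_B_def
    using tri_incl_lact[OF iB[OF n] _ B.A.one_closed u1 rc, of a] tri_incl_ract[OF iB[OF n] _ B.A.one_closed u1 rc, of a]
      uA(1,2)[of a] bar_aug_act_one[OF Bo n' rc, simplified op_alg_simps] by simp
qed

text \<open>On this edge the sign of \<open>1 \<otimes> d\<close> is \<open>(-1)^0\<close>.\<close>

lemma edge_B_d:
  assumes n: "0 \<le> n" and c: "c \<in> carrier (bar_aug K B (n + 1))"
  shows "tri_d K A B (n + 1) (edge_B (n + 1) c) = edge_B n (bar_aug_d K B (n + 1) c)"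
proof (rule tri_eqI[OF A B])
  have n1: "0 \<le> n + 1" and n': "-1 \<le> n" using n by auto
  note ec = mod_hom_closed[OF edge_B_hom[OF n1] c]
  note dc = mod_hom_closed[OF bar_aug_d_hom[OF B n'] c]
  note u1 = uA(3)[OF A.A.one_closed]
  note rc = mod_hom_closed[OF bar_rev_hom[OF B n1] c]
  show "tri_d K A B (n + 1) (edge_B (n + 1) c) \<in> carrier (tri K A B n)"
    by (rule mod_hom_closed[OF tri_d_hom[OF A B] ec])
  show "edge_B n (bar_aug_d K B (n + 1) c) \<in> carrier (tri K A B n)"
    by (rule mod_hom_closed[OF edge_B_hom[OF n] dc])
  fix p q assume i: "(p, q) \<in> tri_index n"
  note j = tri_index_D[OF i]
  interpret S: module K "XY p q" by (rule tri_summand_module[OF A B])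
  note k = ksign_closed[OF A]
  have e1: "edge_B (n + 1) c (p + 1, q) = \<zero>\<^bsub>XY (p + 1) q\<^esub>"
    unfolding edge_B_def tri_incl_apply[OF j(3)] using j(1) by simp
  have d1: "tens_map K (bar_aug K A p) (bar_aug K (op_alg B) q) (bar_aug_d K A (p + 1)) id (\<zero>\<^bsub>XY (p + 1) q\<^esub>) = \<zero>\<^bsub>XY p q\<^esub>"
    by (rule mod_hom_zero[OF d1_hom[OF A B j(1)] module.axioms(2)[OF tri_summand_module[OF A B]] S.abelian_group_axioms])
  have c1: "edge_B n (bar_aug_d K B (n + 1) c) (p, q) \<in> carrier (XY p q)"
    by (rule tri_closed[OF A B mod_hom_closed[OF edge_B_hom[OF n] dc] i])
  have e2: "ksign K (nat (p + 1)) \<odot>\<^bsub>XY p q\<^esub>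
      tens_map K (bar_aug K A p) (bar_aug K (op_alg B) q) id (bar_aug_d K (op_alg B) (q + 1)) (edge_B (n + 1) c (p, q + 1)) =
      edge_B n (bar_aug_d K B (n + 1) c) (p, q)"
  proof (cases "q = n")
    case True
    then have p: "p = -1" using i by (simp add: tri_index_def)
    show ?thesis
      using tens_map_pure[OF mX' mY' mX' mY' mod_hom_id bar_aug_d_hom[OF Bo n'] u1 rc] True p bar_rev_d[OF B n c] S.smult_one[OF c1]
      unfolding edge_B_def tri_incl_apply[OF j(4)] tri_incl_apply[OF i] by simp
  next
    case False
    show ?thesis
      unfolding edge_B_def tri_incl_apply[OF j(4)] tri_incl_apply[OF i]
      using False mod_hom_zero[OF d2_hom[OF A B j(2)] module.axioms(2)[OF tri_summand_module[OF A B]] S.abelian_group_axioms] k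
      by (simp add: S.smult_r_null)
  qed
  show "tri_d K A B (n + 1) (edge_B (n + 1) c) (p, q) = edge_B n (bar_aug_d K B (n + 1) c) (p, q)"
    unfolding tri_d_eq[OF A B] restrict_apply'[OF i] case_prod_conv e1 e2 d1
    using c1 by simp
qed

lemma iB_chain_map: "chain_map K (tri_cx K A B M) (hoch_cx K B (End_A K A B M)) (iB_map K A B M)"
proof -
  note fcts = End_A_facts[OF A B M]
  note bs = bimod_simps[OF B B fcts]
  interpret L: left_module "env_alg K B B" "End_A K A B M" by (rule End_A_left_module[OF A B M])
  have "chain_map K (tri_cx K A B M) (hoch_cx K B (End_A K A B M))
    (\<lambda>n f. \<lambda>c\<in>carrier (bar K B n). \<lambda>m\<in>carrier M. f (mp n (edge_B n c) m))"
  proof (rule edge_chain_map[OF B End_A_left_module[OF A B M]])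
    show "\<zero>\<^bsub>End_A K A B M\<^esub> = (\<lambda>m\<in>carrier M. \<zero>\<^bsub>M\<^esub>)"
      unfolding End_A_def bs by (simp add: res_more_simps[OF A B M])
    show "f \<oplus>\<^bsub>End_A K A B M\<^esub> g = (\<lambda>m\<in>carrier M. f m \<oplus>\<^bsub>M\<^esub> g m)" for f g
      unfolding End_A_def bs by (simp add: res_more_simps[OF A B M])
    show "k \<odot>\<^bsub>k_res (env_alg K B B) (End_A K A B M)\<^esub> f = (\<lambda>m\<in>carrier M. k \<odot>\<^bsub>k_res (env_alg K A B) M\<^esub> f m)"
      if "k \<in> carrier K" "f \<in> carrier (End_A K A B M)" for k f
    proof -
      have f: "f \<in> carrier (hom_mod A (res_A K A B M) (res_A K A B M))"
        using that(2) unfolding End_A_def bs .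
      have "k \<odot>\<^bsub>k_res (env_alg K B B) (End_A K A B M)\<^esub> f = k \<odot>\<^bsub>hom_mod A (res_A K A B M) (res_A K A B M)\<^esub> f"
        unfolding End_A_def
        by (rule bimod_k_res[OF B B fcts that(1) f];
            rule End_unit_laws[OF res_commuting(2)[OF A B M], folded res_simps(1,2), simplified op_alg_simps]; assumption)
      then show ?thesis
        using that(1) by (simp add: res_more_simps[OF A B M] res_k_env[OF A B M])
    qed
    show "edge_B n c = \<zero>\<^bsub>tri K A B n\<^esub>" if "n < 0" for n c
      unfolding edge_B_def by (rule tri_incl_neg[OF that])
    show "edge_B n c \<in> carrier (tri K A B n)" if "0 \<le> n" "c \<in> carrier (bar_aug K B n)" for n c
      by (rule mod_hom_closed[OF edge_B_hom[OF that(1)] that(2)])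
    show "tri_d K A B (n + 1) (edge_B (n + 1) c) = edge_B n (bar_aug_d K B (n + 1) c)"
      if "0 \<le> n" "c \<in> carrier (bar_aug K B (n + 1))" for n c by (rule edge_B_d[OF that])
    fix n f assume n: "(0::int) \<le> n" and f: "f \<in> mod_hom (env_alg K A B) (TT n) M"
    have n': "-1 \<le> n" using n by simp
    note R = tri_tens_hom_rules[OF f]
    note ec = mod_hom_closed[OF edge_B_hom[OF n]]
    have cl: "(\<lambda>m\<in>carrier M. f (mp n (edge_B n c) m)) \<in> carrier (hom_mod A (res_A K A B M) (res_A K A B M))"
      if c: "c \<in> carrier (bar_aug K B n)" for c
    proof -
      note R = R[OF ec[OF c]]
      have "(\<lambda>m\<in>carrier M. f (mp n (edge_B n c) m)) \<in> mod_hom A (res_A K A B M) (res_A K A B M)"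
        by (rule mod_homI)
           (simp_all add: res_more_simps[OF A B M] R res_simps(3) env_pu M.smult_closed edge_B_act(3)[OF n c])
      then show ?thesis by (simp add: res_more_simps[OF A B M])
    qed
    show "(\<lambda>c. \<lambda>m\<in>carrier M. f (mp n (edge_B n c) m)) \<in> mod_hom (env_alg K B B) (bar K B n) (End_A K A B M)"
    proof (rule bar_mod_homI[OF B n L.abelian_group_axioms])
      show "(\<lambda>m\<in>carrier M. f (mp n (edge_B n c) m)) \<in> carrier (End_A K A B M)"
        if "c \<in> carrier (bar_aug K B n)" for c unfolding End_A_def bs by (rule cl[OF that])
      show "(\<lambda>m\<in>carrier M. f (mp n (edge_B n (c \<oplus>\<^bsub>bar_aug K B n\<^esub> c')) m)) =
          (\<lambda>m\<in>carrier M. f (mp n (edge_B n c) m)) \<oplus>\<^bsub>End_A K A B M\<^esub> (\<lambda>m\<in>carrier M. f (mp n (edge_B n c') m))"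
        if "c \<in> carrier (bar_aug K B n)" "c' \<in> carrier (bar_aug K B n)" for c c'
        unfolding End_A_def bs hom_mod_simps res_more_simps[OF A B M] mod_hom_add[OF edge_B_hom[OF n] that]
        by (rule restrict_ext) (simp add: R(2)[OF ec[OF that(1)] _ ec[OF that(2)]])
      fix a b c assume a: "a \<in> carrier B" and b: "b \<in> carrier B" and c: "c \<in> carrier (bar_aug K B n)"
      note lc = bilin_closed[OF bar_aug_lact_bilin[OF B n'] a c]
      show "(\<lambda>m\<in>carrier M. f (mp n (edge_B n (tpow_ract K B (nat (n + 2)) (tpow_lact K B (nat (n + 2)) a c) b)) m)) =
          tens_pure K B (op_alg B) a b \<odot>\<^bsub>End_A K A B M\<^esub> (\<lambda>m\<in>carrier M. f (mp n (edge_B n c) m))"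
        unfolding End_A_def bimod_pure[OF B B fcts a b cl[OF c]]
      proof (rule restrict_ext)
        fix m assume m: "m \<in> carrier M"
        have am: "ab \<one>\<^bsub>A\<^esub> a \<odot>\<^bsub>M\<^esub> m \<in> carrier M" using a m by (simp add: M.smult_closed env_pu)
        have bm: "ab \<one>\<^bsub>A\<^esub> b \<odot>\<^bsub>M\<^esub> (f (mp n (edge_B n c) (ab \<one>\<^bsub>A\<^esub> a \<odot>\<^bsub>M\<^esub> m))) =
            f (mp n (edge_B n (tpow_ract K B (nat (n + 2)) (tpow_lact K B (nat (n + 2)) a c) b)) m)"
          using R(4)[OF ec[OF c] m env_pu[OF A.A.one_closed a]] R(5)[OF ec[OF lc] m env_pu[OF A.A.one_closed b]]
          by (simp add: edge_B_act[OF n c] edge_B_act[OF n lc] a b)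
        show "f (mp n (edge_B n (tpow_ract K B (nat (n + 2)) (tpow_lact K B (nat (n + 2)) a c) b)) m) =
            b \<odot>\<^bsub>res_Bo K A B M\<^esub> (\<lambda>m\<in>carrier M. (\<lambda>m\<in>carrier M. f (mp n (edge_B n c) m)) (a \<odot>\<^bsub>res_Bo K A B M\<^esub> m)) m"
          unfolding res_simps(4) using am bm m by simp
      qed
    qed (rule L.smult_l_distr)
  qed
  then show ?thesis unfolding edge_B_def iB_map_def[abs_def] .
qed

end

section \<open>Cohomology and the Mayer-Vietoris sequence of a cartesian square\<close>

context abelian_group
begin

lemma minus_add_cancel':
  assumes "a \<in> carrier G" "b \<in> carrier G"
  shows "(a \<ominus> b) \<oplus> b = a" "b \<oplus> (a \<ominus> b) = a" "(b \<oplus> a) \<ominus> b = a" "a \<ominus> a = \<zero>"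
    "(a \<ominus> b) \<ominus> (\<zero> \<ominus> b) = a"
proof -
  show 1: "(a \<ominus> b) \<oplus> b = a" using assms by (simp add: a_minus_def a_assoc l_neg)
  show "b \<oplus> (a \<ominus> b) = a" using 1 assms by (simp add: a_comm)
  have "(b \<oplus> a) \<ominus> b = (a \<oplus> b) \<ominus> b" using assms by (simp add: a_comm)
  also have "\<dots> = a" using assms by (simp add: a_minus_def a_assoc r_neg)
  finally show "(b \<oplus> a) \<ominus> b = a" .
  show "a \<ominus> a = \<zero>" using assms by (simp add: a_minus_def r_neg)
  show "(a \<ominus> b) \<ominus> (\<zero> \<ominus> b) = a" using assms by (simp add: a_minus_def a_assoc l_neg)
qed

lemma eq_minusI:
  assumes "a \<in> carrier G" "b \<in> carrier G" "a \<oplus> b = c" shows "c \<ominus> b = a"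
  using assms minus_add_cancel'(3)[of a b] by (simp add: a_comm)

end

text \<open>The coset is formed in the module of cochains, whose addition restricts to that of the cocycles; the
  induced maps in cohomology are unions of cosets in this form.\<close>

definition coho_class :: "('k, 'x) cochain_complex \<Rightarrow> int \<Rightarrow> 'x \<Rightarrow> 'x set" where
  "coho_class X n x = coboundaries X n +>\<^bsub>obj X n\<^esub> x"

definition cocycles :: "('k, 'x) cochain_complex \<Rightarrow> int \<Rightarrow> 'x set" where
  "cocycles X n = {x \<in> carrier (obj X n). diff X n x = \<zero>\<^bsub>obj X (n + 1)\<^esub>}"

lemma cochain_rules:
  assumes X: "cochain K X"
  shows "x \<in> carrier (obj X n) \<Longrightarrow> diff X n x \<in> carrier (obj X (n + 1))"
    "x \<in> carrier (obj X n) \<Longrightarrow> y \<in> carrier (obj X n) \<Longrightarrow>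
      diff X n (x \<oplus>\<^bsub>obj X n\<^esub> y) = diff X n x \<oplus>\<^bsub>obj X (n + 1)\<^esub> diff X n y"
    "x \<in> carrier (obj X n) \<Longrightarrow> y \<in> carrier (obj X n) \<Longrightarrow>
      diff X n (x \<ominus>\<^bsub>obj X n\<^esub> y) = diff X n x \<ominus>\<^bsub>obj X (n + 1)\<^esub> diff X n y"
    "diff X n \<zero>\<^bsub>obj X n\<^esub> = \<zero>\<^bsub>obj X (n + 1)\<^esub>"
    "k \<in> carrier K \<Longrightarrow> x \<in> carrier (obj X n) \<Longrightarrow> diff X n (k \<odot>\<^bsub>obj X n\<^esub> x) = k \<odot>\<^bsub>obj X (n + 1)\<^esub> diff X n x"
    "x \<in> carrier (obj X n) \<Longrightarrow> diff X n x \<in> cocycles X (n + 1)"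
proof -
  note d = cochainD(2)[OF X, of n] and ab = module.axioms(2)[OF cochainD(1)[OF X]]
  show "x \<in> carrier (obj X n) \<Longrightarrow> diff X n x \<in> carrier (obj X (n + 1))" by (rule mod_hom_closed[OF d])
  then show "x \<in> carrier (obj X n) \<Longrightarrow> diff X n x \<in> cocycles X (n + 1)"
    using cochainD(3)[OF X] by (simp add: cocycles_def)
  show "x \<in> carrier (obj X n) \<Longrightarrow> y \<in> carrier (obj X n) \<Longrightarrow>
      diff X n (x \<oplus>\<^bsub>obj X n\<^esub> y) = diff X n x \<oplus>\<^bsub>obj X (n + 1)\<^esub> diff X n y" by (rule mod_hom_add[OF d])
  show "x \<in> carrier (obj X n) \<Longrightarrow> y \<in> carrier (obj X n) \<Longrightarrow>
      diff X n (x \<ominus>\<^bsub>obj X n\<^esub> y) = diff X n x \<ominus>\<^bsub>obj X (n + 1)\<^esub> diff X n y"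
    by (rule mod_hom_minus[OF d ab ab])
  show "diff X n \<zero>\<^bsub>obj X n\<^esub> = \<zero>\<^bsub>obj X (n + 1)\<^esub>" by (rule mod_hom_zero[OF d ab ab])
  show "k \<in> carrier K \<Longrightarrow> x \<in> carrier (obj X n) \<Longrightarrow> diff X n (k \<odot>\<^bsub>obj X n\<^esub> x) = k \<odot>\<^bsub>obj X (n + 1)\<^esub> diff X n x"
    by (rule mod_hom_smult[OF d])
qed

lemma chain_map_rules:
  assumes X: "cochain K X" and Y: "cochain K Y" and f: "chain_map K X Y f"
  shows "x \<in> carrier (obj X n) \<Longrightarrow> f n x \<in> carrier (obj Y n)"
    "x \<in> carrier (obj X n) \<Longrightarrow> y \<in> carrier (obj X n) \<Longrightarrow> f n (x \<oplus>\<^bsub>obj X n\<^esub> y) = f n x \<oplus>\<^bsub>obj Y n\<^esub> f n y"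
    "x \<in> carrier (obj X n) \<Longrightarrow> y \<in> carrier (obj X n) \<Longrightarrow> f n (x \<ominus>\<^bsub>obj X n\<^esub> y) = f n x \<ominus>\<^bsub>obj Y n\<^esub> f n y"
    "f n \<zero>\<^bsub>obj X n\<^esub> = \<zero>\<^bsub>obj Y n\<^esub>"
    "k \<in> carrier K \<Longrightarrow> x \<in> carrier (obj X n) \<Longrightarrow> f n (k \<odot>\<^bsub>obj X n\<^esub> x) = k \<odot>\<^bsub>obj Y n\<^esub> f n x"
    "x \<in> carrier (obj X n) \<Longrightarrow> f (n + 1) (diff X n x) = diff Y n (f n x)"
    "x \<in> cocycles X n \<Longrightarrow> f n x \<in> cocycles Y n"
proof -
  note h = chain_mapD(1)[OF f, of n]
    and ab = module.axioms(2)[OF cochainD(1)[OF X]] module.axioms(2)[OF cochainD(1)[OF Y]]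
  show c: "x \<in> carrier (obj X n) \<Longrightarrow> f n x \<in> carrier (obj Y n)" by (rule mod_hom_closed[OF h])
  show "x \<in> carrier (obj X n) \<Longrightarrow> y \<in> carrier (obj X n) \<Longrightarrow> f n (x \<oplus>\<^bsub>obj X n\<^esub> y) = f n x \<oplus>\<^bsub>obj Y n\<^esub> f n y"
    by (rule mod_hom_add[OF h])
  show "x \<in> carrier (obj X n) \<Longrightarrow> y \<in> carrier (obj X n) \<Longrightarrow> f n (x \<ominus>\<^bsub>obj X n\<^esub> y) = f n x \<ominus>\<^bsub>obj Y n\<^esub> f n y"
    by (rule mod_hom_minus[OF h ab])
  show "f n \<zero>\<^bsub>obj X n\<^esub> = \<zero>\<^bsub>obj Y n\<^esub>" by (rule mod_hom_zero[OF h ab])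
  show "k \<in> carrier K \<Longrightarrow> x \<in> carrier (obj X n) \<Longrightarrow> f n (k \<odot>\<^bsub>obj X n\<^esub> x) = k \<odot>\<^bsub>obj Y n\<^esub> f n x"
    by (rule mod_hom_smult[OF h])
  show "x \<in> carrier (obj X n) \<Longrightarrow> f (n + 1) (diff X n x) = diff Y n (f n x)" by (rule chain_mapD(2)[OF f])
  then show "x \<in> cocycles X n \<Longrightarrow> f n x \<in> cocycles Y n"
    using c mod_hom_zero[OF chain_mapD(1)[OF f, of "n + 1"] ab] unfolding cocycles_def by auto
qed

lemma cocycle_carrier: "x \<in> cocycles X n \<Longrightarrow> x \<in> carrier (obj X n)"
  by (simp add: cocycles_def)

context
  fixes K :: "('k, 'r) ring_scheme" and X :: "('k, 'x) cochain_complex"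
  assumes X: "cochain K X"
begin

interpretation O: module K "obj X n" for n by (rule cochainD(1)[OF X])

private lemma cocycle_mod_simps:
  "carrier (cocycle_mod X n) = cocycles X n" "add (cocycle_mod X n) = add (obj X n)"
  "zero (cocycle_mod X n) = zero (obj X n)" "smult (cocycle_mod X n) = smult (obj X n)"
  by (simp_all add: cocycle_mod_def cocycles_def)

private lemma cocycle_module: "module K (cocycle_mod X n)"
  unfolding cocycle_mod_def
  by (rule submodule.submodule_is_module[OF kernel_submodule[OF cochainD(1,1,2)[OF X]] cochainD(1)[OF X]])

lemma cocycles_closed:
  "\<zero>\<^bsub>obj X n\<^esub> \<in> cocycles X n"
  "x \<in> cocycles X n \<Longrightarrow> y \<in> cocycles X n \<Longrightarrow> x \<oplus>\<^bsub>obj X n\<^esub> y \<in> cocycles X n"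
  "x \<in> cocycles X n \<Longrightarrow> y \<in> cocycles X n \<Longrightarrow> x \<ominus>\<^bsub>obj X n\<^esub> y \<in> cocycles X n"
  "k \<in> carrier K \<Longrightarrow> x \<in> cocycles X n \<Longrightarrow> k \<odot>\<^bsub>obj X n\<^esub> x \<in> cocycles X n"
  by (auto simp: cocycles_def cochain_rules[OF X] O.minus_zero)

private lemma coboundary_submodule: "submodule (coboundaries X n) K (cocycle_mod X n)"
proof -
  interpret C: module K "cocycle_mod X n" by (rule cocycle_module)
  note r = cochain_rules[where n = "n - 1", OF X, simplified]
  have z: "\<zero>\<^bsub>obj X n\<^esub> \<in> coboundaries X n"
    unfolding coboundaries_def by (rule image_eqI[of _ _ "\<zero>\<^bsub>obj X (n - 1)\<^esub>"]) (simp_all add: r)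
  have s: "k \<odot>\<^bsub>obj X n\<^esub> x \<in> coboundaries X n" if kx: "k \<in> carrier K" "x \<in> coboundaries X n" for k x
  proof -
    obtain w where w: "w \<in> carrier (obj X (n - 1))" "x = diff X (n - 1) w" using kx by (auto simp: coboundaries_def)
    show ?thesis unfolding coboundaries_def
      by (rule image_eqI[of _ _ "k \<odot>\<^bsub>obj X (n - 1)\<^esub> w"]) (use kx w in \<open>simp_all add: r\<close>)
  qed
  have a: "x \<oplus>\<^bsub>obj X n\<^esub> y \<in> coboundaries X n" if xy: "x \<in> coboundaries X n" "y \<in> coboundaries X n" for x y
  proof -
    obtain v w where w: "v \<in> carrier (obj X (n - 1))" "x = diff X (n - 1) v"
      "w \<in> carrier (obj X (n - 1))" "y = diff X (n - 1) w" using xy by (auto simp: coboundaries_def)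
    show ?thesis unfolding coboundaries_def
      by (rule image_eqI[of _ _ "v \<oplus>\<^bsub>obj X (n - 1)\<^esub> w"]) (use w in \<open>simp_all add: r\<close>)
  qed
  have sub: "coboundaries X n \<subseteq> cocycles X n" using r by (auto simp: coboundaries_def)
  show ?thesis
  proof (rule C.submoduleI)
    fix x assume x: "x \<in> coboundaries X n"
    then have "x \<in> carrier (cocycle_mod X n)" using sub by (auto simp: cocycle_mod_simps)
    then have "\<ominus>\<^bsub>cocycle_mod X n\<^esub> x = (\<ominus>\<^bsub>K\<^esub> \<one>\<^bsub>K\<^esub>) \<odot>\<^bsub>cocycle_mod X n\<^esub> x" by (simp add: C.smult_l_minus)
    then show "\<ominus>\<^bsub>cocycle_mod X n\<^esub> x \<in> coboundaries X n" using s x by (simp add: cocycle_mod_simps)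
  qed (use z s a sub in \<open>auto simp: cocycle_mod_simps\<close>)
qed

private lemmas ctx = cocycle_module coboundary_submodule

private lemma coho_class_coset: "coboundaries X n +>\<^bsub>cocycle_mod X n\<^esub> x = coho_class X n x"
  unfolding coho_class_def by (rule r_coset_cong) (simp add: cocycle_mod_simps)

lemma cohomology_module: "module K (cohomology X n)"
  unfolding cohomology_def by (rule quot_mod_module[OF ctx])

lemma coho_class_closed: "x \<in> cocycles X n \<Longrightarrow> coho_class X n x \<in> carrier (cohomology X n)"
  using quot_closed[OF ctx, of x n] by (simp add: cocycle_mod_simps coho_class_coset cohomology_def)

lemma coho_class_cases:
  assumes "C \<in> carrier (cohomology X n)" obtains x where "x \<in> cocycles X n" "C = coho_class X n x"
  using quot_cases[OF ctx, of C n] assms by (auto simp: cocycle_mod_simps coho_class_coset cohomology_def)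

lemma coho_class_add: "x \<in> cocycles X n \<Longrightarrow> y \<in> cocycles X n \<Longrightarrow>
    coho_class X n x \<oplus>\<^bsub>cohomology X n\<^esub> coho_class X n y = coho_class X n (x \<oplus>\<^bsub>obj X n\<^esub> y)"
  using quot_add[OF ctx, of x n y] by (simp add: cocycle_mod_simps coho_class_coset cohomology_def)

lemma coho_class_smult: "k \<in> carrier K \<Longrightarrow> x \<in> cocycles X n \<Longrightarrow>
    k \<odot>\<^bsub>cohomology X n\<^esub> coho_class X n x = coho_class X n (k \<odot>\<^bsub>obj X n\<^esub> x)"
  using quot_smult[OF ctx, of k x n] by (simp add: cocycle_mod_simps coho_class_coset cohomology_def)

lemma coho_class_zero: "\<zero>\<^bsub>cohomology X n\<^esub> = coho_class X n \<zero>\<^bsub>obj X n\<^esub>"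
  using quot_zero[OF ctx, of n] by (simp add: cocycle_mod_simps coho_class_coset cohomology_def)

lemma coho_class_minus:
  assumes "x \<in> cocycles X n" "y \<in> cocycles X n"
  shows "coho_class X n x \<ominus>\<^bsub>cohomology X n\<^esub> coho_class X n y = coho_class X n (x \<ominus>\<^bsub>obj X n\<^esub> y)"
proof -
  interpret H: module K "cohomology X n" by (rule cohomology_module)
  show ?thesis
    using assms cocycles_closed(3)[OF assms] O.minus_add_cancel'(1)[OF cocycle_carrier[OF assms(1)] cocycle_carrier[OF assms(2)]]
    by (intro H.eq_minusI coho_class_closed) (simp_all add: coho_class_add)
qed

lemma coho_class_eqI:
  assumes "y \<in> cocycles X n" "w \<in> carrier (obj X (n - 1))" "x = diff X (n - 1) w \<oplus>\<^bsub>obj X n\<^esub> y"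
  shows "coho_class X n x = coho_class X n y"
proof -
  have "x \<in> coboundaries X n +>\<^bsub>cocycle_mod X n\<^esub> y"
    unfolding coho_class_coset coho_class_def a_r_coset_def' using assms by (auto simp: coboundaries_def cocycle_mod_simps)
  then show ?thesis
    using coset_elt(2)[OF ctx, of y n x] assms(1) by (simp add: cocycle_mod_simps coho_class_coset)
qed

lemma coho_class_eqE:
  assumes "coho_class X n x = coho_class X n y" "x \<in> cocycles X n"
  obtains w where "w \<in> carrier (obj X (n - 1))" "x = diff X (n - 1) w \<oplus>\<^bsub>obj X n\<^esub> y"
proof -
  have "x \<in> coho_class X n y" using coset_self[OF ctx, of x n] assms by (simp add: cocycle_mod_simps coho_class_coset)
  then show ?thesis using that by (auto simp: coho_class_def a_r_coset_def' coboundaries_def)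
qed

end

text \<open>The union that defines the induced map ranges over the representatives of a class. These differ by
  coboundaries, which are sent to coboundaries, so all terms of the union coincide.\<close>

lemma cohomology_map_coho_class:
  assumes X: "cochain K X" and Y: "cochain K Y" and f: "chain_map K X Y f" and x: "x \<in> cocycles X n"
  shows "cohomology_map Y f n (coho_class X n x) = coho_class Y n (f n x)"
proof -
  interpret X: module K "obj X m" for m by (rule cochainD(1)[OF X])
  interpret Y: module K "obj Y m" for m by (rule cochainD(1)[OF Y])
  note r = chain_map_rules[OF X Y f]
  have "coho_class Y n (f n y) = coho_class Y n (f n x)" if y: "y \<in> coho_class X n x" for y
  proof -
    obtain w where w: "w \<in> carrier (obj X (n - 1))" "y = diff X (n - 1) w \<oplus>\<^bsub>obj X n\<^esub> x"
      using y by (auto simp: coho_class_def a_r_coset_def' coboundaries_def)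
    have dw: "diff X (n - 1) w \<in> carrier (obj X n)" using cochain_rules(1)[OF X w(1)] by simp
    have "f n y = diff Y (n - 1) (f (n - 1) w) \<oplus>\<^bsub>obj Y n\<^esub> f n x"
      unfolding w(2) r(2)[OF dw cocycle_carrier[OF x]] using r(6)[OF w(1)] by simp
    then show ?thesis using r(1)[OF w(1)] r(7)[OF x] by (intro coho_class_eqI[OF Y])
  qed
  then have "(\<Union>y\<in>coho_class X n x. coho_class Y n (f n y)) = (\<Union>y\<in>coho_class X n x. coho_class Y n (f n x))"
    by (intro SUP_cong refl)
  moreover have "coho_class X n x \<noteq> {}"
  proof -
    have "\<zero>\<^bsub>obj X n\<^esub> \<in> coboundaries X n"
      unfolding coboundaries_def
      using cochain_rules(4)[OF X, of "n - 1"] by (intro image_eqI[of _ _ "\<zero>\<^bsub>obj X (n - 1)\<^esub>"]) simp_all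
    then show ?thesis by (auto simp: coho_class_def a_r_coset_def')
  qed
  ultimately show ?thesis by (simp add: cohomology_map_def coho_class_def)
qed

lemma cohomology_map_hom:
  assumes X: "cochain K X" and Y: "cochain K Y" and f: "chain_map K X Y f"
  shows "cohomology_map Y f n \<in> mod_hom K (cohomology X n) (cohomology Y n)"
proof (rule mod_homI)
  note r = chain_map_rules[OF X Y f] and m = cohomology_map_coho_class[OF X Y f]
  fix C assume "C \<in> carrier (cohomology X n)"
  then obtain x where x: "x \<in> cocycles X n" "C = coho_class X n x" by (rule coho_class_cases[OF X])
  show "cohomology_map Y f n C \<in> carrier (cohomology Y n)"
    unfolding x(2) m[OF x(1)] by (rule coho_class_closed[OF Y r(7)[OF x(1)]])
  { fix D assume "D \<in> carrier (cohomology X n)"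
    then obtain y where y: "y \<in> cocycles X n" "D = coho_class X n y" by (rule coho_class_cases[OF X])
    show "cohomology_map Y f n (C \<oplus>\<^bsub>cohomology X n\<^esub> D) = cohomology_map Y f n C \<oplus>\<^bsub>cohomology Y n\<^esub> cohomology_map Y f n D"
      unfolding x(2) y(2) coho_class_add[OF X x(1) y(1)] m[OF x(1)] m[OF y(1)] m[OF cocycles_closed(2)[OF X x(1) y(1)]]
        coho_class_add[OF Y r(7)[OF x(1)] r(7)[OF y(1)]] r(2)[OF cocycle_carrier[OF x(1)] cocycle_carrier[OF y(1)]] .. }
  fix k assume k: "k \<in> carrier K"
  show "cohomology_map Y f n (k \<odot>\<^bsub>cohomology X n\<^esub> C) = k \<odot>\<^bsub>cohomology Y n\<^esub> cohomology_map Y f n C"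
    unfolding x(2) coho_class_smult[OF X k x(1)] m[OF x(1)] m[OF cocycles_closed(4)[OF X k x(1)]]
      coho_class_smult[OF Y k r(7)[OF x(1)]] r(5)[OF k cocycle_carrier[OF x(1)]] ..
qed

lemma mod_hom_pair:
  "f \<in> mod_hom K X Y \<Longrightarrow> g \<in> mod_hom K X Z \<Longrightarrow> (\<lambda>x. (f x, g x)) \<in> mod_hom K X (prod_mod Y Z)"
  by (auto simp: mod_hom_def)

lemma mod_hom_difference:
  assumes Z: "module K Z" and f: "f \<in> mod_hom K X Z" and g: "g \<in> mod_hom K Y Z"
  shows "(\<lambda>(x, y). f x \<ominus>\<^bsub>Z\<^esub> g y) \<in> mod_hom K (prod_mod X Y) Z"
proof -
  interpret Z: module K Z by fact
  have 1: "(a \<oplus>\<^bsub>Z\<^esub> b) \<ominus>\<^bsub>Z\<^esub> (c \<oplus>\<^bsub>Z\<^esub> d) = (a \<ominus>\<^bsub>Z\<^esub> c) \<oplus>\<^bsub>Z\<^esub> (b \<ominus>\<^bsub>Z\<^esub> d)"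
    if "a \<in> carrier Z" "b \<in> carrier Z" "c \<in> carrier Z" "d \<in> carrier Z" for a b c d
    using that by (simp add: a_minus_def Z.minus_add Z.add_swap)
  show ?thesis
    by (rule mod_homI)
       (auto simp: mod_hom_closed[OF f] mod_hom_closed[OF g] mod_hom_add[OF f] mod_hom_add[OF g]
         mod_hom_smult[OF f] mod_hom_smult[OF g] 1, auto simp: a_minus_def Z.smult_r_distr Z.smult_r_minus
         mod_hom_closed[OF f] mod_hom_closed[OF g])
qed

text \<open>A square that is cartesian in each degree and whose edge \<open>q1\<close> is surjective. Equivalently
  \<open>0 \<rightarrow> P \<rightarrow> X \<times> Y \<rightarrow> Z \<rightarrow> 0\<close>, with the difference of \<open>q1\<close> and \<open>q2\<close> as second map, is a short exact
  sequence of complexes in which elements of \<open>Z\<close> lift already to \<open>X\<close>.\<close>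

locale cartesian_square =
  fixes K :: "('k, 'r) ring_scheme" and P :: "('k, 'p) cochain_complex" and X :: "('k, 'x) cochain_complex"
    and Y :: "('k, 'y) cochain_complex" and Z :: "('k, 'z) cochain_complex"
    and p1 :: "int \<Rightarrow> 'p \<Rightarrow> 'x" and p2 :: "int \<Rightarrow> 'p \<Rightarrow> 'y" and q1 :: "int \<Rightarrow> 'x \<Rightarrow> 'z" and q2 :: "int \<Rightarrow> 'y \<Rightarrow> 'z"
  assumes cochains: "cochain K P" "cochain K X" "cochain K Y" "cochain K Z"
    and maps: "chain_map K P X p1" "chain_map K P Y p2" "chain_map K X Z q1" "chain_map K Y Z q2"
    and commutes: "w \<in> carrier (obj P n) \<Longrightarrow> q1 n (p1 n w) = q2 n (p2 n w)"
    and joint_inj: "w \<in> carrier (obj P n) \<Longrightarrow> w' \<in> carrier (obj P n) \<Longrightarrow> p1 n w = p1 n w' \<Longrightarrow> p2 n w = p2 n w' \<Longrightarrow> w = w'"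
    and glue: "x \<in> carrier (obj X n) \<Longrightarrow> y \<in> carrier (obj Y n) \<Longrightarrow> q1 n x = q2 n y \<Longrightarrow>
      \<exists>w\<in>carrier (obj P n). p1 n w = x \<and> p2 n w = y"
    and q1_surj: "z \<in> carrier (obj Z n) \<Longrightarrow> \<exists>x\<in>carrier (obj X n). q1 n x = z"
begin

interpretation P: module K "obj P n" for n by (rule cochainD(1)[OF cochains(1)])
interpretation X: module K "obj X n" for n by (rule cochainD(1)[OF cochains(2)])
interpretation Y: module K "obj Y n" for n by (rule cochainD(1)[OF cochains(3)])
interpretation Z: module K "obj Z n" for n by (rule cochainD(1)[OF cochains(4)])

lemmas dP = cochain_rules[OF cochains(1)] and dX = cochain_rules[OF cochains(2)]
  and dY = cochain_rules[OF cochains(3)] and dZ = cochain_rules[OF cochains(4)]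
lemmas p1r = chain_map_rules[OF cochains(1,2) maps(1)] and p2r = chain_map_rules[OF cochains(1,3) maps(2)]
  and q1r = chain_map_rules[OF cochains(2,4) maps(3)] and q2r = chain_map_rules[OF cochains(3,4) maps(4)]
lemmas p1h = cohomology_map_coho_class[OF cochains(1,2) maps(1)] and p2h = cohomology_map_coho_class[OF cochains(1,3) maps(2)]
  and q1h = cohomology_map_coho_class[OF cochains(2,4) maps(3)] and q2h = cohomology_map_coho_class[OF cochains(3,4) maps(4)]

lemma cocycle_D: "x \<in> cocycles C n \<Longrightarrow> diff C n x = \<zero>\<^bsub>obj C (n + 1)\<^esub>"
  by (simp add: cocycles_def)

lemma P_cocycleI:
  assumes w: "w \<in> carrier (obj P n)" and 1: "p1 n w \<in> cocycles X n" and 2: "p2 n w \<in> cocycles Y n"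
  shows "w \<in> cocycles P n"
proof -
  have "diff P n w = \<zero>\<^bsub>obj P (n + 1)\<^esub>"
    by (rule joint_inj[of _ "n + 1"])
       (use w cocycle_D[OF 1] cocycle_D[OF 2] in \<open>simp_all add: dP p1r p2r\<close>)
  then show ?thesis using w by (simp add: cocycles_def)
qed

text \<open>The snake relation, with the lift of \<open>z\<close> to \<open>X \<times> Y\<close> chosen as \<open>(x, 0)\<close>: its differential
  \<open>(d x, 0)\<close> comes from an element \<open>w\<close> of \<open>P\<close>.\<close>

definition connects :: "int \<Rightarrow> 'z \<Rightarrow> 'p \<Rightarrow> bool" where
  "connects n z w \<longleftrightarrow> w \<in> carrier (obj P (n + 1)) \<and> p2 (n + 1) w = \<zero>\<^bsub>obj Y (n + 1)\<^esub> \<and>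
     (\<exists>x\<in>carrier (obj X n). q1 n x = z \<and> p1 (n + 1) w = diff X n x)"

lemma connects_exists:
  assumes "z \<in> cocycles Z n" shows "\<exists>w. connects n z w"
proof -
  obtain x where x: "x \<in> carrier (obj X n)" "q1 n x = z"
    using q1_surj cocycle_carrier[OF assms] by blast
  have "q1 (n + 1) (diff X n x) = q2 (n + 1) \<zero>\<^bsub>obj Y (n + 1)\<^esub>"
    using x cocycle_D[OF assms] by (simp add: q1r(6) q2r(4))
  then obtain w where "w \<in> carrier (obj P (n + 1))" "p1 (n + 1) w = diff X n x" "p2 (n + 1) w = \<zero>\<^bsub>obj Y (n + 1)\<^esub>"
    using glue[OF dX(1)[OF x(1)] Y.zero_closed] by blast
  then show ?thesis using x by (auto simp: connects_def)
qed

lemma connects_cocycle: "connects n z w \<Longrightarrow> w \<in> cocycles P (n + 1)"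
  unfolding connects_def
  by (rule P_cocycleI) (auto simp: dX(6) cocycles_closed(1)[OF cochains(3)])

text \<open>If \<open>z = d v + z'\<close> and \<open>u\<close> lifts \<open>v\<close> to \<open>X\<close>, then the lifts \<open>x\<close> and \<open>d u + x'\<close> of \<open>z\<close> differ by an
  element that glues with \<open>0\<close> to some \<open>s\<close> in \<open>P\<close>, and \<open>w = d s + w'\<close>.\<close>

lemma connects_unique:
  assumes z: "coho_class Z n z = coho_class Z n z'" "z \<in> cocycles Z n" "z' \<in> cocycles Z n"
    and w: "connects n z w" "connects n z' w'"
  shows "coho_class P (n + 1) w = coho_class P (n + 1) w'"
proof -
  obtain v where v: "v \<in> carrier (obj Z (n - 1))" "z = diff Z (n - 1) v \<oplus>\<^bsub>obj Z n\<^esub> z'"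
    using z(1,2) by (rule coho_class_eqE[OF cochains(4)])
  obtain u where u: "u \<in> carrier (obj X (n - 1))" "q1 (n - 1) u = v" using q1_surj v(1) by blast
  obtain x where x: "x \<in> carrier (obj X n)" "q1 n x = z" "p1 (n + 1) w = diff X n x"
    using w(1) by (auto simp: connects_def)
  obtain x' where x': "x' \<in> carrier (obj X n)" "q1 n x' = z'" "p1 (n + 1) w' = diff X n x'"
    using w(2) by (auto simp: connects_def)
  have wc: "w \<in> carrier (obj P (n + 1))" "w' \<in> carrier (obj P (n + 1))"
    and w2: "p2 (n + 1) w = \<zero>\<^bsub>obj Y (n + 1)\<^esub>" "p2 (n + 1) w' = \<zero>\<^bsub>obj Y (n + 1)\<^esub>"
    using w by (auto simp: connects_def)
  let ?e = "diff X (n - 1) u \<oplus>\<^bsub>obj X n\<^esub> x'"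
  have du: "diff X (n - 1) u \<in> carrier (obj X n)" using dX(1)[OF u(1)] by simp
  have ddu: "diff X n (diff X (n - 1) u) = \<zero>\<^bsub>obj X (n + 1)\<^esub>" using cocycle_D[OF dX(6)[OF u(1)]] by simp
  have "q1 n (diff X (n - 1) u) = diff Z (n - 1) v" using q1r(6)[OF u(1)] u(2) by simp
  then have qe: "q1 n ?e = z" using du x' v by (simp add: q1r(2))
  have e: "?e \<in> carrier (obj X n)" using du x' by simp
  have "q1 n (x \<ominus>\<^bsub>obj X n\<^esub> ?e) = q2 n \<zero>\<^bsub>obj Y n\<^esub>"
    using x e qe cocycle_carrier[OF z(2)] by (simp add: q1r(3) q2r(4) Z.minus_add_cancel'(4))
  then obtain s where s: "s \<in> carrier (obj P n)" "p1 n s = x \<ominus>\<^bsub>obj X n\<^esub> ?e" "p2 n s = \<zero>\<^bsub>obj Y n\<^esub>"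
    using glue[OF X.minus_closed[OF x(1) e] Y.zero_closed] by blast
  have "diff X n ?e = diff X n x'" using du x' dX(1)[OF x'(1)] by (simp add: dX(2) ddu)
  then have p1: "p1 (n + 1) (diff P n s) = diff X n x \<ominus>\<^bsub>obj X (n + 1)\<^esub> diff X n x'"
    unfolding p1r(6)[OF s(1)] s(2) dX(3)[OF x(1) e] by simp
  have p2: "p2 (n + 1) (diff P n s) = \<zero>\<^bsub>obj Y (n + 1)\<^esub>"
    unfolding p2r(6)[OF s(1)] s(3) by (rule dY(4))
  have "w = diff P n s \<oplus>\<^bsub>obj P (n + 1)\<^esub> w'"
    by (rule joint_inj[of _ "n + 1"])
       (use wc w2 x x' s dX(1)[OF x(1)] dX(1)[OF x'(1)] in
         \<open>simp_all add: p1r(2) p2r(2) dP(1) p1 p2 X.minus_add_cancel'\<close>)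
  then show ?thesis
    using connects_cocycle[OF w(2)] s(1) by (intro coho_class_eqI[OF cochains(1)]) simp_all
qed

definition connecting :: "int \<Rightarrow> 'z set \<Rightarrow> 'p set" where
  "connecting n C = (SOME D. \<exists>z w. z \<in> cocycles Z n \<and> C = coho_class Z n z \<and> connects n z w \<and> D = coho_class P (n + 1) w)"

lemma connecting_coho_class:
  assumes "z \<in> cocycles Z n" "connects n z w" shows "connecting n (coho_class Z n z) = coho_class P (n + 1) w"
proof -
  have "\<exists>z' w'. z' \<in> cocycles Z n \<and> coho_class Z n z = coho_class Z n z' \<and> connects n z' w' \<and>
      connecting n (coho_class Z n z) = coho_class P (n + 1) w'"
    unfolding connecting_def by (rule someI_ex) (use assms in blast)
  then show ?thesis using connects_unique assms by metis
qed

lemma connecting_hom: "connecting n \<in> mod_hom K (cohomology Z n) (cohomology P (n + 1))"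
proof (rule mod_homI)
  fix C assume "C \<in> carrier (cohomology Z n)"
  then obtain z where z: "z \<in> cocycles Z n" "C = coho_class Z n z" by (rule coho_class_cases[OF cochains(4)])
  obtain w where w: "connects n z w" using connects_exists z by blast
  note wc = connects_cocycle[OF w]
  show "connecting n C \<in> carrier (cohomology P (n + 1))"
    unfolding z(2) connecting_coho_class[OF z(1) w] by (rule coho_class_closed[OF cochains(1) wc])
  { fix C' assume "C' \<in> carrier (cohomology Z n)"
    then obtain z' where z': "z' \<in> cocycles Z n" "C' = coho_class Z n z'" by (rule coho_class_cases[OF cochains(4)])
    obtain w' where w': "connects n z' w'" using connects_exists z' by blast
    obtain x x' where x: "x \<in> carrier (obj X n)" "q1 n x = z" "p1 (n + 1) w = diff X n x"
      "x' \<in> carrier (obj X n)" "q1 n x' = z'" "p1 (n + 1) w' = diff X n x'"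
      using w w' by (auto simp: connects_def)
    have ww: "connects n (z \<oplus>\<^bsub>obj Z n\<^esub> z') (w \<oplus>\<^bsub>obj P (n + 1)\<^esub> w')"
      unfolding connects_def
      using w w' x by (intro conjI bexI[of _ "x \<oplus>\<^bsub>obj X n\<^esub> x'"]) (auto simp: connects_def p1r(2) p2r(2) q1r(2) dX(2))
    show "connecting n (C \<oplus>\<^bsub>cohomology Z n\<^esub> C') = connecting n C \<oplus>\<^bsub>cohomology P (n + 1)\<^esub> connecting n C'"
      unfolding z(2) z'(2) coho_class_add[OF cochains(4) z(1) z'(1)] connecting_coho_class[OF z(1) w] connecting_coho_class[OF z'(1) w']
        connecting_coho_class[OF cocycles_closed(2)[OF cochains(4) z(1) z'(1)] ww]
        coho_class_add[OF cochains(1) wc connects_cocycle[OF w']] .. }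
  fix k assume k: "k \<in> carrier K"
  obtain x where x: "x \<in> carrier (obj X n)" "q1 n x = z" "p1 (n + 1) w = diff X n x"
    using w by (auto simp: connects_def)
  have kw: "connects n (k \<odot>\<^bsub>obj Z n\<^esub> z) (k \<odot>\<^bsub>obj P (n + 1)\<^esub> w)"
    unfolding connects_def
    using w x k by (intro conjI bexI[of _ "k \<odot>\<^bsub>obj X n\<^esub> x"]) (auto simp: connects_def p1r(5) p2r(5) q1r(5) dX(5))
  show "connecting n (k \<odot>\<^bsub>cohomology Z n\<^esub> C) = k \<odot>\<^bsub>cohomology P (n + 1)\<^esub> connecting n C"
    unfolding z(2) coho_class_smult[OF cochains(4) k z(1)] connecting_coho_class[OF z(1) w]
      connecting_coho_class[OF cocycles_closed(4)[OF cochains(4) k z(1)] kw] coho_class_smult[OF cochains(1) k wc] ..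
qed

abbreviation "restr n \<equiv> (\<lambda>C. (cohomology_map X p1 n C, cohomology_map Y p2 n C))"
abbreviation "difference n \<equiv>
  (\<lambda>(C, D). cohomology_map Z q1 n C \<ominus>\<^bsub>cohomology Z n\<^esub> cohomology_map Z q2 n D)"

lemma difference_coho_class:
  assumes "x \<in> cocycles X n" "y \<in> cocycles Y n"
  shows "difference n (coho_class X n x, coho_class Y n y) = coho_class Z n (q1 n x \<ominus>\<^bsub>obj Z n\<^esub> q2 n y)"
  using assms by (simp add: q1h q2h coho_class_minus[OF cochains(4)] q1r(7) q2r(7))

text \<open>If the classes of \<open>x\<close> and \<open>y\<close> agree in \<open>Z\<close>, then \<open>x\<close> can be changed by the differential of a lift so that
  the two cocycles agree in \<open>Z\<close> on the nose; then they glue to a cocycle of \<open>P\<close>.\<close>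

lemma exact_middle:
  "restr n ` carrier (cohomology P n) =
    {u \<in> carrier (prod_mod (cohomology X n) (cohomology Y n)). difference n u = \<zero>\<^bsub>cohomology Z n\<^esub>}"
proof (intro equalityI subsetI)
  fix u assume "u \<in> restr n ` carrier (cohomology P n)"
  then obtain C where C: "C \<in> carrier (cohomology P n)" "u = restr n C" by blast
  from C(1) obtain w where w: "w \<in> cocycles P n" "C = coho_class P n w" by (rule coho_class_cases[OF cochains(1)])
  have u: "u = (coho_class X n (p1 n w), coho_class Y n (p2 n w))" by (simp add: C(2) w p1h p2h)
  have "q2 n (p2 n w) \<in> carrier (obj Z n)" using cocycle_carrier[OF q2r(7)[OF p2r(7)[OF w(1)]]] .
  then have "difference n u = \<zero>\<^bsub>cohomology Z n\<^esub>"
    unfolding u difference_coho_class[OF p1r(7)[OF w(1)] p2r(7)[OF w(1)]]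
    by (simp add: commutes[OF cocycle_carrier[OF w(1)]] Z.minus_add_cancel'(4) coho_class_zero[OF cochains(4)])
  then show "u \<in> {u \<in> carrier (prod_mod (cohomology X n) (cohomology Y n)). difference n u = \<zero>\<^bsub>cohomology Z n\<^esub>}"
    unfolding u using coho_class_closed[OF cochains(2) p1r(7)[OF w(1)]] coho_class_closed[OF cochains(3) p2r(7)[OF w(1)]] by simp
next
  fix u assume u: "u \<in> {u \<in> carrier (prod_mod (cohomology X n) (cohomology Y n)). difference n u = \<zero>\<^bsub>cohomology Z n\<^esub>}"
  obtain C D where CD: "u = (C, D)" by (cases u)
  obtain x where x: "x \<in> cocycles X n" "C = coho_class X n x"
    using u CD by (auto elim: coho_class_cases[OF cochains(2)])
  obtain y where y: "y \<in> cocycles Y n" "D = coho_class Y n y"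
    using u CD by (auto elim: coho_class_cases[OF cochains(3)])
  note xc = cocycle_carrier[OF x(1)] and yc = cocycle_carrier[OF y(1)]
  interpret H: module K "cohomology Z n" by (rule cohomology_module[OF cochains(4)])
  have "coho_class Z n (q1 n x) \<ominus>\<^bsub>cohomology Z n\<^esub> coho_class Z n (q2 n y) = \<zero>\<^bsub>cohomology Z n\<^esub>"
    using u by (simp add: CD x y q1h q2h)
  then have "coho_class Z n (q1 n x) = coho_class Z n (q2 n y)"
    by (rule H.minus_eq_zeroD) (intro coho_class_closed[OF cochains(4)] q1r(7) q2r(7) x(1) y(1))+
  then obtain v where v: "v \<in> carrier (obj Z (n - 1))" "q1 n x = diff Z (n - 1) v \<oplus>\<^bsub>obj Z n\<^esub> q2 n y"
    using q1r(7)[OF x(1)] by (rule coho_class_eqE[OF cochains(4)])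
  obtain t where t: "t \<in> carrier (obj X (n - 1))" "q1 (n - 1) t = v" using q1_surj v(1) by blast
  \<comment> \<open>Lifting \<open>v\<close> to \<open>X\<close> corrects \<open>x\<close> within its class.\<close>
  let ?x = "x \<ominus>\<^bsub>obj X n\<^esub> diff X (n - 1) t"
  have dt: "diff X (n - 1) t \<in> cocycles X n" using dX(6)[OF t(1)] by simp
  have dv: "diff Z (n - 1) v \<in> carrier (obj Z n)" using dZ(1)[OF v(1)] by simp
  have x0: "?x \<in> cocycles X n" by (rule cocycles_closed(3)[OF cochains(2) x(1) dt])
  have "q1 n (diff X (n - 1) t) = diff Z (n - 1) v" using q1r(6)[OF t(1)] t(2) by simp
  then have "q1 n ?x = q2 n y"
    using q1r(3)[OF xc cocycle_carrier[OF dt]] v(2) Z.minus_add_cancel'(3)[OF q2r(1)[OF yc] dv] by simp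
  then obtain w where w: "w \<in> carrier (obj P n)" "p1 n w = ?x" "p2 n w = y"
    using glue[OF cocycle_carrier[OF x0] yc] by blast
  have wc: "w \<in> cocycles P n" by (rule P_cocycleI[OF w(1)]) (simp_all add: w x0 y(1))
  have "coho_class X n x = coho_class X n ?x"
    using X.minus_add_cancel'(2)[OF xc cocycle_carrier[OF dt]] by (intro coho_class_eqI[OF cochains(2) x0 t(1)]) simp
  then have "u = restr n (coho_class P n w)" by (simp add: CD x y p1h[OF wc] p2h[OF wc] w)
  then show "u \<in> restr n ` carrier (cohomology P n)" using coho_class_closed[OF cochains(1) wc] by blast
qed

text \<open>Lets the exactness proofs pass from a lift \<open>(x, y)\<close> of \<open>z\<close> to the lift \<open>(x - u, 0)\<close> that the snake
  relation asks for.\<close>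

lemma glue_lift:
  assumes "y \<in> carrier (obj Y n)"
  obtains u s where "u \<in> carrier (obj X n)" "q1 n u = q2 n y" "s \<in> carrier (obj P n)" "p1 n s = u" "p2 n s = y"
  using q1_surj[OF q2r(1)[OF assms]] glue[OF _ assms] by metis

text \<open>A pair of cocycles \<open>(x, y)\<close> is replaced by \<open>(x - u, 0)\<close>, which changes it by the image of \<open>s\<close>, and
  the connecting map gives the coboundary of \<open>- s\<close>. Conversely, if \<open>w = d s\<close>, subtracting the image of
  \<open>s\<close> from the lift \<open>(x, 0)\<close> of \<open>z\<close> gives a lift by cocycles.\<close>

lemma exact_right:
  "difference n ` carrier (prod_mod (cohomology X n) (cohomology Y n)) =
    {C \<in> carrier (cohomology Z n). connecting n C = \<zero>\<^bsub>cohomology P (n + 1)\<^esub>}"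
proof (intro equalityI subsetI)
  fix E assume "E \<in> difference n ` carrier (prod_mod (cohomology X n) (cohomology Y n))"
  then obtain C D where CD: "C \<in> carrier (cohomology X n)" "D \<in> carrier (cohomology Y n)" "E = difference n (C, D)"
    by auto
  from CD(1) obtain x where x: "x \<in> cocycles X n" "C = coho_class X n x" by (rule coho_class_cases[OF cochains(2)])
  from CD(2) obtain y where y: "y \<in> cocycles Y n" "D = coho_class Y n y" by (rule coho_class_cases[OF cochains(3)])
  note xc = cocycle_carrier[OF x(1)] and yc = cocycle_carrier[OF y(1)]
  let ?z = "q1 n x \<ominus>\<^bsub>obj Z n\<^esub> q2 n y"
  have E: "E = coho_class Z n ?z" using CD(3) difference_coho_class[OF x(1) y(1)] x y by simp
  have zc: "?z \<in> cocycles Z n" by (rule cocycles_closed(3)[OF cochains(4) q1r(7)[OF x(1)] q2r(7)[OF y(1)]])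
  obtain u s where u: "u \<in> carrier (obj X n)" "q1 n u = q2 n y"
    and s: "s \<in> carrier (obj P n)" "p1 n s = u" "p2 n s = y" using yc by (rule glue_lift)
  \<comment> \<open>The lift \<open>(x - u, 0)\<close> of \<open>?z\<close> has differential \<open>(- d u, 0)\<close>, the image of \<open>- d s\<close> since \<open>d y = 0\<close>.\<close>
  let ?w = "\<zero>\<^bsub>obj P (n + 1)\<^esub> \<ominus>\<^bsub>obj P (n + 1)\<^esub> diff P n s"
  note ds = dP(1)[OF s(1)]
  have w: "?w \<in> carrier (obj P (n + 1))" using ds by simp
  have p1w: "p1 (n + 1) ?w = diff X n (x \<ominus>\<^bsub>obj X n\<^esub> u)"
    unfolding p1r(3)[OF P.zero_closed ds] p1r(4) p1r(6)[OF s(1)] s(2) dX(3)[OF xc u(1)] cocycle_D[OF x(1)] ..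
  have p2w: "p2 (n + 1) ?w = \<zero>\<^bsub>obj Y (n + 1)\<^esub>"
    unfolding p2r(3)[OF P.zero_closed ds] p2r(4) p2r(6)[OF s(1)] s(3) cocycle_D[OF y(1)]
    by (rule Y.minus_zero[OF Y.zero_closed])
  have "connects n ?z ?w"
    unfolding connects_def using w p1w p2w xc u
    by (intro conjI bexI[of _ "x \<ominus>\<^bsub>obj X n\<^esub> u"]) (auto simp: q1r(3))
  then have "connecting n E = coho_class P (n + 1) ?w" unfolding E by (rule connecting_coho_class[OF zc])
  also have "\<dots> = coho_class P (n + 1) \<zero>\<^bsub>obj P (n + 1)\<^esub>"
  proof (rule coho_class_eqI[OF cochains(1) cocycles_closed(1)[OF cochains(1)]])
    show "\<zero>\<^bsub>obj P n\<^esub> \<ominus>\<^bsub>obj P n\<^esub> s \<in> carrier (obj P (n + 1 - 1))" using s by simp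
    have "diff P n (\<zero>\<^bsub>obj P n\<^esub> \<ominus>\<^bsub>obj P n\<^esub> s) = ?w" using s by (simp add: dP(3,4))
    then show "?w = diff P (n + 1 - 1) (\<zero>\<^bsub>obj P n\<^esub> \<ominus>\<^bsub>obj P n\<^esub> s) \<oplus>\<^bsub>obj P (n + 1)\<^esub> \<zero>\<^bsub>obj P (n + 1)\<^esub>"
      using P.r_zero[OF w] by simp
  qed
  finally show "E \<in> {C \<in> carrier (cohomology Z n). connecting n C = \<zero>\<^bsub>cohomology P (n + 1)\<^esub>}"
    using coho_class_closed[OF cochains(4) zc] by (simp add: E coho_class_zero[OF cochains(1)])
next
  fix E assume E: "E \<in> {C \<in> carrier (cohomology Z n). connecting n C = \<zero>\<^bsub>cohomology P (n + 1)\<^esub>}"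
  then obtain z where z: "z \<in> cocycles Z n" "E = coho_class Z n z" by (auto elim: coho_class_cases[OF cochains(4)])
  obtain w where w: "connects n z w" using connects_exists[OF z(1)] by blast
  obtain x where x: "x \<in> carrier (obj X n)" "q1 n x = z" "p1 (n + 1) w = diff X n x"
    and w2: "p2 (n + 1) w = \<zero>\<^bsub>obj Y (n + 1)\<^esub>"
    using w by (auto simp: connects_def)
  have "coho_class P (n + 1) w = coho_class P (n + 1) \<zero>\<^bsub>obj P (n + 1)\<^esub>"
    using E connecting_coho_class[OF z(1) w] by (simp add: z coho_class_zero[OF cochains(1)])
  then obtain s where s: "s \<in> carrier (obj P (n + 1 - 1))"
    "w = diff P (n + 1 - 1) s \<oplus>\<^bsub>obj P (n + 1)\<^esub> \<zero>\<^bsub>obj P (n + 1)\<^esub>"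
    using connects_cocycle[OF w] by (rule coho_class_eqE[OF cochains(1)])
  then have s: "s \<in> carrier (obj P n)" "w = diff P n s" using dP(1)[of s n] by simp_all
  \<comment> \<open>Subtracting the image of \<open>s\<close> from the lift \<open>(x, 0)\<close> of \<open>z\<close> makes both components cocycles.\<close>
  let ?x = "x \<ominus>\<^bsub>obj X n\<^esub> p1 n s" and ?y = "\<zero>\<^bsub>obj Y n\<^esub> \<ominus>\<^bsub>obj Y n\<^esub> p2 n s"
  note p1s = p1r(1)[OF s(1)] and p2s = p2r(1)[OF s(1)]
  have "diff X n ?x = \<zero>\<^bsub>obj X (n + 1)\<^esub>"
    unfolding dX(3)[OF x(1) p1s] p1r(6)[OF s(1), symmetric] s(2)[symmetric] x(3)
    by (rule X.minus_add_cancel'(4)[OF dX(1)[OF x(1)] dX(1)[OF x(1)]])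
  then have xc: "?x \<in> cocycles X n" using x p1s by (simp add: cocycles_def)
  have "diff Y n ?y = \<zero>\<^bsub>obj Y (n + 1)\<^esub>"
    unfolding dY(3)[OF Y.zero_closed p2s] p2r(6)[OF s(1), symmetric] s(2)[symmetric] w2 dY(4)
    by (rule Y.minus_zero[OF Y.zero_closed])
  then have yc: "?y \<in> cocycles Y n" using p2s by (simp add: cocycles_def)
  have "q1 n ?x \<ominus>\<^bsub>obj Z n\<^esub> q2 n ?y = z"
    unfolding q1r(3)[OF x(1) p1s] q2r(3)[OF Y.zero_closed p2s] q2r(4) x(2) commutes[OF s(1)]
    by (rule Z.minus_add_cancel'(5)[OF cocycle_carrier[OF z(1)] q2r(1)[OF p2s]])
  then have "E = difference n (coho_class X n ?x, coho_class Y n ?y)" using difference_coho_class[OF xc yc] z by simp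
  then show "E \<in> difference n ` carrier (prod_mod (cohomology X n) (cohomology Y n))"
    using coho_class_closed[OF cochains(2) xc] coho_class_closed[OF cochains(3) yc] by (intro image_eqI) auto
qed

text \<open>If \<open>w\<close> becomes the coboundaries of \<open>x\<close> in \<open>X\<close> and of \<open>y\<close> in \<open>Y\<close>, then the class of \<open>w\<close> is the image of
  the class of \<open>q1 x - q2 y\<close>.\<close>

lemma exact_left:
  "connecting n ` carrier (cohomology Z n) = {C \<in> carrier (cohomology P (n + 1)).
    restr (n + 1) C = \<zero>\<^bsub>prod_mod (cohomology X (n + 1)) (cohomology Y (n + 1))\<^esub>}"
proof (intro equalityI subsetI)
  fix C assume "C \<in> connecting n ` carrier (cohomology Z n)"
  then obtain E where E: "E \<in> carrier (cohomology Z n)" "C = connecting n E" by blast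
  from E(1) obtain z where z: "z \<in> cocycles Z n" "E = coho_class Z n z" by (rule coho_class_cases[OF cochains(4)])
  obtain w where w: "connects n z w" using connects_exists[OF z(1)] by blast
  note wc = connects_cocycle[OF w]
  obtain x where x: "x \<in> carrier (obj X n)" "p1 (n + 1) w = diff X n x"
    and w2: "p2 (n + 1) w = \<zero>\<^bsub>obj Y (n + 1)\<^esub>"
    using w by (auto simp: connects_def)
  have C: "C = coho_class P (n + 1) w" using E z connecting_coho_class[OF z(1) w] by simp
  have "coho_class X (n + 1) (diff X n x) = coho_class X (n + 1) \<zero>\<^bsub>obj X (n + 1)\<^esub>"
    using x dX(1)[OF x(1)]
    by (intro coho_class_eqI[OF cochains(2) cocycles_closed(1)[OF cochains(2)], of x]) simp_all
  then show "C \<in> {C \<in> carrier (cohomology P (n + 1)).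
      restr (n + 1) C = \<zero>\<^bsub>prod_mod (cohomology X (n + 1)) (cohomology Y (n + 1))\<^esub>}"
    using coho_class_closed[OF cochains(1) wc] coho_class_zero[OF cochains(2), of "n + 1"] coho_class_zero[OF cochains(3), of "n + 1"]
    by (simp add: C p1h[OF wc] p2h[OF wc] x w2)
next
  fix C assume C: "C \<in> {C \<in> carrier (cohomology P (n + 1)).
      restr (n + 1) C = \<zero>\<^bsub>prod_mod (cohomology X (n + 1)) (cohomology Y (n + 1))\<^esub>}"
  then obtain w where w: "w \<in> cocycles P (n + 1)" "C = coho_class P (n + 1) w" by (auto elim: coho_class_cases[OF cochains(1)])
  have h: "coho_class X (n + 1) (p1 (n + 1) w) = coho_class X (n + 1) \<zero>\<^bsub>obj X (n + 1)\<^esub>"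
    "coho_class Y (n + 1) (p2 (n + 1) w) = coho_class Y (n + 1) \<zero>\<^bsub>obj Y (n + 1)\<^esub>"
    using C coho_class_zero[OF cochains(2), of "n + 1"] coho_class_zero[OF cochains(3), of "n + 1"]
    by (simp_all add: w(2) p1h[OF w(1)] p2h[OF w(1)])
  obtain x where "x \<in> carrier (obj X (n + 1 - 1))"
    "p1 (n + 1) w = diff X (n + 1 - 1) x \<oplus>\<^bsub>obj X (n + 1)\<^esub> \<zero>\<^bsub>obj X (n + 1)\<^esub>"
    using h(1) p1r(7)[OF w(1)] by (rule coho_class_eqE[OF cochains(2)])
  then have x: "x \<in> carrier (obj X n)" "p1 (n + 1) w = diff X n x" using dX(1)[of x n] by simp_all
  obtain y where "y \<in> carrier (obj Y (n + 1 - 1))"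
    "p2 (n + 1) w = diff Y (n + 1 - 1) y \<oplus>\<^bsub>obj Y (n + 1)\<^esub> \<zero>\<^bsub>obj Y (n + 1)\<^esub>"
    using h(2) p2r(7)[OF w(1)] by (rule coho_class_eqE[OF cochains(3)])
  then have y: "y \<in> carrier (obj Y n)" "p2 (n + 1) w = diff Y n y" using dY(1)[of y n] by simp_all
  let ?z = "q1 n x \<ominus>\<^bsub>obj Z n\<^esub> q2 n y"
  note qx = q1r(1)[OF x(1)] and qy = q2r(1)[OF y(1)] and wcl = cocycle_carrier[OF w(1)]
  have "diff Z n ?z = \<zero>\<^bsub>obj Z (n + 1)\<^esub>"
    unfolding dZ(3)[OF qx qy] q1r(6)[OF x(1), symmetric] q2r(6)[OF y(1), symmetric] x(2)[symmetric] y(2)[symmetric]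
      commutes[OF wcl]
    by (rule Z.minus_add_cancel'(4)[OF q2r(1)[OF p2r(1)[OF wcl]] q2r(1)[OF p2r(1)[OF wcl]]])
  then have zc: "?z \<in> cocycles Z n" using qx qy by (simp add: cocycles_def)
  obtain u s where u: "u \<in> carrier (obj X n)" "q1 n u = q2 n y"
    and s: "s \<in> carrier (obj P n)" "p1 n s = u" "p2 n s = y" using y(1) by (rule glue_lift)
  note ds = dP(1)[OF s(1)]
  \<comment> \<open>Passing from \<open>(x, y)\<close> to \<open>(x - u, 0)\<close> changes \<open>w\<close> by the coboundary of \<open>s\<close>.\<close>
  let ?w = "w \<ominus>\<^bsub>obj P (n + 1)\<^esub> diff P n s"
  have p1w: "p1 (n + 1) ?w = diff X n (x \<ominus>\<^bsub>obj X n\<^esub> u)"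
    unfolding p1r(3)[OF wcl ds] p1r(6)[OF s(1)] s(2) dX(3)[OF x(1) u(1)] x(2) ..
  have p2w: "p2 (n + 1) ?w = \<zero>\<^bsub>obj Y (n + 1)\<^esub>"
    unfolding p2r(3)[OF wcl ds] p2r(6)[OF s(1)] s(3) y(2)
    by (rule Y.minus_add_cancel'(4)[OF dY(1)[OF y(1)] dY(1)[OF y(1)]])
  have c: "connects n ?z ?w"
    unfolding connects_def using wcl ds p1w p2w x u
    by (intro conjI bexI[of _ "x \<ominus>\<^bsub>obj X n\<^esub> u"]) (auto simp: q1r(3))
  have "coho_class P (n + 1) w = coho_class P (n + 1) ?w"
    using s(1) P.minus_add_cancel'(2)[OF wcl ds]
    by (intro coho_class_eqI[OF cochains(1) connects_cocycle[OF c], of s]) simp_all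
  then have "C = connecting n (coho_class Z n ?z)" by (simp add: w(2) connecting_coho_class[OF zc c])
  then show "C \<in> connecting n ` carrier (cohomology Z n)" using coho_class_closed[OF cochains(4) zc] by blast
qed

theorem mayer_vietoris:
  "exact_at K (cohomology P n) (restr n) (prod_mod (cohomology X n) (cohomology Y n)) (difference n) (cohomology Z n)"
  "exact_at K (prod_mod (cohomology X n) (cohomology Y n)) (difference n) (cohomology Z n)
     (connecting n) (cohomology P (n + 1))"
  "exact_at K (cohomology Z n) (connecting n) (cohomology P (n + 1)) (restr (n + 1))
     (prod_mod (cohomology X (n + 1)) (cohomology Y (n + 1)))"
proof -
  note mods = cohomology_module[OF cochains(1)] cohomology_module[OF cochains(2)]
    cohomology_module[OF cochains(3)] cohomology_module[OF cochains(4)]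
  note r = mod_hom_pair[OF cohomology_map_hom[OF cochains(1,2) maps(1)] cohomology_map_hom[OF cochains(1,3) maps(2)]]
  note d = mod_hom_difference[OF mods(4) cohomology_map_hom[OF cochains(2,4) maps(3)]
      cohomology_map_hom[OF cochains(3,4) maps(4)]]
  show "exact_at K (cohomology P n) (restr n) (prod_mod (cohomology X n) (cohomology Y n)) (difference n) (cohomology Z n)"
    unfolding exact_at_def by (intro conjI mods prod_mod_module r d exact_middle)
  show "exact_at K (prod_mod (cohomology X n) (cohomology Y n)) (difference n) (cohomology Z n)
     (connecting n) (cohomology P (n + 1))"
    unfolding exact_at_def by (intro conjI mods prod_mod_module d connecting_hom exact_right)
  show "exact_at K (cohomology Z n) (connecting n) (cohomology P (n + 1)) (restr (n + 1))
     (prod_mod (cohomology X (n + 1)) (cohomology Y (n + 1)))"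
    unfolding exact_at_def by (intro conjI mods prod_mod_module r connecting_hom exact_left)
qed

end

section \<open>Products, sums and cones of cochain complexes\<close>

lemma fst_hom: "fst \<in> mod_hom K (prod_mod X Y) X"
  by (rule mod_homI) auto

lemma snd_hom: "snd \<in> mod_hom K (prod_mod X Y) Y"
  by (rule mod_homI) auto

lemma prod_cx_simps:
  "obj (prod_cx X Y) n = prod_mod (obj X n) (obj Y n)"
  "diff (prod_cx X Y) n = (\<lambda>(x, y). (diff X n x, diff Y n y))"
  by (simp_all add: prod_cx_def)

lemma dsum_cx_simps:
  "obj (dsum_cx I X) n = dsum_mod I (\<lambda>i. obj (X i) n)"
  "diff (dsum_cx I X) n = (\<lambda>x. \<lambda>i\<in>I. diff (X i) n (x i))"
  by (simp_all add: dsum_cx_def)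

lemma cone_cx_simps:
  "obj (cone_cx X Y f) n = prod_mod (obj X n) (obj Y (n - 1))"
  "diff (cone_cx X Y f) n = (\<lambda>(x, y). (diff X n x, f n x \<ominus>\<^bsub>obj Y n\<^esub> diff Y (n - 1) y))"
  by (simp_all add: cone_cx_def)

lemma mod_hom_prod:
  assumes "f \<in> mod_hom K X X'" "g \<in> mod_hom K Y Y'"
  shows "(\<lambda>(x, y). (f x, g y)) \<in> mod_hom K (prod_mod X Y) (prod_mod X' Y')"
  using assms by (auto simp: mod_hom_def)

lemma cochain_prod:
  assumes X: "cochain K X" and Y: "cochain K Y" shows "cochain K (prod_cx X Y)"
  unfolding cochain_def prod_cx_simps
  by (auto intro!: prod_mod_module mod_hom_prod cochainD(1,2)[OF X] cochainD(1,2)[OF Y]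
      simp: cochainD(3)[OF X] cochainD(3)[OF Y])

lemma chain_map_prod:
  assumes f: "chain_map K X X' f" and g: "chain_map K Y Y' g"
  shows "chain_map K (prod_cx X Y) (prod_cx X' Y') (\<lambda>n (x, y). (f n x, g n y))"
  unfolding chain_map_def prod_cx_simps
  by (auto intro!: mod_hom_prod chain_mapD(1)[OF f] chain_mapD(1)[OF g]
      simp: chain_mapD(2)[OF f] chain_mapD(2)[OF g])

lemma chain_map_ident: "chain_map K X X (\<lambda>n x. x)"
  by (simp add: chain_map_def mod_hom_ident)

lemma cochain_dsum:
  assumes K: "cring K" and X: "\<And>i. i \<in> I \<Longrightarrow> cochain K (X i)" shows "cochain K (dsum_cx I X)"
  unfolding cochain_def dsum_cx_simps
proof (intro allI conjI ballI)
  fix n :: int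
  show "module K (dsum_mod I (\<lambda>i. obj (X i) n))" by (intro dsum_mod_module K cochainD(1)[OF X])
  show "(\<lambda>x. \<lambda>i\<in>I. diff (X i) n (x i)) \<in> mod_hom K (dsum_mod I (\<lambda>i. obj (X i) n)) (dsum_mod I (\<lambda>i. obj (X i) (n + 1)))"
    by (rule dsum_homI, rule mod_hom_comp, erule dsum_proj, rule cochainD(2), erule X)
  fix x assume "x \<in> carrier (dsum_mod I (\<lambda>i. obj (X i) n))"
  then show "(\<lambda>i\<in>I. diff (X i) (n + 1) ((\<lambda>i\<in>I. diff (X i) n (x i)) i)) = \<zero>\<^bsub>dsum_mod I (\<lambda>i. obj (X i) (n + 1 + 1))\<^esub>"
    unfolding dsum_mod_simps by (intro restrict_ext) (simp only: restrict_apply', intro cochainD(3)[OF X], auto)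
qed

lemma chain_map_restrict:
  assumes "F \<subseteq> E" shows "chain_map K (dsum_cx E X) (dsum_cx F X) (\<lambda>n t. restrict t F)"
  unfolding chain_map_def dsum_cx_simps
proof (intro allI conjI ballI)
  fix n :: int
  show "(\<lambda>t. restrict t F) \<in> mod_hom K (dsum_mod E (\<lambda>i. obj (X i) n)) (dsum_mod F (\<lambda>i. obj (X i) n))"
    by (rule dsum_homI[where f = "\<lambda>i t. t i"], rule dsum_proj) (use assms in auto)
  show "restrict (\<lambda>i\<in>E. diff (X i) n (x i)) F = (\<lambda>i\<in>F. diff (X i) n (restrict x F i))" for x
    by (rule restrict_ext) (use assms in auto)
qed

text \<open>The square of the differential of the cone has second component \<open>f (d x) - d (f x - d y)\<close>, which
  vanishes because \<open>f\<close> is a chain map.\<close>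

lemma cochain_cone:
  assumes X: "cochain K X" and Y: "cochain K Y" and f: "chain_map K X Y f"
  shows "cochain K (cone_cx X Y f)"
  unfolding cochain_def cone_cx_simps
proof (intro allI conjI ballI)
  interpret Y: module K "obj Y m" for m by (rule cochainD(1)[OF Y])
  note dX = cochain_rules[OF X] and dY = cochain_rules[OF Y] and fr = chain_map_rules[OF X Y f]
  fix n :: int
  have d: "diff Y (n - 1) \<in> mod_hom K (obj Y (n - 1)) (obj Y n)" using cochainD(2)[OF Y, of "n - 1"] by simp
  have e: "n + 1 - 1 = n" by simp
  show "module K (prod_mod (obj X n) (obj Y (n - 1)))" by (intro prod_mod_module cochainD(1)[OF X] cochainD(1)[OF Y])
  have "(\<lambda>u. (diff X n (fst u), (\<lambda>(x, y). f n x \<ominus>\<^bsub>obj Y n\<^esub> diff Y (n - 1) y) u))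
      \<in> mod_hom K (prod_mod (obj X n) (obj Y (n - 1))) (prod_mod (obj X (n + 1)) (obj Y n))"
    by (intro mod_hom_pair mod_hom_comp[OF fst_hom cochainD(2)[OF X]]
        mod_hom_difference[OF cochainD(1)[OF Y] chain_mapD(1)[OF f] d])
  then show "(\<lambda>(x, y). (diff X n x, f n x \<ominus>\<^bsub>obj Y n\<^esub> diff Y (n - 1) y))
      \<in> mod_hom K (prod_mod (obj X n) (obj Y (n - 1))) (prod_mod (obj X (n + 1)) (obj Y (n + 1 - 1)))"
    by (simp add: case_prod_beta')
  fix u assume "u \<in> carrier (prod_mod (obj X n) (obj Y (n - 1)))"
  then obtain x y where u: "u = (x, y)" and x: "x \<in> carrier (obj X n)" and y: "y \<in> carrier (obj Y (n - 1))" by auto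
  have ddy: "diff Y n (diff Y (n - 1) y) = \<zero>\<^bsub>obj Y (n + 1)\<^esub>" using cochainD(3)[OF Y y] by simp
  have fx: "diff Y n (f n x) \<in> carrier (obj Y (n + 1))" by (intro dY(1) fr(1) x)
  have "f (n + 1) (diff X n x) \<ominus>\<^bsub>obj Y (n + 1)\<^esub> diff Y n (f n x \<ominus>\<^bsub>obj Y n\<^esub> diff Y (n - 1) y) = \<zero>\<^bsub>obj Y (n + 1)\<^esub>"
    unfolding fr(6)[OF x] dY(3)[OF fr(1)[OF x] mod_hom_closed[OF d y]] ddy Y.minus_zero[OF fx]
    by (rule Y.minus_add_cancel'(4)[OF fx fx])
  then show "(\<lambda>(x, y). (diff X (n + 1) x, f (n + 1) x \<ominus>\<^bsub>obj Y (n + 1)\<^esub> diff Y (n + 1 - 1) y))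
      ((\<lambda>(x, y). (diff X n x, f n x \<ominus>\<^bsub>obj Y n\<^esub> diff Y (n - 1) y)) u) =
      \<zero>\<^bsub>prod_mod (obj X (n + 1 + 1)) (obj Y (n + 1 + 1 - 1))\<^esub>"
    using cochainD(3)[OF X x] by (simp add: u add.commute[of 1 n])
qed

lemma chain_map_cone:
  assumes X: "cochain K X" and Y: "cochain K Y" and Y': "cochain K Y'"
    and f: "chain_map K X Y f" and \<phi>: "chain_map K X X' \<phi>" and \<psi>: "chain_map K Y Y' \<psi>"
    and square: "\<And>n x. x \<in> carrier (obj X n) \<Longrightarrow> \<psi> n (f n x) = f' n (\<phi> n x)"
  shows "chain_map K (cone_cx X Y f) (cone_cx X' Y' f') (\<lambda>n (x, y). (\<phi> n x, \<psi> (n - 1) y))"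
  unfolding chain_map_def cone_cx_simps
proof (intro allI conjI ballI)
  fix n :: int
  show "(\<lambda>(x, y). (\<phi> n x, \<psi> (n - 1) y)) \<in> mod_hom K (prod_mod (obj X n) (obj Y (n - 1))) (prod_mod (obj X' n) (obj Y' (n - 1)))"
    by (intro mod_hom_prod chain_mapD(1)[OF \<phi>] chain_mapD(1)[OF \<psi>])
  fix u assume "u \<in> carrier (prod_mod (obj X n) (obj Y (n - 1)))"
  then obtain x y where u: "u = (x, y)" and x: "x \<in> carrier (obj X n)" and y: "y \<in> carrier (obj Y (n - 1))" by auto
  have dy: "diff Y (n - 1) y \<in> carrier (obj Y n)" using cochain_rules(1)[OF Y y] by simp
  have "\<psi> n (f n x \<ominus>\<^bsub>obj Y n\<^esub> diff Y (n - 1) y) = f' n (\<phi> n x) \<ominus>\<^bsub>obj Y' n\<^esub> diff Y' (n - 1) (\<psi> (n - 1) y)"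
    using chain_map_rules(3)[OF Y Y' \<psi> chain_map_rules(1)[OF X Y f x] dy] square[OF x] chain_mapD(2)[OF \<psi> y]
    by simp
  then show "(\<lambda>(x, y). (\<phi> (n + 1) x, \<psi> (n + 1 - 1) y)) ((\<lambda>(x, y). (diff X n x, f n x \<ominus>\<^bsub>obj Y n\<^esub> diff Y (n - 1) y)) u) =
      (\<lambda>(x, y). (diff X' n x, f' n x \<ominus>\<^bsub>obj Y' n\<^esub> diff Y' (n - 1) y)) ((\<lambda>(x, y). (\<phi> n x, \<psi> (n - 1) y)) u)"
    by (simp add: u chain_mapD(2)[OF \<phi> x])
qed

section \<open>Families of gluing data\<close>

lemma glue_functions:
  assumes t: "t \<in> Pi\<^sub>E F S" and t': "t' \<in> Pi\<^sub>E G S" and eq: "restrict t (F \<inter> G) = restrict t' (F \<inter> G)"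
  obtains s where "s \<in> Pi\<^sub>E (F \<union> G) S" "restrict s F = t" "restrict s G = t'"
proof
  let ?s = "\<lambda>L\<in>F \<union> G. if L \<in> F then t L else t' L"
  have e: "t L = t' L" if "L \<in> F" "L \<in> G" for L using fun_cong[OF eq, of L] that by simp
  show "?s \<in> Pi\<^sub>E (F \<union> G) S" using t t' by (auto simp: PiE_iff)
  show "restrict ?s F = t" by (rule extensionalityI[where A = F]) (use t in \<open>auto simp: PiE_iff\<close>)
  show "restrict ?s G = t'" by (rule extensionalityI[where A = G]) (use t' e in \<open>auto simp: PiE_iff\<close>)
qed

lemma restrict_Un_inject:
  assumes "s \<in> extensional (F \<union> G)" "s' \<in> extensional (F \<union> G)"
    and "restrict s F = restrict s' F" "restrict s G = restrict s' G"
  shows "s = s'"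
proof (rule extensionalityI[OF assms(1,2)])
  fix L assume "L \<in> F \<union> G"
  then show "s L = s' L" using fun_cong[OF assms(3), of L] fun_cong[OF assms(4), of L] by auto
qed

lemma extend_function:
  assumes z: "z \<in> Pi\<^sub>E (F \<inter> G) S" and S: "\<And>L. L \<in> F \<Longrightarrow> e L \<in> S L"
  obtains s where "s \<in> Pi\<^sub>E F S" "restrict s (F \<inter> G) = z"
proof
  let ?s = "\<lambda>L\<in>F. if L \<in> G then z L else e L"
  show "?s \<in> Pi\<^sub>E F S" using z S by (auto simp: PiE_iff)
  show "restrict ?s (F \<inter> G) = z"
    by (rule extensionalityI[where A = "F \<inter> G"]) (use z in \<open>auto simp: PiE_iff\<close>)
qed

text \<open>Only the shape of the diagrams \<open>SA \<rightarrow> U L \<leftarrow> T L \<rightarrow> V L \<leftarrow> SB\<close> matters for the exact sequence, so it is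
  proved for arbitrary complexes in these places: Hochschild cochains of \<open>A\<close> and \<open>B\<close> at the ends,
  cochains on the triangular complex in the middle, and Hochschild cochains with coefficients in
  endomorphisms between them.\<close>

locale gluing_data =
  fixes K :: "('k, 'r) ring_scheme" and I :: "'i set"
    and SA :: "('k, 'sa) cochain_complex" and SB :: "('k, 'sb) cochain_complex"
    and T :: "'i \<Rightarrow> ('k, 't) cochain_complex" and U :: "'i \<Rightarrow> ('k, 'u) cochain_complex"
    and V :: "'i \<Rightarrow> ('k, 'v) cochain_complex"
    and a :: "'i \<Rightarrow> int \<Rightarrow> 'sa \<Rightarrow> 'u" and b :: "'i \<Rightarrow> int \<Rightarrow> 'sb \<Rightarrow> 'v"
    and ia :: "'i \<Rightarrow> int \<Rightarrow> 't \<Rightarrow> 'u" and ib :: "'i \<Rightarrow> int \<Rightarrow> 't \<Rightarrow> 'v"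
  assumes K: "cring K" and SA: "cochain K SA" and SB: "cochain K SB"
    and T: "\<And>L. L \<in> I \<Longrightarrow> cochain K (T L)" and U: "\<And>L. L \<in> I \<Longrightarrow> cochain K (U L)"
    and V: "\<And>L. L \<in> I \<Longrightarrow> cochain K (V L)"
    and a: "\<And>L. L \<in> I \<Longrightarrow> chain_map K SA (U L) (a L)" and b: "\<And>L. L \<in> I \<Longrightarrow> chain_map K SB (V L) (b L)"
    and ia: "\<And>L. L \<in> I \<Longrightarrow> chain_map K (T L) (U L) (ia L)" and ib: "\<And>L. L \<in> I \<Longrightarrow> chain_map K (T L) (V L) (ib L)"
begin

definition source where "source F = prod_cx SA (prod_cx (dsum_cx F T) SB)"

definition target where "target F = prod_cx (dsum_cx F U) (dsum_cx F V)"

definition lam where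
  "lam F n = (\<lambda>(x, t, y). (\<lambda>L\<in>F. a L n x \<oplus>\<^bsub>obj (U L) n\<^esub> ia L n (t L), \<lambda>L\<in>F. b L n y \<oplus>\<^bsub>obj (V L) n\<^esub> ib L n (t L)))"

definition cx where "cx F = cone_cx (source F) (target F) (lam F)"

definition restriction where
  "restriction F n = (\<lambda>((x, t, y), (u, v)). ((x, restrict t F, y), (restrict u F, restrict v F)))"

lemma source_cochain: "F \<subseteq> I \<Longrightarrow> cochain K (source F)"
  unfolding source_def by (intro cochain_prod cochain_dsum K SA SB T) auto

lemma target_cochain: "F \<subseteq> I \<Longrightarrow> cochain K (target F)"
  unfolding target_def by (intro cochain_prod cochain_dsum K U V) auto

lemma lam_chain_map:
  assumes F: "F \<subseteq> I" shows "chain_map K (source F) (target F) (lam F)"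
  unfolding chain_map_def
proof (intro allI conjI ballI)
  fix n :: int
  have L: "L \<in> I" if "L \<in> F" for L using that F by auto
  have t: "(\<lambda>u. fst (snd u) L) \<in> mod_hom K (obj (source F) n) (obj (T L) n)" if "L \<in> F" for L
    unfolding source_def prod_cx_simps dsum_cx_simps
    by (rule mod_hom_comp[OF mod_hom_comp[OF snd_hom fst_hom] dsum_proj[OF that]])
  have x: "(\<lambda>u. fst u) \<in> mod_hom K (obj (source F) n) (obj SA n)"
    and y: "(\<lambda>u. snd (snd u)) \<in> mod_hom K (obj (source F) n) (obj SB n)"
    unfolding source_def prod_cx_simps by (rule fst_hom, rule mod_hom_comp[OF snd_hom snd_hom])
  have "(\<lambda>u. (\<lambda>L\<in>F. a L n (fst u) \<oplus>\<^bsub>obj (U L) n\<^esub> ia L n (fst (snd u) L), \<lambda>L\<in>F. b L n (snd (snd u)) \<oplus>\<^bsub>obj (V L) n\<^esub> ib L n (fst (snd u) L)))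
      \<in> mod_hom K (obj (source F) n) (obj (target F) n)"
    unfolding target_def prod_cx_simps dsum_cx_simps
    by (intro mod_hom_pair dsum_homI mod_hom_plus cochainD(1)[OF U] cochainD(1)[OF V]
        mod_hom_comp[OF x chain_mapD(1)[OF a]] mod_hom_comp[OF y chain_mapD(1)[OF b]]
        mod_hom_comp[OF t chain_mapD(1)[OF ia]] mod_hom_comp[OF t chain_mapD(1)[OF ib]] L)
  then show "lam F n \<in> mod_hom K (obj (source F) n) (obj (target F) n)"
    by (simp add: lam_def case_prod_beta')
  fix u assume "u \<in> carrier (obj (source F) n)"
  then obtain x t y where u: "u = (x, t, y)" and x: "x \<in> carrier (obj SA n)" and y: "y \<in> carrier (obj SB n)"
    and t: "t \<in> (\<Pi>\<^sub>E L\<in>F. carrier (obj (T L) n))"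
    by (auto simp: source_def prod_cx_simps dsum_cx_simps)
  have tL: "t L \<in> carrier (obj (T L) n)" if "L \<in> F" for L using t that by (auto simp: PiE_iff)
  have 1: "a L (n + 1) (diff SA n x) \<oplus>\<^bsub>obj (U L) (n + 1)\<^esub> ia L (n + 1) (diff (T L) n (t L)) =
      diff (U L) n (a L n x \<oplus>\<^bsub>obj (U L) n\<^esub> ia L n (t L))" if "L \<in> F" for L
    unfolding chain_mapD(2)[OF a[OF L[OF that]] x] chain_mapD(2)[OF ia[OF L[OF that]] tL[OF that]]
    by (rule cochain_rules(2)[OF U[OF L[OF that]], symmetric])
       (intro mod_hom_closed[OF chain_mapD(1)[OF a[OF L[OF that]]] x]
         mod_hom_closed[OF chain_mapD(1)[OF ia[OF L[OF that]]] tL[OF that]])+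
  have 2: "b L (n + 1) (diff SB n y) \<oplus>\<^bsub>obj (V L) (n + 1)\<^esub> ib L (n + 1) (diff (T L) n (t L)) =
      diff (V L) n (b L n y \<oplus>\<^bsub>obj (V L) n\<^esub> ib L n (t L))" if "L \<in> F" for L
    unfolding chain_mapD(2)[OF b[OF L[OF that]] y] chain_mapD(2)[OF ib[OF L[OF that]] tL[OF that]]
    by (rule cochain_rules(2)[OF V[OF L[OF that]], symmetric])
       (intro mod_hom_closed[OF chain_mapD(1)[OF b[OF L[OF that]]] y]
         mod_hom_closed[OF chain_mapD(1)[OF ib[OF L[OF that]]] tL[OF that]])+
  show "lam F (n + 1) (diff (source F) n u) = diff (target F) n (lam F n u)"
    by (simp add: u lam_def source_def target_def prod_cx_simps dsum_cx_simps 1 2 cong: restrict_cong)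
qed

lemma cx_cochain: "F \<subseteq> I \<Longrightarrow> cochain K (cx F)"
  unfolding cx_def by (intro cochain_cone source_cochain target_cochain lam_chain_map)

text \<open>The component of the differential at an index \<open>L\<close> involves only \<open>L\<close> and the two fixed complexes,
  so forgetting other indices commutes with it.\<close>

lemma restriction_chain_map:
  assumes F: "F \<subseteq> E" and E: "E \<subseteq> I" shows "chain_map K (cx E) (cx F) (restriction F)"
proof -
  have FI: "F \<subseteq> I" using F E by auto
  have "chain_map K (cx E) (cx F) (\<lambda>n (z, w). ((\<lambda>(x, z). (x, (\<lambda>(t, y). (restrict t F, y)) z)) z,
      (\<lambda>(u, v). (restrict u F, restrict v F)) w))"
    unfolding cx_def
  proof (rule chain_map_cone[OF source_cochain[OF E] target_cochain[OF E] target_cochain[OF FI] lam_chain_map[OF E]])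
    show "chain_map K (source E) (source F) (\<lambda>n (x, z). (x, (\<lambda>(t, y). (restrict t F, y)) z))"
      unfolding source_def by (intro chain_map_prod[OF chain_map_ident] chain_map_prod[OF chain_map_restrict[OF F] chain_map_ident])
    show "chain_map K (target E) (target F) (\<lambda>n (u, v). (restrict u F, restrict v F))"
      unfolding target_def by (intro chain_map_prod chain_map_restrict F)
    fix n u assume "u \<in> carrier (obj (source E) n)"
    show "(\<lambda>(u, v). (restrict u F, restrict v F)) (lam E n u) =
        lam F n ((\<lambda>(x, z). (x, (\<lambda>(t, y). (restrict t F, y)) z)) u)"
      using F by (auto simp: lam_def case_prod_beta' Int_absorb1 intro!: restrict_ext)
  qed
  then show ?thesis by (simp add: restriction_def[abs_def] case_prod_beta')
qed

lemma cx_obj: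
  "obj (cx F) n = prod_mod (prod_mod (obj SA n) (prod_mod (dsum_mod F (\<lambda>L. obj (T L) n)) (obj SB n)))
     (prod_mod (dsum_mod F (\<lambda>L. obj (U L) (n - 1))) (dsum_mod F (\<lambda>L. obj (V L) (n - 1))))"
  by (simp add: cx_def source_def target_def cone_cx_simps prod_cx_simps dsum_cx_simps)

text \<open>In a fixed degree an element of \<open>cx F\<close> consists of components in the two fixed complexes and of three
  functions on \<open>F\<close>, and restriction of families is restriction of these functions. Functions on \<open>F\<close> and
  on \<open>G\<close> that agree on \<open>F \<inter> G\<close> glue uniquely, and a function on \<open>F \<inter> G\<close> extends to \<open>F\<close> by zero.\<close>

lemma cartesian:
  assumes F: "F \<subseteq> I" and G: "G \<subseteq> I"
  shows "cartesian_square K (cx (F \<union> G)) (cx F) (cx G) (cx (F \<inter> G)) (restriction F) (restriction G) (restriction (F \<inter> G)) (restriction (F \<inter> G))"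
proof
  show "cochain K (cx (F \<union> G))" "cochain K (cx F)" "cochain K (cx G)" "cochain K (cx (F \<inter> G))"
    using F G by (auto intro!: cx_cochain)
  show "chain_map K (cx (F \<union> G)) (cx F) (restriction F)" "chain_map K (cx (F \<union> G)) (cx G) (restriction G)"
    "chain_map K (cx F) (cx (F \<inter> G)) (restriction (F \<inter> G))" "chain_map K (cx G) (cx (F \<inter> G)) (restriction (F \<inter> G))"
    using F G by (auto intro!: restriction_chain_map)
  show "restriction (F \<inter> G) n (restriction F n w) = restriction (F \<inter> G) n (restriction G n w)" for n w
  proof -
    have "F \<inter> (F \<inter> G) = F \<inter> G" "G \<inter> (F \<inter> G) = F \<inter> G" by auto
    then show ?thesis by (simp add: restriction_def case_prod_beta')
  qed
  show "w = w'"
    if "w \<in> carrier (obj (cx (F \<union> G)) n)" "w' \<in> carrier (obj (cx (F \<union> G)) n)" "restriction F n w = restriction F n w'" "restriction G n w = restriction G n w'"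
    for n w w'
  proof -
    obtain x t z u v where w: "w = ((x, t, z), (u, v))" by (metis prod.exhaust)
    obtain x' t' z' u' v' where w': "w' = ((x', t', z'), (u', v'))" by (metis prod.exhaust)
    have e: "t \<in> extensional (F \<union> G)" "t' \<in> extensional (F \<union> G)" "u \<in> extensional (F \<union> G)"
      "u' \<in> extensional (F \<union> G)" "v \<in> extensional (F \<union> G)" "v' \<in> extensional (F \<union> G)"
      using that(1,2) by (simp_all add: w w' cx_obj PiE_iff)
    have "t = t'" "u = u'" "v = v'"
      by (rule restrict_Un_inject[of _ F G], use e that(3,4) in \<open>simp_all add: w w' restriction_def\<close>)+
    then show ?thesis using that(3) by (simp add: w w' restriction_def)
  qed
  show "\<exists>w\<in>carrier (obj (cx (F \<union> G)) n). restriction F n w = x \<and> restriction G n w = y"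
    if xy: "x \<in> carrier (obj (cx F) n)" "y \<in> carrier (obj (cx G) n)" "restriction (F \<inter> G) n x = restriction (F \<inter> G) n y" for x n y
  proof -
    obtain x1 t z u v where x: "x = ((x1, t, z), (u, v))" by (metis prod.exhaust)
    obtain x1' t' z' u' v' where y: "y = ((x1', t', z'), (u', v'))" by (metis prod.exhaust)
    have eq: "x1' = x1" "z' = z" "restrict t (F \<inter> G) = restrict t' (F \<inter> G)"
      "restrict u (F \<inter> G) = restrict u' (F \<inter> G)" "restrict v (F \<inter> G) = restrict v' (F \<inter> G)"
      using xy(3) by (simp_all add: x y restriction_def)
    have c: "x1 \<in> carrier (obj SA n)" "z \<in> carrier (obj SB n)"
      "t \<in> (\<Pi>\<^sub>E L\<in>F. carrier (obj (T L) n))" "t' \<in> (\<Pi>\<^sub>E L\<in>G. carrier (obj (T L) n))"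
      "u \<in> (\<Pi>\<^sub>E L\<in>F. carrier (obj (U L) (n - 1)))" "u' \<in> (\<Pi>\<^sub>E L\<in>G. carrier (obj (U L) (n - 1)))"
      "v \<in> (\<Pi>\<^sub>E L\<in>F. carrier (obj (V L) (n - 1)))" "v' \<in> (\<Pi>\<^sub>E L\<in>G. carrier (obj (V L) (n - 1)))"
      using xy(1,2) by (simp_all add: x y cx_obj)
    obtain s where s: "s \<in> (\<Pi>\<^sub>E L\<in>F \<union> G. carrier (obj (T L) n))" "restrict s F = t" "restrict s G = t'"
      using c(3,4) eq(3) by (rule glue_functions)
    obtain p where p: "p \<in> (\<Pi>\<^sub>E L\<in>F \<union> G. carrier (obj (U L) (n - 1)))" "restrict p F = u" "restrict p G = u'"
      using c(5,6) eq(4) by (rule glue_functions)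
    obtain q where q: "q \<in> (\<Pi>\<^sub>E L\<in>F \<union> G. carrier (obj (V L) (n - 1)))" "restrict q F = v" "restrict q G = v'"
      using c(7,8) eq(5) by (rule glue_functions)
    show ?thesis
      by (rule bexI[of _ "((x1, s, z), (p, q))"])
         (use s p q c(1,2) eq(1,2) in \<open>simp_all add: x y cx_obj restriction_def\<close>)
  qed
  show "\<exists>x\<in>carrier (obj (cx F) n). restriction (F \<inter> G) n x = z" if z: "z \<in> carrier (obj (cx (F \<inter> G)) n)" for z n
  proof -
    have L: "L \<in> I" if "L \<in> F" for L using that F by auto
    obtain x1 t y u v where zz: "z = ((x1, t, y), (u, v))" by (metis prod.exhaust)
    have c: "x1 \<in> carrier (obj SA n)" "y \<in> carrier (obj SB n)"
      "t \<in> (\<Pi>\<^sub>E L\<in>F \<inter> G. carrier (obj (T L) n))"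
      "u \<in> (\<Pi>\<^sub>E L\<in>F \<inter> G. carrier (obj (U L) (n - 1)))" "v \<in> (\<Pi>\<^sub>E L\<in>F \<inter> G. carrier (obj (V L) (n - 1)))"
      using z by (simp_all add: zz cx_obj)
    have e: "\<zero>\<^bsub>obj (T L) n\<^esub> \<in> carrier (obj (T L) n)" "\<zero>\<^bsub>obj (U L) (n - 1)\<^esub> \<in> carrier (obj (U L) (n - 1))"
      "\<zero>\<^bsub>obj (V L) (n - 1)\<^esub> \<in> carrier (obj (V L) (n - 1))" if "L \<in> F" for L
      using abelian_groupE(2)[OF module.axioms(2)[OF cochainD(1)[OF T[OF L[OF that]]]]]
        abelian_groupE(2)[OF module.axioms(2)[OF cochainD(1)[OF U[OF L[OF that]]]]]
        abelian_groupE(2)[OF module.axioms(2)[OF cochainD(1)[OF V[OF L[OF that]]]]] by blast+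
    obtain s where s: "s \<in> (\<Pi>\<^sub>E L\<in>F. carrier (obj (T L) n))" "restrict s (F \<inter> G) = t"
      using c(3) e(1) by (rule extend_function)
    obtain p where p: "p \<in> (\<Pi>\<^sub>E L\<in>F. carrier (obj (U L) (n - 1)))" "restrict p (F \<inter> G) = u"
      using c(4) e(2) by (rule extend_function)
    obtain q where q: "q \<in> (\<Pi>\<^sub>E L\<in>F. carrier (obj (V L) (n - 1)))" "restrict q (F \<inter> G) = v"
      using c(5) e(3) by (rule extend_function)
    show ?thesis
      by (rule bexI[of _ "((x1, s, y), (p, q))"]) (use s p q c(1,2) in \<open>simp_all add: zz cx_obj restriction_def\<close>)
  qed
qed

end

section \<open>The Mayer-Vietoris sequence in modified cohomology\<close>

lemma modified_gluing_data:
  assumes A: "k_algebra K A" and B: "k_algebra K B" and M: "\<And>i. i \<in> I \<Longrightarrow> left_module (env_alg K A B) (M i)"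
  shows "gluing_data K I (hoch_cx K A (regular_bimod K A)) (hoch_cx K B (regular_bimod K B))
    (\<lambda>L. tri_cx K A B (M L)) (\<lambda>L. hoch_cx K A (End_Bo K A B (M L))) (\<lambda>L. hoch_cx K B (End_A K A B (M L)))
    (\<lambda>L. alpha_map K A B (M L)) (\<lambda>L. beta_map K A B (M L)) (\<lambda>L. iA_map K A B (M L)) (\<lambda>L. iB_map K A B (M L))"
proof (rule gluing_data.intro)
  show "cring K" using k_algebra_module[OF A] by (simp add: module_def)
qed (intro hoch_cochain regular_left_module tri_cx_cochain End_Bo_left_module End_A_left_module
  alpha_chain_map beta_chain_map iA_chain_map iB_chain_map A B M; assumption)+

theorem mainTheorem2:
  fixes K :: "('k, 'r) ring_scheme"
    and A :: "('k, 'a) module"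
    and B :: "('k, 'b) module"
    and M :: "nat \<Rightarrow> (('a \<times> 'b \<Rightarrow> 'k) set, 'm) module"
    and n :: nat
    and F G :: "nat set"
  assumes "cring K"
    and "k_algebra K A" and "projective K A"
    and "k_algebra K B" and "projective K B"
    and "\<And>i. i \<in> {1..n} \<Longrightarrow> left_module (env_alg K A B) (M i)"
    and "\<And>i. i \<in> {1..n} \<Longrightarrow> projective K (k_res (env_alg K A B) (M i))"
    and "F \<subseteq> {1..n}" and "G \<subseteq> {1..n}"
  shows "\<exists>\<delta>. \<forall>j :: int.
    exact_at K
      (modified_cohomology K A B M (F \<union> G) j)
        (\<lambda>z. (rho K A B M F j z, rho K A B M G j z))
      (prod_mod (modified_cohomology K A B M F j) (modified_cohomology K A B M G j))
        (\<lambda>(x, y). rho K A B M (F \<inter> G) j x \<ominus>\<^bsub>modified_cohomology K A B M (F \<inter> G) j\<^esub> rho K A B M (F \<inter> G) j y)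
      (modified_cohomology K A B M (F \<inter> G) j) \<and>
    exact_at K
      (prod_mod (modified_cohomology K A B M F j) (modified_cohomology K A B M G j))
        (\<lambda>(x, y). rho K A B M (F \<inter> G) j x \<ominus>\<^bsub>modified_cohomology K A B M (F \<inter> G) j\<^esub> rho K A B M (F \<inter> G) j y)
      (modified_cohomology K A B M (F \<inter> G) j)
        (\<delta> j)
      (modified_cohomology K A B M (F \<union> G) (j + 1)) \<and>
    exact_at K
      (modified_cohomology K A B M (F \<inter> G) j)
        (\<delta> j)
      (modified_cohomology K A B M (F \<union> G) (j + 1))
        (\<lambda>z. (rho K A B M F (j + 1) z, rho K A B M G (j + 1) z))
      (prod_mod (modified_cohomology K A B M F (j + 1)) (modified_cohomology K A B M G (j + 1)))"
proof -
  interpret D: gluing_data K "{1..n}" "hoch_cx K A (regular_bimod K A)" "hoch_cx K B (regular_bimod K B)"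
    "\<lambda>L. tri_cx K A B (M L)" "\<lambda>L. hoch_cx K A (End_Bo K A B (M L))" "\<lambda>L. hoch_cx K B (End_A K A B (M L))"
    "\<lambda>L. alpha_map K A B (M L)" "\<lambda>L. beta_map K A B (M L)" "\<lambda>L. iA_map K A B (M L)" "\<lambda>L. iB_map K A B (M L)"
    by (rule modified_gluing_data[OF assms(2,4,6)])
  have cx: "modified_cx K A B M E = D.cx E" for E
    by (simp add: modified_cx_def D.cx_def D.source_def D.target_def D.lam_def[abs_def] lam_source_def lam_target_def
        lam_map_def[abs_def])
  have rho: "rho K A B M E = cohomology_map (D.cx E) (D.restriction E)" for E
    by (simp add: rho_def cx D.restriction_def[abs_def])
  interpret S: cartesian_square K "D.cx (F \<union> G)" "D.cx F" "D.cx G" "D.cx (F \<inter> G)"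
    "D.restriction F" "D.restriction G" "D.restriction (F \<inter> G)" "D.restriction (F \<inter> G)"
    by (rule D.cartesian[OF assms(8,9)])
  show ?thesis
    unfolding modified_cohomology_def cx rho
    by (intro exI[of _ S.connecting] allI conjI S.mayer_vietoris)
qed

end
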